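(* Let $d_1\ge1$, $d_2\ge 2$, and let $(\mathbf X_i,\xi_i,\eta_i)=(X_{i1},\ldots,X_{id_1},\xi_{i1},\ldots,\xi_{i,d_2-1},\eta_i)$, $i=1,2,\ldots$, be independent and identically distributed random row vectors (components of one row may be dependent), such that the distribution function of $\mathbf X_1=(X_{11},\ldots,X_{1d_1})$ is a copula on $[0,1]^{d_1}$ having a density with respect to Lebesgue measure. Assume the linear regression hypothesis $H_0$: there is a (non-random) vector $\theta=(\theta_1,\ldots,\theta_{d_2-1})^T$ such that $$\eta_i=\xi_i\theta+\varepsilon_i=\sum_{j=1}^{d_2-1}\xi_{ij}\theta_j+\varepsilon_i,$$ where $\{\varepsilon_i\}$ and $\{(\mathbf X_i,\xi_i)\}$ are independent, $\mathbf E\,\varepsilon_1=0$ and $0<\mathbf{Var}\,\varepsilon_1<\infty$. Assume that the matrix $G=\mathbf E\,\xi_1^T\xi_1$ exists (with finite entries) and is non-degenerate. Let $\widehat Z_n=(\widehat Z_n^{(1)},\ldots,\widehat Z_n^{(d_1)})$ be the $d_1$-dimensional process on $[0,1]$ whose $j$-th component is the normalized, piecewise linear partial-sum process of the least-squares regression residuals of the first $n$ observations, taken after sorting these observations in ascending order of $X_{1j},\ldots,X_{nj}$ (precise definition in the context). Then, as $n\to\infty$, $\widehat Z_n\Longrightarrow\widehat Z$, where $\widehat Z$ is a centered $d_1$-dimensional Gaussian process with a.s. continuous sample paths and covariance matrix function $\widehat K(s,t)=\bigl(\widehat K_{ij}(s,t)\bigr)_{i,j=1}^{d_1}$, $$\widehat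 K_{ij}(s,t)=\mathbf P(X_{1i}\le s,\ X_{1j}\le t)-L^{(i)}(s)\,G^{-1}\,(L^{(j)}(t))^T,\qquad s,t\in[0,1],$$ where $L^{(j)}(x)=\int_0^x h^{(j)}(s)\,ds$ and $h^{(j)}(x)=\mathbf E\{\xi_1\mid X_{1j}=x\}$.
   Context: A copula is a distribution function on $[0,1]^{d_1}$ with marginals uniform on $[0,1]$; in particular, ties among $X_{1j},\ldots,X_{nj}$ have probability zero. $\mathbf X_i$ and $\xi_i$ are row vectors; $h^{(j)}$ and $L^{(j)}$ are row-vector-valued of length $d_2-1$. For given $n$, let $\xi$ be the $n\times(d_2-1)$ matrix with rows $\xi_1,\ldots,\xi_n$ and let $\eta=(\eta_1,\ldots,\eta_n)^T$. The least squares estimate is $\widehat\theta=(\xi^T\xi)^{-1}\xi^T\eta$ (under the assumptions, $\xi^T\xi$ is invertible with probability tending to $1$; $\widehat\theta$ may be defined arbitrarily otherwise). It does not depend on the order of the rows. For $j=1,\ldots,d_1$ let $(\mathbf X_i^{(j)},\xi_i^{(j)},\eta_i^{(j)})$, $i=1,\ldots,n$, be the rows $(\mathbf X_i,\xi_i,\eta_i)$, $i=1,\ldots,n$, rearranged in ascending order of the $j$-th column of $X$, i.e. of the values $X_{1j},\ldots,X_{nj}$. The regression residuals are $\widehat\varepsilon_i^{(j)}=\eta_i^{(j)}-\xi_i^{(j)}\widehat\theta$, with partial sums $\widehat\Delta_k^{(j)}=\sum_{i=1}^k\widehat\varepsilon_i^{(j)}$, $\widehat\Delta_0^{(j)}=0$.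 The process $\widehat Z_n^{(j)}=\{\widehat Z_n^{(j)}(t),\ 0\le t\le1\}$ is the piecewise linear random function with nodes $$\left(\frac kn,\ \frac{\widehat\Delta_k^{(j)}}{\sqrt{n\,\mathbf{Var}\,\varepsilon_1}}\right),\qquad k=0,1,\ldots,n.$$ The symbol $\Longrightarrow$ denotes weak convergence of stochastic processes in the uniform topology, i.e. (since all processes here have continuous paths) convergence in distribution in the space of continuous functions $[0,1]\to\mathbb R^{d_1}$ with the supremum metric. *)

theory Defs
  imports "HOL-Probability.Probability"
begin

definition joint_cdf :: "(real^'d) measure \<Rightarrow> real^'d \<Rightarrow> real" where
  "joint_cdf \<mu> x = measure \<mu> {y. \<forall>j. y $ j \<le> x $ j}"

definition is_copula :: "(real^'d \<Rightarrow> real) \<Rightarrow> bool" where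
  "is_copula C \<longleftrightarrow> (\<exists>\<mu>. prob_space \<mu> \<and> sets \<mu> = sets borel \<and> C = joint_cdf \<mu> \<and>
     (\<forall>j. distr \<mu> borel (\<lambda>y. y $ j) = uniform_measure lborel {0..1}))"

text \<open>\<open>h\<close> is a version of \<open>x \<mapsto> E(V | Y = x)\<close>, that is, \<open>h\<close> is Borel and
  \<open>h(Y) = E(V | \<sigma>(Y))\<close> almost surely, componentwise.\<close>

definition regression_function ::
    "'w measure \<Rightarrow> ('w \<Rightarrow> real) \<Rightarrow> ('w \<Rightarrow> real^'q) \<Rightarrow> (real \<Rightarrow> real^'q) \<Rightarrow> bool" where
  "regression_function M Y V h \<longleftrightarrow> h \<in> borel_measurable borel \<and>
     (\<forall>a. AE \<omega> in M. h (Y \<omega>) $ a =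
        real_cond_exp M (vimage_algebra (space M) Y borel) (\<lambda>\<omega>. V \<omega> $ a) \<omega>)"

definition cumulative :: "(real \<Rightarrow> real^'q) \<Rightarrow> real \<Rightarrow> real^'q" where
  "cumulative h x = set_lebesgue_integral lborel {0..x} h"

definition second_moment_matrix :: "'w measure \<Rightarrow> ('w \<Rightarrow> real^'q) \<Rightarrow> real^'q^'q" where
  "second_moment_matrix M V = (\<chi> a b. integral\<^sup>L M (\<lambda>\<omega>. V \<omega> $ a * V \<omega> $ b))"

text \<open>Independence of two random elements whose value types may differ (the library's
  \<open>indep_var\<close> requires equal types): the generated sigma-algebras are independent.\<close>

definition independent_elements ::
    "'w measure \<Rightarrow> 'a measure \<Rightarrow> ('w \<Rightarrow> 'a) \<Rightarrow> 'b measure \<Rightarrow> ('w \<Rightarrow> 'b) \<Rightarrow> bool" where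
  "independent_elements M S A T B \<longleftrightarrow> A \<in> measurable M S \<and> B \<in> measurable M T \<and>
     prob_space.indep_set M
       (sets (vimage_algebra (space M) A S)) (sets (vimage_algebra (space M) B T))"

text \<open>
  Observations are indexed from 0, so the first \<open>n\<close> of them are those with index below \<open>n\<close>.
  For the \<open>n\<close>-row matrix \<open>U\<close> with rows \<open>u 0, \<dots>, u (n - 1)\<close>, \<open>normal_matrix n u\<close> is the
  product of the transpose of \<open>U\<close> with \<open>U\<close>, and \<open>normal_rhs n u y\<close> is the product of the
  transpose of \<open>U\<close> with the column \<open>y 0, \<dots>, y (n - 1)\<close>; both are written out entrywise because
  \<open>n\<close> varies.  If \<open>normal_matrix n u\<close> is singular, \<open>matrix_inv\<close> returns an unspecified
  matrix that does not depend on the data.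
\<close>

definition normal_matrix :: "nat \<Rightarrow> (nat \<Rightarrow> real^'q) \<Rightarrow> real^'q^'q" where
  "normal_matrix n u = (\<chi> a b. \<Sum>i<n. u i $ a * u i $ b)"

definition normal_rhs :: "nat \<Rightarrow> (nat \<Rightarrow> real^'q) \<Rightarrow> (nat \<Rightarrow> real) \<Rightarrow> real^'q" where
  "normal_rhs n u y = (\<chi> a. \<Sum>i<n. u i $ a * y i)"

definition least_squares :: "nat \<Rightarrow> (nat \<Rightarrow> real^'q) \<Rightarrow> (nat \<Rightarrow> real) \<Rightarrow> real^'q" where
  "least_squares n u y = matrix_inv (normal_matrix n u) *v normal_rhs n u y"

definition residual :: "nat \<Rightarrow> (nat \<Rightarrow> real^'q) \<Rightarrow> (nat \<Rightarrow> real) \<Rightarrow> nat \<Rightarrow> real" where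
  "residual n u y i = y i - u i \<bullet> least_squares n u y"

text \<open>\<open>sorted_row n z k\<close> is the index of the row in position \<open>k\<close> (from 0) after
  sorting by \<open>z\<close>; ties keep their original order.\<close>

definition sorted_row :: "nat \<Rightarrow> (nat \<Rightarrow> real) \<Rightarrow> nat \<Rightarrow> nat" where
  "sorted_row n z k = sort_key z [0..<n] ! k"

definition partial_sum ::
    "nat \<Rightarrow> (nat \<Rightarrow> real) \<Rightarrow> (nat \<Rightarrow> real^'q) \<Rightarrow> (nat \<Rightarrow> real) \<Rightarrow> nat \<Rightarrow> real" where
  "partial_sum n z u y k = (\<Sum>m<k. residual n u y (sorted_row n z m))"

text \<open>Piecewise linear function on \<open>[0,1]\<close> with nodes \<open>(k/n, v k)\<close>, \<open>k = 0, \<dots>, n\<close>.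
  At \<open>t = 1\<close> the value \<open>v (n + 1)\<close> is multiplied by 0.\<close>

definition piecewise_linear :: "nat \<Rightarrow> (nat \<Rightarrow> real) \<Rightarrow> real \<Rightarrow> real" where
  "piecewise_linear n v t =
     (let k = nat \<lfloor>real n * t\<rfloor> in v k + (real n * t - real k) * (v (Suc k) - v k))"

definition residual_process ::
    "nat \<Rightarrow> real \<Rightarrow> (nat \<Rightarrow> real^'d) \<Rightarrow> (nat \<Rightarrow> real^'q) \<Rightarrow> (nat \<Rightarrow> real) \<Rightarrow> real \<Rightarrow> real^'d" where
  "residual_process n \<sigma>2 x u y t =
     (\<chi> j. piecewise_linear n
            (\<lambda>k. partial_sum n (\<lambda>i. x i $ j) u y k / sqrt (real n * \<sigma>2)) t)"

text \<open>Degenerate (almost surely constant) variables count as Gaussian.\<close>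

definition gaussian_variable :: "'w measure \<Rightarrow> ('w \<Rightarrow> real) \<Rightarrow> bool" where
  "gaussian_variable N Y \<longleftrightarrow> Y \<in> borel_measurable N \<and>
     (\<exists>m. (AE \<omega> in N. Y \<omega> = m) \<or> (\<exists>\<sigma>>0. distributed N lborel Y (\<lambda>x. ennreal (normal_density m \<sigma> x))))"

definition gaussian_process ::
    "'w measure \<Rightarrow> real set \<Rightarrow> (real \<Rightarrow> 'w \<Rightarrow> real^'d) \<Rightarrow> bool" where
  "gaussian_process N T Z \<longleftrightarrow> (\<forall>t\<in>T. Z t \<in> borel_measurable N) \<and>
     (\<forall>S c. finite S \<longrightarrow> S \<subseteq> T \<longrightarrow> gaussian_variable N (\<lambda>\<omega>. \<Sum>t\<in>S. c t \<bullet> Z t \<omega>))"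

definition covariance :: "'w measure \<Rightarrow> ('w \<Rightarrow> real) \<Rightarrow> ('w \<Rightarrow> real) \<Rightarrow> real" where
  "covariance N A B =
     integral\<^sup>L N (\<lambda>\<omega>. (A \<omega> - integral\<^sup>L N A) * (B \<omega> - integral\<^sup>L N B))"

text \<open>\<open>path_metric\<close> is \<open>C([0,1], \<real>\<^sup>d)\<close> with the supremum metric; its points are functions
  extended by \<open>undefined\<close> outside \<open>[0,1]\<close>, hence the \<open>restrict\<close> in \<open>path_of\<close>.\<close>

definition path_metric :: "(real \<Rightarrow> real^'d) metric" where
  "path_metric = cfunspace (top_of_set {0..1}) euclidean_metric"

definition path_of :: "(real \<Rightarrow> 'w \<Rightarrow> real^'d) \<Rightarrow> 'w \<Rightarrow> real \<Rightarrow> real^'d" where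
  "path_of Z \<omega> = restrict (\<lambda>t. Z t \<omega>) {0..1}"

definition borel_of_topology :: "'a topology \<Rightarrow> 'a measure" where
  "borel_of_topology X = sigma (topspace X) {U. openin X U}"

definition converges_in_distribution ::
    "'a topology \<Rightarrow> 'v measure \<Rightarrow> (nat \<Rightarrow> 'v \<Rightarrow> 'a) \<Rightarrow> 'w measure \<Rightarrow> ('w \<Rightarrow> 'a) \<Rightarrow> bool" where
  "converges_in_distribution X M Y N Z \<longleftrightarrow>
     (\<forall>n. Y n \<in> measurable M (borel_of_topology X)) \<and>
     Z \<in> measurable N (borel_of_topology X) \<and>
     (\<forall>f. continuous_map X euclideanreal f \<longrightarrow> bounded (f ` topspace X) \<longrightarrow>
        (\<lambda>n. integral\<^sup>L M (\<lambda>\<omega>. f (Y n \<omega>))) \<longlonglongrightarrow> integral\<^sup>L N (\<lambda>\<omega>. f (Z \<omega>)))"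

end

theory Submission
  imports Defs
begin

text \<open>
  Sorting by \<open>X\<^sub>j\<close> turns the partial sums of the residuals into sums over all observations with
  weights that differ from the indicators \<open>X\<^sub>i\<^sub>j \<le> t\<close> by an amount controlled by the empirical
  distribution function.  Together with the expansion of the least squares error this shows that
  the process at a fixed \<open>t\<close> is asymptotically a normalized sum of the independent terms
  \<open>(1 {X\<^sub>i\<^sub>j \<le> t} - L\<^sup>j(t) G\<^sup>-\<^sup>1 \<xi>\<^sub>i) \<epsilon>\<^sub>i\<close>, which gives the finite-dimensional limits.  For the
  modulus of continuity, the errors are exchangeable given the design, so the sorted errors have
  the law of the unsorted ones and their walk is handled by truncation and fourth moments, while
  the contribution of the estimation error is Hoelder continuous of order 1/2 by the Cauchy-Schwarz
  inequality.  The limit process is constructed by dyadic chaining from a sequence of independent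
  standard normal variables.
\<close>

subsection \<open>Piecewise linear interpolation\<close>

text \<open>Two dependences have to be broken. The sorted weight of a row depends on all
  observations; but sorting uses the design only, and the errors are independent of it, so second
  moments of weighted error sums have no cross terms. The estimate enters every residual; its effect
  is to replace the indicator of \<open>X_j \<le> t\<close> by its residual after L2-projection on
  the regressors. Hence the limit covariance is a Gram kernel of projection residuals: positive
  semidefinite, with increments of variance at most \<open>\<bar>t - s\<bar>\<close>, as for
  Brownian motion. Only second moments of the errors are given while chaining wants fourth ones,
  which forces the truncation. The same holds for the regressors, so their maximum cannot enter: the
  squared fitted deviations add up to the inner product of normalized estimation error and score, a
  sum that sorting does not change. Weak convergence is tested on bounded Lipschitz functions, and
  paths are compared with their polygons at dyadic nodes. All errors become estimates of
  \<open>E min 1 Q\<close>, and the laws at finitely many nodes are reached from cosines by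
  trigonometric approximation.\<close>

definition ramp :: "real \<Rightarrow> real" where
  "ramp x = max 0 (min 1 x)"

lemma ramp_ge_0: "0 \<le> ramp x" and ramp_le_1: "ramp x \<le> 1"
  and ramp_nonpos: "x \<le> 0 \<Longrightarrow> ramp x = 0" and ramp_ge1: "x \<ge> 1 \<Longrightarrow> ramp x = 1"
  and ramp_mid: "0 \<le> x \<Longrightarrow> x \<le> 1 \<Longrightarrow> ramp x = x"
  by (auto simp: ramp_def)

lemma ramp_mono: "x \<le> y \<Longrightarrow> ramp x \<le> ramp y"
  by (auto simp: ramp_def)

lemma continuous_on_ramp [continuous_intros]:
  "continuous_on S f \<Longrightarrow> continuous_on S (\<lambda>x. ramp (f x))"
  unfolding ramp_def by (intro continuous_intros)

text \<open>At \<open>t = 1\<close> the floor is \<open>n\<close>. Choosing \<open>k = n - 1\<close>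
  and \<open>a = 1\<close> there keeps the meaningless node value \<open>v (Suc n)\<close> out of
  all later arguments; the price is that \<open>k\<close> is not unique at nodes.\<close>

lemma piecewise_linear_cases:
  assumes "0 \<le> t" "t \<le> 1" "n > 0"
  obtains k a where "k < n" "0 \<le> a" "a \<le> 1" "real n * t = real k + a"
    "\<And>v. piecewise_linear n v t = (1 - a) * v k + a * v (Suc k)"
proof -
  define k where "k = nat \<lfloor>real n * t\<rfloor>"
  have nt: "0 \<le> real n * t" "real n * t \<le> real n" using assms by (auto simp: mult_left_le)
  have k: "real k \<le> real n * t" "real n * t < real k + 1"
    using nt unfolding k_def by linarith+
  show thesis
  proof (cases "k < n")
    case True
    have "piecewise_linear n v t = (1 - (real n * t - real k)) * v k + (real n * t - real k) * v (Suc k)" for v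
      unfolding piecewise_linear_def Let_def k_def[symmetric] by algebra
    with True k show ?thesis
      by (intro that[of k "real n * t - real k"]) auto
  next
    case False
    with k nt have e: "real n * t = real n" "k = n" by linarith+
    show ?thesis
      by (rule that[of "n - 1" 1])
        (use e assms k in \<open>auto simp: piecewise_linear_def Let_def k_def[symmetric]\<close>)
  qed
qed

text \<open>This is why interpolation is expressed by \<open>ramp\<close>: at position
  \<open>k + a\<close> a finished step has weight 1, the running step weight \<open>a\<close>, and a
  later step weight 0. Interpolated partial sums are thereby plain weighted sums.\<close>

lemma sum_ramp_split:
  fixes x :: "nat \<Rightarrow> 'a::real_vector"
  assumes "k < n" "0 \<le> a" "a \<le> 1"
  shows "(\<Sum>m<n. ramp (real k + a - real m) *\<^sub>R x m) = (\<Sum>m<k. x m) + a *\<^sub>R x k"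
proof -
  have "{..<n} = {..<k} \<union> {k} \<union> {Suc k..<n}" using assms by auto
  then have "(\<Sum>m<n. ramp (real k + a - real m) *\<^sub>R x m) =
      (\<Sum>m\<in>{..<k} \<union> {k} \<union> {Suc k..<n}. ramp (real k + a - real m) *\<^sub>R x m)" by simp
  also have "\<dots> = (\<Sum>m\<in>{..<k} \<union> {k}. ramp (real k + a - real m) *\<^sub>R x m)
      + (\<Sum>m=Suc k..<n. ramp (real k + a - real m) *\<^sub>R x m)" by (rule sum.union_disjoint) auto
  also have "(\<Sum>m\<in>{..<k} \<union> {k}. ramp (real k + a - real m) *\<^sub>R x m) =
      (\<Sum>m<k. ramp (real k + a - real m) *\<^sub>R x m) + ramp a *\<^sub>R x k" by (subst sum.union_disjoint) auto
  finally have "(\<Sum>m<n. ramp (real k + a - real m) *\<^sub>R x m) =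
      (\<Sum>m<k. ramp (real k + a - real m) *\<^sub>R x m) + ramp a *\<^sub>R x k
      + (\<Sum>m=Suc k..<n. ramp (real k + a - real m) *\<^sub>R x m)"
    .
  moreover have "(\<Sum>m<k. ramp (real k + a - real m) *\<^sub>R x m) = (\<Sum>m<k. x m)"
    by (rule sum.cong) (use assms in \<open>auto simp: ramp_ge1\<close>)
  moreover have "(\<Sum>m=Suc k..<n. ramp (real k + a - real m) *\<^sub>R x m) = 0"
    by (rule sum.neutral) (use assms in \<open>auto simp: ramp_nonpos\<close>)
  ultimately show ?thesis using assms by (simp add: ramp_mid)
qed

lemma piecewise_linear_0: "piecewise_linear 0 v t = v 0"
  by (simp add: piecewise_linear_def)

lemma piecewise_linear_sums:
  assumes "0 \<le> t" "t \<le> 1"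
  shows "piecewise_linear n (\<lambda>k. (\<Sum>m<k. x m) / c) t = (\<Sum>m<n. ramp (real n * t - real m) * x m) / c"
proof (cases "n = 0")
  case False
  then obtain k a where *: "k < n" "0 \<le> a" "a \<le> 1" "real n * t = real k + a"
    "\<And>v. piecewise_linear n v t = (1 - a) * v k + a * v (Suc k)"
    using piecewise_linear_cases[of t n] assms by auto
  show ?thesis using sum_ramp_split[OF *(1-3), of x]
    unfolding *(4) by (simp add: *(5) field_simps flip: add_divide_distrib)
qed (simp add: piecewise_linear_0)

lemma sum_ramp:
  assumes "0 \<le> t" "t \<le> real n"
  shows "(\<Sum>m<n. ramp (t - real m)) = t"
proof (cases "n = 0")
  case False
  then have "0 \<le> t / n" "t / n \<le> 1" using assms by auto
  then obtain k a where *: "k < n" "0 \<le> a" "a \<le> 1" "real n * (t / n) = real k + a"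
    using piecewise_linear_cases[of "t / n" n] False by (metis bot_nat_0.not_eq_extremum)
  show ?thesis using sum_ramp_split[OF *(1-3), of "\<lambda>_. 1::real"] *(4) False
    by (simp add: algebra_simps)
qed (use assms in auto)

lemma sum_abs_ramp_diff:
  assumes "0 \<le> s" "s \<le> real n" "0 \<le> t" "t \<le> real n"
  shows "(\<Sum>m<n. \<bar>ramp (t - real m) - ramp (s - real m)\<bar>) = \<bar>t - s\<bar>"
proof -
  have "(\<Sum>m<n. \<bar>ramp (t - real m) - ramp (s - real m)\<bar>) = \<bar>t - s\<bar>"
    if "s \<le> t" "0 \<le> s" "t \<le> real n" for s t
  proof -
    have "(\<Sum>m<n. \<bar>ramp (t - real m) - ramp (s - real m)\<bar>) =
       (\<Sum>m<n. ramp (t - real m)) - (\<Sum>m<n. ramp (s - real m))"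
      unfolding sum_subtractf[symmetric] using that by (intro sum.cong) (auto simp: ramp_mono)
    then show ?thesis using that by (simp add: sum_ramp)
  qed
  from this[of s t] this[of t s] show ?thesis using assms
    by (cases "s \<le> t") (auto simp: abs_minus_commute)
qed

text \<open>Weight differences lie between -1 and 1, so squares are dominated by absolute values. It
  makes the variance of an increment of an interpolated walk at most linear in the time step, also
  between nodes.\<close>

lemma sum_ramp_diff_squared_le:
  assumes "0 \<le> s" "s \<le> real n" "0 \<le> t" "t \<le> real n"
  shows "(\<Sum>m<n. (ramp (t - real m) - ramp (s - real m))\<^sup>2) \<le> \<bar>t - s\<bar>"
proof -
  have "(ramp a - ramp b)\<^sup>2 \<le> \<bar>ramp a - ramp b\<bar>" for a b
  proof -
    have "\<bar>ramp a - ramp b\<bar> \<le> 1" using ramp_ge_0[of a] ramp_ge_0[of b] ramp_le_1[of a] ramp_le_1[of b] by linarith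
    then have "\<bar>ramp a - ramp b\<bar> * \<bar>ramp a - ramp b\<bar> \<le> \<bar>ramp a - ramp b\<bar> * 1" by (intro mult_left_mono) auto
    then show ?thesis unfolding power2_eq_square abs_mult_self_eq by simp
  qed
  then show ?thesis unfolding sum_abs_ramp_diff[OF assms, symmetric] by (intro sum_mono)
qed

lemma piecewise_linear_add:
  "piecewise_linear n (\<lambda>k. u k + v k) t = piecewise_linear n u t + piecewise_linear n v t"
  and piecewise_linear_diff:
  "piecewise_linear n (\<lambda>k. u k - v k) t = piecewise_linear n u t - piecewise_linear n v t"
  by (auto simp: piecewise_linear_def Let_def algebra_simps)

lemma piecewise_linear_ramp:
  assumes "0 \<le> t" "t \<le> 1"
  shows "piecewise_linear n v t = v 0 + (\<Sum>m<n. ramp (real n * t - real m) * (v (Suc m) - v m))"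
proof -
  have "piecewise_linear n v t - v 0 = piecewise_linear n (\<lambda>k. v k - v 0) t"
    by (simp add: piecewise_linear_def Let_def algebra_simps)
  also have "(\<lambda>k. v k - v 0) = (\<lambda>k. (\<Sum>m<k. v (Suc m) - v m) / 1)"
    by (simp add: sum_lessThan_telescope)
  also have "piecewise_linear n \<dots> t = (\<Sum>m<n. ramp (real n * t - real m) * (v (Suc m) - v m))"
    using piecewise_linear_sums[OF assms, of n _ 1] by simp
  finally show ?thesis by simp
qed

lemma continuous_on_piecewise_linear: "continuous_on {0..1} (piecewise_linear n v)"
proof -
  have "continuous_on {0..1} (\<lambda>t. v 0 + (\<Sum>m<n. ramp (real n * t - real m) * (v (Suc m) - v m)))"
    by (intro continuous_intros)
  then show ?thesis by (rule continuous_on_eq) (auto simp: piecewise_linear_ramp)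
qed

lemma piecewise_linear_diff_le:
  assumes "0 \<le> t" "t \<le> 1" and "\<And>k. k \<le> n \<Longrightarrow> \<bar>v k - c\<bar> \<le> e"
  shows "\<bar>piecewise_linear n v t - c\<bar> \<le> e"
proof (cases "n = 0")
  case False
  then obtain k a where *: "k < n" "0 \<le> a" "a \<le> 1" "real n * t = real k + a"
    "\<And>v. piecewise_linear n v t = (1 - a) * v k + a * v (Suc k)"
    using piecewise_linear_cases[of t n] assms by auto
  have "piecewise_linear n v t - c = (1 - a) * (v k - c) + a * (v (Suc k) - c)"
    unfolding *(5) by (simp add: algebra_simps)
  also have "\<bar>\<dots>\<bar> \<le> (1 - a) * \<bar>v k - c\<bar> + a * \<bar>v (Suc k) - c\<bar>"
    using * by (intro order_trans[OF abs_triangle_ineq]) (auto simp: abs_mult)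
  also have "\<dots> \<le> (1 - a) * e + a * e"
    using * assms(3)[of k] assms(3)[of "Suc k"] by (intro add_mono mult_left_mono) auto
  finally show ?thesis by (simp add: algebra_simps)
qed (use assms in \<open>auto simp: piecewise_linear_0\<close>)

section \<open>Dyadic interpolation and chaining\<close>

definition dyadic_interpolation :: "nat \<Rightarrow> (real \<Rightarrow> real) \<Rightarrow> real \<Rightarrow> real" where
  "dyadic_interpolation m y = piecewise_linear (2 ^ m) (\<lambda>k. y (real k / 2 ^ m))"

text \<open>The two nodes around \<open>t\<close> are within \<open>1 / 2 ^ m\<close> of it, and the
  interpolated value is a convex combination of the values there.\<close>

lemma dyadic_interpolation_diff_le:
  assumes "0 \<le> t" "t \<le> 1" and "\<And>s. 0 \<le> s \<Longrightarrow> s \<le> 1 \<Longrightarrow> \<bar>s - t\<bar> \<le> 1 / 2 ^ m \<Longrightarrow> \<bar>y s - c\<bar> \<le> e"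
  shows "\<bar>dyadic_interpolation m y t - c\<bar> \<le> e"
proof -
  obtain k a where *: "k < 2 ^ m" "0 \<le> a" "a \<le> 1" "real (2 ^ m) * t = real k + a"
    "\<And>v. piecewise_linear (2 ^ m) v t = (1 - a) * v k + a * v (Suc k)"
    using piecewise_linear_cases[of t "2 ^ m"] assms(1,2) by auto
  have t: "t = (real k + a) / 2 ^ m" using *(4) by (simp add: field_simps)
  have k2: "real k + 1 \<le> 2 ^ m" using *(1)
    by (metis Suc_leI of_nat_Suc of_nat_le_iff of_nat_numeral of_nat_power add.commute)
  have 1: "\<bar>y (real k / 2 ^ m) - c\<bar> \<le> e"
    using k2 * by (intro assms(3)) (auto simp: t field_simps)
  have 2: "\<bar>y (real (Suc k) / 2 ^ m) - c\<bar> \<le> e"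
  proof (intro assms(3))
    have "real (Suc k) / 2 ^ m - t = (1 - a) / 2 ^ m" by (simp add: t field_simps)
    then show "\<bar>real (Suc k) / 2 ^ m - t\<bar> \<le> 1 / 2 ^ m" using * by (simp add: field_simps)
  qed (use k2 in \<open>auto simp: field_simps\<close>)
  have "dyadic_interpolation m y t - c = (1 - a) * (y (real k / 2 ^ m) - c) + a * (y (real (Suc k) / 2 ^ m) - c)"
    unfolding dyadic_interpolation_def *(5) by (simp add: algebra_simps)
  also have "\<bar>\<dots>\<bar> \<le> (1 - a) * \<bar>y (real k / 2 ^ m) - c\<bar> + a * \<bar>y (real (Suc k) / 2 ^ m) - c\<bar>"
    using * by (intro order_trans[OF abs_triangle_ineq]) (auto simp: abs_mult)
  also have "\<dots> \<le> (1 - a) * e + a * e"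
    using * 1 2 by (intro add_mono mult_left_mono) auto
  finally show ?thesis by (simp add: algebra_simps)
qed

lemma dyadic_interpolation_tendsto:
  assumes "continuous_on {0..1} y" "0 \<le> t" "t \<le> 1"
  shows "(\<lambda>m. dyadic_interpolation m y t) \<longlonglongrightarrow> y t"
proof (rule LIMSEQ_I)
  fix e :: real assume "e > 0"
  then have "e/2 > 0" by simp
  then obtain d where d: "d > 0" "\<And>s. s \<in> {0..1} \<Longrightarrow> dist s t < d \<Longrightarrow> dist (y s) (y t) < e/2"
    using assms unfolding continuous_on_iff by (metis atLeastAtMost_iff)
  obtain M where M: "(1/2::real) ^ M < d" using d(1) real_arch_pow_inv[of d "1/2"] by auto
  show "\<exists>M. \<forall>m\<ge>M. norm (dyadic_interpolation m y t - y t) < e"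
  proof (intro exI allI impI)
    fix m assume "m \<ge> M"
    then have "(1/2::real) ^ m \<le> (1/2) ^ M" by (intro power_decreasing) auto
    then have m: "1 / 2 ^ m < d" using M by (simp add: power_divide)
    have "\<bar>dyadic_interpolation m y t - y t\<bar> \<le> e/2"
      using d(2) m assms by (intro dyadic_interpolation_diff_le) (auto simp: dist_real_def less_imp_le)
    then show "norm (dyadic_interpolation m y t - y t) < e" using \<open>e > 0\<close> by simp
  qed
qed

text \<open>Since \<open>\<bar>x\<bar> \<le> a + x ^ 4 / a ^ 3\<close> for every \<open>a > 0\<close>, this dominates the largest
  increment of \<open>y\<close> at level \<open>l\<close>. With \<open>a = (9/10) ^ l\<close> it is summable in mean as soon as the
  fourth moments of increments are of the order of the squared step, because \<open>2 * (9/10) ^ 4 > 1\<close>.\<close>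

definition dyadic_osc :: "nat \<Rightarrow> (real \<Rightarrow> real) \<Rightarrow> real" where
  "dyadic_osc l y = (9/10) ^ l +
     (\<Sum>k<2 ^ l. (y (real (Suc k) / 2 ^ l) - y (real k / 2 ^ l)) ^ 4) / ((9/10) ^ l) ^ 3"

lemma abs_le_fourth_power:
  assumes "(a::real) > 0" shows "\<bar>x\<bar> \<le> a + x ^ 4 / a ^ 3"
proof (cases "\<bar>x\<bar> \<le> a")
  case True then show ?thesis using assms by (intro order_trans[OF True]) auto
next
  case False
  then have "\<bar>x\<bar> * a ^ 3 \<le> \<bar>x\<bar> * \<bar>x\<bar> ^ 3" using assms by (intro mult_left_mono power_mono) auto
  also have "\<dots> = x ^ 4" by (simp add: power_numeral_reduce flip: abs_mult)
  finally have "\<bar>x\<bar> \<le> x ^ 4 / a ^ 3" using assms by (simp add: pos_le_divide_eq)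
  then show ?thesis using assms by linarith
qed

lemma dyadic_osc_ge:
  assumes "k < 2 ^ l"
  shows "\<bar>y (real (Suc k) / 2 ^ l) - y (real k / 2 ^ l)\<bar> \<le> dyadic_osc l y"
proof -
  let ?d = "\<lambda>k. y (real (Suc k) / 2 ^ l) - y (real k / 2 ^ l)"
  have "?d k ^ 4 \<le> (\<Sum>k<2 ^ l. ?d k ^ 4)"
    using assms by (intro member_le_sum) auto
  then have "?d k ^ 4 / ((9/10) ^ l) ^ 3 \<le> (\<Sum>k<2 ^ l. ?d k ^ 4) / ((9/10) ^ l) ^ 3"
    by (rule divide_right_mono) auto
  then show ?thesis using abs_le_fourth_power[of "(9/10) ^ l" "?d k"]
    unfolding dyadic_osc_def by simp
qed

lemma dyadic_osc_nonneg: "0 \<le> dyadic_osc l y"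
  unfolding dyadic_osc_def by (auto intro!: add_nonneg_nonneg sum_nonneg divide_nonneg_nonneg)

text \<open>Refining a cell with end values \<open>A\<close>, \<open>C\<close> only inserts the
  midpoint value \<open>B\<close>. The two polygons differ by \<open>a * ((B - A) - (C - B))\<close>
  on the left half, where \<open>a \<le> 1/2\<close>, and symmetrically on the right half, so two
  increments of level \<open>m + 1\<close> with factor 1/2 suffice.\<close>

lemma dyadic_interpolation_Suc:
  assumes "0 \<le> t" "t \<le> 1"
  shows "\<bar>dyadic_interpolation (Suc m) y t - dyadic_interpolation m y t\<bar> \<le> dyadic_osc (Suc m) y"
proof -
  obtain k a where *: "k < 2 ^ m" "0 \<le> a" "a \<le> 1" "real (2 ^ m) * t = real k + a"
    "\<And>v. piecewise_linear (2 ^ m) v t = (1 - a) * v k + a * v (Suc k)"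
    using piecewise_linear_cases[of t "2 ^ m"] assms by auto
  obtain k' b where **: "k' < 2 ^ Suc m" "0 \<le> b" "b \<le> 1" "real (2 ^ Suc m) * t = real k' + b"
    "\<And>v. piecewise_linear (2 ^ Suc m) v t = (1 - b) * v k' + b * v (Suc k')"
    using piecewise_linear_cases[of t "2 ^ Suc m"] assms by auto
  define A where "A = y (real (2 * k) / 2 ^ Suc m)"
  define B where "B = y (real (2 * k + 1) / 2 ^ Suc m)"
  define C where "C = y (real (2 * k + 2) / 2 ^ Suc m)"
  let ?D = "dyadic_osc (Suc m) y"
  have AB: "\<bar>B - A\<bar> \<le> ?D" using dyadic_osc_ge[of "2 * k" "Suc m" y] * by (simp add: A_def B_def)
  have BC: "\<bar>C - B\<bar> \<le> ?D" using dyadic_osc_ge[of "2 * k + 1" "Suc m" y] * by (simp add: B_def C_def)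
  have "real k / 2 ^ m = real (2 * k) / 2 ^ Suc m" "real (Suc k) / 2 ^ m = real (2 * k + 2) / 2 ^ Suc m"
    by (auto simp: divide_simps)
  then have 1: "dyadic_interpolation m y t = (1 - a) * A + a * C"
    unfolding dyadic_interpolation_def *(5) A_def C_def by (simp only:)
  \<comment> \<open>One formula for both halves of the cell: the coefficient of \<open>B\<close> is
    a tent, and only one of the two outer coefficients is nonzero.\<close>
  have 2: "dyadic_interpolation (Suc m) y t = ramp (1 - 2*a) * A + (1 - \<bar>1 - 2*a\<bar>) * B + ramp (2*a - 1) * C"
  proof -
    have e: "real k' + b = 2 * real k + 2 * a" using *(4) **(4) by simp
    \<comment> \<open>The last two alternatives occur only when \<open>t\<close> is a node of level
      \<open>m\<close>: there the fine cell may have been chosen next to the coarse one instead of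
      inside it.\<close>
    consider "k' = 2 * k" | "k' = 2 * k + 1" "b = 2 * a - 1" | "k' = 2 * k + 2" "a = 1" "b = 0" | "Suc k' = 2 * k" "a = 0" "b = 1"
    proof -
      have "k' \<le> 2 * k + 2" "2 * k \<le> k' + 1" using e *(2,3) **(2,3) by linarith+
      then consider "k' = 2 * k" | "k' = 2 * k + 1" | "k' = 2 * k + 2" | "Suc k' = 2 * k" by arith
      then show thesis
      proof cases
        case 1 then show ?thesis using that(1) by blast
      next
        case 2
        then have "b = 2 * a - 1" using e by simp
        with 2 show ?thesis using that(2) by blast
      next
        case 3
        then have "a = 1" "b = 0" using e *(2,3) **(2,3) by auto
        with 3 show ?thesis using that(3) by blast
      next
        case 4
        then have "real k' + 1 = 2 * real k" by linarith
        then have "a = 0" "b = 1" using e *(2,3) **(2,3) by linarith+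
        with 4 show ?thesis using that(4) by blast
      qed
    qed
    then show ?thesis
    proof cases
      case 1
      then have "b = 2 * a" using e by simp
      with 1 ** show ?thesis unfolding dyadic_interpolation_def **(5) A_def B_def C_def
        by (simp add: ramp_def algebra_simps)
    next
      case 2
      then show ?thesis using *(2,3) **(2,3)[unfolded 2]
        unfolding dyadic_interpolation_def **(5) A_def B_def C_def 2 by (simp add: ramp_def algebra_simps)
    next
      case 3
      then show ?thesis unfolding dyadic_interpolation_def **(5) A_def B_def C_def
        by (simp add: ramp_def algebra_simps)
    next
      case 4
      from 4(1) have "real (Suc k') = real (2 * k)" by simp
      with 4 show ?thesis unfolding dyadic_interpolation_def **(5) A_def B_def C_def
        by (simp add: ramp_def algebra_simps)
    qed
  qed
  show ?thesis
  proof (cases "2 * a \<le> 1")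
    case True
    then have "dyadic_interpolation (Suc m) y t - dyadic_interpolation m y t = a * ((B - A) - (C - B))"
      using * unfolding 1 2 by (simp add: ramp_def algebra_simps)
    also have "\<bar>\<dots>\<bar> \<le> (1/2) * (?D + ?D)"
      unfolding abs_mult using True * AB BC by (intro mult_mono) auto
    finally show ?thesis by simp
  next
    case False
    then have "dyadic_interpolation (Suc m) y t - dyadic_interpolation m y t = (1 - a) * ((B - A) - (C - B))"
      using * unfolding 1 2 by (simp add: ramp_def algebra_simps)
    also have "\<bar>\<dots>\<bar> \<le> (1/2) * (?D + ?D)"
      unfolding abs_mult using False * AB BC by (intro mult_mono) auto
    finally show ?thesis by simp
  qed
qed

lemma dyadic_interpolation_le_suminf:
  assumes "0 \<le> t" "t \<le> 1" and s: "summable (\<lambda>l. dyadic_osc l y)" and "m \<le> M"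
  shows "\<bar>dyadic_interpolation M y t - dyadic_interpolation m y t\<bar> \<le> (\<Sum>l. dyadic_osc (l + Suc m) y)"
proof -
  have s': "summable (\<lambda>l. dyadic_osc (l + Suc m) y)" using s by (subst summable_iff_shift)
  have "\<bar>dyadic_interpolation (m + k) y t - dyadic_interpolation m y t\<bar> \<le> (\<Sum>l<k. dyadic_osc (l + Suc m) y)" for k
  proof (induction k)
    case (Suc k)
    then show ?case using dyadic_interpolation_Suc[OF assms(1,2), of "m + k" y] by (simp add: add.commute)
  qed simp
  from this[of "M - m"] show ?thesis using \<open>m \<le> M\<close>
    by (fastforce intro: order_trans[OF _ sum_le_suminf[OF s']] dyadic_osc_nonneg)
qed

text \<open>The level-to-level bounds telescope, and continuity identifies the limit of the
  interpolations with \<open>y t\<close>. The bound is uniform in \<open>t\<close>.\<close>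

lemma dyadic_chaining:
  assumes "0 \<le> t" "t \<le> 1" and s: "summable (\<lambda>l. dyadic_osc l y)" and "continuous_on {0..1} y"
  shows "\<bar>y t - dyadic_interpolation m y t\<bar> \<le> (\<Sum>l. dyadic_osc (l + Suc m) y)"
proof (rule LIMSEQ_le_const2)
  show "(\<lambda>M. \<bar>dyadic_interpolation M y t - dyadic_interpolation m y t\<bar>) \<longlonglongrightarrow> \<bar>y t - dyadic_interpolation m y t\<bar>"
    by (intro tendsto_intros dyadic_interpolation_tendsto assms)
  show "\<exists>N. \<forall>n\<ge>N. \<bar>dyadic_interpolation n y t - dyadic_interpolation m y t\<bar> \<le> (\<Sum>l. dyadic_osc (l + Suc m) y)"
    using dyadic_interpolation_le_suminf[OF assms(1,2) s] by auto
qed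

subsection \<open>Finite-dimensional convergence\<close>

text \<open>The phase \<open>b\<close> makes constants and sines special cases, and the product
  formula for cosines turns sums of such terms into an algebra, as Stone-Weierstrass requires.
  Expectations of the generators are real parts of rotated characteristic functions.\<close>

inductive_set trig_polynomials :: "'i set \<Rightarrow> (('i \<Rightarrow> real) \<Rightarrow> real) set" for J where
  cos: "(\<lambda>x. a * cos ((\<Sum>i\<in>J. c i * x i) + b)) \<in> trig_polynomials J"
| add: "f \<in> trig_polynomials J \<Longrightarrow> g \<in> trig_polynomials J \<Longrightarrow> (\<lambda>x. f x + g x) \<in> trig_polynomials J"

lemma trig_polynomials_const: "(\<lambda>x. a) \<in> trig_polynomials J"
  using trig_polynomials.cos[of a "\<lambda>_. 0" J 0] by simp

lemma trig_polynomials_sin: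
  assumes "finite J" "j \<in> J"
  shows "(\<lambda>x. sin (w * x j)) \<in> trig_polynomials J"
proof -
  have "(\<Sum>i\<in>J. (if i = j then w else 0) * x i) = w * x j" for x
    using assms by (simp add: if_distrib[of "\<lambda>y. y * _"] cong: if_cong)
  then show ?thesis using trig_polynomials.cos[of 1 "\<lambda>i. if i = j then w else 0" J "- pi/2"]
    by (simp add: cos_diff)
qed

lemma trig_polynomials_mult:
  assumes "f \<in> trig_polynomials J" "g \<in> trig_polynomials J"
  shows "(\<lambda>x. f x * g x) \<in> trig_polynomials J"
  using assms(1)
proof induction
  case (cos a c b)
  from assms(2) show ?case
  proof induction
    case (cos a' c' b')
    let ?A = "\<lambda>x. (\<Sum>i\<in>J. c i * x i) + b" and ?B = "\<lambda>x. (\<Sum>i\<in>J. c' i * x i) + b'"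
    have *: "a * cos (?A x) * (a' * cos (?B x)) =
        (a * a' / 2) * cos ((\<Sum>i\<in>J. (c i - c' i) * x i) + (b - b')) +
        (a * a' / 2) * cos ((\<Sum>i\<in>J. (c i + c' i) * x i) + (b + b'))" for x
    proof -
      have "(\<Sum>i\<in>J. (c i - c' i) * x i) + (b - b') = ?A x - ?B x"
        "(\<Sum>i\<in>J. (c i + c' i) * x i) + (b + b') = ?A x + ?B x"
        by (auto simp: sum.distrib sum_subtractf algebra_simps)
      moreover have "a * cos p * (a' * cos q) = (a * a' / 2) * cos (p - q) + (a * a' / 2) * cos (p + q)" for p q
        by (simp add: cos_add cos_diff field_simps)
      ultimately show ?thesis by (simp only:)
    qed
    show ?case unfolding * by (intro trig_polynomials.intros)
  next
    case (add g h)
    then show ?case by (simp add: ring_distribs trig_polynomials.add)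
  qed
next
  case (add f h)
  then show ?case by (simp add: ring_distribs trig_polynomials.add)
qed

lemma trig_polynomials_bounded:
  assumes "g \<in> trig_polynomials J" shows "\<exists>B. \<forall>x. \<bar>g x\<bar> \<le> B"
  using assms
proof induction
  case (cos a c b)
  have "\<bar>a * cos y\<bar> \<le> \<bar>a\<bar>" for y using abs_cos_le_one[of y] by (simp add: abs_mult mult_left_le)
  then show ?case by blast
next
  case (add f g)
  then obtain A B where "\<forall>x. \<bar>f x\<bar> \<le> A" "\<forall>x. \<bar>g x\<bar> \<le> B" by auto
  then have "\<forall>x. \<bar>f x + g x\<bar> \<le> A + B" by (meson abs_triangle_ineq add_mono order_trans)
  then show ?case by blast
qed

lemma trig_polynomials_measurable:
  assumes "g \<in> trig_polynomials J" "\<And>i. (\<lambda>\<omega>. U \<omega> i) \<in> borel_measurable M"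
  shows "(\<lambda>\<omega>. g (U \<omega>)) \<in> borel_measurable M"
  using assms(1) by induction (use assms(2) in measurable)

text \<open>The function \<open>x \<mapsto> arcsin (sin (w * x)) / w\<close> is a triangle wave that agrees with the identity
  near 0. Applying it to all coordinates makes \<open>F\<close> periodic, so that it becomes uniformly
  approximable by trigonometric polynomials on the whole space.\<close>

lemma trig_polynomials_approx:
  fixes F :: "('i::countable \<Rightarrow> real) \<Rightarrow> real"
  assumes J: "finite J" and F: "continuous_on UNIV F" and B: "\<And>x. \<bar>F x\<bar> \<le> B"
    and dep: "\<And>x y. (\<And>i. i \<in> J \<Longrightarrow> x i = y i) \<Longrightarrow> F x = F y"
    and R: "R > 0" and e: "e > 0"
  obtains g where "g \<in> trig_polynomials J"
    "\<And>x. \<bar>F x - g x\<bar> \<le> e + 2 * B / R\<^sup>2 * (\<Sum>i\<in>J. (x i)\<^sup>2)"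
proof -
  define w where "w = pi / (2 * R)"
  have w: "w > 0" using R by (simp add: w_def)
  \<comment> \<open>The image of the sine map. Coordinates outside \<open>J\<close> are frozen at 0,
    so that \<open>S\<close> is compact and its points are separated by the coordinates in
    \<open>J\<close>.\<close>
  define S :: "('i \<Rightarrow> real) set" where "S = PiE UNIV (\<lambda>i. if i \<in> J then {-1..1} else {0})"
  define s :: "('i \<Rightarrow> real) \<Rightarrow> 'i \<Rightarrow> real" where "s x i = (if i \<in> J then sin (w * x i) else 0)" for x i
  define F' where "F' y = F (\<lambda>i. if i \<in> J then arcsin (y i) / w else 0)" for y
  have "compactin (product_topology (\<lambda>i::'i. euclidean) UNIV) S"
    unfolding S_def by (subst compactin_PiE) auto
  then have compact: "compact S" by (simp add: euclidean_product_topology)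
  define RR where "RR = {g. continuous_on S g \<and> (\<lambda>x. g (s x)) \<in> trig_polynomials J}"
  interpret function_ring_on RR S
  proof
    show "compact S" by fact
    show "continuous_on S f" if "f \<in> RR" for f using that by (simp add: RR_def)
    show "(\<lambda>x. f x + g x) \<in> RR" if "f \<in> RR" "g \<in> RR" for f g
      using that by (auto simp: RR_def intro!: continuous_intros trig_polynomials.add)
    show "(\<lambda>x. f x * g x) \<in> RR" if "f \<in> RR" "g \<in> RR" for f g
      using that by (auto simp: RR_def intro!: continuous_intros trig_polynomials_mult)
    show "(\<lambda>_. c) \<in> RR" for c by (auto simp: RR_def trig_polynomials_const)
    show "\<exists>f\<in>RR. f x \<noteq> f y" if "x \<in> S" "y \<in> S" "x \<noteq> y" for x y
    proof -
      from \<open>x \<noteq> y\<close> obtain i where i: "x i \<noteq> y i" by auto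
      have "i \<in> J"
      proof (rule ccontr)
        assume "i \<notin> J"
        then have "x i = 0" "y i = 0" using that(1,2) PiE_mem[of _ UNIV _ i] unfolding S_def by fastforce+
        with i show False by simp
      qed
      then have "(\<lambda>x. x i) \<in> RR" using trig_polynomials_sin[OF J, of i w]
        by (auto simp: RR_def s_def intro: continuous_on_subset[OF continuous_on_product_coordinates])
      then show ?thesis by (rule bexI[rotated]) (rule i)
    qed
  qed
  have "continuous_on S F'"
  proof -
    have "continuous_on S (\<lambda>y i. if i \<in> J then arcsin (y i) / w else 0)"
    proof (rule continuous_on_coordinatewise_then_product)
      fix i
      show "continuous_on S (\<lambda>y. if i \<in> J then arcsin (y i) / w else 0)"
      proof (cases "i \<in> J")
        case True
        have "continuous_on S (\<lambda>y. y i)"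
          by (rule continuous_on_subset[OF continuous_on_product_coordinates]) auto
        moreover have "\<forall>y\<in>S. -1 \<le> y i \<and> y i \<le> 1"
        proof
          fix y assume "y \<in> S"
          then have "y i \<in> (if i \<in> J then {-1..1} else {0})" unfolding S_def by (rule PiE_mem) simp
          then show "-1 \<le> y i \<and> y i \<le> 1" using True by simp
        qed
        ultimately show ?thesis using True w by (auto intro!: continuous_intros)
      qed auto
    qed
    then show ?thesis unfolding F'_def by (rule continuous_on_compose2[OF F]) auto
  qed
  then obtain g where g: "g \<in> RR" "\<And>x. x \<in> S \<Longrightarrow> \<bar>F' x - g x\<bar> < e"
    using Stone_Weierstrass_basic e by blast
  have sS: "s x \<in> S" for x by (auto simp: s_def S_def)
  have B0: "0 \<le> B" using B[of "\<lambda>_. 0"] by linarith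
  \<comment> \<open>If every coordinate is at most \<open>R\<close> in absolute value,
    \<open>w * x i\<close> stays in the range where \<open>arcsin\<close> inverts \<open>sin\<close>
    and the two sides agree. Otherwise the crude bound \<open>2 * B\<close> is charged to one
    coordinate beyond \<open>R\<close>; for bounded second moments this costs O(1 / R^2) in
    mean.\<close>
  have 1: "\<bar>F x - F' (s x)\<bar> \<le> 2 * B / R\<^sup>2 * (\<Sum>i\<in>J. (x i)\<^sup>2)" for x
  proof (cases "\<exists>i\<in>J. \<bar>x i\<bar> > R")
    case True
    then obtain i where i: "i \<in> J" "\<bar>x i\<bar> > R" by auto
    have "\<bar>F x - F' (s x)\<bar> \<le> 2 * B" using B[of x] B[of "\<lambda>i. if i \<in> J then arcsin (s x i) / w else 0"]
      unfolding F'_def by linarith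
    also have "\<dots> = 2 * B / R\<^sup>2 * R\<^sup>2" using R by simp
    also have "\<dots> \<le> 2 * B / R\<^sup>2 * (\<Sum>i\<in>J. (x i)\<^sup>2)"
    proof (intro mult_left_mono)
      have "R\<^sup>2 \<le> (x i)\<^sup>2" using i R by (metis abs_le_square_iff abs_of_pos less_imp_le)
      also have "\<dots> \<le> (\<Sum>i\<in>J. (x i)\<^sup>2)" using i J by (intro member_le_sum) auto
      finally show "R\<^sup>2 \<le> (\<Sum>i\<in>J. (x i)\<^sup>2)" .
    qed (use B0 in auto)
    finally show ?thesis .
  next
    case False
    have "F' (s x) = F x" unfolding F'_def
    proof (rule dep)
      fix i assume i: "i \<in> J"
      then have "\<bar>w * x i\<bar> \<le> w * R" using False w by (auto simp: abs_mult)
      also have "w * R = pi / 2" using R by (simp add: w_def)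
      finally have "arcsin (sin (w * x i)) = w * x i" by (intro arcsin_sin) linarith+
      then show "(if i \<in> J then arcsin (s x i) / w else 0) = x i" using i w by (simp add: s_def)
    qed
    then show ?thesis using B0 by (simp add: sum_nonneg divide_nonneg_nonneg)
  qed
  show ?thesis
  proof (rule that[of "\<lambda>x. g (s x)"])
    show "(\<lambda>x. g (s x)) \<in> trig_polynomials J" using g by (simp add: RR_def)
    show "\<bar>F x - g (s x)\<bar> \<le> e + 2 * B / R\<^sup>2 * (\<Sum>i\<in>J. (x i)\<^sup>2)" for x
      using 1[of x] g(2)[OF sS[of x]] by linarith
  qed
qed

lemma (in prob_space) trig_approx_expectation:
  fixes U :: "'a \<Rightarrow> 'i::countable \<Rightarrow> real"
  assumes [measurable]: "\<And>i. (\<lambda>\<omega>. U \<omega> i) \<in> borel_measurable M" and J: "finite J"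
    and int: "\<And>i. i \<in> J \<Longrightarrow> integrable M (\<lambda>\<omega>. (U \<omega> i)\<^sup>2)" and C: "\<And>i. i \<in> J \<Longrightarrow> expectation (\<lambda>\<omega>. (U \<omega> i)\<^sup>2) \<le> C"
    and F: "continuous_on UNIV F" and B: "\<And>x. \<bar>F x\<bar> \<le> B"
    and g: "g \<in> trig_polynomials J" "\<And>x. \<bar>F x - g x\<bar> \<le> e + K * (\<Sum>i\<in>J. (x i)\<^sup>2)" and "K \<ge> 0"
  shows "\<bar>expectation (\<lambda>\<omega>. F (U \<omega>)) - expectation (\<lambda>\<omega>. g (U \<omega>))\<bar> \<le> e + K * (real (card J) * C)"
proof -
  have "U \<in> borel_measurable M" by (rule measurable_coordinatewise_then_product) simp
  then have [measurable]: "(\<lambda>\<omega>. F (U \<omega>)) \<in> borel_measurable M"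
    using borel_measurable_continuous_onI[OF F] by simp
  have [measurable]: "(\<lambda>\<omega>. g (U \<omega>)) \<in> borel_measurable M"
    by (rule trig_polynomials_measurable[OF g(1)]) simp
  obtain B' where B': "\<bar>g x\<bar> \<le> B'" for x using trig_polynomials_bounded[OF g(1)] by auto
  have iF: "integrable M (\<lambda>\<omega>. F (U \<omega>))" by (rule integrable_const_bound[of _ B]) (auto simp: B)
  have ig: "integrable M (\<lambda>\<omega>. g (U \<omega>))" by (rule integrable_const_bound[of _ B']) (auto simp: B')
  have iS: "integrable M (\<lambda>\<omega>. e + K * (\<Sum>i\<in>J. (U \<omega> i)\<^sup>2))"
    by (intro Bochner_Integration.integrable_add integrable_mult_right Bochner_Integration.integrable_sum int) auto
  have "\<bar>expectation (\<lambda>\<omega>. F (U \<omega>)) - expectation (\<lambda>\<omega>. g (U \<omega>))\<bar> = \<bar>expectation (\<lambda>\<omega>. F (U \<omega>) - g (U \<omega>))\<bar>"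
    using iF ig by simp
  also have "\<dots> \<le> expectation (\<lambda>\<omega>. \<bar>F (U \<omega>) - g (U \<omega>)\<bar>)" by (rule integral_abs_bound)
  also have "\<dots> \<le> expectation (\<lambda>\<omega>. e + K * (\<Sum>i\<in>J. (U \<omega> i)\<^sup>2))"
    by (intro integral_mono iS g(2)) (use iF ig in auto)
  also have "\<dots> = e + K * (\<Sum>i\<in>J. expectation (\<lambda>\<omega>. (U \<omega> i)\<^sup>2))"
    using int by (subst Bochner_Integration.integral_add) (auto simp: prob_space)
  also have "\<dots> \<le> e + K * (real (card J) * C)"
    using sum_bounded_above[of J "\<lambda>i. expectation (\<lambda>\<omega>. (U \<omega> i)\<^sup>2)" C] C \<open>K \<ge> 0\<close>
    by (intro add_left_mono mult_left_mono) auto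
  finally show ?thesis .
qed

text \<open>A continuity theorem in several variables, obtained from cosines of linear forms. The
  uniform second moment bound \<open>C\<close> takes the place of tightness: it makes the error of
  the trigonometric approximation small under all laws at once.\<close>

theorem finite_dimensional_convergence:
  fixes U :: "nat \<Rightarrow> 'v \<Rightarrow> 'i::countable \<Rightarrow> real" and V :: "'w \<Rightarrow> 'i \<Rightarrow> real"
    and F :: "('i \<Rightarrow> real) \<Rightarrow> real"
  assumes "prob_space M" "prob_space N"
    and J: "finite J"
    and [measurable]: "\<And>n i. (\<lambda>\<omega>. U n \<omega> i) \<in> borel_measurable M" "\<And>i. (\<lambda>\<omega>. V \<omega> i) \<in> borel_measurable N"
    and U2: "\<And>n i. i \<in> J \<Longrightarrow> integrable M (\<lambda>\<omega>. (U n \<omega> i)\<^sup>2)" "\<And>n i. i \<in> J \<Longrightarrow> integral\<^sup>L M (\<lambda>\<omega>. (U n \<omega> i)\<^sup>2) \<le> C"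
    and V2: "\<And>i. i \<in> J \<Longrightarrow> integrable N (\<lambda>\<omega>. (V \<omega> i)\<^sup>2)" "\<And>i. i \<in> J \<Longrightarrow> integral\<^sup>L N (\<lambda>\<omega>. (V \<omega> i)\<^sup>2) \<le> C"
    and conv: "\<And>c b. (\<lambda>n. integral\<^sup>L M (\<lambda>\<omega>. cos ((\<Sum>i\<in>J. c i * U n \<omega> i) + b)))
         \<longlonglongrightarrow> integral\<^sup>L N (\<lambda>\<omega>. cos ((\<Sum>i\<in>J. c i * V \<omega> i) + b))"
    and F: "continuous_on UNIV F" and B: "\<And>x. \<bar>F x\<bar> \<le> B"
    and dep: "\<And>x y. (\<And>i. i \<in> J \<Longrightarrow> x i = y i) \<Longrightarrow> F x = F y"
  shows "(\<lambda>n. integral\<^sup>L M (\<lambda>\<omega>. F (U n \<omega>))) \<longlonglongrightarrow> integral\<^sup>L N (\<lambda>\<omega>. F (V \<omega>))"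
proof -
  interpret M: prob_space M by fact
  interpret N: prob_space N by fact
  have trig: "(\<lambda>n. integral\<^sup>L M (\<lambda>\<omega>. g (U n \<omega>))) \<longlonglongrightarrow> integral\<^sup>L N (\<lambda>\<omega>. g (V \<omega>))"
    if "g \<in> trig_polynomials J" for g
    using that
  proof induction
    case (cos a c b)
    show ?case using tendsto_mult_left[OF conv, of a c b] by simp
  next
    case (add f g)
    have int: "integrable M (\<lambda>\<omega>. h (U n \<omega>))" "integrable N (\<lambda>\<omega>. h (V \<omega>))" if "h \<in> trig_polynomials J" for h n
    proof -
      obtain B' where "\<bar>h x\<bar> \<le> B'" for x using trig_polynomials_bounded[OF \<open>h \<in> _\<close>] by auto
      then show "integrable M (\<lambda>\<omega>. h (U n \<omega>))" "integrable N (\<lambda>\<omega>. h (V \<omega>))"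
        by (auto intro!: M.integrable_const_bound[of _ B'] N.integrable_const_bound[of _ B'] trig_polynomials_measurable[OF that])
    qed
    show ?case using tendsto_add[OF add.IH] add.hyps by (simp add: int)
  qed
  have B0: "0 \<le> B" using B[of "\<lambda>_. 0"] by linarith
  define D where "D = \<bar>2 * B * (real (card J) * C)\<bar>"
  show ?thesis
  proof (rule LIMSEQ_I)
    fix r :: real assume "r > 0"
    \<comment> \<open>Chosen to give \<open>D / R^2 \<le> r/4\<close>; the summand 1 keeps
      \<open>R\<close> positive when \<open>D = 0\<close>.\<close>
    define R where "R = sqrt (4 * D / r + 1)"
    have D0: "0 \<le> 4 * D / r" using \<open>r > 0\<close> by (simp add: D_def)
    have R: "R > 0" "R\<^sup>2 = 4 * D / r + 1" using D0 by (auto simp: R_def)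
    have "2 * B / R\<^sup>2 * (real (card J) * C) \<le> D / R\<^sup>2" unfolding D_def by (simp add: divide_right_mono)
    also have "D / R\<^sup>2 \<le> r/4" unfolding R(2) using \<open>r > 0\<close> D0 by (simp add: field_simps)
    finally have K: "2 * B / R\<^sup>2 * (real (card J) * C) \<le> r/4" .
    obtain g where g: "g \<in> trig_polynomials J"
      "\<And>x. \<bar>F x - g x\<bar> \<le> r/16 + 2 * B / R\<^sup>2 * (\<Sum>i\<in>J. (x i)\<^sup>2)"
      using trig_polynomials_approx[OF J F B dep R(1), of "r/16"] \<open>r > 0\<close> by auto
    have K0: "2 * B / R\<^sup>2 \<ge> 0" using B0 by simp
    have 1: "\<bar>integral\<^sup>L M (\<lambda>\<omega>. F (U n \<omega>)) - integral\<^sup>L M (\<lambda>\<omega>. g (U n \<omega>))\<bar> \<le> r/16 + 2 * B / R\<^sup>2 * (real (card J) * C)" for n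
      by (rule M.trig_approx_expectation[OF _ J _ _ F B g K0]) (use U2 in auto)
    have 2: "\<bar>integral\<^sup>L N (\<lambda>\<omega>. F (V \<omega>)) - integral\<^sup>L N (\<lambda>\<omega>. g (V \<omega>))\<bar> \<le> r/16 + 2 * B / R\<^sup>2 * (real (card J) * C)"
      by (rule N.trig_approx_expectation[OF _ J _ _ F B g K0]) (use V2 in auto)
    obtain n0 where n0: "\<And>n. n \<ge> n0 \<Longrightarrow> \<bar>integral\<^sup>L M (\<lambda>\<omega>. g (U n \<omega>)) - integral\<^sup>L N (\<lambda>\<omega>. g (V \<omega>))\<bar> < r/16"
      using LIMSEQ_D[OF trig[OF g(1)], of "r/16"] \<open>r > 0\<close> by auto
    have "norm (integral\<^sup>L M (\<lambda>\<omega>. F (U n \<omega>)) - integral\<^sup>L N (\<lambda>\<omega>. F (V \<omega>))) < r" if "n \<ge> n0" for n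
      using 1[of n] 2 n0[OF that] K \<open>r > 0\<close> unfolding real_norm_def by linarith
    then show "\<exists>n0. \<forall>n\<ge>n0. norm (integral\<^sup>L M (\<lambda>\<omega>. F (U n \<omega>)) - integral\<^sup>L N (\<lambda>\<omega>. F (V \<omega>))) < r" by blast
  qed
qed

subsection \<open>Convergence in distribution through Lipschitz functions\<close>

lemma space_borel_of_topology: "space (borel_of_topology X) = topspace X"
  unfolding borel_of_topology_def by (rule space_measure_of) (auto dest: openin_subset)

lemma measurable_borel_of_topologyI:
  assumes "f \<in> space M \<rightarrow> topspace X" "\<And>U. openin X U \<Longrightarrow> f -` U \<inter> space M \<in> sets M"
  shows "f \<in> measurable M (borel_of_topology X)"
  unfolding borel_of_topology_def
  by (rule measurable_measure_of) (use assms in \<open>auto dest: openin_subset\<close>)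

lemma continuous_map_borel_measurable:
  assumes "continuous_map X (euclidean :: real topology) f"
  shows "f \<in> borel_measurable (borel_of_topology X)"
proof (rule borel_measurableI)
  fix S :: "real set" assume "open S"
  then have "openin X {x \<in> topspace X. f x \<in> S}"
    using assms by (simp add: continuous_map)
  then have "{x \<in> topspace X. f x \<in> S} \<in> sets (borel_of_topology X)"
    unfolding borel_of_topology_def by (auto intro!: in_measure_of dest: openin_subset)
  moreover have "f -` S \<inter> space (borel_of_topology X) = {x \<in> topspace X. f x \<in> S}"
    by (auto simp: space_borel_of_topology)
  ultimately show "f -` S \<inter> space (borel_of_topology X) \<in> sets (borel_of_topology X)" by simp
qed

lemma Lipschitz_imp_continuous_map_real:
  fixes f :: "'a \<Rightarrow> real"
  assumes "\<And>x y. x \<in> mspace m \<Longrightarrow> y \<in> mspace m \<Longrightarrow> \<bar>f x - f y\<bar> \<le> K * mdist m x y"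
  shows "continuous_map (mtopology_of m) euclidean f"
proof -
  have "Lipschitz_continuous_map m euclidean_metric f"
    unfolding Lipschitz_continuous_map_def using assms by (auto simp: dist_real_def)
  then show ?thesis using Lipschitz_continuous_imp_continuous_map by fastforce
qed

lemma continuous_map_metric_real:
  fixes f :: "'a \<Rightarrow> real"
  assumes f: "continuous_map (mtopology_of m) euclidean f" and x: "x \<in> mspace m" and e: "e > 0"
  obtains d where "d > 0" "\<And>y. y \<in> mspace m \<Longrightarrow> mdist m x y < d \<Longrightarrow> \<bar>f y - f x\<bar> < e"
proof -
  interpret Metric_space "mspace m" "mdist m" by simp
  have "openin (mtopology_of m) {y \<in> topspace (mtopology_of m). f y \<in> ball (f x) e}"
    using f by (auto simp: continuous_map)
  then obtain r where "r > 0" "mball x r \<subseteq> {y \<in> mspace m. f y \<in> ball (f x) e}"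
    using x e by (auto simp: mtopology_of_def openin_mtopology)
  then show ?thesis using x by (intro that[of r]) (auto simp: subset_iff dist_real_def abs_minus_commute)
qed

text \<open>The infimal convolutions \<open>inf_y f y + k * d x y\<close> are Lipschitz and increase to \<open>f\<close>; they bound
  the lower limit of the integrals of \<open>f\<close>, and those of \<open>- f\<close> the upper limit.\<close>

lemma infimal_convolution:
  fixes f :: "'a \<Rightarrow> real"
  assumes f: "continuous_map (mtopology_of m) euclidean f" and B: "\<And>x. x \<in> mspace m \<Longrightarrow> \<bar>f x\<bar> \<le> B"
    and ne: "mspace m \<noteq> {}"
  obtains g where "\<And>k x. x \<in> mspace m \<Longrightarrow> \<bar>g k x\<bar> \<le> B" "\<And>k x. x \<in> mspace m \<Longrightarrow> g k x \<le> f x"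
    "\<And>k x y. x \<in> mspace m \<Longrightarrow> y \<in> mspace m \<Longrightarrow> \<bar>g k x - g k y\<bar> \<le> real k * mdist m x y"
    "\<And>x. x \<in> mspace m \<Longrightarrow> (\<lambda>k. g k x) \<longlonglongrightarrow> f x"
proof -
  interpret Metric_space "mspace m" "mdist m" by simp
  define g where "g k x = (INF y\<in>mspace m. f y + real k * mdist m x y)" for k x
  have low: "- B \<le> f y + real k * mdist m x y" if "y \<in> mspace m" for k x y
  proof -
    have "0 \<le> real k * mdist m x y" by simp
    then show ?thesis using B[OF that] by linarith
  qed
  have bdd: "bdd_below ((\<lambda>y. f y + real k * mdist m x y) ` mspace m)" for k x
    using low by (intro bdd_belowI2) auto
  have g_le: "g k x \<le> f y + real k * mdist m x y" if "y \<in> mspace m" for k x y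
    unfolding g_def by (rule cINF_lower[OF bdd that])
  have g_ge: "c \<le> g k x" if "\<And>y. y \<in> mspace m \<Longrightarrow> c \<le> f y + real k * mdist m x y" for c k x
    unfolding g_def by (rule cINF_greatest[OF ne that])
  have le: "g k x \<le> f x" if "x \<in> mspace m" for k x using g_le[OF that, of k x] that by simp
  show ?thesis
  proof (rule that[of g])
    show "\<bar>g k x\<bar> \<le> B" if "x \<in> mspace m" for k x
      using g_ge[of "-B" k x] low le[OF that, of k] B[OF that] by fastforce
    show "g k x \<le> f x" if "x \<in> mspace m" for k x by (rule le[OF that])
    have 1: "g k x - real k * mdist m x y \<le> g k y" if "x \<in> mspace m" "y \<in> mspace m" for k x y
    proof (rule g_ge)
      fix z assume z: "z \<in> mspace m"
      have "real k * mdist m x z \<le> real k * (mdist m x y + mdist m y z)"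
        using triangle[OF that z] by (intro mult_left_mono) auto
      then show "g k x - real k * mdist m x y \<le> f z + real k * mdist m y z"
        using g_le[OF z, of k x] by (simp add: algebra_simps)
    qed
    show "\<bar>g k x - g k y\<bar> \<le> real k * mdist m x y" if "x \<in> mspace m" "y \<in> mspace m" for k x y
      using 1[OF that, of k] 1[OF that(2,1), of k] commute[of x y] by (simp add: abs_le_iff)
    show "(\<lambda>k. g k x) \<longlonglongrightarrow> f x" if x: "x \<in> mspace m" for x
    proof (rule LIMSEQ_I)
      fix e :: real assume "e > 0"
      then obtain d where d: "d > 0" "\<And>y. y \<in> mspace m \<Longrightarrow> mdist m x y < d \<Longrightarrow> \<bar>f y - f x\<bar> < e/2"
        using continuous_map_metric_real[OF f x, of "e/2"] by auto
      \<comment> \<open>Points farther than \<open>d\<close> from \<open>x\<close> pay a penalty of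
        at least \<open>k * d \<ge> 2 * B\<close>, more than \<open>f\<close> can gain there, so
        only the neighbourhood given by continuity matters.\<close>
      obtain k0 :: nat where k0: "real k0 \<ge> 2 * B / d" using real_arch_simple by blast
      show "\<exists>no. \<forall>n\<ge>no. norm (g n x - f x) < e"
      proof (intro exI allI impI)
        fix k assume "k \<ge> k0"
        then have "2 * B / d \<le> real k" using k0 by linarith
        then have k: "2 * B \<le> real k * d" using d(1) by (simp add: pos_divide_le_eq)
        have "f x - e/2 \<le> g k x"
        proof (rule g_ge)
          fix y assume y: "y \<in> mspace m"
          show "f x - e/2 \<le> f y + real k * mdist m x y"
          proof (cases "mdist m x y < d")
            case True
            have "0 \<le> real k * mdist m x y" by simp
            with d(2)[OF y True] show ?thesis by linarith
          next
            case False
            then have "real k * d \<le> real k * mdist m x y" by (intro mult_left_mono) auto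
            with k B[OF x] B[OF y] \<open>e > 0\<close> show ?thesis by linarith
          qed
        qed
        then show "norm (g k x - f x) < e" using le[OF x, of k] \<open>e > 0\<close> by simp
      qed
    qed
  qed
qed

lemma converges_in_distributionI_Lipschitz:
  assumes "prob_space M" "prob_space N"
    and Y: "\<And>n. Y n \<in> measurable M (borel_of_topology (mtopology_of m))"
    and Z: "Z \<in> measurable N (borel_of_topology (mtopology_of m))"
    and conv: "\<And>f B K. (\<And>x. x \<in> mspace m \<Longrightarrow> \<bar>f x\<bar> \<le> B) \<Longrightarrow> K \<ge> 0 \<Longrightarrow>
        (\<And>x y. x \<in> mspace m \<Longrightarrow> y \<in> mspace m \<Longrightarrow> \<bar>f x - f y\<bar> \<le> K * mdist m x y) \<Longrightarrow>
        (\<lambda>n. integral\<^sup>L M (\<lambda>\<omega>. f (Y n \<omega>))) \<longlonglongrightarrow> integral\<^sup>L N (\<lambda>\<omega>. f (Z \<omega>))"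
  shows "converges_in_distribution (mtopology_of m) M Y N Z"
  unfolding converges_in_distribution_def
proof (intro conjI allI impI Y Z)
  interpret M: prob_space M by fact
  interpret N: prob_space N by fact
  have Ysp: "Y n \<omega> \<in> mspace m" if "\<omega> \<in> space M" for n \<omega>
    using measurable_space[OF Y that] by (simp add: space_borel_of_topology)
  have Zsp: "Z \<omega> \<in> mspace m" if "\<omega> \<in> space N" for \<omega>
    using measurable_space[OF Z that] by (simp add: space_borel_of_topology)
  have ne: "mspace m \<noteq> {}" using Ysp M.not_empty by blast
  have low: "\<exists>n0. \<forall>n\<ge>n0. integral\<^sup>L N (\<lambda>\<omega>. f (Z \<omega>)) - e < integral\<^sup>L M (\<lambda>\<omega>. f (Y n \<omega>))"
    if f: "continuous_map (mtopology_of m) euclideanreal f"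
      and B: "\<And>x. x \<in> mspace m \<Longrightarrow> \<bar>f x\<bar> \<le> B" and e: "e > 0" for f B e
  proof -
    obtain g where g: "\<And>k x. x \<in> mspace m \<Longrightarrow> \<bar>g k x\<bar> \<le> B" "\<And>k x. x \<in> mspace m \<Longrightarrow> g k x \<le> f x"
      "\<And>k x y. x \<in> mspace m \<Longrightarrow> y \<in> mspace m \<Longrightarrow> \<bar>g k x - g k y\<bar> \<le> real k * mdist m x y"
      "\<And>x. x \<in> mspace m \<Longrightarrow> (\<lambda>k. g k x) \<longlonglongrightarrow> f x"
      using infimal_convolution[OF f B ne] by metis
    have gm: "g k \<in> borel_measurable (borel_of_topology (mtopology_of m))" for k
      by (intro continuous_map_borel_measurable Lipschitz_imp_continuous_map_real[where K="real k"] g(3))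
    have fm: "f \<in> borel_measurable (borel_of_topology (mtopology_of m))"
      by (rule continuous_map_borel_measurable[OF f])
    note meas = measurable_compose[OF Y gm] measurable_compose[OF Y fm] measurable_compose[OF Z gm] measurable_compose[OF Z fm]
    \<comment> \<open>The level \<open>k\<close> is chosen under the limit law alone; a single
      Lipschitz function is then followed along the sequence.\<close>
    have "(\<lambda>k. integral\<^sup>L N (\<lambda>\<omega>. g k (Z \<omega>))) \<longlonglongrightarrow> integral\<^sup>L N (\<lambda>\<omega>. f (Z \<omega>))"
      by (rule integral_dominated_convergence[where w="\<lambda>_. B"])
        (use meas g Zsp in \<open>auto intro!: AE_I2\<close>)
    then obtain k where k: "\<bar>integral\<^sup>L N (\<lambda>\<omega>. g k (Z \<omega>)) - integral\<^sup>L N (\<lambda>\<omega>. f (Z \<omega>))\<bar> < e/2"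
      using LIMSEQ_D[of _ _ "e/2"] e by (metis half_gt_zero le_refl real_norm_def)
    have "(\<lambda>n. integral\<^sup>L M (\<lambda>\<omega>. g k (Y n \<omega>))) \<longlonglongrightarrow> integral\<^sup>L N (\<lambda>\<omega>. g k (Z \<omega>))"
      by (rule conv[OF g(1) _ g(3)]) auto
    then obtain n0 where n0: "\<And>n. n \<ge> n0 \<Longrightarrow> \<bar>integral\<^sup>L M (\<lambda>\<omega>. g k (Y n \<omega>)) - integral\<^sup>L N (\<lambda>\<omega>. g k (Z \<omega>))\<bar> < e/2"
      using LIMSEQ_D[of _ _ "e/2"] e by (metis half_gt_zero real_norm_def)
    have le_gf: "integral\<^sup>L M (\<lambda>\<omega>. g k (Y n \<omega>)) \<le> integral\<^sup>L M (\<lambda>\<omega>. f (Y n \<omega>))" for n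
      by (intro integral_mono M.integrable_const_bound[of _ B]) (use meas g B Ysp in \<open>auto intro!: AE_I2\<close>)
    have "integral\<^sup>L N (\<lambda>\<omega>. f (Z \<omega>)) - e < integral\<^sup>L M (\<lambda>\<omega>. f (Y n \<omega>))" if "n \<ge> n0" for n
      using n0[OF that] k le_gf[of n] by linarith
    then show ?thesis by blast
  qed
  fix f
  assume f: "continuous_map (mtopology_of m) euclideanreal f" and bdd: "bounded (f ` topspace (mtopology_of m))"
  then obtain B where B: "\<And>x. x \<in> mspace m \<Longrightarrow> \<bar>f x\<bar> \<le> B" by (auto simp: bounded_iff)
  have f': "continuous_map (mtopology_of m) euclideanreal (\<lambda>x. - f x)" using f by (rule continuous_map_minus)
  show "(\<lambda>n. integral\<^sup>L M (\<lambda>\<omega>. f (Y n \<omega>))) \<longlonglongrightarrow> integral\<^sup>L N (\<lambda>\<omega>. f (Z \<omega>))"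
  proof (rule LIMSEQ_I)
    fix e :: real assume e: "e > 0"
    obtain n1 where n1: "\<And>n. n \<ge> n1 \<Longrightarrow> integral\<^sup>L N (\<lambda>\<omega>. f (Z \<omega>)) - e < integral\<^sup>L M (\<lambda>\<omega>. f (Y n \<omega>))"
      using low[OF f B e] by auto
    obtain n2 where n2: "\<And>n. n \<ge> n2 \<Longrightarrow> integral\<^sup>L N (\<lambda>\<omega>. - f (Z \<omega>)) - e < integral\<^sup>L M (\<lambda>\<omega>. - f (Y n \<omega>))"
      using low[OF f' _ e, of B] B by auto
    have "norm (integral\<^sup>L M (\<lambda>\<omega>. f (Y n \<omega>)) - integral\<^sup>L N (\<lambda>\<omega>. f (Z \<omega>))) < e" if "n \<ge> max n1 n2" for n
      using n1[of n] n2[of n] that by auto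
    then show "\<exists>no. \<forall>n\<ge>no. norm (integral\<^sup>L M (\<lambda>\<omega>. f (Y n \<omega>)) - integral\<^sup>L N (\<lambda>\<omega>. f (Z \<omega>))) < e" by blast
  qed
qed

subsection \<open>The space of continuous paths\<close>

lemma mspace_path_metric:
  "mspace (path_metric :: (real \<Rightarrow> real^'d) metric) = {f \<in> extensional {0..1}. continuous_on {0..1} f}"
  unfolding path_metric_def by (subst compactin_mspace_cfunspace) (auto simp: compactin_subtopology)

lemma path_mdist_le:
  assumes "f \<in> mspace path_metric" "g \<in> mspace (path_metric :: (real \<Rightarrow> real^'d) metric)"
  shows "mdist path_metric f g \<le> a \<longleftrightarrow> (\<forall>t\<in>{0..1}. norm (f t - g t) \<le> a)"
  using assms unfolding path_metric_def by (subst cfunspace_mdist_le) (auto simp: dist_norm)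

lemma path_of_in_mspace:
  "continuous_on {0..1} (\<lambda>t. Z t \<omega>) \<Longrightarrow> path_of Z \<omega> \<in> mspace path_metric"
  by (auto simp: mspace_path_metric path_of_def cong: continuous_on_cong_simp)

definition dyadic_floor :: "nat \<Rightarrow> real \<Rightarrow> real" where
  "dyadic_floor m t = real_of_int \<lfloor>2 ^ m * t\<rfloor> / 2 ^ m"

lemma dyadic_floor_bounds:
  "dyadic_floor m t \<le> t" "t < dyadic_floor m t + (1/2) ^ m" "0 \<le> t \<Longrightarrow> 0 \<le> dyadic_floor m t"
proof -
  show "dyadic_floor m t \<le> t" unfolding dyadic_floor_def
    using of_int_floor_le[of "2 ^ m * t"] by (simp add: pos_divide_le_eq mult.commute)
  have "2 ^ m * t < real_of_int \<lfloor>2 ^ m * t\<rfloor> + 1" by linarith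
  then show "t < dyadic_floor m t + (1/2) ^ m"
    unfolding dyadic_floor_def by (simp add: field_simps power_one_over)
qed (auto simp: dyadic_floor_def)

lemma dyadic_floor_tendsto: "(\<lambda>m. dyadic_floor m t) \<longlonglongrightarrow> t"
proof (rule tendsto_sandwich)
  show "(\<lambda>m. t - (1/2) ^ m) \<longlonglongrightarrow> t"
    using tendsto_diff[OF tendsto_const LIMSEQ_power_zero[of "1/2::real"]] by auto
  show "\<forall>\<^sub>F m in sequentially. t - (1/2) ^ m \<le> dyadic_floor m t"
    using dyadic_floor_bounds(2)[of t] by (intro always_eventually allI) (smt (verit))
  show "\<forall>\<^sub>F m in sequentially. dyadic_floor m t \<le> t"
    using dyadic_floor_bounds(1) by auto
qed auto

lemma dyadic_floor_in_unit: "t \<in> {0..1} \<Longrightarrow> dyadic_floor m t \<in> {0..1}"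
  using dyadic_floor_bounds(1)[of m t] dyadic_floor_bounds(3)[of t m] by auto

lemma continuous_on_dyadic_tendsto:
  assumes "continuous_on {0..1} f" "t \<in> {0..1}"
  shows "(\<lambda>m. f (dyadic_floor m t)) \<longlonglongrightarrow> f t"
  using assms by (intro continuous_on_tendsto_compose[OF assms(1) dyadic_floor_tendsto])
    (auto intro!: always_eventually dyadic_floor_in_unit simp del: atLeastAtMost_iff)

definition unit_dyadics :: "real set" where
  "unit_dyadics = (\<lambda>(k, m). real k / 2 ^ m) ` {(k :: nat, m :: nat). k \<le> 2 ^ m}"

lemma countable_unit_dyadics: "countable unit_dyadics"
  unfolding unit_dyadics_def by auto

lemma unit_dyadics_subset: "unit_dyadics \<subseteq> {0..1}"
  unfolding unit_dyadics_def by (auto simp: divide_le_eq)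

lemma unit_dyadicsI: "k \<le> 2 ^ m \<Longrightarrow> real k / 2 ^ m \<in> unit_dyadics"
  unfolding unit_dyadics_def by auto

lemma dyadic_floor_unit_dyadics: "t \<in> {0..1} \<Longrightarrow> dyadic_floor m t \<in> unit_dyadics"
proof -
  assume t: "t \<in> {0..1}"
  have "dyadic_floor m t = real (nat \<lfloor>2 ^ m * t\<rfloor>) / 2 ^ m" using t by (simp add: dyadic_floor_def)
  moreover have "nat \<lfloor>2 ^ m * t\<rfloor> \<le> 2 ^ m"
  proof -
    have "\<lfloor>2 ^ m * t\<rfloor> \<le> \<lfloor>2 ^ m :: real\<rfloor>" using t by (intro floor_mono) (auto simp: mult_left_le)
    then show ?thesis by (simp add: nat_le_iff)
  qed
  ultimately show ?thesis by (metis unit_dyadicsI)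
qed

text \<open>Nodes are an array over \<open>nat \<times> 'd\<close>, so that a functional of a
  polygon is a function on a countable product, the setting of the finite-dimensional limit
  theorem.\<close>

definition polygon :: "nat \<Rightarrow> (nat \<times> 'd \<Rightarrow> real) \<Rightarrow> real \<Rightarrow> real^'d" where
  "polygon m x = restrict (\<lambda>t. \<chi> j. piecewise_linear (2 ^ m) (\<lambda>k. x (k, j)) t) {0..1}"

lemma continuous_on_polygon: "continuous_on {0..1} (polygon m x)"
proof -
  have "continuous_on {0..1} (\<lambda>t. \<chi> j. piecewise_linear (2 ^ m) (\<lambda>k. x (k, j)) t)"
    by (intro continuous_on_vec_lambda continuous_on_piecewise_linear)
  then show ?thesis unfolding polygon_def by (simp cong: continuous_on_cong_simp)
qed

lemma polygon_in_mspace: "polygon m x \<in> mspace path_metric"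
  using continuous_on_polygon[of m x] by (simp add: mspace_path_metric polygon_def)

lemma norm_vec_le: "(\<And>j. \<bar>v $ j\<bar> \<le> e j) \<Longrightarrow> norm (v :: real^'d) \<le> (\<Sum>j\<in>UNIV. e j)"
  by (rule order_trans[OF norm_le_l1_cart]) (intro sum_mono)

lemma polygon_dist_le:
  fixes x y :: "nat \<times> 'd::finite \<Rightarrow> real"
  assumes "\<And>k j. k \<le> 2 ^ m \<Longrightarrow> \<bar>x (k, j) - y (k, j)\<bar> \<le> e"
  shows "mdist path_metric (polygon m x) (polygon m y) \<le> real CARD('d) * e"
proof (subst path_mdist_le, goal_cases)
  case 3
  show ?case
  proof
    fix t :: real assume t: "t \<in> {0..1}"
    have "\<bar>piecewise_linear (2 ^ m) (\<lambda>k. x (k, j)) t - piecewise_linear (2 ^ m) (\<lambda>k. y (k, j)) t\<bar> \<le> e" for j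
      using piecewise_linear_diff_le[of t "2 ^ m" "\<lambda>k. x (k, j) - y (k, j)" 0 e] t assms
      by (simp add: piecewise_linear_diff)
    then have "norm (polygon m x t - polygon m y t) \<le> (\<Sum>j\<in>(UNIV::'d set). e)"
      using t by (intro norm_vec_le) (simp add: polygon_def)
    then show "norm (polygon m x t - polygon m y t) \<le> real CARD('d) * e" by simp
  qed
qed (rule polygon_in_mspace)+

definition path_nodes :: "nat \<Rightarrow> (real \<Rightarrow> real^'d) \<Rightarrow> nat \<times> 'd \<Rightarrow> real" where
  "path_nodes m y = (\<lambda>(k, j). y (real k / 2 ^ m) $ j)"

lemma polygon_path_nodes:
  "t \<in> {0..1} \<Longrightarrow> polygon m (path_nodes m y) t $ j = dyadic_interpolation m (\<lambda>t. y t $ j) t"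
  by (simp add: polygon_def path_nodes_def dyadic_interpolation_def)

lemma polygon_tendsto:
  fixes y :: "real \<Rightarrow> real^'d"
  assumes "y \<in> mspace path_metric" "e > 0"
  obtains m where "\<And>m'. m' \<ge> m \<Longrightarrow> mdist path_metric (polygon m' (path_nodes m' y)) y \<le> e"
proof -
  define e' where "e' = e / CARD('d)"
  have e': "e' > 0" using assms by (simp add: e'_def)
  have "uniformly_continuous_on {0..1} y"
    using assms by (intro compact_uniformly_continuous) (auto simp: mspace_path_metric)
  then obtain d where d: "d > 0" "\<And>s t. s \<in> {0..1} \<Longrightarrow> t \<in> {0..1} \<Longrightarrow> dist s t < d \<Longrightarrow> dist (y s) (y t) < e'"
    unfolding uniformly_continuous_on_def using e' by metis
  obtain m where m: "(1/2::real) ^ m < d" using d(1) real_arch_pow_inv[of d "1/2"] by auto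
  show thesis
  proof (rule that)
    fix m' assume "m \<le> m'"
    then have "(1/2::real) ^ m' \<le> (1/2) ^ m" by (intro power_decreasing) auto
    then have m': "1 / 2 ^ m' < d" using m by (simp add: power_divide)
    have "norm (polygon m' (path_nodes m' y) t - y t) \<le> e" if t: "t \<in> {0..1}" for t
    proof -
      have "\<bar>(polygon m' (path_nodes m' y) t - y t) $ j\<bar> \<le> e'" for j
      proof -
        have "\<bar>y s $ j - y t $ j\<bar> \<le> e'" if "0 \<le> s" "s \<le> 1" "\<bar>s - t\<bar> \<le> 1 / 2 ^ m'" for s
          using d(2)[of s t] that t m' component_le_norm_cart[of "y s - y t" j] by (auto simp: dist_norm)
        then show ?thesis
          using dyadic_interpolation_diff_le[of t m' "\<lambda>t. y t $ j" "y t $ j" e'] t by (simp add: polygon_path_nodes)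
      qed
      then have "norm (polygon m' (path_nodes m' y) t - y t) \<le> (\<Sum>j\<in>(UNIV::'d set). e')"
        by (rule norm_vec_le)
      then show ?thesis by (simp add: e'_def)
    qed
    then show "mdist path_metric (polygon m' (path_nodes m' y)) y \<le> e"
      by (subst path_mdist_le) (auto simp: polygon_in_mspace assms)
  qed
qed

text \<open>Lists of rationals form a countable type, and \<open>to_nat\<close> finds the list entry
  of the node \<open>(k, j)\<close>. The polygons with these nodes are therefore countably
  many.\<close>

definition rational_nodes :: "rat list \<Rightarrow> nat \<times> 'd::finite \<Rightarrow> real" where
  "rational_nodes l i = of_rat (l ! to_nat i)"

text \<open>Separability of the path space: a path is approximated by its own polygon up to
  \<open>e/2\<close>, and finitely many nodes are then moved to rational values.\<close>

lemma rational_polygons_dense: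
  fixes y :: "real \<Rightarrow> real^'d"
  assumes y: "y \<in> mspace path_metric" and e: "e > 0"
  obtains m l where "mdist path_metric (polygon m (rational_nodes l)) y \<le> e"
proof -
  interpret Metric_space "mspace path_metric" "mdist (path_metric :: (real \<Rightarrow> real^'d) metric)" by simp
  obtain m where m: "mdist path_metric (polygon m (path_nodes m y)) y \<le> e/2"
    using polygon_tendsto[OF y, of "e/2"] e by auto
  define e' where "e' = e / (2 * CARD('d))"
  have "e' > 0" using e by (simp add: e'_def)
  then have "\<exists>q. \<bar>of_rat q - path_nodes m y i\<bar> \<le> e'" for i
  proof -
    from \<open>e' > 0\<close> obtain q where "path_nodes m y i < of_rat q" "of_rat q < path_nodes m y i + e'"
      using of_rat_dense[of "path_nodes m y i" "path_nodes m y i + e'"] by auto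
    then show ?thesis by (intro exI[of _ q]) auto
  qed
  then obtain q where q: "\<And>i. \<bar>of_rat (q i) - path_nodes m y i\<bar> \<le> e'" by metis
  have fin: "finite (to_nat ` ({..(2::nat) ^ m} \<times> (UNIV :: 'd set)) :: nat set)" by simp
  then obtain L where L: "\<And>i. i \<in> {..(2::nat) ^ m} \<times> (UNIV :: 'd set) \<Longrightarrow> (to_nat i :: nat) < L"
    using finite_nat_set_iff_bounded by (metis imageI)
  define l where "l = map (\<lambda>n. q (from_nat n)) [0..<L]"
  have "\<bar>rational_nodes l (k, j) - path_nodes m y (k, j)\<bar> \<le> e'" if "k \<le> 2 ^ m" for k j
    using q[of "(k, j)"] L[of "(k, j)"] that by (simp add: rational_nodes_def l_def)
  then have "mdist path_metric (polygon m (rational_nodes l)) (polygon m (path_nodes m y)) \<le> real CARD('d) * e'"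
    by (rule polygon_dist_le)
  also have "\<dots> = e/2" by (simp add: e'_def)
  finally have "mdist path_metric (polygon m (rational_nodes l)) y \<le> e"
    using m triangle[OF polygon_in_mspace[of m "rational_nodes l"] polygon_in_mspace[of m "path_nodes m y"] y] by simp
  then show ?thesis by (rule that)
qed

text \<open>By separability an open set is a countable union of closed balls around rational
  polygons. By continuity such a ball is described by countably many conditions, one for each dyadic
  time, so measurability of the single variables \<open>Z t\<close> suffices.\<close>

lemma path_of_measurable:
  fixes Z :: "real \<Rightarrow> 'w \<Rightarrow> real^'d"
  assumes Z: "\<And>t. t \<in> {0..1} \<Longrightarrow> Z t \<in> borel_measurable M"
    and cont: "\<And>\<omega>. \<omega> \<in> space M \<Longrightarrow> continuous_on {0..1} (\<lambda>t. Z t \<omega>)"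
  shows "path_of Z \<in> measurable M (borel_of_topology (mtopology_of path_metric))"
proof (rule measurable_borel_of_topologyI)
  interpret Metric_space "mspace path_metric" "mdist (path_metric :: (real \<Rightarrow> real^'d) metric)" by simp
  show "path_of Z \<in> space M \<rightarrow> topspace (mtopology_of path_metric)"
    using cont by (auto intro!: path_of_in_mspace)
  fix U :: "(real \<Rightarrow> real^'d) set" assume U: "openin (mtopology_of path_metric) U"
  define Q where "Q m l = polygon m (rational_nodes l :: nat \<times> 'd \<Rightarrow> real)" for m l
  define A where "A m l n = {\<omega> \<in> space M. \<forall>t\<in>unit_dyadics. norm (Q m l t - Z t \<omega>) \<le> 1 / real (Suc n)}" for m l n
  \<comment> \<open>The countable set of indices of those balls that lie inside
    \<open>U\<close>.\<close>
  define I where "I = {(m, l, n). \<forall>y\<in>mspace path_metric. mdist path_metric (Q m l) y \<le> 1 / real (Suc n) \<longrightarrow> y \<in> U}"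
  have A: "A m l n \<in> sets M" for m l n
  proof -
    have "{\<omega> \<in> space M. norm (Q m l t - Z t \<omega>) \<le> 1 / real (Suc n)} \<in> sets M" if "t \<in> unit_dyadics" for t
    proof -
      have [measurable]: "Z t \<in> borel_measurable M" using Z that unit_dyadics_subset by blast
      show ?thesis by measurable
    qed
    then have "(\<Inter>t\<in>unit_dyadics. {\<omega> \<in> space M. norm (Q m l t - Z t \<omega>) \<le> 1 / real (Suc n)}) \<in> sets M"
      using unit_dyadicsI[of 0 0] by (intro sets.countable_INT' countable_unit_dyadics) auto
    also have "(\<Inter>t\<in>unit_dyadics. {\<omega> \<in> space M. norm (Q m l t - Z t \<omega>) \<le> 1 / real (Suc n)}) = A m l n"
      using unit_dyadicsI[of 0 0] by (auto simp: A_def)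
    finally show ?thesis .
  qed
  have A_iff: "\<omega> \<in> A m l n \<longleftrightarrow> mdist path_metric (Q m l) (path_of Z \<omega>) \<le> 1 / real (Suc n)" if w: "\<omega> \<in> space M" for m l n \<omega>
  proof -
    have "(\<forall>t\<in>unit_dyadics. norm (Q m l t - Z t \<omega>) \<le> 1 / real (Suc n)) \<longleftrightarrow> (\<forall>t\<in>{0..1}. norm (Q m l t - Z t \<omega>) \<le> 1 / real (Suc n))"
    proof
      assume *: "\<forall>t\<in>unit_dyadics. norm (Q m l t - Z t \<omega>) \<le> 1 / real (Suc n)"
      show "\<forall>t\<in>{0..1}. norm (Q m l t - Z t \<omega>) \<le> 1 / real (Suc n)"
      proof
        fix t :: real assume t: "t \<in> {0..1}"
        have c: "continuous_on {0..1} (\<lambda>t. norm (Q m l t - Z t \<omega>))"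
          unfolding Q_def by (intro continuous_intros continuous_on_polygon cont w)
        show "norm (Q m l t - Z t \<omega>) \<le> 1 / real (Suc n)"
          by (rule LIMSEQ_le_const2[OF continuous_on_dyadic_tendsto[OF c t]])
            (use * dyadic_floor_unit_dyadics[OF t] in blast)
      qed
    qed (use unit_dyadics_subset in blast)
    moreover have "mdist path_metric (Q m l) (path_of Z \<omega>) \<le> 1 / real (Suc n) \<longleftrightarrow>
        (\<forall>t\<in>{0..1}. norm (Q m l t - Z t \<omega>) \<le> 1 / real (Suc n))"
      using cont[OF w] by (subst path_mdist_le) (auto simp: Q_def polygon_in_mspace path_of_in_mspace[unfolded path_of_def] path_of_def)
    ultimately show ?thesis using w by (simp add: A_def)
  qed
  have "path_of Z -` U \<inter> space M = (\<Union>(m, l, n)\<in>I. A m l n)"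
  proof (intro set_eqI iffI)
    fix \<omega> assume w: "\<omega> \<in> path_of Z -` U \<inter> space M"
    then have pm: "path_of Z \<omega> \<in> mspace path_metric" using cont by (auto intro!: path_of_in_mspace)
    obtain r where r: "r > 0" "mball (path_of Z \<omega>) r \<subseteq> U"
      using U w by (auto simp: mtopology_of_def openin_mtopology)
    obtain n where n: "1 / real (Suc n) < r / 2" using nat_approx_posE[of "r/2"] r by auto
    obtain m l where ml: "mdist path_metric (Q m l) (path_of Z \<omega>) \<le> 1 / real (Suc n)"
      unfolding Q_def using rational_polygons_dense[OF pm, of "1 / real (Suc n)"] by auto
    have "(m, l, n) \<in> I" unfolding I_def
    proof (clarify)
      fix y :: "real \<Rightarrow> real^'d" assume y: "y \<in> mspace path_metric" "mdist path_metric (Q m l) y \<le> 1 / real (Suc n)"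
      have "mdist path_metric (path_of Z \<omega>) y \<le> mdist path_metric (Q m l) (path_of Z \<omega>) + mdist path_metric (Q m l) y"
        using triangle[OF pm _ y(1), of "Q m l"] polygon_in_mspace commute unfolding Q_def by metis
      then have "mdist path_metric (path_of Z \<omega>) y < r" using ml y(2) n by linarith
      then show "y \<in> U" using r pm y(1) by auto
    qed
    moreover have "\<omega> \<in> A m l n" using w ml A_iff by auto
    ultimately show "\<omega> \<in> (\<Union>(m, l, n)\<in>I. A m l n)" by blast
  next
    fix \<omega> assume "\<omega> \<in> (\<Union>(m, l, n)\<in>I. A m l n)"
    then obtain m l n where i: "(m, l, n) \<in> I" "\<omega> \<in> A m l n" by blast
    then have w: "\<omega> \<in> space M" by (simp add: A_def)
    have "path_of Z \<omega> \<in> U"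
      using i A_iff[OF w] path_of_in_mspace[where Z=Z, OF cont[OF w]] by (auto simp: I_def)
    then show "\<omega> \<in> path_of Z -` U \<inter> space M" using w by simp
  qed
  moreover have "(\<Union>(m, l, n)\<in>I. A m l n) \<in> sets M"
    by (rule sets.countable_UN') (auto simp: A)
  ultimately show "path_of Z -` U \<inter> space M \<in> sets M" by simp
qed

subsection \<open>Centered Gaussian variables\<close>

text \<open>Working with the characteristic function covers the degenerate case \<open>v = 0\<close>.\<close>

definition centered_gaussian :: "'a measure \<Rightarrow> ('a \<Rightarrow> real) \<Rightarrow> real \<Rightarrow> bool" where
  "centered_gaussian M Y v \<longleftrightarrow> Y \<in> borel_measurable M \<and> 0 \<le> v \<and>
     char (distr M borel Y) = (\<lambda>u. complex_of_real (exp (- (u\<^sup>2 * v) / 2)))"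

context prob_space
begin

lemma char_distr:
  "Y \<in> borel_measurable M \<Longrightarrow> char (distr M borel Y) u = (CLINT \<omega>|M. iexp (u * Y \<omega>))"
  by (simp add: char_def integral_distr)

lemma centered_gaussian_AE_cong:
  assumes "centered_gaussian M Y v" "AE \<omega> in M. Y \<omega> = Y' \<omega>" "Y' \<in> borel_measurable M"
  shows "centered_gaussian M Y' v"
proof -
  have "distr M borel Y = distr M borel Y'"
    using assms by (intro distr_cong_AE) (auto simp: centered_gaussian_def)
  then show ?thesis using assms by (simp add: centered_gaussian_def)
qed

lemma centered_gaussian_0:
  assumes "centered_gaussian M Y 0"
  shows "AE \<omega> in M. Y \<omega> = 0"
proof -
  have [measurable]: "Y \<in> borel_measurable M" using assms by (simp add: centered_gaussian_def)
  have "distr M borel Y = return borel 0"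
  proof (rule Levy_uniqueness)
    show "real_distribution (distr M borel Y)" by (simp add: real_distribution_distr)
    interpret R: prob_space "return borel (0::real)" by (rule prob_space_return) simp
    show "real_distribution (return borel (0::real))" by unfold_locales auto
    show "char (distr M borel Y) = char (return borel 0)"
      using assms by (auto simp: centered_gaussian_def char_def integral_return)
  qed
  moreover have "AE x in return borel (0::real). x = 0" by (subst AE_return) auto
  ultimately have "AE x in distr M borel Y. x = 0" by (simp only:)
  then show ?thesis by (simp add: AE_distr_iff)
qed

lemma centered_gaussian_distributed:
  assumes Y: "centered_gaussian M Y v" and v: "v > 0"
  shows "distributed M lborel Y (\<lambda>x. ennreal (normal_density 0 (sqrt v) x))"
proof -
  have [measurable]: "Y \<in> borel_measurable M" using Y by (simp add: centered_gaussian_def)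
  have "distr M borel (\<lambda>\<omega>. Y \<omega> / sqrt v) = std_normal_distribution"
  proof (rule Levy_uniqueness)
    show "real_distribution (distr M borel (\<lambda>\<omega>. Y \<omega> / sqrt v))" by (simp add: real_distribution_distr)
    show "real_distribution std_normal_distribution" by (rule real_dist_normal_dist)
    have "char (distr M borel (\<lambda>\<omega>. Y \<omega> / sqrt v)) u = char (distr M borel Y) (u / sqrt v)" for u
      by (simp add: char_distr)
    then show "char (distr M borel (\<lambda>\<omega>. Y \<omega> / sqrt v)) = char std_normal_distribution"
      using Y v by (auto simp: centered_gaussian_def char_std_normal_distribution fun_eq_iff power_divide)
  qed
  moreover have "distr M lborel (\<lambda>\<omega>. Y \<omega> / sqrt v) = distr M borel (\<lambda>\<omega>. Y \<omega> / sqrt v)"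
    by (rule distr_cong) auto
  ultimately have "distributed M lborel (\<lambda>\<omega>. (Y \<omega> - 0) / sqrt v) std_normal_density"
    unfolding distributed_def by simp
  then show ?thesis using normal_standard_normal_convert[of "sqrt v" Y 0] v by simp
qed

lemma centered_gaussian_moments:
  assumes Y: "centered_gaussian M Y v"
  shows "integrable M (\<lambda>\<omega>. Y \<omega> ^ k)" and "expectation Y = 0"
    and "expectation (\<lambda>\<omega>. (Y \<omega>)\<^sup>2) = v" and "expectation (\<lambda>\<omega>. Y \<omega> ^ 4) = 3 * v\<^sup>2"
proof -
  have [measurable]: "Y \<in> borel_measurable M" and v0: "0 \<le> v" using Y by (simp_all add: centered_gaussian_def)
  have "integrable M (\<lambda>\<omega>. Y \<omega> ^ k) \<and> expectation Y = 0 \<and> expectation (\<lambda>\<omega>. (Y \<omega>)\<^sup>2) = v \<and>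
      expectation (\<lambda>\<omega>. Y \<omega> ^ 4) = 3 * v\<^sup>2"
  proof (cases "v = 0")
    case True
    then have *: "AE \<omega> in M. Y \<omega> = 0" using Y centered_gaussian_0 by simp
    have "integrable M (\<lambda>\<omega>. Y \<omega> ^ k) \<longleftrightarrow> integrable M (\<lambda>\<omega>. (0::real) ^ k)"
      by (intro integrable_cong_AE) (use * in auto)
    moreover have "expectation Y = expectation (\<lambda>\<omega>. 0)" by (intro integral_cong_AE) (use * in auto)
    moreover have "expectation (\<lambda>\<omega>. (Y \<omega>)\<^sup>2) = expectation (\<lambda>\<omega>. 0)" by (intro integral_cong_AE) (use * in auto)
    moreover have "expectation (\<lambda>\<omega>. Y \<omega> ^ 4) = expectation (\<lambda>\<omega>. 0)" by (intro integral_cong_AE) (use * in auto)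
    ultimately show ?thesis using True by simp
  next
    case False
    then have s: "0 < sqrt v" using v0 by simp
    have D: "distributed M lborel Y (\<lambda>x. ennreal (normal_density 0 (sqrt v) x))"
      using centered_gaussian_distributed[OF Y] False v0 by simp
    have int: "integrable M (\<lambda>\<omega>. Y \<omega> ^ k)" for k
      using integrable_normal_moment[OF s, of 0 k] distributed_integrable[OF D, of "\<lambda>x. x ^ k"] by simp
    have "expectation (\<lambda>\<omega>. Y \<omega> ^ (2 * k)) = fact (2 * k) / ((2 / v) ^ k * fact k)" for k
      using integral_normal_moment_even[OF s, of 0 k] distributed_integral[OF D, of "\<lambda>x. x ^ (2 * k)"] v0 by simp
    from this[of 1] this[of 2] show ?thesis
      using int normal_distributed_expectation[OF s D] False
      by (simp add: fact_numeral power2_eq_square eval_nat_numeral)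
  qed
  then show "integrable M (\<lambda>\<omega>. Y \<omega> ^ k)" and "expectation Y = 0"
    and "expectation (\<lambda>\<omega>. (Y \<omega>)\<^sup>2) = v" and "expectation (\<lambda>\<omega>. Y \<omega> ^ 4) = 3 * v\<^sup>2" by auto
qed

lemma gaussian_variable_centered:
  assumes "centered_gaussian M Y v"
  shows "gaussian_variable M Y"
proof (cases "v = 0")
  case True
  then show ?thesis using assms centered_gaussian_0[of Y] by (auto simp: gaussian_variable_def centered_gaussian_def)
next
  case False
  then have "v > 0" using assms by (simp add: centered_gaussian_def)
  then show ?thesis using centered_gaussian_distributed[OF assms] assms
    unfolding gaussian_variable_def centered_gaussian_def by (metis real_sqrt_gt_0_iff)
qed

text \<open>Characteristic functions converge by dominated convergence, so the class is closed under
  pointwise limits even if the limiting variance is 0.\<close>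

lemma centered_gaussian_limit:
  assumes Y: "\<And>m. centered_gaussian M (Y m) (v m)" and v: "v \<longlonglongrightarrow> v'"
    and lim: "\<And>\<omega>. \<omega> \<in> space M \<Longrightarrow> (\<lambda>m. Y m \<omega>) \<longlonglongrightarrow> Y' \<omega>"
  shows "centered_gaussian M Y' v'"
proof -
  have Ym [measurable]: "Y m \<in> borel_measurable M" and v0: "0 \<le> v m" for m
    using Y by (simp_all add: centered_gaussian_def)
  have [measurable]: "Y' \<in> borel_measurable M" by (rule borel_measurable_LIMSEQ_real[OF lim Ym])
  have v'0: "0 \<le> v'" by (rule LIMSEQ_le_const[OF v]) (use v0 in auto)
  have "char (distr M borel Y') u = complex_of_real (exp (- (u\<^sup>2 * v') / 2))" for u
  proof (rule LIMSEQ_unique)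
    show "(\<lambda>m. char (distr M borel (Y m)) u) \<longlonglongrightarrow> char (distr M borel Y') u"
      unfolding char_distr[OF Ym] char_distr[OF \<open>Y' \<in> borel_measurable M\<close>]
    proof (rule integral_dominated_convergence[where w="\<lambda>_. 1"])
      show "AE \<omega> in M. (\<lambda>m. iexp (u * Y m \<omega>)) \<longlonglongrightarrow> iexp (u * Y' \<omega>)"
        using lim by (intro AE_I2) (auto intro!: tendsto_intros)
    qed auto
    have "(\<lambda>m. complex_of_real (exp (- (u\<^sup>2 * v m) / 2))) \<longlonglongrightarrow> complex_of_real (exp (- (u\<^sup>2 * v') / 2))"
      by (intro tendsto_intros v) simp
    then show "(\<lambda>m. char (distr M borel (Y m)) u) \<longlonglongrightarrow> complex_of_real (exp (- (u\<^sup>2 * v') / 2))"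
      using Y by (simp add: centered_gaussian_def)
  qed
  then show ?thesis using v'0 by (auto simp: centered_gaussian_def)
qed

lemma centered_gaussian_sum:
  fixes \<gamma> :: "nat \<Rightarrow> 'a \<Rightarrow> real"
  assumes ind: "indep_vars (\<lambda>_. borel) \<gamma> UNIV"
    and std: "\<And>n. distr M borel (\<gamma> n) = std_normal_distribution"
  shows "centered_gaussian M (\<lambda>\<omega>. \<Sum>n<m. a n * \<gamma> n \<omega>) (\<Sum>n<m. (a n)\<^sup>2)"
proof -
  have [measurable]: "\<gamma> n \<in> borel_measurable M" for n
    using ind by (simp add: indep_vars_def)
  have ind': "indep_vars (\<lambda>_. borel) (\<lambda>n \<omega>. a n * \<gamma> n \<omega>) {..<m}"
    using indep_vars_subset[OF ind, of "{..<m}"] by (rule indep_vars_compose2) auto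
  have "char (distr M borel (\<lambda>\<omega>. \<Sum>n<m. a n * \<gamma> n \<omega>)) u =
      complex_of_real (exp (- (u\<^sup>2 * (\<Sum>n<m. (a n)\<^sup>2)) / 2))" for u
  proof -
    have "char (distr M borel (\<lambda>\<omega>. a n * \<gamma> n \<omega>)) u = char (distr M borel (\<gamma> n)) (u * a n)" for n
      by (simp add: char_distr mult.assoc)
    then have "char (distr M borel (\<lambda>\<omega>. \<Sum>n<m. a n * \<gamma> n \<omega>)) u =
        (\<Prod>n<m. complex_of_real (exp (- (u * a n)\<^sup>2 / 2)))"
      by (simp add: char_distr_sum[OF ind'] std char_std_normal_distribution)
    also have "\<dots> = complex_of_real (exp (\<Sum>n<m. - (u * a n)\<^sup>2 / 2))"
      by (simp only: exp_sum finite_lessThan of_real_prod)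
    also have "(\<Sum>n<m. - (u * a n)\<^sup>2 / 2) = - (u\<^sup>2 * (\<Sum>n<m. (a n)\<^sup>2)) / 2"
      by (simp add: sum_distrib_left sum_negf power_mult_distrib flip: sum_divide_distrib)
    finally show ?thesis .
  qed
  then show ?thesis by (auto simp: centered_gaussian_def sum_nonneg)
qed

end

subsection \<open>Cholesky decomposition of an infinite kernel\<close>

definition psd_kernel :: "(nat \<Rightarrow> nat \<Rightarrow> real) \<Rightarrow> bool" where
  "psd_kernel \<kappa> \<longleftrightarrow> (\<forall>k l. \<kappa> k l = \<kappa> l k) \<and>
     (\<forall>A a. finite A \<longrightarrow> 0 \<le> (\<Sum>i\<in>A. \<Sum>j\<in>A. a i * a j * \<kappa> i j))"

text \<open>One elimination step with pivot \<open>p\<close>. If \<open>\<kappa> p p = 0\<close>,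
  division by zero leaves the kernel as it is, which is right: positivity then forces the whole
  column of \<open>p\<close> to vanish.\<close>

definition schur_complement :: "nat \<Rightarrow> (nat \<Rightarrow> nat \<Rightarrow> real) \<Rightarrow> nat \<Rightarrow> nat \<Rightarrow> real" where
  "schur_complement p \<kappa> k l = \<kappa> k l - \<kappa> k p * \<kappa> l p / \<kappa> p p"

lemma psd_kernel_sym: "psd_kernel \<kappa> \<Longrightarrow> \<kappa> k l = \<kappa> l k"
  unfolding psd_kernel_def by blast

lemma psd_kernel_nonneg: "psd_kernel \<kappa> \<Longrightarrow> finite A \<Longrightarrow> 0 \<le> (\<Sum>i\<in>A. \<Sum>j\<in>A. a i * a j * \<kappa> i j)"
  unfolding psd_kernel_def by blast

lemma psd_kernel_diag: "psd_kernel \<kappa> \<Longrightarrow> 0 \<le> \<kappa> p p"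
proof -
  assume "psd_kernel \<kappa>"
  then have "0 \<le> (\<Sum>i\<in>{p}. \<Sum>j\<in>{p}. 1 * 1 * \<kappa> i j)" by (rule psd_kernel_nonneg) simp
  then show ?thesis by simp
qed

text \<open>With a vanishing diagonal entry the quadratic form at \<open>e_k + t e_p\<close> is
  affine in \<open>t\<close>; it can stay nonnegative for all \<open>t\<close> only if its slope is
  0.\<close>

lemma psd_kernel_diag_0:
  assumes "psd_kernel \<kappa>" "\<kappa> p p = 0"
  shows "\<kappa> k p = 0"
proof (cases "k = p")
  case False
  have sym: "\<kappa> p k = \<kappa> k p" by (rule psd_kernel_sym[OF assms(1)])
  have *: "0 \<le> \<kappa> k k + 2 * t * \<kappa> k p" for t
  proof -
    have "0 \<le> (\<Sum>i\<in>{k, p}. \<Sum>j\<in>{k, p}. (if i = p then t else 1) * (if j = p then t else 1) * \<kappa> i j)"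
      by (rule psd_kernel_nonneg[OF assms(1)]) simp
    then show ?thesis using False assms(2) sym by (simp add: algebra_simps)
  qed
  show ?thesis
  proof (rule ccontr)
    assume n: "\<kappa> k p \<noteq> 0"
    have "2 * (- (\<kappa> k k + 1) / (2 * \<kappa> k p)) * \<kappa> k p = - (\<kappa> k k + 1)" using n by (simp add: field_simps)
    with *[of "- (\<kappa> k k + 1) / (2 * \<kappa> k p)"] show False by linarith
  qed
qed (use assms in auto)

text \<open>Completing the square: the form of the complement at \<open>a\<close> is the form of
  \<open>\<kappa>\<close> at \<open>a + t e_p\<close> for the \<open>t\<close> that annihilates the
  \<open>p\<close>-th equation, hence nonnegative.\<close>

lemma psd_kernel_schur_complement:
  assumes \<kappa>: "psd_kernel \<kappa>"
  shows "psd_kernel (schur_complement p \<kappa>)"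
proof (cases "\<kappa> p p = 0")
  case True
  then have "schur_complement p \<kappa> = \<kappa>" by (simp add: schur_complement_def fun_eq_iff)
  then show ?thesis using \<kappa> by simp
next
  case False
  then have pos: "\<kappa> p p > 0" using psd_kernel_diag[OF \<kappa>, of p] by simp
  have sym: "\<kappa> k l = \<kappa> l k" for k l by (rule psd_kernel_sym[OF \<kappa>])
  have "0 \<le> (\<Sum>i\<in>A. \<Sum>j\<in>A. a i * a j * schur_complement p \<kappa> i j)" if A: "finite A" for A a
  proof -
    define s where "s = (\<Sum>i\<in>A. a i * \<kappa> i p)"
    define t where "t = - s / \<kappa> p p"
    \<comment> \<open>The coefficients are cut off outside \<open>A\<close>, so that adding
      \<open>t\<close> at \<open>p\<close> is correct whether or not \<open>p\<close> belongs to
      \<open>A\<close>.\<close>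
    define a' where "a' i = (if i \<in> A then a i else 0)" for i
    define b where "b i = a' i + (if i = p then t else 0)" for i
    let ?A = "insert p A"
    have f: "finite ?A" using A by simp
    have E: "(\<Sum>i\<in>?A. a' i * g i) = (\<Sum>i\<in>A. a i * g i)" for g
    proof -
      have "(\<Sum>i\<in>?A. a' i * g i) = (\<Sum>i\<in>A. a' i * g i)"
        using f by (intro sum.mono_neutral_right) (auto simp: a'_def)
      then show ?thesis by (simp add: a'_def)
    qed
    have E2: "(\<Sum>i\<in>?A. b i * g i) = (\<Sum>i\<in>A. a i * g i) + t * g p" for g
    proof -
      have "(\<Sum>i\<in>?A. b i * g i) = (\<Sum>i\<in>?A. a' i * g i) + (\<Sum>i\<in>?A. if i = p then t * g i else 0)"
        unfolding sum.distrib[symmetric] by (intro sum.cong) (auto simp: b_def algebra_simps)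
      then show ?thesis using f E by simp
    qed
    have "0 \<le> (\<Sum>i\<in>?A. \<Sum>j\<in>?A. b i * b j * \<kappa> i j)" by (rule psd_kernel_nonneg[OF \<kappa> f])
    also have "\<dots> = (\<Sum>i\<in>?A. b i * (\<Sum>j\<in>?A. b j * \<kappa> i j))" by (simp add: sum_distrib_left mult.assoc)
    also have "\<dots> = (\<Sum>i\<in>?A. b i * ((\<Sum>j\<in>A. a j * \<kappa> i j) + t * \<kappa> i p))" by (simp only: E2)
    also have "\<dots> = (\<Sum>i\<in>A. a i * ((\<Sum>j\<in>A. a j * \<kappa> i j) + t * \<kappa> i p)) + t * ((\<Sum>j\<in>A. a j * \<kappa> p j) + t * \<kappa> p p)"
      by (simp only: E2)
    also have "(\<Sum>j\<in>A. a j * \<kappa> p j) = s" unfolding s_def by (simp add: sym[of p])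
    also have "t * (s + t * \<kappa> p p) = 0" using pos by (simp add: t_def)
    also have "(\<Sum>i\<in>A. a i * ((\<Sum>j\<in>A. a j * \<kappa> i j) + t * \<kappa> i p)) =
        (\<Sum>i\<in>A. \<Sum>j\<in>A. a i * a j * \<kappa> i j) + t * s"
      unfolding s_def by (simp add: sum.distrib ring_distribs sum_distrib_left mult_ac)
    also have "t * s = - (\<Sum>i\<in>A. \<Sum>j\<in>A. a i * a j * (\<kappa> i p * \<kappa> j p / \<kappa> p p))"
    proof -
      have "(\<Sum>i\<in>A. \<Sum>j\<in>A. a i * a j * (\<kappa> i p * \<kappa> j p / \<kappa> p p)) = s * s / \<kappa> p p"
        unfolding s_def sum_product by (simp add: sum_divide_distrib mult_ac)
      then show ?thesis by (simp add: t_def)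
    qed
    finally show ?thesis
      by (simp add: schur_complement_def ring_distribs sum_subtractf)
  qed
  moreover have "schur_complement p \<kappa> k l = schur_complement p \<kappa> l k" for k l
    unfolding schur_complement_def by (simp add: sym[of k l])
  ultimately show ?thesis unfolding psd_kernel_def by blast
qed

text \<open>The pivots 0, 1, 2, ... are eliminated in turn; after \<open>n\<close> steps the rows
  below \<open>n\<close> are zero, and the removed rank-one parts add up to the kernel.
  Triangularity matters: it expresses every Gaussian variable by finitely many independent normals.
  A zero pivot yields a zero column.\<close>

lemma cholesky:
  assumes \<kappa>: "psd_kernel \<kappa>"
  shows "\<exists>c. (\<forall>k n. n > k \<longrightarrow> c k n = 0) \<and> (\<forall>k l m. k < m \<longrightarrow> \<kappa> k l = (\<Sum>n<m. c k n * c l n))"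
proof -
  define S where "S n = rec_nat \<kappa> schur_complement n" for n
  have S0: "S 0 = \<kappa>" and SS: "S (Suc n) = schur_complement n (S n)" for n by (simp_all add: S_def)
  have psd: "psd_kernel (S n)" for n
    by (induction n) (auto simp: S0 SS \<kappa> psd_kernel_schur_complement)
  then have sym: "S n k l = S n l k" for n k l by (rule psd_kernel_sym)
  have z: "S n k l = 0" if "k < n" for n k l
    using that
  proof (induction n arbitrary: k l)
    case (Suc n)
    show ?case
    proof (cases "k = n")
      case True
      then show ?thesis
        using psd_kernel_diag_0[OF psd, of n n l] sym[of n l n] by (auto simp: SS schur_complement_def)
    next
      case False
      then have "k < n" using Suc.prems by simp
      then show ?thesis using Suc.IH[of k] by (simp add: SS schur_complement_def)
    qed
  qed simp
  define c where "c k n = S n k n / sqrt (S n n n)" for k n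
  have cc: "c k n * c l n = S n k n * S n l n / S n n n" for k l n
    using psd_kernel_diag[OF psd, of n n] by (simp add: c_def)
  have tel: "\<kappa> k l = S m k l + (\<Sum>n<m. c k n * c l n)" for k l m
    by (induction m) (auto simp: S0 SS schur_complement_def cc)
  have "c k n = 0" if "n > k" for k n using z[OF that] by (simp add: c_def)
  moreover have "\<kappa> k l = (\<Sum>n<m. c k n * c l n)" if "k < m" for k l m
    using tel[of k l m] z[OF that] by simp
  ultimately show ?thesis by blast
qed

subsection \<open>Gaussian processes with continuous paths\<close>

lemma dyadic_interpolation_at_dyadic:
  assumes "k \<le> 2 ^ m" "m \<le> m'"
  shows "dyadic_interpolation m' y (real k / 2 ^ m) = y (real k / 2 ^ m)"
proof -
  define k' where "k' = k * 2 ^ (m' - m)"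
  have "2 ^ m' = (2 ^ (m' - m) * 2 ^ m :: real)" using assms by (simp flip: power_add)
  then have e: "real k / 2 ^ m = real k' / 2 ^ m'" by (simp add: k'_def)
  have "real (2 ^ m') * (real k' / 2 ^ m') = real k'" by simp
  then show ?thesis unfolding e dyadic_interpolation_def piecewise_linear_def Let_def
    by (simp only: floor_of_nat nat_int) simp
qed

text \<open>Tails of the oscillation series make the interpolations uniformly Cauchy. Only values of
  \<open>y\<close> at dyadic points enter and \<open>y\<close> need not be continuous, so this
  produces a continuous path from data on the dyadics.\<close>

lemma dyadic_interpolation_uniform_limit:
  assumes s: "summable (\<lambda>l. dyadic_osc l y)"
  shows "uniform_limit {0..1} (\<lambda>m. dyadic_interpolation m y) (\<lambda>t. lim (\<lambda>m. dyadic_interpolation m y t)) sequentially"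
proof -
  define T where "T m = (\<Sum>l. dyadic_osc (l + Suc m) y)" for m
  have "(\<lambda>m. suminf (\<lambda>l. dyadic_osc l y) - (\<Sum>l<Suc m. dyadic_osc l y)) \<longlonglongrightarrow> suminf (\<lambda>l. dyadic_osc l y) - suminf (\<lambda>l. dyadic_osc l y)"
    by (intro tendsto_intros LIMSEQ_Suc summable_LIMSEQ s)
  then have T: "T \<longlonglongrightarrow> 0" unfolding T_def suminf_minus_initial_segment[OF s] by simp
  have "uniformly_Cauchy_on {0..1} (\<lambda>m. dyadic_interpolation m y)"
  proof (rule uniformly_Cauchy_onI)
    fix e :: real assume "e > 0"
    then obtain M where M: "\<bar>T M\<bar> < e/2" using LIMSEQ_D[OF T, of "e/2"] by auto
    have "dist (dyadic_interpolation m y t) (dyadic_interpolation n y t) < e"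
      if "t \<in> {0..1}" "m \<ge> M" "n \<ge> M" for t m n
    proof -
      have "\<bar>dyadic_interpolation m y t - dyadic_interpolation M y t\<bar> \<le> T M"
        "\<bar>dyadic_interpolation n y t - dyadic_interpolation M y t\<bar> \<le> T M"
        using dyadic_interpolation_le_suminf[OF _ _ s that(2), of t] dyadic_interpolation_le_suminf[OF _ _ s that(3), of t] that(1)
        by (simp_all add: T_def)
      then show ?thesis using M unfolding dist_real_def by linarith
    qed
    then show "\<exists>M. \<forall>x\<in>{0..1}. \<forall>m\<ge>M. \<forall>n\<ge>M. dist (dyadic_interpolation m y x) (dyadic_interpolation n y x) < e" by blast
  qed
  then show ?thesis
    using Cauchy_uniformly_convergent uniformly_convergent_uniform_limit_iff by blast
qed

section \<open>Chaining in mean and construction of the Gaussian process\<close>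

lemma (in prob_space) nonneg_series_expectation:
  fixes f :: "nat \<Rightarrow> 'a \<Rightarrow> real"
  assumes int: "\<And>l. integrable M (f l)" and nn: "\<And>l \<omega>. 0 \<le> f l \<omega>"
    and b: "\<And>l. expectation (f l) \<le> b l" "summable b"
  shows "AE \<omega> in M. summable (\<lambda>l. f l \<omega>)" and "integrable M (\<lambda>\<omega>. \<Sum>l. f l \<omega>)"
    and "expectation (\<lambda>\<omega>. \<Sum>l. f l \<omega>) \<le> suminf b"
proof -
  have [measurable]: "f l \<in> borel_measurable M" for l using int by auto
  have b0: "0 \<le> b l" for l 
  proof -
    have "0 \<le> expectation (f l)" by (simp add: nn)
    then show ?thesis using b(1)[of l] by (rule order_trans)
  qed
  have "(\<integral>\<^sup>+\<omega>. (\<Sum>l. ennreal (f l \<omega>)) \<partial>M) = (\<Sum>l. \<integral>\<^sup>+\<omega>. ennreal (f l \<omega>) \<partial>M)"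
    by (rule nn_integral_suminf) simp
  also have "\<dots> \<le> (\<Sum>l. ennreal (b l))"
    using int nn b(1) by (intro suminf_le) (auto simp: nn_integral_eq_integral intro!: ennreal_leI)
  also have "\<dots> = ennreal (suminf b)" by (rule suminf_ennreal2[OF b0 b(2)])
  finally have "(\<integral>\<^sup>+\<omega>. (\<Sum>l. ennreal (f l \<omega>)) \<partial>M) \<noteq> \<infinity>" by (auto simp: top_unique)
  then have "AE \<omega> in M. (\<Sum>l. ennreal (f l \<omega>)) \<noteq> \<infinity>"
    by (intro nn_integral_PInf_AE) auto
  then show ae: "AE \<omega> in M. summable (\<lambda>l. f l \<omega>)"
    by eventually_elim (use nn in \<open>auto intro!: summable_suminf_not_top\<close>)
  have sE: "summable (\<lambda>l. expectation (f l))"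
    by (rule summable_comparison_test'[OF b(2), of 0]) (use b(1) nn in \<open>auto simp: integral_nonneg\<close>)
  have ae': "AE \<omega> in M. summable (\<lambda>l. norm (f l \<omega>))" and sE': "summable (\<lambda>l. expectation (\<lambda>\<omega>. norm (f l \<omega>)))"
    using ae sE nn by auto
  show "integrable M (\<lambda>\<omega>. \<Sum>l. f l \<omega>)" by (rule integrable_suminf[OF int ae' sE'])
  have "expectation (\<lambda>\<omega>. \<Sum>l. f l \<omega>) = (\<Sum>l. expectation (f l))" by (rule integral_suminf[OF int ae' sE'])
  also have "\<dots> \<le> suminf b" by (rule suminf_le[OF b(1) sE b(2)])
  finally show "expectation (\<lambda>\<omega>. \<Sum>l. f l \<omega>) \<le> suminf b" .
qed

text \<open>At level \<open>l\<close> there are \<open>2 ^ l\<close> increments with fourth moments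
  at most \<open>C / 4 ^ l\<close>. Their sum over \<open>(9/10) ^ (3 * l)\<close> has mean at most
  \<open>C * (500/729) ^ l\<close>, below \<open>C * (9/10) ^ l\<close>. The factor 10 is the sum of
  the geometric series, \<open>1 / (1 - 9/10)\<close>.\<close>

lemma (in prob_space) dyadic_osc_expectation:
  fixes y :: "real \<Rightarrow> 'a \<Rightarrow> real"
  assumes int: "\<And>l k. k < 2 ^ l \<Longrightarrow> integrable M (\<lambda>\<omega>. (y (real (Suc k) / 2 ^ l) \<omega> - y (real k / 2 ^ l) \<omega>) ^ 4)"
    and C: "\<And>l k. k < 2 ^ l \<Longrightarrow> expectation (\<lambda>\<omega>. (y (real (Suc k) / 2 ^ l) \<omega> - y (real k / 2 ^ l) \<omega>) ^ 4) \<le> C * (1 / 2 ^ l)\<^sup>2"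
    and "C \<ge> 0"
  shows "AE \<omega> in M. summable (\<lambda>l. dyadic_osc l (\<lambda>t. y t \<omega>))"
    and "integrable M (\<lambda>\<omega>. \<Sum>l. dyadic_osc (l + m) (\<lambda>t. y t \<omega>))"
    and "expectation (\<lambda>\<omega>. \<Sum>l. dyadic_osc (l + m) (\<lambda>t. y t \<omega>)) \<le> 10 * (1 + C) * (9/10) ^ m"
proof -
  let ?d = "\<lambda>l k \<omega>. y (real (Suc k) / 2 ^ l) \<omega> - y (real k / 2 ^ l) \<omega>"
  have iS: "integrable M (\<lambda>\<omega>. (\<Sum>k<2 ^ l. ?d l k \<omega> ^ 4) / ((9/10) ^ l) ^ 3)" for l
    by (intro integrable_divide_zero Bochner_Integration.integrable_sum int) auto
  have i: "integrable M (\<lambda>\<omega>. dyadic_osc l (\<lambda>t. y t \<omega>))" for l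
    unfolding dyadic_osc_def 
    by (intro Bochner_Integration.integrable_add integrable_const iS)
  have e: "expectation (\<lambda>\<omega>. dyadic_osc l (\<lambda>t. y t \<omega>)) \<le> (1 + C) * (9/10) ^ l" for l
  proof -
    have "expectation (\<lambda>\<omega>. dyadic_osc l (\<lambda>t. y t \<omega>)) =
        (9/10) ^ l + (\<Sum>k<2 ^ l. expectation (\<lambda>\<omega>. ?d l k \<omega> ^ 4)) / ((9/10) ^ l) ^ 3"
      unfolding dyadic_osc_def using int
      by (subst Bochner_Integration.integral_add[OF integrable_const iS]) (simp add: prob_space del: of_nat_Suc)
    also have "(\<Sum>k<2 ^ l. expectation (\<lambda>\<omega>. ?d l k \<omega> ^ 4)) \<le> real (card {..<(2::nat) ^ l}) * (C * (1 / 2 ^ l)\<^sup>2)"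
      by (rule sum_bounded_above) (use C in auto)
    also have "\<dots> = C / 2 ^ l" by (simp add: power2_eq_square)
    also have "C / 2 ^ l / ((9/10) ^ l) ^ 3 = C * (500/729) ^ l"
    proof -
      have "((9/10) ^ l) ^ 3 = ((9/10) ^ 3 :: real) ^ l" by (simp only: power_mult[symmetric] mult.commute)
      then have "2 ^ l * ((9/10) ^ l) ^ 3 = (729/500 :: real) ^ l"
        by (simp only: power_mult_distrib[symmetric]) (simp add: power3_eq_cube)
      then have "C / 2 ^ l / ((9/10) ^ l) ^ 3 = C / (729/500) ^ l" by (simp only: divide_divide_eq_left)
      also have "\<dots> = C * (1 / (729/500)) ^ l" by (simp only: power_one_over times_divide_eq_right mult_1_right)
      finally show ?thesis by simp
    qed
    also have "C * (500/729) ^ l \<le> C * (9/10) ^ l" using \<open>C \<ge> 0\<close> by (intro mult_left_mono power_mono) auto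
    finally show ?thesis by (simp add: algebra_simps divide_right_mono)
  qed
  have sg: "(\<lambda>l. (1 + C) * (9/10) ^ (l + m)) sums ((1 + C) * (9/10) ^ m * (1 / (1 - 9/10)))" for m
    unfolding power_add using sums_mult[OF geometric_sums[of "9/10::real"], of "(1 + C) * (9/10) ^ m"] by (simp add: mult_ac)
  show "AE \<omega> in M. summable (\<lambda>l. dyadic_osc l (\<lambda>t. y t \<omega>))"
    by (rule nonneg_series_expectation(1)[OF i dyadic_osc_nonneg e]) (use sg[of 0] in \<open>auto dest: sums_summable\<close>)
  show "integrable M (\<lambda>\<omega>. \<Sum>l. dyadic_osc (l + m) (\<lambda>t. y t \<omega>))"
    by (rule nonneg_series_expectation(2)[OF i dyadic_osc_nonneg e sums_summable[OF sg]])
  have "expectation (\<lambda>\<omega>. \<Sum>l. dyadic_osc (l + m) (\<lambda>t. y t \<omega>)) \<le> (\<Sum>l. (1 + C) * (9/10) ^ (l + m))"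
    by (rule nonneg_series_expectation(3)[OF i dyadic_osc_nonneg e sums_summable[OF sg]])
  then show "expectation (\<lambda>\<omega>. \<Sum>l. dyadic_osc (l + m) (\<lambda>t. y t \<omega>)) \<le> 10 * (1 + C) * (9/10) ^ m"
    using sums_unique[OF sg] by (simp add: algebra_simps)
qed

text \<open>On the countable set of dyadic times and coordinates the Cholesky factor gives Gaussian
  variables with the prescribed covariance. A Gaussian increment of variance \<open>v\<close> has
  fourth moment \<open>3 * v^2\<close>, so \<open>inc\<close> supplies the chaining bound with
  \<open>C = 3\<close>. Other times are reached as limits along \<open>dyadic_floor\<close>, where
  \<open>cont\<close> controls the covariances.\<close>

theorem (in prob_space) gaussian_process_exists:
  fixes \<gamma> :: "nat \<Rightarrow> 'a \<Rightarrow> real" and K :: "'d::finite \<Rightarrow> 'd \<Rightarrow> real \<Rightarrow> real \<Rightarrow> real"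
  assumes ind: "indep_vars (\<lambda>_. borel) \<gamma> UNIV"
    and std: "\<And>n. distr M borel (\<gamma> n) = std_normal_distribution"
    and sym: "\<And>i j s t. K i j s t = K j i t s"
    and psd: "\<And>A a t j. finite A \<Longrightarrow> (\<And>k::nat. t k \<in> {0..1}) \<Longrightarrow>
        0 \<le> (\<Sum>k\<in>A. \<Sum>l\<in>A. a k * a l * K (j k) (j l) (t k) (t l))"
    and inc: "\<And>j s t. s \<in> {0..1} \<Longrightarrow> t \<in> {0..1} \<Longrightarrow> K j j t t - 2 * K j j s t + K j j s s \<le> \<bar>t - s\<bar>"
    and cont: "\<And>i j s t. s \<in> {0..1} \<Longrightarrow> t \<in> {0..1} \<Longrightarrow>
        (\<lambda>m. K i j (dyadic_floor m s) (dyadic_floor m t)) \<longlonglongrightarrow> K i j s t"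
  obtains Z :: "real \<Rightarrow> 'a \<Rightarrow> real^'d" where
    "\<And>t. t \<in> {0..1} \<Longrightarrow> Z t \<in> borel_measurable M"
    "\<And>\<omega>. continuous_on {0..1} (\<lambda>t. Z t \<omega>)"
    "\<And>A a t j. finite A \<Longrightarrow> (\<And>k::nat. t k \<in> {0..1}) \<Longrightarrow>
       centered_gaussian M (\<lambda>\<omega>. \<Sum>k\<in>A. a k * Z (t k) \<omega> $ j k)
         (\<Sum>k\<in>A. \<Sum>l\<in>A. a k * a l * K (j k) (j l) (t k) (t l))"
proof -
  have [measurable]: "\<gamma> n \<in> borel_measurable M" for n
    using ind by (simp add: indep_vars_def)
  define I where "I = unit_dyadics \<times> (UNIV :: 'd set)"
  have I: "countable I" "I \<noteq> {}" using countable_unit_dyadics unit_dyadicsI[of 0 0] by (auto simp: I_def)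
  define idx where "idx = from_nat_into I"
  have idx: "idx k \<in> I" for k unfolding idx_def by (rule from_nat_into[OF I(2)])
  define \<kappa> where "\<kappa> k l = K (snd (idx k)) (snd (idx l)) (fst (idx k)) (fst (idx l))" for k l
  have "psd_kernel \<kappa>" unfolding psd_kernel_def
  proof (intro conjI allI impI)
    show "\<kappa> k l = \<kappa> l k" for k l unfolding \<kappa>_def by (rule sym)
    show "0 \<le> (\<Sum>i\<in>A. \<Sum>j\<in>A. a i * a j * \<kappa> i j)" if "finite A" for A a
    proof -
      have "fst (idx k) \<in> {0..1}" for k
        using idx[of k] unit_dyadics_subset unfolding I_def by (metis mem_Times_iff subsetD)
      then show ?thesis unfolding \<kappa>_def by (intro psd that)
    qed
  qed
  obtain c where c: "\<And>k n. n > k \<Longrightarrow> c k n = 0" "\<And>k l m. k < m \<Longrightarrow> \<kappa> k l = (\<Sum>n<m. c k n * c l n)"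
    using cholesky[OF \<open>psd_kernel \<kappa>\<close>] by blast
  define code where "code = to_nat_on I"
  have code: "idx (code (t, j)) = (t, j)" if "t \<in> unit_dyadics" for t j
    unfolding idx_def code_def by (rule from_nat_into_to_nat_on[OF I(1)]) (simp add: I_def that)
  \<comment> \<open>By triangularity of \<open>c\<close> this finite sum is the whole row of the
    factor.\<close>
  define B where "B t j \<omega> = (\<Sum>n\<le>code (t, j). c (code (t, j)) n * \<gamma> n \<omega>)" for t j \<omega>
  have [measurable]: "B t j \<in> borel_measurable M" for t j unfolding B_def by measurable
  have B: "centered_gaussian M (\<lambda>\<omega>. \<Sum>k\<in>A. a k * B (t k) (j k) \<omega>)
         (\<Sum>k\<in>A. \<Sum>l\<in>A. a k * a l * K (j k) (j l) (t k) (t l))"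
    if A: "finite A" and t: "\<And>k. t k \<in> unit_dyadics" for A :: "nat set" and a t j
  proof -
    define e where "e k = code (t k, j k)" for k
    obtain m where m: "\<And>k. k \<in> A \<Longrightarrow> e k < m"
      using finite_nat_set_iff_bounded[of "e ` A"] A by auto
    have Bm: "B (t k) (j k) \<omega> = (\<Sum>n<m. c (e k) n * \<gamma> n \<omega>)" if "k \<in> A" for k \<omega>
      unfolding B_def e_def[symmetric] using m[OF that] c(1)[of "e k"]
      by (intro sum.mono_neutral_left) auto
    have 1: "(\<Sum>k\<in>A. a k * B (t k) (j k) \<omega>) = (\<Sum>n<m. (\<Sum>k\<in>A. a k * c (e k) n) * \<gamma> n \<omega>)" for \<omega>
    proof -
      have "(\<Sum>k\<in>A. a k * B (t k) (j k) \<omega>) = (\<Sum>k\<in>A. \<Sum>n<m. a k * c (e k) n * \<gamma> n \<omega>)"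
        by (intro sum.cong refl) (simp add: Bm sum_distrib_left mult.assoc)
      also have "\<dots> = (\<Sum>n<m. \<Sum>k\<in>A. a k * c (e k) n * \<gamma> n \<omega>)" by (rule sum.swap)
      finally show ?thesis by (simp add: sum_distrib_right)
    qed
    have 2: "(\<Sum>n<m. (\<Sum>k\<in>A. a k * c (e k) n)\<^sup>2) = (\<Sum>k\<in>A. \<Sum>l\<in>A. a k * a l * K (j k) (j l) (t k) (t l))"
    proof -
      have "(\<Sum>n<m. (\<Sum>k\<in>A. a k * c (e k) n)\<^sup>2) = (\<Sum>n<m. \<Sum>k\<in>A. \<Sum>l\<in>A. a k * a l * (c (e k) n * c (e l) n))"
        by (simp add: power2_eq_square sum_product mult_ac)
      also have "\<dots> = (\<Sum>k\<in>A. \<Sum>n<m. \<Sum>l\<in>A. a k * a l * (c (e k) n * c (e l) n))" by (rule sum.swap)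
      also have "\<dots> = (\<Sum>k\<in>A. \<Sum>l\<in>A. \<Sum>n<m. a k * a l * (c (e k) n * c (e l) n))"
        by (intro sum.cong refl sum.swap)
      also have "\<dots> = (\<Sum>k\<in>A. \<Sum>l\<in>A. a k * a l * \<kappa> (e k) (e l))"
        by (intro sum.cong refl) (simp add: c(2)[OF m] sum_distrib_left)
      finally show ?thesis by (simp add: \<kappa>_def e_def code t)
    qed
    show ?thesis using centered_gaussian_sum[OF ind std, of "\<lambda>n. \<Sum>k\<in>A. a k * c (e k) n" m]
      unfolding 1 2 .
  qed
  have fourth: "integrable M (\<lambda>\<omega>. (B t j \<omega> - B s j \<omega>) ^ 4) \<and> expectation (\<lambda>\<omega>. (B t j \<omega> - B s j \<omega>) ^ 4) \<le> 3 * (t - s)\<^sup>2"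
    if st: "s \<in> unit_dyadics" "t \<in> unit_dyadics" for s t j
  proof -
    define v where "v = K j j t t - 2 * K j j s t + K j j s s"
    have "centered_gaussian M (\<lambda>\<omega>. B t j \<omega> - B s j \<omega>) v"
      using B[of "{0, 1}" "\<lambda>k. if k = 0 then t else s" "\<lambda>k. if k = 0 then 1 else -1" "\<lambda>_. j"] st sym[of j j s t]
      by (simp add: v_def algebra_simps)
    note m = centered_gaussian_moments[OF this] and g = this
    have "v \<le> \<bar>t - s\<bar>"
      unfolding v_def using st unit_dyadics_subset by (intro inc) blast+
    then have "v\<^sup>2 \<le> \<bar>t - s\<bar>\<^sup>2"
      using g unfolding centered_gaussian_def by (intro power_mono) auto
    then show ?thesis using m by simp
  qed
  have "AE \<omega> in M. \<forall>j\<in>UNIV. summable (\<lambda>l. dyadic_osc l (\<lambda>t. B t j \<omega>))"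
  proof (intro AE_finite_allI)
    fix j :: 'd
    have *: "(real (Suc k) / 2 ^ l - real k / 2 ^ l)\<^sup>2 = (1 / 2 ^ l)\<^sup>2" for k l by (simp add: diff_divide_distrib[symmetric])
    have **: "real (Suc k) / 2 ^ l \<in> unit_dyadics" "real k / 2 ^ l \<in> unit_dyadics" if "k < 2 ^ l" for k l
      using that by (auto intro!: unit_dyadicsI simp del: of_nat_Suc)
    show "AE \<omega> in M. summable (\<lambda>l. dyadic_osc l (\<lambda>t. B t j \<omega>))"
    proof (rule dyadic_osc_expectation(1)[where C=3])
      fix l k :: nat assume k: "k < 2 ^ l"
      note f = fourth[OF **(2)[OF k] **(1)[OF k], of j, unfolded *]
      show "integrable M (\<lambda>\<omega>. (B (real (Suc k) / 2 ^ l) j \<omega> - B (real k / 2 ^ l) j \<omega>) ^ 4)" using f by (rule conjunct1)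
      show "expectation (\<lambda>\<omega>. (B (real (Suc k) / 2 ^ l) j \<omega> - B (real k / 2 ^ l) j \<omega>) ^ 4) \<le> 3 * (1 / 2 ^ l)\<^sup>2"
        using f by (rule conjunct2)
    qed simp
  qed simp
  then obtain N0 where N0: "N0 \<in> null_sets M" "\<And>\<omega> j. \<omega> \<in> space M - N0 \<Longrightarrow> summable (\<lambda>l. dyadic_osc l (\<lambda>t. B t j \<omega>))"
    by (auto elim!: AE_E3)
  define good where "good = space M - N0"
  have [measurable]: "good \<in> sets M" using N0 by (auto simp: good_def)
  define z where "z j \<omega> t = lim (\<lambda>m. dyadic_interpolation m (\<lambda>t. B t j \<omega>) t)" for j \<omega> t
  \<comment> \<open>Setting the process to 0 on the exceptional null set makes every path
    continuous, not only almost every one.\<close>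
  define Z where "Z t \<omega> = (if \<omega> \<in> good then \<chi> j. z j \<omega> t else 0)" for t \<omega>
  have zlim: "uniform_limit {0..1} (\<lambda>m. dyadic_interpolation m (\<lambda>t. B t j \<omega>)) (z j \<omega>) sequentially" if "\<omega> \<in> good" for j \<omega>
    unfolding z_def using N0(2) that by (intro dyadic_interpolation_uniform_limit) (auto simp: good_def)
  have zcont: "continuous_on {0..1} (z j \<omega>)" if "\<omega> \<in> good" for j \<omega>
    by (rule uniform_limit_theorem[OF _ zlim[OF that]])
      (auto simp: dyadic_interpolation_def intro!: always_eventually continuous_on_piecewise_linear)
  have Zcont: "continuous_on {0..1} (\<lambda>t. Z t \<omega>)" for \<omega>
    unfolding Z_def by (cases "\<omega> \<in> good") (auto intro!: continuous_on_vec_lambda zcont)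
  have zt: "(\<lambda>m. dyadic_interpolation m (\<lambda>t. B t j \<omega>) t) \<longlonglongrightarrow> z j \<omega> t" if "\<omega> \<in> good" "t \<in> {0..1}" for j \<omega> t
    by (rule tendsto_uniform_limitI[OF zlim[OF that(1)] that(2)])
  have zB: "z j \<omega> t = B t j \<omega>" if w: "\<omega> \<in> good" and t: "t \<in> unit_dyadics" for j \<omega> t
  proof -
    obtain k m where km: "t = real k / 2 ^ m" "k \<le> 2 ^ m" using t by (auto simp: unit_dyadics_def)
    have "(\<lambda>m. dyadic_interpolation m (\<lambda>t. B t j \<omega>) t) \<longlonglongrightarrow> B t j \<omega>"
      by (rule tendsto_eventually) (use dyadic_interpolation_at_dyadic[OF km(2)] km(1) in \<open>auto simp: eventually_sequentially\<close>)
    moreover have "t \<in> {0..1}" using t unit_dyadics_subset by blast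
    ultimately show ?thesis using zt[OF w, of t j] by (metis LIMSEQ_unique)
  qed
  have Zj: "(\<lambda>\<omega>. Z t \<omega> $ j) \<in> borel_measurable M" if t: "t \<in> {0..1}" for t j
  proof (rule borel_measurable_LIMSEQ_real)
    show "(\<lambda>m. if \<omega> \<in> good then dyadic_interpolation m (\<lambda>t. B t j \<omega>) t else 0) \<longlonglongrightarrow> Z t \<omega> $ j" for \<omega>
      using zt[of \<omega> t j] t by (cases "\<omega> \<in> good") (auto simp: Z_def)
    show "(\<lambda>\<omega>. if \<omega> \<in> good then dyadic_interpolation m (\<lambda>t. B t j \<omega>) t else 0) \<in> borel_measurable M" for m
      unfolding dyadic_interpolation_def piecewise_linear_def Let_def by measurable
  qed
  have Zmeas: "Z t \<in> borel_measurable M" if t: "t \<in> {0..1}" for t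
  proof (rule borel_measurable_euclidean_space[THEN iffD2], intro ballI)
    fix b :: "real^'d" assume "b \<in> Basis"
    then obtain j where "b = axis j 1" by (auto simp: Basis_vec_def)
    then show "(\<lambda>\<omega>. Z t \<omega> \<bullet> b) \<in> borel_measurable M" using Zj[OF t, of j] by (simp add: inner_axis)
  qed
  have Zgauss: "centered_gaussian M (\<lambda>\<omega>. \<Sum>k\<in>A. a k * Z (t k) \<omega> $ j k)
         (\<Sum>k\<in>A. \<Sum>l\<in>A. a k * a l * K (j k) (j l) (t k) (t l))"
    if A: "finite A" and t: "\<And>k. t k \<in> {0..1}" for A :: "nat set" and a t j
  proof (rule centered_gaussian_limit)
    let ?t = "\<lambda>m k. dyadic_floor m (t k)"
    have td: "?t m k \<in> unit_dyadics" for m k by (rule dyadic_floor_unit_dyadics[OF t])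
    show "centered_gaussian M (\<lambda>\<omega>. \<Sum>k\<in>A. a k * Z (?t m k) \<omega> $ j k)
         (\<Sum>k\<in>A. \<Sum>l\<in>A. a k * a l * K (j k) (j l) (?t m k) (?t m l))" for m
    proof (rule centered_gaussian_AE_cong[OF B[OF A td]])
      have "AE \<omega> in M. \<omega> \<in> good" using N0(1) AE_not_in[OF N0(1)] by (auto simp: good_def)
      then show "AE \<omega> in M. (\<Sum>k\<in>A. a k * B (?t m k) (j k) \<omega>) = (\<Sum>k\<in>A. a k * Z (?t m k) \<omega> $ j k)"
        by eventually_elim (simp add: Z_def zB td)
      show "(\<lambda>\<omega>. \<Sum>k\<in>A. a k * Z (?t m k) \<omega> $ j k) \<in> borel_measurable M"
        by (intro borel_measurable_sum borel_measurable_times borel_measurable_const Zj dyadic_floor_in_unit t)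
    qed
    show "(\<lambda>m. \<Sum>k\<in>A. \<Sum>l\<in>A. a k * a l * K (j k) (j l) (?t m k) (?t m l)) \<longlonglongrightarrow>
        (\<Sum>k\<in>A. \<Sum>l\<in>A. a k * a l * K (j k) (j l) (t k) (t l))"
      by (intro tendsto_sum tendsto_mult_left cont t)
    show "(\<lambda>m. \<Sum>k\<in>A. a k * Z (?t m k) \<omega> $ j k) \<longlonglongrightarrow> (\<Sum>k\<in>A. a k * Z (t k) \<omega> $ j k)" for \<omega>
      by (intro tendsto_sum tendsto_mult_left tendsto_vec_nth continuous_on_dyadic_tendsto[OF Zcont t])
  qed
  show thesis by (rule that[OF Zmeas Zcont Zgauss])
qed

subsection \<open>Independence\<close>

context prob_space
begin

text \<open>Connects independence of elements with different value types to the library notion: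
  functions of the two sides with a common value type generate sub-sigma-algebras of the independent
  ones.\<close>

lemma independent_elements_indep_var:
  assumes ind: "independent_elements M S A T B"
    and f: "f \<in> measurable S S'" and g: "g \<in> measurable T T'"
  shows "indep_var S' (\<lambda>\<omega>. f (A \<omega>)) T' (\<lambda>\<omega>. g (B \<omega>))"
proof -
  have A [measurable]: "A \<in> measurable M S" and B [measurable]: "B \<in> measurable M T"
    and i: "indep_set (sets (vimage_algebra (space M) A S)) (sets (vimage_algebra (space M) B T))"
    using ind by (auto simp: independent_elements_def)
  have sub: "sigma_sets (space M) {(\<lambda>\<omega>. f (A \<omega>)) -` U \<inter> space M |U. U \<in> sets S'} \<subseteq> sets (vimage_algebra (space M) A S)"
    if "A \<in> measurable M S" "f \<in> measurable S S'" for A :: "'a \<Rightarrow> 'x" and S and f :: "'x \<Rightarrow> 'y" and S'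
    unfolding sets_vimage_algebra
  proof (rule sigma_sets_mono, clarify)
    fix U assume U: "U \<in> sets S'"
    have "(\<lambda>\<omega>. f (A \<omega>)) -` U \<inter> space M = A -` (f -` U \<inter> space S) \<inter> space M"
      using measurable_space[OF that(1)] by auto
    moreover have "A -` (f -` U \<inter> space S) \<inter> space M \<in> {A -` U \<inter> space M |U. U \<in> sets S}"
      using measurable_sets[OF that(2) U] by blast
    ultimately show "(\<lambda>\<omega>. f (A \<omega>)) -` U \<inter> space M \<in> sigma_sets (space M) {A -` U \<inter> space M |U. U \<in> sets S}"
      by (simp only: sigma_sets.Basic)
  qed
  show ?thesis unfolding indep_var_eq
  proof (intro conjI)
    show "random_variable S' (\<lambda>\<omega>. f (A \<omega>))" using f by measurable
    show "random_variable T' (\<lambda>\<omega>. g (B \<omega>))" using g by measurable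
    show "indep_set (sigma_sets (space M) {(\<lambda>\<omega>. f (A \<omega>)) -` U \<inter> space M |U. U \<in> sets S'})
      (sigma_sets (space M) {(\<lambda>\<omega>. g (B \<omega>)) -` U \<inter> space M |U. U \<in> sets T'})"
      using indep_setD[OF i] indep_setD_ev1[OF i] indep_setD_ev2[OF i] sub[OF A f] sub[OF B g]
      by (intro indep_setI) (meson subsetD subset_trans)+
  qed
qed

section \<open>Moment and maximal inequalities for independent sums\<close>

lemma bounded_moments_indep:
  fixes X Y :: "'a \<Rightarrow> real"
  assumes i: "indep_var borel X borel Y" and "\<And>\<omega>. \<omega> \<in> space M \<Longrightarrow> \<bar>X \<omega>\<bar> \<le> c" "\<And>\<omega>. \<omega> \<in> space M \<Longrightarrow> \<bar>Y \<omega>\<bar> \<le> d"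
  shows "integrable M (\<lambda>\<omega>. X \<omega> ^ p * Y \<omega> ^ q)"
    and "expectation (\<lambda>\<omega>. X \<omega> ^ p * Y \<omega> ^ q) = expectation (\<lambda>\<omega>. X \<omega> ^ p) * expectation (\<lambda>\<omega>. Y \<omega> ^ q)"
proof -
  have [measurable]: "X \<in> borel_measurable M" "Y \<in> borel_measurable M"
    using i by (auto dest: indep_var_rv1 indep_var_rv2)
  have iX: "integrable M (\<lambda>\<omega>. X \<omega> ^ p)"
    by (rule integrable_const_bound[of _ "c ^ p"]) (use assms in \<open>auto simp: power_abs intro!: power_mono\<close>)
  have iY: "integrable M (\<lambda>\<omega>. Y \<omega> ^ q)"
    by (rule integrable_const_bound[of _ "d ^ q"]) (use assms in \<open>auto simp: power_abs intro!: power_mono\<close>)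
  have i': "indep_var borel (\<lambda>\<omega>. X \<omega> ^ p) borel (\<lambda>\<omega>. Y \<omega> ^ q)"
    using indep_var_compose[OF i, of "\<lambda>x. x ^ p" borel "\<lambda>x. x ^ q" borel] by (simp add: comp_def)
  show "integrable M (\<lambda>\<omega>. X \<omega> ^ p * Y \<omega> ^ q)" by (rule indep_var_integrable[OF i' iX iY])
  show "expectation (\<lambda>\<omega>. X \<omega> ^ p * Y \<omega> ^ q) = expectation (\<lambda>\<omega>. X \<omega> ^ p) * expectation (\<lambda>\<omega>. Y \<omega> ^ q)"
    by (rule indep_var_lebesgue_integral[OF i' iX iY])
qed

text \<open>Induction on \<open>A\<close>. In the expansion of the fourth power of
  \<open>b * X x + S\<close> the terms with a single factor \<open>X x\<close> or a single factor
  \<open>S\<close> have mean zero. The middle term has coefficient 6, exactly the cross term of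
  \<open>3 * (b^2 + s)^2\<close>. The second moment and the mean are carried along because the
  inductive step uses them.\<close>

lemma fourth_moment_sum_le:
  fixes X :: "'i \<Rightarrow> 'a \<Rightarrow> real"
  assumes "finite A" and "indep_vars (\<lambda>_. borel) X A"
    and "\<And>i \<omega>. i \<in> A \<Longrightarrow> \<omega> \<in> space M \<Longrightarrow> \<bar>X i \<omega>\<bar> \<le> c" and "\<And>i. i \<in> A \<Longrightarrow> expectation (X i) = 0"
  shows "expectation (\<lambda>\<omega>. (\<Sum>i\<in>A. a i * X i \<omega>) ^ 4) \<le> 3 * c ^ 4 * (\<Sum>i\<in>A. (a i)\<^sup>2)\<^sup>2
    \<and> expectation (\<lambda>\<omega>. (\<Sum>i\<in>A. a i * X i \<omega>)\<^sup>2) \<le> c\<^sup>2 * (\<Sum>i\<in>A. (a i)\<^sup>2)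
    \<and> expectation (\<lambda>\<omega>. \<Sum>i\<in>A. a i * X i \<omega>) = 0"
  using assms
proof (induction A rule: finite_induct)
  case (insert x A)
  define S where "S \<omega> = (\<Sum>i\<in>A. a i * X i \<omega>)" for \<omega>
  define s where "s = (\<Sum>i\<in>A. (a i)\<^sup>2)"
  define b where "b = a x"
  have IH: "expectation (\<lambda>\<omega>. S \<omega> ^ 4) \<le> 3 * c ^ 4 * s\<^sup>2" "expectation (\<lambda>\<omega>. (S \<omega>)\<^sup>2) \<le> c\<^sup>2 * s" "expectation S = 0"
    using insert.IH[OF indep_vars_subset[OF insert.prems(1)]] insert.prems by (auto simp: S_def[abs_def] s_def)
  have [measurable]: "X i \<in> borel_measurable M" if "i \<in> insert x A" for i
    using insert.prems(1) that by (auto simp: indep_vars_def)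
  have bX: "\<bar>X x \<omega>\<bar> \<le> c" if "\<omega> \<in> space M" for \<omega> using insert.prems that by auto
  obtain \<omega>0 where "\<omega>0 \<in> space M" using not_empty by auto
  then have c0: "0 \<le> c" using bX by fastforce
  have bS: "\<bar>S \<omega>\<bar> \<le> (\<Sum>i\<in>A. \<bar>a i\<bar> * c)" if "\<omega> \<in> space M" for \<omega>
    unfolding S_def using insert.prems that
    by (intro order_trans[OF sum_abs] sum_mono) (auto simp: abs_mult intro!: mult_left_mono)
  \<comment> \<open>All variables but the one at \<open>x\<close> are scaled, so that
    \<open>indep_vars_sum\<close> separates \<open>X x\<close> from the weighted sum of the
    others.\<close>
  have "indep_vars (\<lambda>_. borel) (\<lambda>i \<omega>. if i = x then X i \<omega> else a i * X i \<omega>) (insert x A)"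
    by (rule indep_vars_compose2[OF insert.prems(1), of "\<lambda>i y. if i = x then y else a i * y"]) auto
  from indep_vars_sum[OF insert.hyps(1,2) this]
  have i: "indep_var borel (X x) borel (\<lambda>\<omega>. \<Sum>i\<in>A. if i = x then X i \<omega> else a i * X i \<omega>)" by simp
  have ind: "indep_var borel (X x) borel S"
  proof -
    have "(\<lambda>\<omega>. \<Sum>i\<in>A. if i = x then X i \<omega> else a i * X i \<omega>) = S"
      unfolding S_def using insert.hyps(2) by (intro ext sum.cong) auto
    with i show ?thesis by simp
  qed
  note m = bounded_moments_indep[OF ind bX bS]
  have m0: "integrable M (\<lambda>\<omega>. X x \<omega> ^ p)" "integrable M (\<lambda>\<omega>. S \<omega> ^ q)" for p q
    using m(1)[of p 0] m(1)[of 0 q] by simp_all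
  have X1: "expectation (X x) = 0" using insert.prems by simp
  have X2: "expectation (\<lambda>\<omega>. (X x \<omega>)\<^sup>2) \<le> c\<^sup>2"
  proof -
    have "expectation (\<lambda>\<omega>. (X x \<omega>)\<^sup>2) \<le> expectation (\<lambda>\<omega>. c\<^sup>2)"
      using m0 bX c0 by (intro integral_mono) (auto simp: abs_le_square_iff[symmetric])
    then show ?thesis by (simp add: prob_space)
  qed
  have X4: "expectation (\<lambda>\<omega>. X x \<omega> ^ 4) \<le> c ^ 4"
  proof -
    have "X x \<omega> ^ 4 \<le> c ^ 4" if "\<omega> \<in> space M" for \<omega>
      using power_mono[OF bX[OF that], of 4] by simp
    then have "expectation (\<lambda>\<omega>. X x \<omega> ^ 4) \<le> expectation (\<lambda>\<omega>. c ^ 4)"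
      using m0 by (intro integral_mono) auto
    then show ?thesis by (simp add: prob_space)
  qed
  have s0: "0 \<le> s" by (simp add: s_def sum_nonneg)
  have e1: "expectation (\<lambda>\<omega>. b * X x \<omega> + S \<omega>) = 0"
    using X1 IH(3) m0(1)[of 1] m0(2)[of 1] by simp
  have "(b * X x \<omega> + S \<omega>)\<^sup>2 = b\<^sup>2 * (X x \<omega>)\<^sup>2 + 2 * b * (X x \<omega> ^ 1 * S \<omega> ^ 1) + (S \<omega>)\<^sup>2" for \<omega>
    by (simp add: power2_eq_square algebra_simps)
  then have "expectation (\<lambda>\<omega>. (b * X x \<omega> + S \<omega>)\<^sup>2) =
      b\<^sup>2 * expectation (\<lambda>\<omega>. (X x \<omega>)\<^sup>2) + 2 * b * (expectation (\<lambda>\<omega>. X x \<omega> ^ 1) * expectation (\<lambda>\<omega>. S \<omega> ^ 1)) + expectation (\<lambda>\<omega>. (S \<omega>)\<^sup>2)"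
    using m0 m(1)[of 1 1] m(2)[of 1 1] by simp
  then have "expectation (\<lambda>\<omega>. (b * X x \<omega> + S \<omega>)\<^sup>2) =
      b\<^sup>2 * expectation (\<lambda>\<omega>. (X x \<omega>)\<^sup>2) + expectation (\<lambda>\<omega>. (S \<omega>)\<^sup>2)" using X1 by simp
  also have "\<dots> \<le> b\<^sup>2 * c\<^sup>2 + c\<^sup>2 * s" by (intro add_mono mult_left_mono X2 IH) auto
  finally have e2: "expectation (\<lambda>\<omega>. (b * X x \<omega> + S \<omega>)\<^sup>2) \<le> c\<^sup>2 * (b\<^sup>2 + s)" by (simp add: algebra_simps)
  have "(b * X x \<omega> + S \<omega>) ^ 4 = b ^ 4 * X x \<omega> ^ 4 + 4 * b ^ 3 * (X x \<omega> ^ 3 * S \<omega> ^ 1)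
      + 6 * b\<^sup>2 * (X x \<omega> ^ 2 * S \<omega> ^ 2) + 4 * b * (X x \<omega> ^ 1 * S \<omega> ^ 3) + S \<omega> ^ 4" for \<omega>
    by (simp add: eval_nat_numeral algebra_simps)
  then have "expectation (\<lambda>\<omega>. (b * X x \<omega> + S \<omega>) ^ 4) = b ^ 4 * expectation (\<lambda>\<omega>. X x \<omega> ^ 4)
      + 4 * b ^ 3 * (expectation (\<lambda>\<omega>. X x \<omega> ^ 3) * expectation (\<lambda>\<omega>. S \<omega> ^ 1))
      + 6 * b\<^sup>2 * (expectation (\<lambda>\<omega>. X x \<omega> ^ 2) * expectation (\<lambda>\<omega>. S \<omega> ^ 2))
      + 4 * b * (expectation (\<lambda>\<omega>. X x \<omega> ^ 1) * expectation (\<lambda>\<omega>. S \<omega> ^ 3)) + expectation (\<lambda>\<omega>. S \<omega> ^ 4)"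
    using m0 m(1)[of 3 1] m(1)[of 2 2] m(1)[of 1 3] m(2)[of 3 1] m(2)[of 2 2] m(2)[of 1 3] by simp
  also have "\<dots> = b ^ 4 * expectation (\<lambda>\<omega>. X x \<omega> ^ 4)
      + 6 * b\<^sup>2 * (expectation (\<lambda>\<omega>. X x \<omega> ^ 2) * expectation (\<lambda>\<omega>. S \<omega> ^ 2)) + expectation (\<lambda>\<omega>. S \<omega> ^ 4)"
    using X1 IH(3) by simp
  also have "\<dots> \<le> b ^ 4 * c ^ 4 + 6 * b\<^sup>2 * (c\<^sup>2 * (c\<^sup>2 * s)) + 3 * c ^ 4 * s\<^sup>2"
    by (intro add_mono mult_left_mono mult_mono X4 X2 IH) auto
  also have "\<dots> \<le> 3 * c ^ 4 * (b\<^sup>2 + s)\<^sup>2"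
  proof -
    have "3 * c ^ 4 * (b\<^sup>2 + s)\<^sup>2 - (b ^ 4 * c ^ 4 + 6 * b\<^sup>2 * (c\<^sup>2 * (c\<^sup>2 * s)) + 3 * c ^ 4 * s\<^sup>2) = 2 * (b ^ 4 * c ^ 4)"
      by (simp add: eval_nat_numeral algebra_simps)
    moreover have "0 \<le> b ^ 4 * c ^ 4" by simp
    ultimately show ?thesis by linarith
  qed
  finally show ?case using e1 e2 insert.hyps by (simp add: S_def s_def b_def)
qed (simp_all)

text \<open>On the event that \<open>k\<close> is the first index at which the bound
  is exceeded, the later increment is orthogonal to the partial sum up to \<open>k\<close>.\<close>

lemma Kolmogorov_maximal_inequality:
  fixes X :: "nat \<Rightarrow> 'a \<Rightarrow> real"
  assumes ind: "indep_vars (\<lambda>_. borel) X UNIV"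
    and int: "\<And>i. integrable M (\<lambda>\<omega>. (X i \<omega>)\<^sup>2)" and mean: "\<And>i. expectation (X i) = 0"
    and var: "\<And>i. expectation (\<lambda>\<omega>. (X i \<omega>)\<^sup>2) \<le> v" and r: "r > 0"
  shows "prob {\<omega> \<in> space M. \<exists>k\<le>n. r \<le> \<bar>\<Sum>i<k. X i \<omega>\<bar>} \<le> real n * v / r\<^sup>2"
proof -
  have [measurable]: "X i \<in> borel_measurable M" for i
    using ind by (simp add: indep_vars_def)
  define S where "S k \<omega> = (\<Sum>i<k. X i \<omega>)" for k \<omega>
  have [measurable]: "S k \<in> borel_measurable M" for k unfolding S_def by measurable
  have iX: "integrable M (X i)" for i by (rule square_integrable_imp_integrable) (use int in auto)
  have sq_sum: "integrable M (\<lambda>\<omega>. (\<Sum>i\<in>A. X i \<omega>)\<^sup>2)" if "finite A" for A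
    using that
  proof (induction A rule: finite_induct)
    case (insert x A)
    have "integrable M (\<lambda>\<omega>. 2 * (X x \<omega>)\<^sup>2 + 2 * (\<Sum>i\<in>A. X i \<omega>)\<^sup>2)" using insert int by auto
    then show ?case
    proof (rule Bochner_Integration.integrable_bound)
      have "(a + b)\<^sup>2 \<le> 2 * a\<^sup>2 + 2 * b\<^sup>2" for a b :: real
        using zero_le_power2[of "a - b"] by (simp add: power2_sum power2_diff)
      then show "AE \<omega> in M. norm ((\<Sum>i\<in>insert x A. X i \<omega>)\<^sup>2) \<le> norm (2 * (X x \<omega>)\<^sup>2 + 2 * (\<Sum>i\<in>A. X i \<omega>)\<^sup>2)"
        using insert.hyps by (intro AE_I2) simp
    qed measurable
  qed simp
  have iS: "integrable M (\<lambda>\<omega>. (S k \<omega>)\<^sup>2)" for k unfolding S_def by (rule sq_sum) simp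
  have indX: "indep_var borel (X i) borel (X j)" if "i \<noteq> j" for i j
    using indep_vars_sum[of "{j}" i X] indep_vars_subset[OF ind, of "{i, j}"] that by simp
  have ES: "expectation (\<lambda>\<omega>. (S n \<omega>)\<^sup>2) \<le> real n * v"
  proof (induction n)
    case (Suc n)
    have i: "indep_var borel (X n) borel (S n)"
      unfolding S_def using indep_vars_sum[of "{..<n}" n X] indep_vars_subset[OF ind] by simp
    have iSn: "integrable M (S n)" unfolding S_def using iX by simp
    have "expectation (\<lambda>\<omega>. X n \<omega> * S n \<omega>) = 0"
      using indep_var_lebesgue_integral[OF i iX iSn] mean by simp
    moreover have "(S (Suc n) \<omega>)\<^sup>2 = (S n \<omega>)\<^sup>2 + 2 * (X n \<omega> * S n \<omega>) + (X n \<omega>)\<^sup>2" for \<omega>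
      by (simp add: S_def power2_sum algebra_simps)
    ultimately have "expectation (\<lambda>\<omega>. (S (Suc n) \<omega>)\<^sup>2) = expectation (\<lambda>\<omega>. (S n \<omega>)\<^sup>2) + expectation (\<lambda>\<omega>. (X n \<omega>)\<^sup>2)"
      using iS int indep_var_integrable[OF i iX iSn] by simp
    then show ?case using Suc var[of n] by (simp add: algebra_simps)
  qed (simp add: S_def)
  define A where "A k = {\<omega> \<in> space M. r \<le> \<bar>S k \<omega>\<bar> \<and> (\<forall>j<k. \<bar>S j \<omega>\<bar> < r)}" for k
  have A [measurable]: "A k \<in> sets M" for k unfolding A_def by measurable
  have disj: "disjoint_family_on A {..n}"
    unfolding disjoint_family_on_def A_def by (auto simp: not_le) (metis linorder_neqE_nat not_le)
  have un: "{\<omega> \<in> space M. \<exists>k\<le>n. r \<le> \<bar>\<Sum>i<k. X i \<omega>\<bar>} = (\<Union>k\<le>n. A k)"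
  proof (intro set_eqI iffI)
    fix \<omega> assume "\<omega> \<in> {\<omega> \<in> space M. \<exists>k\<le>n. r \<le> \<bar>\<Sum>i<k. X i \<omega>\<bar>}"
    then obtain k where k: "\<omega> \<in> space M" "k \<le> n" "r \<le> \<bar>S k \<omega>\<bar>" by (auto simp: S_def)
    define l where "l = (LEAST l. r \<le> \<bar>S l \<omega>\<bar>)"
    have "r \<le> \<bar>S l \<omega>\<bar>" "l \<le> k" "\<And>j. j < l \<Longrightarrow> \<bar>S j \<omega>\<bar> < r"
      unfolding l_def using k(3) by (auto intro: LeastI Least_le dest: not_less_Least)
    then show "\<omega> \<in> (\<Union>k\<le>n. A k)" using k by (auto simp: A_def intro!: bexI[of _ l])
  qed (auto simp: A_def S_def)
  have key: "r\<^sup>2 * prob (A k) \<le> expectation (\<lambda>\<omega>. indicator (A k) \<omega> * (S n \<omega>)\<^sup>2)" if k: "k \<le> n" for k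
  proof -
    \<comment> \<open>The partial sum \<open>S k\<close> cut to the event \<open>A k\<close>,
      written as a function of the first \<open>k\<close> variables alone; \<open>h\<close> uses the
      remaining ones, and independence of disjoint blocks applies.\<close>
    define g where "g x = (\<Sum>i<k. x i) * (if r \<le> \<bar>\<Sum>i<k. x i\<bar> \<and> (\<forall>j<k. \<bar>\<Sum>i<j. x i\<bar> < r) then 1 else 0)" for x :: "nat \<Rightarrow> real"
    define h where "h x = (\<Sum>i\<in>{k..<n}. x i)" for x :: "nat \<Rightarrow> real"
    have "g \<in> borel_measurable (PiM {..<k} (\<lambda>_. borel))"
    proof -
      have pm [measurable]: "(\<lambda>x. \<Sum>i<j. x i) \<in> borel_measurable (PiM {..<k} (\<lambda>_. borel :: real measure))" if "j \<le> k" for j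
        using that by (intro borel_measurable_sum measurable_component_singleton) auto
      have "{x \<in> space (PiM {..<k} (\<lambda>_. borel :: real measure)). \<forall>j<k. \<bar>\<Sum>i<j. x i\<bar> < r} \<in> sets (PiM {..<k} (\<lambda>_. borel))"
      proof -
        have "{x \<in> space (PiM {..<k} (\<lambda>_. borel :: real measure)). \<forall>j\<in>{..<k}. \<bar>\<Sum>i<j. x i\<bar> < r} \<in> sets (PiM {..<k} (\<lambda>_. borel))"
          by (intro sets.sets_Collect_finite_All borel_measurable_less borel_measurable_abs borel_measurable_const pm) auto
        then show ?thesis by (simp add: Ball_def)
      qed
      moreover have "{x \<in> space (PiM {..<k} (\<lambda>_. borel :: real measure)). r \<le> \<bar>\<Sum>i<k. x i\<bar>} \<in> sets (PiM {..<k} (\<lambda>_. borel))"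
        by (intro borel_measurable_le borel_measurable_abs borel_measurable_const pm) simp
      ultimately show ?thesis
        unfolding g_def by (intro borel_measurable_times measurable_If borel_measurable_const pm sets.sets_Collect_conj) auto
    qed
    moreover have "h \<in> borel_measurable (PiM {k..<n} (\<lambda>_. borel))"
      unfolding h_def by (intro borel_measurable_sum measurable_component_singleton)
    ultimately have ind': "indep_var borel (\<lambda>\<omega>. g (restrict (\<lambda>i. X i \<omega>) {..<k})) borel (\<lambda>\<omega>. h (restrict (\<lambda>i. X i \<omega>) {k..<n}))"
      using indep_var_compose[OF indep_var_restrict[OF ind, of "{..<k}" "{k..<n}"], of g borel h borel]
      by (simp add: comp_def ivl_disj_int)
    have g: "g (restrict (\<lambda>i. X i \<omega>) {..<k}) = indicator (A k) \<omega> * S k \<omega>" if "\<omega> \<in> space M" for \<omega>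
    proof -
      have "(\<Sum>i<j. restrict (\<lambda>i. X i \<omega>) {..<k} i) = S j \<omega>" if "j \<le> k" for j
        unfolding S_def using that by (intro sum.cong) auto
      then show ?thesis using that by (auto simp: g_def A_def indicator_def)
    qed
    have h: "h (restrict (\<lambda>i. X i \<omega>) {k..<n}) = S n \<omega> - S k \<omega>" for \<omega>
      using k sum.atLeastLessThan_concat[of 0 k n "\<lambda>i. X i \<omega>"] by (simp add: h_def S_def lessThan_atLeast0)
    have iSk: "integrable M (S k)" for k unfolding S_def using iX by simp
    have i1: "integrable M (\<lambda>\<omega>. indicator (A k) \<omega> * S k \<omega>)"
      using integrable_mult_indicator[OF A iSk] by simp
    have i1': "integrable M (\<lambda>\<omega>. g (restrict (\<lambda>i. X i \<omega>) {..<k}))"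
      using i1 by (rule Bochner_Integration.integrable_cong[THEN iffD1, rotated -1]) (auto simp: g)
    have i2': "integrable M (\<lambda>\<omega>. h (restrict (\<lambda>i. X i \<omega>) {k..<n}))" unfolding h using iSk by simp
    have "expectation (\<lambda>\<omega>. g (restrict (\<lambda>i. X i \<omega>) {..<k}) * h (restrict (\<lambda>i. X i \<omega>) {k..<n})) = 0"
      unfolding indep_var_lebesgue_integral[OF ind' i1' i2'] using mean iX unfolding h S_def by simp
    then have z: "expectation (\<lambda>\<omega>. indicator (A k) \<omega> * S k \<omega> * (S n \<omega> - S k \<omega>)) = 0"
      unfolding h by (subst Bochner_Integration.integral_cong[OF refl, of M _ "\<lambda>\<omega>. g (restrict (\<lambda>i. X i \<omega>) {..<k}) * (S n \<omega> - S k \<omega>)"]) (auto simp: g)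
    have iz: "integrable M (\<lambda>\<omega>. indicator (A k) \<omega> * S k \<omega> * (S n \<omega> - S k \<omega>))"
      using indep_var_integrable[OF ind' i1' i2'] unfolding h
      by (rule Bochner_Integration.integrable_cong[THEN iffD1, rotated -1]) (auto simp: g)
    have iA: "integrable M (\<lambda>\<omega>. indicator (A k) \<omega> * (S n \<omega>)\<^sup>2)"
      using integrable_mult_indicator[OF A iS] by simp
    define W where "W = (\<lambda>\<omega>. indicator (A k) \<omega> * S k \<omega> * (S n \<omega> - S k \<omega>))"
    have W: "expectation W = 0" "integrable M W" using z iz by (simp_all only: W_def)
    have iI: "integrable M (\<lambda>\<omega>. r\<^sup>2 * indicator (A k) \<omega>)"
      by (intro integrable_mult_right integrable_real_indicator A) (simp add: emeasure_eq_measure)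
    have "expectation (\<lambda>\<omega>. r\<^sup>2 * indicator (A k) \<omega>) = r\<^sup>2 * prob (A k)"
      using A[of k] by simp
    \<comment> \<open>\<open>W\<close> has mean zero and may be added for free. The comparison then
      holds pointwise, since the square of \<open>S n\<close> is at least
      \<open>(S k)^2 + 2 * S k * (S n - S k)\<close>.\<close>
    then have "r\<^sup>2 * prob (A k) = expectation (\<lambda>\<omega>. r\<^sup>2 * indicator (A k) \<omega> + 2 * W \<omega>)"
      using Bochner_Integration.integral_add[OF iI integrable_mult_right[OF W(2), of 2]] W(1) by simp
    also have "\<dots> \<le> expectation (\<lambda>\<omega>. indicator (A k) \<omega> * (S n \<omega>)\<^sup>2)"
    proof (rule integral_mono[OF _ iA])
      show "integrable M (\<lambda>\<omega>. r\<^sup>2 * indicator (A k) \<omega> + 2 * W \<omega>)"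
        by (intro Bochner_Integration.integrable_add iI integrable_mult_right W)
      fix \<omega> assume "\<omega> \<in> space M"
      show "r\<^sup>2 * indicator (A k) \<omega> + 2 * W \<omega> \<le> indicator (A k) \<omega> * (S n \<omega>)\<^sup>2"
      proof (cases "\<omega> \<in> A k")
        case True
        then have "r \<le> \<bar>S k \<omega>\<bar>" by (simp add: A_def)
        then have "r\<^sup>2 \<le> (S k \<omega>)\<^sup>2" using r by (metis abs_le_square_iff abs_of_pos)
        moreover have "(S n \<omega>)\<^sup>2 = (S k \<omega>)\<^sup>2 + 2 * (S k \<omega> * (S n \<omega> - S k \<omega>)) + (S n \<omega> - S k \<omega>)\<^sup>2"
          by (simp add: power2_eq_square algebra_simps)
        moreover have "0 \<le> (S n \<omega> - S k \<omega>)\<^sup>2" by simp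
        ultimately have "r\<^sup>2 + 2 * (S k \<omega> * (S n \<omega> - S k \<omega>)) \<le> (S n \<omega>)\<^sup>2" by linarith
        then show ?thesis using True by (simp add: W_def)
      qed (simp add: W_def)
    qed
    finally show ?thesis .
  qed
  have "r\<^sup>2 * prob (\<Union>k\<le>n. A k) = (\<Sum>k\<le>n. r\<^sup>2 * prob (A k))"
    using disj by (subst finite_measure_finite_Union) (auto simp: sum_distrib_left)
  also have "\<dots> \<le> (\<Sum>k\<le>n. expectation (\<lambda>\<omega>. indicator (A k) \<omega> * (S n \<omega>)\<^sup>2))" by (intro sum_mono key) simp
  also have "\<dots> = expectation (\<lambda>\<omega>. \<Sum>k\<le>n. indicator (A k) \<omega> * (S n \<omega>)\<^sup>2)"
    using integrable_mult_indicator[OF A iS] by (intro Bochner_Integration.integral_sum[symmetric]) simp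
  also have "\<dots> \<le> expectation (\<lambda>\<omega>. (S n \<omega>)\<^sup>2)"
  proof (rule integral_mono)
    show "integrable M (\<lambda>\<omega>. \<Sum>k\<le>n. indicator (A k) \<omega> * (S n \<omega>)\<^sup>2)"
      using integrable_mult_indicator[OF A iS] by (intro Bochner_Integration.integrable_sum) simp
    fix \<omega>
    have "(\<Sum>k\<le>n. indicator (A k) \<omega>) = (indicator (\<Union>k\<le>n. A k) \<omega> :: real)"
      using disj by (intro indicator_UN_disjoint[symmetric]) auto
    then show "(\<Sum>k\<le>n. indicator (A k) \<omega> * (S n \<omega>)\<^sup>2) \<le> (S n \<omega>)\<^sup>2"
      by (simp add: sum_distrib_right[symmetric] indicator_def)
  qed (rule iS)
  also note ES
  finally show ?thesis unfolding un using r by (simp add: pos_le_divide_eq mult.commute)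
qed

end

subsection \<open>Partial sum processes\<close>

text \<open>The joint law is a product of equal factors, and such a product is invariant under
  injective reindexing.\<close>

lemma (in prob_space) iid_distr_reindex:
  fixes \<epsilon> :: "nat \<Rightarrow> 'a \<Rightarrow> real"
  assumes ind: "indep_vars (\<lambda>_. borel) \<epsilon> UNIV" and id: "\<And>i. distr M borel (\<epsilon> i) = \<mu>" and p: "inj p"
  shows "distr M (PiM UNIV (\<lambda>_. borel)) (\<lambda>\<omega> i. \<epsilon> (p i) \<omega>) = distr M (PiM UNIV (\<lambda>_. borel)) (\<lambda>\<omega> i. \<epsilon> i \<omega>)"
proof -
  have [measurable]: "\<epsilon> i \<in> borel_measurable M" for i
    using ind by (simp add: indep_vars_def)
  interpret mu: prob_space \<mu> unfolding id[of 0, symmetric] by (rule prob_space_distr) simp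
  have sets_mu: "sets \<mu> = sets borel" unfolding id[of 0, symmetric] by simp
  have setsP: "sets (PiM UNIV (\<lambda>_::nat. \<mu>)) = sets (PiM UNIV (\<lambda>_::nat. borel))"
    by (intro sets_PiM_cong refl sets_mu)
  have P: "distr M (PiM UNIV (\<lambda>_. borel)) (\<lambda>\<omega> i. \<epsilon> i \<omega>) = PiM UNIV (\<lambda>_. \<mu>)"
    using ind by (subst (asm) indep_vars_iff_distr_eq_PiM') (auto simp: id restrict_UNIV)
  have [measurable]: "(\<lambda>x i. x (p i)) \<in> measurable (PiM UNIV (\<lambda>_. borel)) (PiM UNIV (\<lambda>_::nat. borel :: real measure))"
    by (rule measurable_PiM_single') auto
  have [measurable]: "(\<lambda>\<omega> i. \<epsilon> i \<omega>) \<in> measurable M (PiM UNIV (\<lambda>_::nat. borel :: real measure))"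
    by (rule measurable_PiM_single') auto
  have "distr M (PiM UNIV (\<lambda>_. borel)) (\<lambda>\<omega> i. \<epsilon> (p i) \<omega>) =
      distr (distr M (PiM UNIV (\<lambda>_. borel)) (\<lambda>\<omega> i. \<epsilon> i \<omega>)) (PiM UNIV (\<lambda>_. borel)) (\<lambda>x i. x (p i))"
    by (subst distr_distr) (auto simp: comp_def)
  also have "\<dots> = distr (PiM UNIV (\<lambda>_. \<mu>)) (PiM UNIV (\<lambda>_. \<mu>)) (\<lambda>x i. x (p i))"
    unfolding P by (rule distr_cong) (auto simp: setsP)
  also have "\<dots> = PiM UNIV (\<lambda>_. \<mu>)"
    using distr_PiM_reindex[of UNIV "\<lambda>_. \<mu>" p UNIV] p mu.prob_space_axioms by (simp add: restrict_UNIV)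
  finally show ?thesis unfolding P .
qed

text \<open>The random injection \<open>\<pi> (D \<omega>)\<close> takes finitely many values, so
  conditioning on \<open>D\<close> is a finite sum over events \<open>E p\<close>. On each of them
  the injection is fixed, independence factors the expectation, the law is that of the original
  order, and the probabilities add up to 1.\<close>

lemma (in prob_space) random_permutation_expectation:
  fixes \<epsilon> :: "nat \<Rightarrow> 'a \<Rightarrow> real" and g :: "(nat \<Rightarrow> real) \<Rightarrow> real"
  assumes ie: "independent_elements M (PiM UNIV (\<lambda>_. borel)) (\<lambda>\<omega> i. \<epsilon> i \<omega>) T D"
    and ind: "indep_vars (\<lambda>_. borel) \<epsilon> UNIV" and id: "\<And>i. distr M borel (\<epsilon> i) = \<mu>"
    and fin: "finite P" and inj: "\<And>p. p \<in> P \<Longrightarrow> inj p"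
    and \<pi>: "\<And>d. d \<in> space T \<Longrightarrow> \<pi> d \<in> P" "\<And>p. p \<in> P \<Longrightarrow> {d \<in> space T. \<pi> d = p} \<in> sets T"
    and g: "g \<in> borel_measurable (PiM UNIV (\<lambda>_. borel))" and B: "\<And>x. \<bar>g x\<bar> \<le> B"
  shows "(\<lambda>\<omega>. g (\<lambda>i. \<epsilon> (\<pi> (D \<omega>) i) \<omega>)) \<in> borel_measurable M"
    and "expectation (\<lambda>\<omega>. g (\<lambda>i. \<epsilon> (\<pi> (D \<omega>) i) \<omega>)) = expectation (\<lambda>\<omega>. g (\<lambda>i. \<epsilon> i \<omega>))"
proof -
  note g [measurable]
  have [measurable]: "\<epsilon> i \<in> borel_measurable M" for i
    using ind by (simp add: indep_vars_def)
  have D [measurable]: "D \<in> measurable M T" using ie by (simp add: independent_elements_def)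
  have pm [measurable]: "(\<lambda>x i. x (p i)) \<in> measurable (PiM UNIV (\<lambda>_. borel)) (PiM UNIV (\<lambda>_::nat. borel :: real measure))" for p :: "nat \<Rightarrow> nat"
    by (rule measurable_PiM_single') auto
  have em [measurable]: "(\<lambda>\<omega> i. \<epsilon> (p i) \<omega>) \<in> measurable M (PiM UNIV (\<lambda>_::nat. borel :: real measure))" for p :: "nat \<Rightarrow> nat"
    by (rule measurable_PiM_single') auto
  define E where "E p = {d \<in> space T. \<pi> d = p}" for p
  have E [measurable]: "E p \<in> sets T" if "p \<in> P" for p using \<pi>(2)[OF that] by (simp add: E_def)
  have gm: "(\<lambda>\<omega>. g (\<lambda>i. \<epsilon> (p i) \<omega>)) \<in> borel_measurable M" for p
    using measurable_compose[OF em g] .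
  have im: "(\<lambda>\<omega>. indicator (E p) (D \<omega>) :: real) \<in> borel_measurable M" if "p \<in> P" for p
    using measurable_compose[OF D borel_measurable_indicator[OF E[OF that]]] .
  have split: "g (\<lambda>i. \<epsilon> (\<pi> (D \<omega>) i) \<omega>) = (\<Sum>p\<in>P. g (\<lambda>i. \<epsilon> (p i) \<omega>) * indicator (E p) (D \<omega>))" (is "?l = ?r")
    if "\<omega> \<in> space M" for \<omega>
  proof -
    have d: "D \<omega> \<in> space T" using measurable_space[OF D that] .
    have "?r = (\<Sum>p\<in>P. if p = \<pi> (D \<omega>) then g (\<lambda>i. \<epsilon> (p i) \<omega>) else 0)"
      by (rule sum.cong) (use d in \<open>auto simp: E_def\<close>)
    also have "\<dots> = ?l" using fin \<pi>(1)[OF d] by simp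
    finally show ?thesis by simp
  qed
  have sm: "(\<lambda>\<omega>. \<Sum>p\<in>P. g (\<lambda>i. \<epsilon> (p i) \<omega>) * indicator (E p) (D \<omega>)) \<in> borel_measurable M"
    by (intro borel_measurable_sum borel_measurable_times gm im)
  then show "(\<lambda>\<omega>. g (\<lambda>i. \<epsilon> (\<pi> (D \<omega>) i) \<omega>)) \<in> borel_measurable M"
    by (rule measurable_cong[THEN iffD2, rotated]) (rule split)
  have ig: "integrable M (\<lambda>\<omega>. g (\<lambda>i. \<epsilon> (p i) \<omega>))" for p
    by (rule integrable_const_bound[of _ B]) (simp_all add: B gm)
  have iE: "integrable M (\<lambda>\<omega>. indicator (E p) (D \<omega>) :: real)" if "p \<in> P" for p
    by (rule integrable_const_bound[where B=1, OF _ im[OF that]]) (auto split: split_indicator)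
  have iv: "indep_var borel (\<lambda>\<omega>. g (\<lambda>i. \<epsilon> (p i) \<omega>)) borel (\<lambda>\<omega>. indicator (E p) (D \<omega>) :: real)" if "p \<in> P" for p
  proof -
    have "(\<lambda>x. g (\<lambda>i. x (p i))) \<in> borel_measurable (PiM UNIV (\<lambda>_. borel))" by (rule measurable_compose[OF pm g])
    moreover have "(indicator (E p) :: _ \<Rightarrow> real) \<in> borel_measurable T" by (rule borel_measurable_indicator[OF E[OF that]])
    ultimately show ?thesis by (rule independent_elements_indep_var[OF ie])
  qed
  have eg: "expectation (\<lambda>\<omega>. g (\<lambda>i. \<epsilon> (p i) \<omega>)) = expectation (\<lambda>\<omega>. g (\<lambda>i. \<epsilon> i \<omega>))" if "p \<in> P" for p
  proof -
    have "expectation (\<lambda>\<omega>. g (\<lambda>i. \<epsilon> (p i) \<omega>)) = integral\<^sup>L (distr M (PiM UNIV (\<lambda>_. borel)) (\<lambda>\<omega> i. \<epsilon> (p i) \<omega>)) g"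
      by (rule integral_distr[OF em g, symmetric])
    also have "\<dots> = integral\<^sup>L (distr M (PiM UNIV (\<lambda>_. borel)) (\<lambda>\<omega> i. \<epsilon> i \<omega>)) g"
      by (simp only: iid_distr_reindex[OF ind id inj[OF that]])
    also have "\<dots> = expectation (\<lambda>\<omega>. g (\<lambda>i. \<epsilon> i \<omega>))"
      by (rule integral_distr[OF em[of "\<lambda>i. i"] g])
    finally show ?thesis .
  qed
  have "expectation (\<lambda>\<omega>. g (\<lambda>i. \<epsilon> (\<pi> (D \<omega>) i) \<omega>)) = expectation (\<lambda>\<omega>. \<Sum>p\<in>P. g (\<lambda>i. \<epsilon> (p i) \<omega>) * indicator (E p) (D \<omega>))"
    by (rule Bochner_Integration.integral_cong[OF refl split])
  also have "\<dots> = (\<Sum>p\<in>P. expectation (\<lambda>\<omega>. g (\<lambda>i. \<epsilon> (p i) \<omega>) * indicator (E p) (D \<omega>)))"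
    by (rule Bochner_Integration.integral_sum) (rule indep_var_integrable[OF iv ig iE])
  also have "\<dots> = (\<Sum>p\<in>P. expectation (\<lambda>\<omega>. g (\<lambda>i. \<epsilon> i \<omega>)) * expectation (\<lambda>\<omega>. indicator (E p) (D \<omega>)))"
    by (intro sum.cong refl) (simp only: indep_var_lebesgue_integral[OF iv ig iE] eg)
  also have "\<dots> = expectation (\<lambda>\<omega>. g (\<lambda>i. \<epsilon> i \<omega>)) * expectation (\<lambda>\<omega>. \<Sum>p\<in>P. indicator (E p) (D \<omega>))"
    by (simp add: sum_distrib_left Bochner_Integration.integral_sum[OF iE])
  also have "expectation (\<lambda>\<omega>. \<Sum>p\<in>P. indicator (E p) (D \<omega>)) = expectation (\<lambda>\<omega>. 1 :: real)"
  proof (rule Bochner_Integration.integral_cong[OF refl])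
    fix \<omega> assume "\<omega> \<in> space M"
    then have d: "D \<omega> \<in> space T" by (rule measurable_space[OF D])
    have "(\<Sum>p\<in>P. indicator (E p) (D \<omega>)) = (\<Sum>p\<in>P. if p = \<pi> (D \<omega>) then 1 else 0 :: real)"
      by (rule sum.cong) (use d in \<open>auto simp: E_def\<close>)
    then show "(\<Sum>p\<in>P. indicator (E p) (D \<omega>)) = (1 :: real)" using fin \<pi>(1)[OF d] by simp
  qed
  finally show "expectation (\<lambda>\<omega>. g (\<lambda>i. \<epsilon> (\<pi> (D \<omega>) i) \<omega>)) = expectation (\<lambda>\<omega>. g (\<lambda>i. \<epsilon> i \<omega>))"
    by (simp add: prob_space)
qed

section \<open>Interpolated random walks and their tightness\<close>

definition walk :: "nat \<Rightarrow> real \<Rightarrow> (nat \<Rightarrow> real) \<Rightarrow> real \<Rightarrow> real" where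
  "walk n s e t = (\<Sum>m<n. ramp (real n * t - real m) * e m) / s"

lemma continuous_on_walk: "continuous_on A (walk n s e)"
  unfolding walk_def divide_inverse by (intro continuous_intros)

lemma walk_diff: "walk n s (\<lambda>i. e i - f i) t = walk n s e t - walk n s f t"
  by (simp add: walk_def sum_subtractf diff_divide_distrib algebra_simps)

lemma walk_le_partial_sums:
  assumes t: "t \<in> {0..1}" and b: "\<And>k. k \<le> n \<Longrightarrow> \<bar>\<Sum>i<k. e i\<bar> \<le> b" and s: "s \<ge> 0"
  shows "\<bar>walk n s e t\<bar> \<le> b / s"
proof -
  have "\<bar>piecewise_linear n (\<lambda>k. (\<Sum>m<k. e m) / s) t - 0\<bar> \<le> b / s"
    using t b s by (intro piecewise_linear_diff_le) (auto simp: divide_right_mono)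
  then show ?thesis using t by (simp add: piecewise_linear_sums walk_def)
qed

text \<open>Here the fourth powers at level \<open>l\<close> are at most
  \<open>K ^ 4 / 16 ^ l\<close>, hence their sum at most \<open>K ^ 4 / 8 ^ l\<close>; dividing
  \<open>1/8\<close> by \<open>(9/10) ^ 3\<close> gives \<open>125/729\<close>. It yields
  summability on every path rather than almost surely, so that the chaining bound is
  deterministic.\<close>

lemma dyadic_osc_summable_Lipschitz:
  assumes L: "\<And>s t. s \<in> {0..1} \<Longrightarrow> t \<in> {0..1} \<Longrightarrow> \<bar>y t - y s\<bar> \<le> K * \<bar>t - s\<bar>"
  shows "summable (\<lambda>l. dyadic_osc l y)"
proof (rule summable_comparison_test')
  show "summable (\<lambda>l. (9/10) ^ l + K ^ 4 * (125/729) ^ l)"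
    by (intro summable_add summable_mult summable_geometric) auto
  fix l :: nat
  have "(y (real (Suc k) / 2 ^ l) - y (real k / 2 ^ l)) ^ 4 \<le> (K * (1 / 2 ^ l)) ^ 4" if "k < 2 ^ l" for k
  proof -
    have "real (Suc k) / 2 ^ l \<in> {0..1}" "real k / 2 ^ l \<in> {0..1}"
      using that unit_dyadicsI[of "Suc k" l] unit_dyadicsI[of k l] unit_dyadics_subset by (auto simp del: of_nat_Suc)
    from L[OF this(2,1)] have "\<bar>y (real (Suc k) / 2 ^ l) - y (real k / 2 ^ l)\<bar> \<le> K * (1 / 2 ^ l)"
      by (simp add: diff_divide_distrib[symmetric])
    from power_mono[OF this, of 4] show ?thesis by simp
  qed
  then have "(\<Sum>k<2 ^ l. (y (real (Suc k) / 2 ^ l) - y (real k / 2 ^ l)) ^ 4) \<le> real (card {..<(2::nat) ^ l}) * (K * (1 / 2 ^ l)) ^ 4"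
    by (intro sum_bounded_above) auto
  also have "\<dots> = K ^ 4 * (1/8) ^ l"
  proof -
    have "(2::real) ^ l * (1 / 2 ^ l) ^ 4 = (2 * (1/2) ^ 4) ^ l"
      by (simp only: power_mult_distrib power_one_over[symmetric] power_mult[symmetric] mult.commute[of l 4])
    also have "(2 * (1/2) ^ 4 :: real) = 1/8" by (simp add: eval_nat_numeral)
    finally have "K ^ 4 * ((2::real) ^ l * (1 / 2 ^ l) ^ 4) = K ^ 4 * (1/8) ^ l" by (simp only:)
    then show ?thesis by (simp only: power_mult_distrib card_lessThan of_nat_power of_nat_numeral mult_ac)
  qed
  finally have "(\<Sum>k<2 ^ l. (y (real (Suc k) / 2 ^ l) - y (real k / 2 ^ l)) ^ 4) / ((9/10) ^ l) ^ 3 \<le> K ^ 4 * (1/8) ^ l / ((9/10) ^ l) ^ 3"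
    by (rule divide_right_mono) simp
  also have "\<dots> = K ^ 4 * (125/729) ^ l"
  proof -
    have "((9/10) ^ l) ^ 3 = ((9/10) ^ 3 :: real) ^ l" by (simp only: power_mult[symmetric] mult.commute)
    then have "(1/8) ^ l / ((9/10) ^ l) ^ 3 = ((1/8) / (9/10) ^ 3 :: real) ^ l" by (simp only: power_divide)
    also have "((1/8) / (9/10) ^ 3 :: real) = 125/729" by (simp add: power3_eq_cube)
    finally show ?thesis by (simp only: times_divide_eq_right[symmetric])
  qed
  finally show "norm (dyadic_osc l y) \<le> (9/10) ^ l + K ^ 4 * (125/729) ^ l"
    using dyadic_osc_nonneg[of l y] by (simp add: dyadic_osc_def)
qed

lemma walk_increment:
  "walk n s e t - walk n s e u = (\<Sum>m<n. (ramp (real n * t - real m) - ramp (real n * u - real m)) / s * e m)"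
  unfolding walk_def diff_divide_distrib[symmetric] sum_subtractf[symmetric]
  by (simp add: sum_divide_distrib algebra_simps diff_divide_distrib)

text \<open>The constant may grow with \<open>n\<close>: it serves summability and integrability for
  fixed \<open>n\<close>, while uniformity in \<open>n\<close> comes from the fourth
  moments.\<close>

lemma walk_Lipschitz:
  assumes b: "\<And>i. \<bar>e i\<bar> \<le> b" and s: "s > 0" and u: "u \<in> {0..1}" and t: "t \<in> {0..1}"
  shows "\<bar>walk n s e t - walk n s e u\<bar> \<le> (b * real n / s) * \<bar>t - u\<bar>"
proof -
  have b0: "0 \<le> b" using b[of 0] by linarith
  let ?d = "\<lambda>m. ramp (real n * t - real m) - ramp (real n * u - real m)"
  have nt: "0 \<le> real n * t" "real n * t \<le> real n" "0 \<le> real n * u" "real n * u \<le> real n"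
    using t u by (auto simp: mult_left_le)
  have "\<bar>walk n s e t - walk n s e u\<bar> \<le> (\<Sum>m<n. \<bar>?d m\<bar> / s * b)"
    unfolding walk_increment using s b
    by (intro order_trans[OF sum_abs] sum_mono) (auto simp: abs_mult intro!: mult_left_mono divide_right_mono)
  also have "\<dots> = \<bar>real n * t - real n * u\<bar> / s * b"
    unfolding sum_abs_ramp_diff[OF nt(3,4,1,2), symmetric] by (simp add: sum_divide_distrib sum_distrib_right)
  also have "\<dots> = (b * real n / s) * \<bar>t - u\<bar>"
    unfolding right_diff_distrib[symmetric] abs_mult by simp
  finally show ?thesis .
qed

lemma walk_measurable [measurable]:
  "(\<lambda>e. walk n s e t) \<in> borel_measurable (PiM UNIV (\<lambda>_. borel))"
  unfolding walk_def by measurable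

lemma (in prob_space) truncation_second_moment:
  assumes Y [measurable]: "Y \<in> borel_measurable M" and int: "integrable M (\<lambda>\<omega>. (Y \<omega>)\<^sup>2)" and "\<delta> > 0"
  obtains c :: real where "c > 0" "expectation (\<lambda>\<omega>. (if \<bar>Y \<omega>\<bar> \<le> c then 0 else Y \<omega>)\<^sup>2) \<le> \<delta>"
proof -
  have "(\<lambda>N. expectation (\<lambda>\<omega>. (if \<bar>Y \<omega>\<bar> \<le> real N then 0 else Y \<omega>)\<^sup>2)) \<longlonglongrightarrow> expectation (\<lambda>\<omega>. 0)"
  proof (rule integral_dominated_convergence[OF _ _ int])
    show "AE \<omega> in M. (\<lambda>N. (if \<bar>Y \<omega>\<bar> \<le> real N then 0 else Y \<omega>)\<^sup>2) \<longlonglongrightarrow> 0"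
    proof (intro AE_I2 tendsto_eventually)
      fix \<omega>
      obtain N0 :: nat where "\<bar>Y \<omega>\<bar> \<le> real N0" using real_arch_simple by blast
      then have "\<bar>Y \<omega>\<bar> \<le> real N" if "N \<ge> N0" for N using that by (meson of_nat_le_iff order_trans)
      then show "\<forall>\<^sub>F N in sequentially. (if \<bar>Y \<omega>\<bar> \<le> real N then 0 else Y \<omega>)\<^sup>2 = 0"
        unfolding eventually_sequentially by auto
    qed
  qed auto
  from LIMSEQ_D[OF this \<open>\<delta> > 0\<close>] obtain N0 where
    "\<And>N. N \<ge> N0 \<Longrightarrow> \<bar>expectation (\<lambda>\<omega>. (if \<bar>Y \<omega>\<bar> \<le> real N then 0 else Y \<omega>)\<^sup>2)\<bar> < \<delta>" by auto
  from this[of "Suc N0"] show ?thesis by (intro that[of "real (Suc N0)"]) auto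
qed

text \<open>Errors are split at a truncation level: the bounded part has controlled fourth moments and is
  handled by chaining, the remainder by the maximal inequality.\<close>

lemma (in prob_space) walk_tight:
  fixes \<epsilon> :: "nat \<Rightarrow> 'a \<Rightarrow> real"
  assumes ind: "indep_vars (\<lambda>_. borel) \<epsilon> UNIV" and id: "\<And>i. distr M borel (\<epsilon> i) = distr M borel (\<epsilon> 0)"
    and int: "integrable M (\<lambda>\<omega>. (\<epsilon> 0 \<omega>)\<^sup>2)" and mean: "expectation (\<epsilon> 0) = 0" and v: "v > 0" and \<delta>: "\<delta> > 0"
  obtains m0 R where
    "\<And>m n. R m n \<in> borel_measurable (PiM UNIV (\<lambda>_. borel))" "\<And>m n e. 0 \<le> R m n e"
    "\<And>m n e t. t \<in> {0..1} \<Longrightarrow> n > 0 \<Longrightarrow>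
       \<bar>walk n (sqrt (real n * v)) e t - dyadic_interpolation m (walk n (sqrt (real n * v)) e) t\<bar> \<le> R m n e"
    "\<And>m n. m \<ge> m0 \<Longrightarrow> n > 0 \<Longrightarrow> expectation (\<lambda>\<omega>. min 1 (R m n (\<lambda>i. \<epsilon> i \<omega>))) \<le> \<delta>"
proof -
  have em [measurable]: "\<epsilon> i \<in> borel_measurable M" for i
    using ind by (simp add: indep_vars_def)
  have tr: "expectation (\<lambda>\<omega>. f (\<epsilon> i \<omega>)) = expectation (\<lambda>\<omega>. f (\<epsilon> 0 \<omega>))" if [measurable]: "f \<in> borel_measurable borel" for f :: "real \<Rightarrow> real" and i
    using id[of i] integral_distr[OF em that, of i] integral_distr[OF em that, of 0] by simp
  have tri: "integrable M (\<lambda>\<omega>. f (\<epsilon> i \<omega>)) \<longleftrightarrow> integrable M (\<lambda>\<omega>. f (\<epsilon> 0 \<omega>))" if [measurable]: "f \<in> borel_measurable borel" for f :: "real \<Rightarrow> real" and i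
    using id[of i] integrable_distr_eq[OF em that, of i] integrable_distr_eq[OF em that, of 0] by simp
  have i0: "integrable M (\<epsilon> 0)" by (rule square_integrable_imp_integrable) (use int in auto)
  define lam where "lam = \<delta> / 4"
  have lam: "lam > 0" using \<delta> by (simp add: lam_def)
  \<comment> \<open>With this second moment of the remainder, the maximal inequality at height
    \<open>lam * s n / 2\<close> gives probability
    \<open>4 * \<eta> / (lam^2 * v) = \<delta> / 4\<close>.\<close>
  define \<eta> where "\<eta> = lam\<^sup>2 * v * \<delta> / 16"
  have \<eta>: "\<eta> > 0" using lam v \<delta> by (simp add: \<eta>_def)
  obtain c where c: "c > 0" "expectation (\<lambda>\<omega>. (if \<bar>\<epsilon> 0 \<omega>\<bar> \<le> c then 0 else \<epsilon> 0 \<omega>)\<^sup>2) \<le> \<eta>"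
    using truncation_second_moment[OF em int \<eta>] by blast
  define \<mu> where "\<mu> = expectation (\<lambda>\<omega>. if \<bar>\<epsilon> 0 \<omega>\<bar> \<le> c then \<epsilon> 0 \<omega> else 0)"
  \<comment> \<open>Truncation with recentring: the fourth moment bound requires mean zero. The
    bound on the values grows from \<open>c\<close> to \<open>2 * c\<close>.\<close>
  define T where "T x = (if \<bar>x\<bar> \<le> c then x else 0) - \<mu>" for x
  have Tm [measurable]: "T \<in> borel_measurable borel" unfolding T_def by measurable
  have ic: "integrable M (\<lambda>\<omega>. if \<bar>\<epsilon> 0 \<omega>\<bar> \<le> c then \<epsilon> 0 \<omega> else 0)"
    by (rule integrable_const_bound[of _ c]) (use c in auto)
  have "\<bar>\<mu>\<bar> \<le> expectation (\<lambda>\<omega>. \<bar>if \<bar>\<epsilon> 0 \<omega>\<bar> \<le> c then \<epsilon> 0 \<omega> else 0\<bar>)" unfolding \<mu>_def by (rule integral_abs_bound)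
  also have "\<dots> \<le> expectation (\<lambda>\<omega>. c)" using ic c by (intro integral_mono) auto
  finally have \<mu>: "\<bar>\<mu>\<bar> \<le> c" by (simp add: prob_space)
  have Tb: "\<bar>T x\<bar> \<le> 2 * c" for x using \<mu> c unfolding T_def by (auto simp: abs_if split: if_splits)
  have T0: "expectation (\<lambda>\<omega>. T (\<epsilon> 0 \<omega>)) = 0" unfolding T_def using ic by (simp add: \<mu>_def prob_space)
  have ie: "integrable M (\<lambda>\<omega>. (if \<bar>\<epsilon> 0 \<omega>\<bar> \<le> c then 0 else \<epsilon> 0 \<omega>)\<^sup>2)"
    by (rule Bochner_Integration.integrable_bound[OF int]) (auto intro!: AE_I2)
  have r0: "expectation (\<lambda>\<omega>. \<epsilon> 0 \<omega> - T (\<epsilon> 0 \<omega>)) = 0"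
    using T0 mean i0 ic unfolding T_def by simp
  have r2: "integrable M (\<lambda>\<omega>. (\<epsilon> 0 \<omega> - T (\<epsilon> 0 \<omega>))\<^sup>2) \<and> expectation (\<lambda>\<omega>. (\<epsilon> 0 \<omega> - T (\<epsilon> 0 \<omega>))\<^sup>2) \<le> \<eta>"
  proof -
    let ?Y = "\<lambda>\<omega>. if \<bar>\<epsilon> 0 \<omega>\<bar> \<le> c then 0 else \<epsilon> 0 \<omega>"
    have iY: "integrable M ?Y" by (rule square_integrable_imp_integrable) (use ie in auto)
    have Ye: "\<epsilon> 0 \<omega> - T (\<epsilon> 0 \<omega>) = ?Y \<omega> + \<mu>" for \<omega> by (simp add: T_def)
    have EY: "expectation ?Y = - \<mu>" using r0 iY unfolding Ye by (simp add: prob_space)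
    have sq: "(\<epsilon> 0 \<omega> - T (\<epsilon> 0 \<omega>))\<^sup>2 = (?Y \<omega>)\<^sup>2 + 2 * \<mu> * ?Y \<omega> + \<mu>\<^sup>2" for \<omega>
      unfolding Ye by (simp add: power2_sum)
    have "integrable M (\<lambda>\<omega>. (\<epsilon> 0 \<omega> - T (\<epsilon> 0 \<omega>))\<^sup>2)" unfolding sq using ie iY by simp
    moreover have "expectation (\<lambda>\<omega>. (\<epsilon> 0 \<omega> - T (\<epsilon> 0 \<omega>))\<^sup>2) = expectation (\<lambda>\<omega>. (?Y \<omega>)\<^sup>2) - \<mu>\<^sup>2"
      unfolding sq using ie iY EY by (simp add: prob_space power2_eq_square)
    ultimately show ?thesis using c(2) by (smt (verit) zero_le_power2)
  qed
  \<comment> \<open>The fourth moment constant for variables bounded by \<open>2 * c\<close>, when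
    the squared weights of an increment add up to at most
    \<open>\<bar>t - u\<bar> / v\<close>.\<close>
  define C where "C = 3 * (2 * c) ^ 4 / v\<^sup>2"
  have C: "C \<ge> 0" by (simp add: C_def)
  have "(\<lambda>m. 10 * (1 + C) * (9/10) ^ Suc m) \<longlonglongrightarrow> 10 * (1 + C) * 0"
    by (intro tendsto_mult_left LIMSEQ_Suc LIMSEQ_power_zero) simp
  then obtain m0 where m0: "\<And>m. m \<ge> m0 \<Longrightarrow> 10 * (1 + C) * (9/10) ^ Suc m < \<delta> / 2"
  proof -
    assume *: "(\<lambda>m. 10 * (1 + C) * (9/10) ^ Suc m) \<longlonglongrightarrow> 10 * (1 + C) * 0"
    have "\<forall>\<^sub>F m in sequentially. 10 * (1 + C) * (9/10) ^ Suc m < \<delta> / 2"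
      by (rule order_tendstoD(2)[OF *]) (use \<delta> in simp)
    then show thesis unfolding eventually_sequentially using that by blast
  qed
  define s where "s n = sqrt (real n * v)" for n
  have s: "s n > 0" "(s n)\<^sup>2 = real n * v" if "n > 0" for n using that v by (auto simp: s_def)
  \<comment> \<open>Both parts of the majorant are functions of the error sequence alone; this
    allows the sorted errors to be substituted later without changing the expectation.\<close>
  define R1 where "R1 m n e = (\<Sum>l. dyadic_osc (l + Suc m) (walk n (s n) (\<lambda>i. T (e i))))" for m n e
  define R2 where "R2 n e = Max ((\<lambda>k. \<bar>\<Sum>i<k. e i - T (e i)\<bar>) ` {..n}) / s n" for n e
  have Tc [measurable]: "(\<lambda>e. (\<lambda>i. T (e i))) \<in> measurable (PiM UNIV (\<lambda>_. borel)) (PiM UNIV (\<lambda>_::nat. borel))"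
    by (rule measurable_PiM_single') auto
  have wT [measurable]: "(\<lambda>e. walk n (s n) (\<lambda>i. T (e i)) t) \<in> borel_measurable (PiM UNIV (\<lambda>_. borel))" for n t
    by (rule measurable_compose[OF Tc walk_measurable])
  have R1m [measurable]: "R1 m n \<in> borel_measurable (PiM UNIV (\<lambda>_. borel))" for m n
    unfolding R1_def dyadic_osc_def by measurable
  have R2m [measurable]: "R2 n \<in> borel_measurable (PiM UNIV (\<lambda>_. borel))" for n
    unfolding R2_def by measurable
  have sm: "summable (\<lambda>l. dyadic_osc l (walk n (s n) (\<lambda>i. T (e i))))" if "n > 0" for n e
    by (rule dyadic_osc_summable_Lipschitz[OF walk_Lipschitz[OF Tb]]) (use s that in auto)
  have R10: "0 \<le> R1 m n e" if "n > 0" for m n e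
    unfolding R1_def using sm[OF that, of e] by (intro suminf_nonneg dyadic_osc_nonneg) (subst summable_iff_shift)
  have Mx: "\<bar>\<Sum>i<k. e i - T (e i)\<bar> \<le> Max ((\<lambda>k. \<bar>\<Sum>i<k. e i - T (e i)\<bar>) ` {..n})" if "k \<le> n" for k n :: nat and e
    using that by (intro Max_ge) auto
  have R20: "0 \<le> R2 n e" for n e
    unfolding R2_def using order_trans[OF abs_ge_zero Mx[of 0 n e]] v by (simp add: s_def)
  \<comment> \<open>The walk of remainders is bounded by \<open>R2\<close> both at \<open>t\<close>
    and at the nodes of its interpolation, hence the factor 2.\<close>
  define R where "R m n e = (if n > 0 then R1 m n e + 2 * R2 n e else 0)" for m n e
  have Rm: "R m n \<in> borel_measurable (PiM UNIV (\<lambda>_. borel))" for m n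
    unfolding R_def by (cases "n > 0") simp_all
  have R0: "0 \<le> R m n e" for m n e using R10[of n m e] R20[of n e] by (simp add: R_def)
  have R_bound: "\<bar>walk n (s n) e t - dyadic_interpolation m (walk n (s n) e) t\<bar> \<le> R m n e"
    if t: "t \<in> {0..1}" and n: "n > 0" for m n e t
  proof -
    let ?w = "walk n (s n) (\<lambda>i. T (e i))" and ?r = "walk n (s n) (\<lambda>i. e i - T (e i))"
    have w: "walk n (s n) e = (\<lambda>u. ?w u + ?r u)" by (simp add: fun_eq_iff walk_diff)
    have d: "dyadic_interpolation m (walk n (s n) e) t = dyadic_interpolation m ?w t + dyadic_interpolation m ?r t"
      unfolding w dyadic_interpolation_def piecewise_linear_add ..
    have 1: "\<bar>?w t - dyadic_interpolation m ?w t\<bar> \<le> R1 m n e"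
      unfolding R1_def using t by (intro dyadic_chaining sm n continuous_on_walk) auto
    have r: "\<bar>?r u\<bar> \<le> R2 n e" if "u \<in> {0..1}" for u
      unfolding R2_def using that s(1)[OF n] by (intro walk_le_partial_sums Mx) auto
    have 2: "\<bar>dyadic_interpolation m ?r t - 0\<bar> \<le> R2 n e"
      using t r by (intro dyadic_interpolation_diff_le) auto
    have "R m n e = R1 m n e + 2 * R2 n e" using n by (simp add: R_def)
    moreover have "walk n (s n) e t = ?w t + ?r t" by (simp add: walk_diff)
    ultimately show ?thesis using 1 2 r[OF t] d by linarith
  qed
  have E: "expectation (\<lambda>\<omega>. min 1 (R m n (\<lambda>i. \<epsilon> i \<omega>))) \<le> \<delta>" if m: "m \<ge> m0" and n: "n > 0" for m n
  proof -
    have indT: "indep_vars (\<lambda>_. borel) (\<lambda>i \<omega>. T (\<epsilon> i \<omega>)) UNIV"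
      by (rule indep_vars_compose2[OF ind, of "\<lambda>_. T"]) simp
    have indr: "indep_vars (\<lambda>_. borel) (\<lambda>i \<omega>. \<epsilon> i \<omega> - T (\<epsilon> i \<omega>)) UNIV"
      by (rule indep_vars_compose2[OF ind, of "\<lambda>_ x. x - T x"]) simp
    let ?w = "\<lambda>t \<omega>. walk n (s n) (\<lambda>i. T (\<epsilon> i \<omega>)) t"
    have wm [measurable]: "?w t \<in> borel_measurable M" for t unfolding walk_def by measurable
    have inc: "integrable M (\<lambda>\<omega>. (?w t \<omega> - ?w u \<omega>) ^ 4) \<and> expectation (\<lambda>\<omega>. (?w t \<omega> - ?w u \<omega>) ^ 4) \<le> C * (t - u)\<^sup>2"
      if tu: "t \<in> {0..1}" "u \<in> {0..1}" for t u
    proof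
      show "integrable M (\<lambda>\<omega>. (?w t \<omega> - ?w u \<omega>) ^ 4)"
      proof (rule integrable_const_bound)
        show "AE \<omega> in M. norm ((?w t \<omega> - ?w u \<omega>) ^ 4) \<le> ((2 * c * real n / s n) * \<bar>t - u\<bar>) ^ 4"
        proof (intro AE_I2)
          fix \<omega>
          have "\<bar>?w t \<omega> - ?w u \<omega>\<bar> \<le> (2 * c * real n / s n) * \<bar>t - u\<bar>"
            by (rule walk_Lipschitz[OF Tb s(1)[OF n] tu(2,1)])
          from power_mono[OF this abs_ge_zero, of 4]
          show "norm ((?w t \<omega> - ?w u \<omega>) ^ 4) \<le> ((2 * c * real n / s n) * \<bar>t - u\<bar>) ^ 4"
            by (simp only: real_norm_def power_abs)
        qed
      qed (intro borel_measurable_power borel_measurable_diff wm)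
      have nt: "0 \<le> real n * t" "real n * t \<le> real n" "0 \<le> real n * u" "real n * u \<le> real n"
        using tu by (auto simp: mult_left_le)
      let ?d = "\<lambda>m. ramp (real n * t - real m) - ramp (real n * u - real m)"
      have "expectation (\<lambda>\<omega>. (?w t \<omega> - ?w u \<omega>) ^ 4) \<le> 3 * (2 * c) ^ 4 * (\<Sum>m<n. (?d m / s n)\<^sup>2)\<^sup>2"
        unfolding walk_increment
        by (rule fourth_moment_sum_le[THEN conjunct1])
          (use indep_vars_subset[OF indT] Tb tr[of T] T0 in auto)
      also have "(\<Sum>m<n. (?d m / s n)\<^sup>2) = (\<Sum>m<n. (?d m)\<^sup>2) / (s n)\<^sup>2"
        by (simp add: power_divide sum_divide_distrib)
      also have "3 * (2 * c) ^ 4 * ((\<Sum>m<n. (?d m)\<^sup>2) / (s n)\<^sup>2)\<^sup>2 \<le> 3 * (2 * c) ^ 4 * (\<bar>real n * t - real n * u\<bar> / (s n)\<^sup>2)\<^sup>2"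
        using sum_ramp_diff_squared_le[OF nt(3,4,1,2)] s(1)[OF n]
        by (intro mult_left_mono power_mono divide_right_mono divide_nonneg_nonneg sum_nonneg) auto
      also have "\<bar>real n * t - real n * u\<bar> / (s n)\<^sup>2 = \<bar>t - u\<bar> / v"
        unfolding right_diff_distrib[symmetric] abs_mult s(2)[OF n] using n v by simp
      also have "3 * (2 * c) ^ 4 * (\<bar>t - u\<bar> / v)\<^sup>2 = C * (t - u)\<^sup>2"
        by (simp add: C_def power_divide)
      finally show "expectation (\<lambda>\<omega>. (?w t \<omega> - ?w u \<omega>) ^ 4) \<le> C * (t - u)\<^sup>2" .
    qed
    have dy: "real (Suc k) / 2 ^ l \<in> {0..1}" "real k / 2 ^ l \<in> {0..1}" "(real (Suc k) / 2 ^ l - real k / 2 ^ l)\<^sup>2 = (1 / 2 ^ l)\<^sup>2"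
      if "k < 2 ^ l" for k l
      using that unit_dyadicsI[of "Suc k" l] unit_dyadicsI[of k l] unit_dyadics_subset
      by (auto simp: diff_divide_distrib[symmetric] simp del: of_nat_Suc)
    have inc': "integrable M (\<lambda>\<omega>. (?w (real (Suc k) / 2 ^ l) \<omega> - ?w (real k / 2 ^ l) \<omega>) ^ 4)"
      "expectation (\<lambda>\<omega>. (?w (real (Suc k) / 2 ^ l) \<omega> - ?w (real k / 2 ^ l) \<omega>) ^ 4) \<le> C * (1 / 2 ^ l)\<^sup>2" if "k < 2 ^ l" for k l
    proof -
      note i = inc[OF dy(1)[OF that] dy(2)[OF that], unfolded dy(3)[OF that]]
      show "integrable M (\<lambda>\<omega>. (?w (real (Suc k) / 2 ^ l) \<omega> - ?w (real k / 2 ^ l) \<omega>) ^ 4)"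
        by (rule i[THEN conjunct1])
      show "expectation (\<lambda>\<omega>. (?w (real (Suc k) / 2 ^ l) \<omega> - ?w (real k / 2 ^ l) \<omega>) ^ 4) \<le> C * (1 / 2 ^ l)\<^sup>2"
        by (rule i[THEN conjunct2])
    qed
    have iR1: "integrable M (\<lambda>\<omega>. R1 m n (\<lambda>i. \<epsilon> i \<omega>))"
      unfolding R1_def by (rule dyadic_osc_expectation(2)[where y="?w", OF inc' C])
    have eR1: "expectation (\<lambda>\<omega>. R1 m n (\<lambda>i. \<epsilon> i \<omega>)) \<le> 10 * (1 + C) * (9/10) ^ Suc m"
      unfolding R1_def by (rule dyadic_osc_expectation(3)[where y="?w", OF inc' C])
    define Bad where "Bad = {\<omega> \<in> space M. \<exists>k\<le>n. lam * s n / 2 \<le> \<bar>\<Sum>i<k. \<epsilon> i \<omega> - T (\<epsilon> i \<omega>)\<bar>}"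
    have Bad: "Bad \<in> sets M" unfolding Bad_def by measurable
    have iB: "integrable M (indicator Bad :: _ \<Rightarrow> real)"
      by (rule integrable_real_indicator[OF Bad]) (simp add: emeasure_eq_measure)
    have rr: "integrable M (\<lambda>\<omega>. (\<epsilon> i \<omega> - T (\<epsilon> i \<omega>))\<^sup>2)" "expectation (\<lambda>\<omega>. \<epsilon> i \<omega> - T (\<epsilon> i \<omega>)) = 0"
      "expectation (\<lambda>\<omega>. (\<epsilon> i \<omega> - T (\<epsilon> i \<omega>))\<^sup>2) \<le> \<eta>" for i
      using tri[of "\<lambda>x. (x - T x)\<^sup>2" i] tr[of "\<lambda>x. x - T x" i] tr[of "\<lambda>x. (x - T x)\<^sup>2" i] r2 r0 by auto
    have "prob Bad \<le> real n * \<eta> / (lam * s n / 2)\<^sup>2"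
      unfolding Bad_def using lam s(1)[OF n]
      by (intro Kolmogorov_maximal_inequality[where X="\<lambda>i \<omega>. \<epsilon> i \<omega> - T (\<epsilon> i \<omega>)"] indr rr) auto
    also have "\<dots> = \<delta> / 4"
      unfolding power_divide power_mult_distrib s(2)[OF n] \<eta>_def using n v lam by simp
    finally have pB: "prob Bad \<le> \<delta> / 4" .
    \<comment> \<open>On \<open>Bad\<close> the cut at 1 is paid by the indicator; off
      \<open>Bad\<close> the contribution \<open>2 * R2\<close> is at most
      \<open>lam\<close>.\<close>
    have pt: "min 1 (R m n (\<lambda>i. \<epsilon> i \<omega>)) \<le> R1 m n (\<lambda>i. \<epsilon> i \<omega>) + lam + indicator Bad \<omega>" if w: "\<omega> \<in> space M" for \<omega>
    proof (cases "\<omega> \<in> Bad")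
      case True
      then show ?thesis using R10[OF n, of m "\<lambda>i. \<epsilon> i \<omega>"] lam by simp
    next
      case False
      have "\<bar>\<Sum>i<k. \<epsilon> i \<omega> - T (\<epsilon> i \<omega>)\<bar> \<le> lam * s n / 2" if k: "k \<le> n" for k
      proof (rule ccontr)
        assume "\<not> \<bar>\<Sum>i<k. \<epsilon> i \<omega> - T (\<epsilon> i \<omega>)\<bar> \<le> lam * s n / 2"
        then have "lam * s n / 2 \<le> \<bar>\<Sum>i<k. \<epsilon> i \<omega> - T (\<epsilon> i \<omega>)\<bar>" by linarith
        with k w have "\<omega> \<in> Bad" unfolding Bad_def by blast
        with False show False by simp
      qed
      then have "Max ((\<lambda>k. \<bar>\<Sum>i<k. \<epsilon> i \<omega> - T (\<epsilon> i \<omega>)\<bar>) ` {..n}) \<le> lam * s n / 2" by (subst Max_le_iff) auto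
      then have "R2 n (\<lambda>i. \<epsilon> i \<omega>) \<le> lam / 2"
        unfolding R2_def using s(1)[OF n] by (simp add: pos_divide_le_eq)
      then have "R m n (\<lambda>i. \<epsilon> i \<omega>) \<le> R1 m n (\<lambda>i. \<epsilon> i \<omega>) + lam" using n by (simp add: R_def)
      then show ?thesis using False by simp
    qed
    have RM: "(\<lambda>\<omega>. R m n (\<lambda>i. \<epsilon> i \<omega>)) \<in> borel_measurable M"
    proof -
      have "(\<lambda>\<omega> i. \<epsilon> i \<omega>) \<in> measurable M (PiM UNIV (\<lambda>_::nat. borel :: real measure))"
        by (rule measurable_PiM_single') auto
      from measurable_compose[OF this Rm[of m n]] show ?thesis .
    qed
    have "expectation (\<lambda>\<omega>. min 1 (R m n (\<lambda>i. \<epsilon> i \<omega>))) \<le> expectation (\<lambda>\<omega>. R1 m n (\<lambda>i. \<epsilon> i \<omega>) + lam + indicator Bad \<omega>)"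
    proof (rule integral_mono)
      show "integrable M (\<lambda>\<omega>. min 1 (R m n (\<lambda>i. \<epsilon> i \<omega>)))"
      proof (rule integrable_const_bound[of _ 1])
        have "norm (min 1 x) \<le> 1" if "0 \<le> x" for x :: real using that by (auto simp: min_def)
        then show "AE \<omega> in M. norm (min 1 (R m n (\<lambda>i. \<epsilon> i \<omega>))) \<le> 1" by (intro AE_I2) (simp add: R0)
      qed (intro borel_measurable_min borel_measurable_const RM)
      show "integrable M (\<lambda>\<omega>. R1 m n (\<lambda>i. \<epsilon> i \<omega>) + lam + indicator Bad \<omega>)"
        by (intro Bochner_Integration.integrable_add integrable_const iR1 iB)
    qed (rule pt)
    also have "\<dots> = expectation (\<lambda>\<omega>. R1 m n (\<lambda>i. \<epsilon> i \<omega>)) + lam + prob Bad"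
      using Bochner_Integration.integral_add[OF Bochner_Integration.integrable_add[OF iR1 integrable_const[of lam]] iB]
        Bochner_Integration.integral_add[OF iR1 integrable_const[of lam]] Bad
      by (simp add: prob_space)
    also have "\<dots> \<le> \<delta> / 2 + \<delta> / 4 + \<delta> / 4" using eR1 m0[OF m] pB unfolding lam_def by linarith
    finally show ?thesis by simp
  qed
  show thesis
  proof (rule that[of R m0])
    show "R m n \<in> borel_measurable (PiM UNIV (\<lambda>_. borel))" for m n by (rule Rm)
    show "0 \<le> R m n e" for m n e by (rule R0)
    show "\<bar>walk n (sqrt (real n * v)) e t - dyadic_interpolation m (walk n (sqrt (real n * v)) e) t\<bar> \<le> R m n e"
      if "t \<in> {0..1}" "n > 0" for m n e t
      using R_bound[OF that, of e m] by (simp only: s_def)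
    show "expectation (\<lambda>\<omega>. min 1 (R m n (\<lambda>i. \<epsilon> i \<omega>))) \<le> \<delta>" if "m \<ge> m0" "n > 0" for m n
      by (rule E[OF that])
  qed
qed

subsection \<open>Convergence in probability and limit theorems\<close>

context prob_space
begin

lemma Cauchy_Schwarz_expectation:
  assumes f [measurable]: "f \<in> borel_measurable M" and g [measurable]: "g \<in> borel_measurable M"
    and f2: "integrable M (\<lambda>\<omega>. (f \<omega>)\<^sup>2)" and g2: "integrable M (\<lambda>\<omega>. (g \<omega> :: real)\<^sup>2)"
  shows "integrable M (\<lambda>\<omega>. f \<omega> * g \<omega>)"
    and "(expectation (\<lambda>\<omega>. f \<omega> * g \<omega>))\<^sup>2 \<le> expectation (\<lambda>\<omega>. (f \<omega>)\<^sup>2) * expectation (\<lambda>\<omega>. (g \<omega>)\<^sup>2)"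
proof -
  show fg: "integrable M (\<lambda>\<omega>. f \<omega> * g \<omega>)"
  proof (rule Bochner_Integration.integrable_bound)
    show "integrable M (\<lambda>\<omega>. (f \<omega>)\<^sup>2 + (g \<omega>)\<^sup>2)" using f2 g2 by simp
    have "\<bar>a * b\<bar> \<le> a\<^sup>2 + b\<^sup>2" for a b :: real
    proof -
      have "2 * (\<bar>a\<bar> * \<bar>b\<bar>) \<le> a\<^sup>2 + b\<^sup>2" using sum_squares_bound[of "\<bar>a\<bar>" "\<bar>b\<bar>"] by (simp add: mult.assoc)
      moreover have "0 \<le> \<bar>a\<bar> * \<bar>b\<bar>" by simp
      ultimately show ?thesis unfolding abs_mult by linarith
    qed
    then show "AE \<omega> in M. norm (f \<omega> * g \<omega>) \<le> norm ((f \<omega>)\<^sup>2 + (g \<omega>)\<^sup>2)" by simp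
  qed measurable
  define a b c where "a = expectation (\<lambda>\<omega>. (f \<omega>)\<^sup>2)" and "b = expectation (\<lambda>\<omega>. (g \<omega>)\<^sup>2)"
    and "c = expectation (\<lambda>\<omega>. f \<omega> * g \<omega>)"
  have q: "0 \<le> a + 2 * r * c + r\<^sup>2 * b" for r
  proof -
    have "0 \<le> expectation (\<lambda>\<omega>. (f \<omega> + r * g \<omega>)\<^sup>2)" by simp
    also have "(\<lambda>\<omega>. (f \<omega> + r * g \<omega>)\<^sup>2) = (\<lambda>\<omega>. (f \<omega>)\<^sup>2 + 2 * r * (f \<omega> * g \<omega>) + r\<^sup>2 * (g \<omega>)\<^sup>2)"
      by (simp add: fun_eq_iff power2_eq_square algebra_simps)
    also have "expectation \<dots> = a + 2 * r * c + r\<^sup>2 * b"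
      unfolding a_def b_def c_def using f2 g2 fg by simp
    finally show ?thesis .
  qed
  have b0: "0 \<le> b" by (simp add: b_def)
  have "c\<^sup>2 \<le> a * b"
  proof (cases "b = 0")
    case True
    have "c = 0"
    proof (rule ccontr)
      assume "c \<noteq> 0"
      then have "2 * (- (a + 1) / (2 * c)) * c = - (a + 1)" by (simp add: field_simps)
      with q[of "- (a + 1) / (2 * c)"] True show False by simp
    qed
    with True show ?thesis by simp
  next
    case False
    then have "b > 0" using b0 by simp
    have "a + 2 * (- c / b) * c + (- c / b)\<^sup>2 * b = a - c\<^sup>2 / b"
      using \<open>b > 0\<close> by (simp add: power2_eq_square)
    with q[of "- c / b"] have "c\<^sup>2 / b \<le> a" by linarith
    then show ?thesis using \<open>b > 0\<close> by (simp add: pos_divide_le_eq)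
  qed
  then show "(expectation (\<lambda>\<omega>. f \<omega> * g \<omega>))\<^sup>2 \<le> expectation (\<lambda>\<omega>. (f \<omega>)\<^sup>2) * expectation (\<lambda>\<omega>. (g \<omega>)\<^sup>2)"
    by (simp add: a_def b_def c_def)
qed

text \<open>Convergence to 0 in probability. The expectation of \<open>min 1 \<bar>Y\<bar>\<close>
  metrizes it, is subadditive, and is the form in which bounded Lipschitz functions use it.\<close>

definition negligible_sequence :: "(nat \<Rightarrow> 'a \<Rightarrow> real) \<Rightarrow> bool" where
  "negligible_sequence Y \<longleftrightarrow> (\<forall>n. Y n \<in> borel_measurable M) \<and>
     (\<lambda>n. expectation (\<lambda>\<omega>. min 1 \<bar>Y n \<omega>\<bar>)) \<longlonglongrightarrow> 0"

lemma integrable_min_1_abs: "Y \<in> borel_measurable M \<Longrightarrow> integrable M (\<lambda>\<omega>. min 1 \<bar>Y \<omega> :: real\<bar>)"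
  by (rule integrable_const_bound[of _ 1]) auto

lemma negligible_sequenceI:
  assumes [measurable]: "\<And>n. Y n \<in> borel_measurable M"
    and lim: "\<And>e. e > 0 \<Longrightarrow> \<exists>b. b \<longlonglongrightarrow> 0 \<and> (\<forall>n. expectation (\<lambda>\<omega>. min 1 \<bar>Y n \<omega>\<bar>) \<le> b n + e)"
  shows "negligible_sequence Y"
  unfolding negligible_sequence_def
proof (intro conjI allI assms(1) LIMSEQ_I)
  fix r :: real assume r: "r > 0"
  then obtain b where b: "b \<longlonglongrightarrow> 0" "\<And>n. expectation (\<lambda>\<omega>. min 1 \<bar>Y n \<omega>\<bar>) \<le> b n + r/2"
    using lim[of "r/2"] by auto
  obtain n0 where n0: "\<And>n. n \<ge> n0 \<Longrightarrow> \<bar>b n\<bar> < r/2" using LIMSEQ_D[OF b(1), of "r/2"] r by auto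
  have "norm (expectation (\<lambda>\<omega>. min 1 \<bar>Y n \<omega>\<bar>) - 0) < r" if "n \<ge> n0" for n
  proof -
    have "0 \<le> expectation (\<lambda>\<omega>. min 1 \<bar>Y n \<omega>\<bar>)" by simp
    then show ?thesis using b(2)[of n] n0[OF that] by simp
  qed
  then show "\<exists>no. \<forall>n\<ge>no. norm (expectation (\<lambda>\<omega>. min 1 \<bar>Y n \<omega>\<bar>) - 0) < r" by blast
qed

lemma negligible_measurable: "negligible_sequence Y \<Longrightarrow> Y n \<in> borel_measurable M"
  by (simp add: negligible_sequence_def)

lemma negligible_add:
  assumes Y: "negligible_sequence Y" and Z: "negligible_sequence Z"
  shows "negligible_sequence (\<lambda>n \<omega>. Y n \<omega> + Z n \<omega>)"
proof (rule negligible_sequenceI)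
  note [measurable] = negligible_measurable[OF Y] negligible_measurable[OF Z]
  show "(\<lambda>\<omega>. Y n \<omega> + Z n \<omega>) \<in> borel_measurable M" for n by measurable
  fix e :: real assume "e > 0"
  let ?b = "\<lambda>n. expectation (\<lambda>\<omega>. min 1 \<bar>Y n \<omega>\<bar>) + expectation (\<lambda>\<omega>. min 1 \<bar>Z n \<omega>\<bar>)"
  have "?b \<longlonglongrightarrow> 0 + 0" using Y Z by (intro tendsto_add) (auto simp: negligible_sequence_def)
  moreover have "expectation (\<lambda>\<omega>. min 1 \<bar>Y n \<omega> + Z n \<omega>\<bar>) \<le> ?b n + e" for n
  proof -
    have "expectation (\<lambda>\<omega>. min 1 \<bar>Y n \<omega> + Z n \<omega>\<bar>) \<le> expectation (\<lambda>\<omega>. min 1 \<bar>Y n \<omega>\<bar> + min 1 \<bar>Z n \<omega>\<bar>)"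
      by (intro integral_mono Bochner_Integration.integrable_add integrable_min_1_abs) auto
    also have "\<dots> = ?b n" by (intro Bochner_Integration.integral_add integrable_min_1_abs) auto
    finally show ?thesis using \<open>e > 0\<close> by simp
  qed
  ultimately show "\<exists>b. b \<longlonglongrightarrow> 0 \<and> (\<forall>n. expectation (\<lambda>\<omega>. min 1 \<bar>Y n \<omega> + Z n \<omega>\<bar>) \<le> b n + e)"
    by (intro exI[of _ ?b]) simp
qed

lemma negligible_sum:
  assumes "\<And>i. i \<in> A \<Longrightarrow> negligible_sequence (Y i)"
  shows "negligible_sequence (\<lambda>n \<omega>. \<Sum>i\<in>A. Y i n \<omega>)"
  using assms
proof (induction A rule: infinite_finite_induct)
  case (insert x A)
  then show ?case by (simp add: negligible_add)
qed (simp_all add: negligible_sequence_def)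

lemma negligible_L1:
  assumes Y: "\<And>n. integrable M (Y n)" and b: "\<And>n. expectation (\<lambda>\<omega>. \<bar>Y n \<omega>\<bar>) \<le> b n" "b \<longlonglongrightarrow> 0"
  shows "negligible_sequence Y"
proof (rule negligible_sequenceI)
  show m: "Y n \<in> borel_measurable M" for n using Y by auto
  fix e :: real assume "e > 0"
  have "expectation (\<lambda>\<omega>. min 1 \<bar>Y n \<omega>\<bar>) \<le> b n + e" for n
  proof -
    have "expectation (\<lambda>\<omega>. min 1 \<bar>Y n \<omega>\<bar>) \<le> expectation (\<lambda>\<omega>. \<bar>Y n \<omega>\<bar>)"
      using Y m by (intro integral_mono integrable_min_1_abs) auto
    then show ?thesis using b(1)[of n] \<open>e > 0\<close> by linarith
  qed
  with b(2) show "\<exists>b. b \<longlonglongrightarrow> 0 \<and> (\<forall>n. expectation (\<lambda>\<omega>. min 1 \<bar>Y n \<omega>\<bar>) \<le> b n + e)" by blast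
qed

lemma expectation_abs_le_second_moment:
  assumes [measurable]: "Y \<in> borel_measurable M" and Y2: "integrable M (\<lambda>\<omega>. (Y \<omega> :: real)\<^sup>2)" and "e > 0"
  shows "expectation (\<lambda>\<omega>. \<bar>Y \<omega>\<bar>) \<le> e + expectation (\<lambda>\<omega>. (Y \<omega>)\<^sup>2) / e"
proof -
  have iY: "integrable M Y" by (rule square_integrable_imp_integrable[OF _ Y2]) simp
  have "\<bar>y\<bar> \<le> e + y\<^sup>2 / e" for y :: real
  proof (cases "\<bar>y\<bar> \<le> e")
    case False
    then have "\<bar>y\<bar> * e \<le> \<bar>y\<bar> * \<bar>y\<bar>" by (intro mult_left_mono) auto
    then have "\<bar>y\<bar> \<le> y\<^sup>2 / e" using \<open>e > 0\<close> by (simp add: pos_le_divide_eq power2_eq_square)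
    then show ?thesis using \<open>e > 0\<close> by linarith
  qed (use \<open>e > 0\<close> in \<open>auto intro: order_trans\<close>)
  then have "expectation (\<lambda>\<omega>. \<bar>Y \<omega>\<bar>) \<le> expectation (\<lambda>\<omega>. e + (Y \<omega>)\<^sup>2 / e)"
    using iY Y2 by (intro integral_mono) auto
  also have "\<dots> = e + expectation (\<lambda>\<omega>. (Y \<omega>)\<^sup>2) / e" using Y2 by (simp add: prob_space)
  finally show ?thesis .
qed

lemma negligible_L2:
  assumes m: "\<And>n. Y n \<in> borel_measurable M" and Y: "\<And>n. integrable M (\<lambda>\<omega>. (Y n \<omega>)\<^sup>2)"
    and b: "\<And>n. expectation (\<lambda>\<omega>. (Y n \<omega>)\<^sup>2) \<le> b n" "b \<longlonglongrightarrow> 0"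
  shows "negligible_sequence Y"
proof (rule negligible_sequenceI[OF m])
  fix e :: real assume e: "e > 0"
  have "(\<lambda>n. b n / e) \<longlonglongrightarrow> 0 / e" by (intro tendsto_divide b tendsto_const) (use e in auto)
  moreover have "expectation (\<lambda>\<omega>. min 1 \<bar>Y n \<omega>\<bar>) \<le> b n / e + e" for n
  proof -
    have iY: "integrable M (Y n)" by (rule square_integrable_imp_integrable[OF m Y])
    have "expectation (\<lambda>\<omega>. min 1 \<bar>Y n \<omega>\<bar>) \<le> expectation (\<lambda>\<omega>. \<bar>Y n \<omega>\<bar>)"
      using iY m by (intro integral_mono integrable_min_1_abs) auto
    also have "\<dots> \<le> e + expectation (\<lambda>\<omega>. (Y n \<omega>)\<^sup>2) / e" by (rule expectation_abs_le_second_moment[OF m Y e])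
    also have "\<dots> \<le> b n / e + e" using b(1)[of n] e by (simp add: divide_right_mono)
    finally show ?thesis .
  qed
  ultimately show "\<exists>b. b \<longlonglongrightarrow> 0 \<and> (\<forall>n. expectation (\<lambda>\<omega>. min 1 \<bar>Y n \<omega>\<bar>) \<le> b n + e)"
    by (intro exI[of _ "\<lambda>n. b n / e"]) simp
qed

lemma negligible_prob:
  assumes Y: "negligible_sequence Y" and d: "\<delta> > 0"
  shows "(\<lambda>n. prob {\<omega> \<in> space M. \<delta> \<le> \<bar>Y n \<omega>\<bar>}) \<longlonglongrightarrow> 0"
proof (rule tendsto_sandwich[where f="\<lambda>_. 0"])
  note [measurable] = negligible_measurable[OF Y]
  define d where "d = min 1 \<delta>"
  have d0: "d > 0" using assms by (simp add: d_def)
  show "\<forall>\<^sub>F n in sequentially. prob {\<omega> \<in> space M. \<delta> \<le> \<bar>Y n \<omega>\<bar>} \<le> expectation (\<lambda>\<omega>. min 1 \<bar>Y n \<omega>\<bar>) / d"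
  proof (intro always_eventually allI)
    fix n
    have A: "{\<omega> \<in> space M. \<delta> \<le> \<bar>Y n \<omega>\<bar>} \<in> sets M" by measurable
    have "d * prob {\<omega> \<in> space M. \<delta> \<le> \<bar>Y n \<omega>\<bar>} = expectation (\<lambda>\<omega>. d * indicator {\<omega> \<in> space M. \<delta> \<le> \<bar>Y n \<omega>\<bar>} \<omega>)"
      using A by simp
    also have "\<dots> \<le> expectation (\<lambda>\<omega>. min 1 \<bar>Y n \<omega>\<bar>)"
    proof (rule integral_mono)
      show "integrable M (\<lambda>\<omega>. d * indicator {\<omega> \<in> space M. \<delta> \<le> \<bar>Y n \<omega>\<bar>} \<omega>)"
        by (intro integrable_mult_right integrable_real_indicator A) (simp add: emeasure_eq_measure)
      show "integrable M (\<lambda>\<omega>. min 1 \<bar>Y n \<omega>\<bar>)" by (rule integrable_min_1_abs) measurable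
    qed (auto simp: d_def indicator_def min_def)
    finally show "prob {\<omega> \<in> space M. \<delta> \<le> \<bar>Y n \<omega>\<bar>} \<le> expectation (\<lambda>\<omega>. min 1 \<bar>Y n \<omega>\<bar>) / d"
      using d0 by (simp add: pos_le_divide_eq mult.commute)
  qed
  have "(\<lambda>n. expectation (\<lambda>\<omega>. min 1 \<bar>Y n \<omega>\<bar>) / d) \<longlonglongrightarrow> 0 / d"
    using Y d0 by (intro tendsto_divide tendsto_const) (auto simp: negligible_sequence_def)
  then show "(\<lambda>n. expectation (\<lambda>\<omega>. min 1 \<bar>Y n \<omega>\<bar>) / d) \<longlonglongrightarrow> 0" by simp
qed auto

text \<open>Because of the cut at 1, an exceptional event costs no more than its probability,
  however large \<open>Y\<close> may be there.\<close>

lemma expectation_min_le_off_event: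
  assumes [measurable]: "Y \<in> borel_measurable M" and B: "B \<in> sets M" and Z: "integrable M Z" "\<And>\<omega>. 0 \<le> Z \<omega>"
    and le: "\<And>\<omega>. \<omega> \<in> space M \<Longrightarrow> \<omega> \<notin> B \<Longrightarrow> \<bar>Y \<omega> :: real\<bar> \<le> Z \<omega>"
  shows "expectation (\<lambda>\<omega>. min 1 \<bar>Y \<omega>\<bar>) \<le> prob B + expectation Z"
proof -
  have iB: "integrable M (indicator B :: _ \<Rightarrow> real)"
    by (rule integrable_real_indicator[OF B]) (simp add: emeasure_eq_measure)
  have "expectation (\<lambda>\<omega>. min 1 \<bar>Y \<omega>\<bar>) \<le> expectation (\<lambda>\<omega>. indicator B \<omega> + Z \<omega>)"
  proof (rule integral_mono)
    show "integrable M (\<lambda>\<omega>. min 1 \<bar>Y \<omega>\<bar>)" by (rule integrable_min_1_abs) simp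
    show "integrable M (\<lambda>\<omega>. indicator B \<omega> + Z \<omega>)" by (intro Bochner_Integration.integrable_add iB Z)
    fix \<omega> assume "\<omega> \<in> space M"
    then show "min 1 \<bar>Y \<omega>\<bar> \<le> indicator B \<omega> + Z \<omega>"
      using Z(2)[of \<omega>] le[of \<omega>] by (cases "\<omega> \<in> B") auto
  qed
  also have "\<dots> = prob B + expectation Z"
    using Bochner_Integration.integral_add[OF iB Z(1)] B by simp
  finally show ?thesis .
qed

text \<open>Truncation at a fixed level: the bounded centred part has second moment of order 1/n,
  and the mean of the rest is small uniformly in \<open>n\<close>. Convergence in mean, and not just
  in probability, is wanted since these expectations later bound second moments of weighted error
  sums.\<close>

lemma L1_law_of_large_numbers:
  fixes Y :: "nat \<Rightarrow> 'a \<Rightarrow> real"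
  assumes ind: "indep_vars (\<lambda>_. borel) Y UNIV" and id: "\<And>i. distr M borel (Y i) = distr M borel (Y 0)"
    and int: "integrable M (Y 0)"
  shows "\<And>n. integrable M (\<lambda>\<omega>. (\<Sum>i<n. Y i \<omega>) / real n - expectation (Y 0))"
    and "(\<lambda>n. expectation (\<lambda>\<omega>. \<bar>(\<Sum>i<n. Y i \<omega>) / real n - expectation (Y 0)\<bar>)) \<longlonglongrightarrow> 0"
proof -
  have em [measurable]: "Y i \<in> borel_measurable M" for i
    using ind by (simp add: indep_vars_def)
  have tr: "expectation (\<lambda>\<omega>. f (Y i \<omega>)) = expectation (\<lambda>\<omega>. f (Y 0 \<omega>))" if [measurable]: "f \<in> borel_measurable borel" for f :: "real \<Rightarrow> real" and i
    using id[of i] integral_distr[OF em that, of i] integral_distr[OF em that, of 0] by simp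
  have tri: "integrable M (\<lambda>\<omega>. f (Y i \<omega>)) \<longleftrightarrow> integrable M (\<lambda>\<omega>. f (Y 0 \<omega>))" if [measurable]: "f \<in> borel_measurable borel" for f :: "real \<Rightarrow> real" and i
    using id[of i] integrable_distr_eq[OF em that, of i] integrable_distr_eq[OF em that, of 0] by simp
  have iY: "integrable M (Y i)" for i using tri[of "\<lambda>x. x" i] int by simp
  define \<mu> where "\<mu> = expectation (Y 0)"
  show iA: "integrable M (\<lambda>\<omega>. (\<Sum>i<n. Y i \<omega>) / real n - expectation (Y 0))" for n
    using iY by simp
  show "(\<lambda>n. expectation (\<lambda>\<omega>. \<bar>(\<Sum>i<n. Y i \<omega>) / real n - expectation (Y 0)\<bar>)) \<longlonglongrightarrow> 0"
  proof (rule LIMSEQ_I)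
    fix r :: real assume r: "r > 0"
    have "(\<lambda>N. expectation (\<lambda>\<omega>. \<bar>if \<bar>Y 0 \<omega>\<bar> \<le> real N then 0 else Y 0 \<omega>\<bar>)) \<longlonglongrightarrow> expectation (\<lambda>\<omega>. 0)"
    proof (rule integral_dominated_convergence[where w="\<lambda>\<omega>. \<bar>Y 0 \<omega>\<bar>"])
      show "AE \<omega> in M. (\<lambda>N. \<bar>if \<bar>Y 0 \<omega>\<bar> \<le> real N then 0 else Y 0 \<omega>\<bar>) \<longlonglongrightarrow> 0"
      proof (intro AE_I2 tendsto_eventually)
        fix \<omega>
        obtain N0 :: nat where "\<bar>Y 0 \<omega>\<bar> \<le> real N0" using real_arch_simple by blast
        then have "\<bar>Y 0 \<omega>\<bar> \<le> real N" if "N \<ge> N0" for N using that by (meson of_nat_le_iff order_trans)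
        then show "\<forall>\<^sub>F N in sequentially. \<bar>if \<bar>Y 0 \<omega>\<bar> \<le> real N then 0 else Y 0 \<omega>\<bar> = 0"
          unfolding eventually_sequentially by auto
      qed
    qed (use int in auto)
    from LIMSEQ_D[OF this, of "r/8"] r obtain N where
      N: "expectation (\<lambda>\<omega>. \<bar>if \<bar>Y 0 \<omega>\<bar> \<le> real N then 0 else Y 0 \<omega>\<bar>) < r/8"
      by (auto simp: abs_less_iff)
    define c where "c = real N"
    define H where "H x = (if \<bar>x\<bar> \<le> c then 0 else x)" for x :: real
    define g where "g = expectation (\<lambda>\<omega>. Y 0 \<omega> - H (Y 0 \<omega>))"
    have [measurable]: "H \<in> borel_measurable borel" unfolding H_def by measurable
    have H: "expectation (\<lambda>\<omega>. \<bar>H (Y 0 \<omega>)\<bar>) < r/8" using N unfolding H_def c_def .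
    have iH0: "integrable M (\<lambda>\<omega>. H (Y 0 \<omega>))"
      by (rule Bochner_Integration.integrable_bound[OF int]) (auto simp: H_def)
    have iH: "integrable M (\<lambda>\<omega>. H (Y i \<omega>))" for i using tri[of H i] iH0 by simp
    have gb: "\<bar>x - H x\<bar> \<le> c" for x by (simp add: H_def c_def)
    have "\<bar>g\<bar> \<le> expectation (\<lambda>\<omega>. \<bar>Y 0 \<omega> - H (Y 0 \<omega>)\<bar>)" unfolding g_def by (rule integral_abs_bound)
    also have "\<dots> \<le> expectation (\<lambda>\<omega>. c)" using int iH0 gb by (intro integral_mono) auto
    finally have g: "\<bar>g\<bar> \<le> c" by (simp add: prob_space)
    define X where "X i \<omega> = Y i \<omega> - H (Y i \<omega>) - g" for i \<omega>
    have [measurable]: "X i \<in> borel_measurable M" for i unfolding X_def by measurable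
    have Xb: "\<bar>X i \<omega>\<bar> \<le> 2 * c" for i \<omega> using gb[of "Y i \<omega>"] g unfolding X_def by linarith
    have EX: "expectation (X i) = 0" for i
      unfolding X_def using tr[of "\<lambda>x. x - H x - g" i] int iH0 by (simp add: g_def prob_space)
    have indX: "indep_vars (\<lambda>_. borel) X UNIV"
      unfolding X_def[abs_def] by (rule indep_vars_compose2[OF ind, of "\<lambda>_ x. x - H x - g"]) simp
    have X2: "expectation (\<lambda>\<omega>. (\<Sum>i<n. 1 / real n * X i \<omega>)\<^sup>2) \<le> 4 * c\<^sup>2 / real n" for n
    proof -
      have "expectation (\<lambda>\<omega>. (\<Sum>i<n. 1 / real n * X i \<omega>)\<^sup>2) \<le> (2 * c)\<^sup>2 * (\<Sum>i<n. (1 / real n)\<^sup>2)"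
        by (rule fourth_moment_sum_le[THEN conjunct2, THEN conjunct1])
          (use indep_vars_subset[OF indX] Xb EX in auto)
      also have "\<dots> = 4 * c\<^sup>2 / real n" by (simp add: power2_eq_square)
      finally show ?thesis .
    qed
    \<comment> \<open>The constant \<open>r/2\<close> collects \<open>r/4\<close> from splitting the
      absolute value of the bounded part, \<open>r/8\<close> for the mean of the tails and
      \<open>r/8\<close> for their centring.\<close>
    have bd: "expectation (\<lambda>\<omega>. \<bar>(\<Sum>i<n. Y i \<omega>) / real n - \<mu>\<bar>) \<le> r/2 + (4 * c\<^sup>2 / real n) / (r/4)" if n: "n > 0" for n
    proof -
      let ?S = "\<lambda>\<omega>. \<Sum>i<n. 1 / real n * X i \<omega>"
      have S2: "integrable M (\<lambda>\<omega>. (?S \<omega>)\<^sup>2)"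
      proof (rule integrable_const_bound)
        have "\<bar>?S \<omega>\<bar> \<le> (\<Sum>i<n. 1 / real n * (2 * c))" for \<omega>
          by (rule order_trans[OF sum_abs]) (intro sum_mono, simp add: divide_right_mono Xb)
        then have "(?S \<omega>)\<^sup>2 \<le> (\<Sum>i<n. 1 / real n * (2 * c))\<^sup>2" for \<omega>
          using power_mono[of "\<bar>?S \<omega>\<bar>" _ 2] by simp
        then show "AE \<omega> in M. norm ((?S \<omega>)\<^sup>2) \<le> (\<Sum>i<n. 1 / real n * (2 * c))\<^sup>2" by (simp add: AE_I2)
      qed measurable
      have iS: "integrable M ?S" by (rule square_integrable_imp_integrable[OF _ S2]) measurable
      have iS': "integrable M (\<lambda>\<omega>. \<bar>?S \<omega>\<bar>)" by (rule integrable_abs[OF iS])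
      have iH': "integrable M (\<lambda>\<omega>. \<Sum>i<n. 1 / real n * \<bar>H (Y i \<omega>)\<bar>)"
        by (intro Bochner_Integration.integrable_sum integrable_mult_right integrable_abs iH)
      have \<mu>g: "\<mu> - g = expectation (\<lambda>\<omega>. H (Y 0 \<omega>))" unfolding \<mu>_def g_def using int iH0 by simp
      have \<mu>g': "\<bar>\<mu> - g\<bar> \<le> r/8" unfolding \<mu>g using H by (intro order_trans[OF integral_abs_bound]) simp
      have dec: "(\<Sum>i<n. Y i \<omega>) / real n - \<mu> = ?S \<omega> + (\<Sum>i<n. 1 / real n * H (Y i \<omega>)) - (\<mu> - g)" for \<omega>
      proof -
        have "(\<Sum>i<n. Y i \<omega>) = (\<Sum>i<n. X i \<omega>) + (\<Sum>i<n. H (Y i \<omega>)) + real n * g"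
          by (simp add: X_def sum.distrib sum_subtractf)
        then show ?thesis using n by (simp add: sum_distrib_left[symmetric] add_divide_distrib sum_divide_distrib[symmetric])
      qed
      have "expectation (\<lambda>\<omega>. \<bar>(\<Sum>i<n. Y i \<omega>) / real n - \<mu>\<bar>) \<le>
          expectation (\<lambda>\<omega>. \<bar>?S \<omega>\<bar> + (\<Sum>i<n. 1 / real n * \<bar>H (Y i \<omega>)\<bar>) + r/8)"
      proof (rule integral_mono)
        show "integrable M (\<lambda>\<omega>. \<bar>(\<Sum>i<n. Y i \<omega>) / real n - \<mu>\<bar>)" using iA[of n] by (simp add: \<mu>_def)
        show "integrable M (\<lambda>\<omega>. \<bar>?S \<omega>\<bar> + (\<Sum>i<n. 1 / real n * \<bar>H (Y i \<omega>)\<bar>) + r/8)"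
          by (intro Bochner_Integration.integrable_add[OF Bochner_Integration.integrable_add[OF iS' iH']] integrable_const)
        fix \<omega>
        have "\<bar>\<Sum>i<n. 1 / real n * H (Y i \<omega>)\<bar> \<le> (\<Sum>i<n. 1 / real n * \<bar>H (Y i \<omega>)\<bar>)"
          by (rule order_trans[OF sum_abs]) (simp add: abs_mult)
        then show "\<bar>(\<Sum>i<n. Y i \<omega>) / real n - \<mu>\<bar> \<le> \<bar>?S \<omega>\<bar> + (\<Sum>i<n. 1 / real n * \<bar>H (Y i \<omega>)\<bar>) + r/8"
          unfolding dec using \<mu>g' by linarith
      qed
      also have "\<dots> = expectation (\<lambda>\<omega>. \<bar>?S \<omega>\<bar>) + (\<Sum>i<n. 1 / real n * expectation (\<lambda>\<omega>. \<bar>H (Y i \<omega>)\<bar>)) + r/8"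
        unfolding Bochner_Integration.integral_add[OF Bochner_Integration.integrable_add[OF iS' iH'] integrable_const]
          Bochner_Integration.integral_add[OF iS' iH']
        using iH by (subst Bochner_Integration.integral_sum) (auto simp: prob_space)
      also have "(\<Sum>i<n. 1 / real n * expectation (\<lambda>\<omega>. \<bar>H (Y i \<omega>)\<bar>)) = expectation (\<lambda>\<omega>. \<bar>H (Y 0 \<omega>)\<bar>)"
      proof -
        have "(\<Sum>i<n. 1 / real n * expectation (\<lambda>\<omega>. \<bar>H (Y i \<omega>)\<bar>)) = (\<Sum>i<n. 1 / real n * expectation (\<lambda>\<omega>. \<bar>H (Y 0 \<omega>)\<bar>))"
          by (intro sum.cong arg_cong2[where f="(*)"] refl tr[of "\<lambda>x. \<bar>H x\<bar>"]) simp
        then show ?thesis using n by simp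
      qed
      also have "expectation (\<lambda>\<omega>. \<bar>?S \<omega>\<bar>) \<le> r/4 + expectation (\<lambda>\<omega>. (?S \<omega>)\<^sup>2) / (r/4)"
        by (rule expectation_abs_le_second_moment[OF _ S2]) (use r in auto)
      also have "expectation (\<lambda>\<omega>. (?S \<omega>)\<^sup>2) / (r/4) \<le> (4 * c\<^sup>2 / real n) / (r/4)"
        using X2[of n] r by (intro divide_right_mono) auto
      finally show ?thesis using H by simp
    qed
    define q where "q n = (4 * c\<^sup>2 / real n) / (r/4)" for n
    have "q \<longlonglongrightarrow> 0 / (r/4)"
      unfolding q_def using r by (intro tendsto_divide tendsto_const lim_const_over_n) auto
    then have "q \<longlonglongrightarrow> 0" by simp
    from LIMSEQ_D[OF this, of "r/2"] r obtain n0 where n0: "\<And>n. n \<ge> n0 \<Longrightarrow> \<bar>q n\<bar> < r/2" by auto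
    have "norm (expectation (\<lambda>\<omega>. \<bar>(\<Sum>i<n. Y i \<omega>) / real n - expectation (Y 0)\<bar>) - 0) < r" if "n \<ge> max 1 n0" for n
    proof -
      have "0 \<le> expectation (\<lambda>\<omega>. \<bar>(\<Sum>i<n. Y i \<omega>) / real n - \<mu>\<bar>)" by simp
      moreover have "expectation (\<lambda>\<omega>. \<bar>(\<Sum>i<n. Y i \<omega>) / real n - \<mu>\<bar>) < r"
        using bd[of n] n0[of n] that unfolding q_def by linarith
      ultimately show ?thesis by (simp add: \<mu>_def)
    qed
    then show "\<exists>no. \<forall>n\<ge>no. norm (expectation (\<lambda>\<omega>. \<bar>(\<Sum>i<n. Y i \<omega>) / real n - expectation (Y 0)\<bar>) - 0) < r" by blast
  qed
qed

lemma expectation_cos: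
  assumes [measurable]: "Y \<in> borel_measurable M"
  shows "expectation (\<lambda>\<omega>. cos (Y \<omega> + b)) = Re (iexp b * char (distr M borel Y) 1)"
proof -
  have i: "complex_integrable M (\<lambda>\<omega>. iexp b * iexp (Y \<omega>))"
    by (rule integrable_const_bound[of _ 1]) (auto simp: norm_mult)
  have "expectation (\<lambda>\<omega>. cos (Y \<omega> + b)) = expectation (\<lambda>\<omega>. Re (iexp b * iexp (Y \<omega>)))"
    by (simp add: Re_exp add.commute flip: exp_add)
  also have "\<dots> = Re (CLINT \<omega>|M. iexp b * iexp (Y \<omega>))" by (rule integral_Re[OF i])
  also have "(CLINT \<omega>|M. iexp b * iexp (Y \<omega>)) = iexp b * char (distr M borel Y) 1"
    by (simp add: char_distr)
  finally show ?thesis .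
qed

lemma centered_gaussian_cos:
  assumes "centered_gaussian M Y w"
  shows "expectation (\<lambda>\<omega>. cos (Y \<omega> + b)) = cos b * exp (- w / 2)"
  using assms expectation_cos[of Y b] unfolding centered_gaussian_def
  by (simp add: Re_exp exp_of_real)

text \<open>The normalization uses \<open>v\<close>, in general not the variance \<open>s\<close> of
  \<open>Y 0\<close>, so the central limit theorem is read at the argument
  \<open>sqrt (s / v)\<close>. The degenerate case \<open>s = 0\<close> is separate: there all
  variables vanish almost surely.\<close>

lemma iid_cos_limit:
  fixes Y :: "nat \<Rightarrow> 'a \<Rightarrow> real"
  assumes ind: "indep_vars (\<lambda>_. borel) Y UNIV" and id: "\<And>i. distr M borel (Y i) = distr M borel (Y 0)"
    and int: "integrable M (\<lambda>\<omega>. (Y 0 \<omega>)\<^sup>2)" and mean: "expectation (Y 0) = 0" and v: "v > 0"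
  shows "(\<lambda>n. expectation (\<lambda>\<omega>. cos ((\<Sum>i<n. Y i \<omega>) / sqrt (real n * v) + b)))
    \<longlonglongrightarrow> cos b * exp (- (expectation (\<lambda>\<omega>. (Y 0 \<omega>)\<^sup>2) / v) / 2)"
proof -
  have em [measurable]: "Y i \<in> borel_measurable M" for i
    using ind by (simp add: indep_vars_def)
  have tr: "expectation (\<lambda>\<omega>. f (Y i \<omega>)) = expectation (\<lambda>\<omega>. f (Y 0 \<omega>))" if [measurable]: "f \<in> borel_measurable borel" for f :: "real \<Rightarrow> real" and i
    using id[of i] integral_distr[OF em that, of i] integral_distr[OF em that, of 0] by simp
  have tri: "integrable M (\<lambda>\<omega>. f (Y i \<omega>)) \<longleftrightarrow> integrable M (\<lambda>\<omega>. f (Y 0 \<omega>))" if [measurable]: "f \<in> borel_measurable borel" for f :: "real \<Rightarrow> real" and i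
    using id[of i] integrable_distr_eq[OF em that, of i] integrable_distr_eq[OF em that, of 0] by simp
  define s where "s = expectation (\<lambda>\<omega>. (Y 0 \<omega>)\<^sup>2)"
  have s0: "0 \<le> s" by (simp add: s_def)
  have i2: "integrable M (\<lambda>\<omega>. (Y i \<omega>)\<^sup>2)" and e2: "expectation (\<lambda>\<omega>. (Y i \<omega>)\<^sup>2) = s" and e1: "expectation (Y i) = 0" for i
    using tri[of "\<lambda>x. x\<^sup>2" i] tr[of "\<lambda>x. x\<^sup>2" i] tr[of "\<lambda>x. x" i] int mean by (auto simp: s_def)
  show ?thesis
  proof (cases "s = 0")
    case True
    have "AE \<omega> in M. Y i \<omega> = 0" for i
      using e2[of i] True integral_nonneg_eq_0_iff_AE[OF i2[of i]] by simp
    then have "AE \<omega> in M. \<forall>i. Y i \<omega> = 0" by (simp add: AE_all_countable)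
    then have "expectation (\<lambda>\<omega>. cos ((\<Sum>i<n. Y i \<omega>) / sqrt (real n * v) + b)) = expectation (\<lambda>\<omega>. cos b)" for n
      by (intro integral_cong_AE) auto
    then show ?thesis using True by (simp add: s_def prob_space)
  next
    case False
    then have s: "s > 0" using s0 by simp
    define w where "w = s / v"
    have w: "w > 0" using s v by (simp add: w_def)
    let ?S = "\<lambda>n \<omega>. \<Sum>i<n. Y i \<omega>"
    have "weak_conv_m (\<lambda>n. distr M borel (\<lambda>\<omega>. ?S n \<omega> / sqrt (real n * (sqrt s)\<^sup>2))) std_normal_distribution"
      by (rule central_limit_theorem_zero_mean[OF ind e1 _ i2 _ id]) (use s e2 e1 in auto)
    then have "(\<lambda>n. char (distr M borel (\<lambda>\<omega>. ?S n \<omega> / sqrt (real n * (sqrt s)\<^sup>2))) (sqrt w)) \<longlonglongrightarrow> char std_normal_distribution (sqrt w)"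
      by (rule levy_continuity1[rotated 2]) (auto simp: real_distribution_distr real_dist_normal_dist)
    moreover have "char (distr M borel (\<lambda>\<omega>. ?S n \<omega> / sqrt (real n * (sqrt s)\<^sup>2))) (sqrt w) =
        char (distr M borel (\<lambda>\<omega>. ?S n \<omega> / sqrt (real n * v))) 1" for n
    proof -
      have "sqrt w * (?S n \<omega> / sqrt (real n * (sqrt s)\<^sup>2)) = ?S n \<omega> / sqrt (real n * v)" for \<omega>
        using s v by (simp add: w_def real_sqrt_divide real_sqrt_mult)
      then show ?thesis by (simp add: char_distr flip: of_real_mult)
    qed
    ultimately have "(\<lambda>n. char (distr M borel (\<lambda>\<omega>. ?S n \<omega> / sqrt (real n * v))) 1) \<longlonglongrightarrow> complex_of_real (exp (- w / 2))"
      using w by (simp add: char_std_normal_distribution)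
    then have "(\<lambda>n. Re (iexp b * char (distr M borel (\<lambda>\<omega>. ?S n \<omega> / sqrt (real n * v))) 1)) \<longlonglongrightarrow> Re (iexp b * complex_of_real (exp (- w / 2)))"
      by (intro tendsto_Re tendsto_mult_left)
    moreover have "Re (iexp b * complex_of_real (exp (- w / 2))) = cos b * exp (- w / 2)"
      by (simp add: Re_exp)
    ultimately show ?thesis by (simp add: expectation_cos w_def s_def)
  qed
qed

end

subsection \<open>Sorting\<close>

lemma bij_betw_sorted_row: "bij_betw (sorted_row n z) {..<n} {..<n}"
proof -
  have "bij_betw ((!) (sort_key z [0..<n])) {..<n} {..<n}"
    by (rule bij_betw_nth) (simp_all add: atLeast0LessThan)
  then show ?thesis by (simp add: sorted_row_def[abs_def])
qed

lemma sorted_row_mono: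
  assumes "k \<le> l" "l < n"
  shows "z (sorted_row n z k) \<le> z (sorted_row n z l)"
proof -
  have "map z (sort_key z [0..<n]) ! k \<le> map z (sort_key z [0..<n]) ! l"
    using assms by (intro sorted_nth_mono) (auto intro: sorted_sort_key)
  then show ?thesis using assms by (simp add: sorted_row_def)
qed

lemma sorted_row_less: "k < n \<Longrightarrow> sorted_row n z k < n"
  using bij_betw_sorted_row[of n z] by (auto simp: bij_betw_def)

lemma down_closed_nat_set:
  assumes "finite D" "\<And>k l. l \<in> D \<Longrightarrow> k \<le> l \<Longrightarrow> k \<in> D"
  shows "D = {..<card D}"
proof (cases "D = {}")
  case False
  have "D = {..Max D}"
  proof (intro set_eqI iffI)
    fix x assume "x \<in> D" then show "x \<in> {..Max D}" using assms(1) by simp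
  next
    fix x assume "x \<in> {..Max D}" then show "x \<in> D" using assms(2)[OF Max_in[OF assms(1) False]] by simp
  qed
  then have "D = {..<Suc (Max D)}" by (simp add: lessThan_Suc_atMost)
  then show ?thesis by (metis card_lessThan)
qed simp

section \<open>Ranks, counts and sorting weights\<close>

definition count_le :: "nat \<Rightarrow> (nat \<Rightarrow> real) \<Rightarrow> real \<Rightarrow> nat" where
  "count_le n z t = card {i. i < n \<and> z i \<le> t}"

text \<open>The positions with key at most \<open>t\<close> are closed downwards, hence an initial
  segment, and sorting is a bijection, so its length is the count.\<close>

lemma sorted_row_le_iff:
  assumes "m < n"
  shows "z (sorted_row n z m) \<le> t \<longleftrightarrow> m < count_le n z t"
proof -
  define D where "D = {m. m < n \<and> z (sorted_row n z m) \<le> t}"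
  have "D = {..<card D}"
    by (rule down_closed_nat_set) (auto simp: D_def intro: order_trans[OF sorted_row_mono])
  moreover have "card D = count_le n z t"
  proof -
    have "bij_betw (sorted_row n z) D {i. i < n \<and> z i \<le> t}"
      using bij_betw_sorted_row[of n z] unfolding D_def bij_betw_def
      by (auto simp: inj_on_def image_iff)
    then show ?thesis unfolding count_le_def by (rule bij_betw_same_card)
  qed
  ultimately have "m \<in> D \<longleftrightarrow> m < count_le n z t" by (metis lessThan_iff)
  then show ?thesis using assms by (simp add: D_def)
qed

text \<open>The weight that interpolation up to \<open>n * t\<close> sorted positions gives to row
  \<open>i\<close>: \<open>ramp\<close> at its rank. Summing over all positions avoids the inverse
  permutation and is measurable in the keys.\<close>

definition sort_weight :: "nat \<Rightarrow> (nat \<Rightarrow> real) \<Rightarrow> real \<Rightarrow> nat \<Rightarrow> real" where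
  "sort_weight n z t i = (\<Sum>m<n. ramp (real n * t - real m) * (if sorted_row n z m = i then 1 else 0))"

lemma sort_weight_sorted_row:
  assumes "m < n"
  shows "sort_weight n z t (sorted_row n z m) = ramp (real n * t - real m)"
proof -
  have "sorted_row n z m' = sorted_row n z m \<longleftrightarrow> m' = m" if "m' < n" for m'
    using bij_betw_sorted_row[of n z] assms that by (auto simp: bij_betw_def inj_on_def)
  then have "sort_weight n z t (sorted_row n z m) = (\<Sum>m'<n. if m' = m then ramp (real n * t - real m) else 0)"
    unfolding sort_weight_def by (intro sum.cong) auto
  then show ?thesis using assms by simp
qed

lemma sum_sorted_row:
  fixes f :: "nat \<Rightarrow> 'a::real_vector"
  shows "(\<Sum>m<n. ramp (real n * t - real m) *\<^sub>R f (sorted_row n z m)) = (\<Sum>i<n. sort_weight n z t i *\<^sub>R f i)"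
proof -
  have "(\<Sum>i<n. sort_weight n z t i *\<^sub>R f i) = (\<Sum>m<n. sort_weight n z t (sorted_row n z m) *\<^sub>R f (sorted_row n z m))"
    by (rule sum.reindex_bij_betw[OF bij_betw_sorted_row, symmetric])
  then show ?thesis by (simp add: sort_weight_sorted_row)
qed

lemma sort_weight_bounds:
  assumes "i < n"
  shows "0 \<le> sort_weight n z t i" "sort_weight n z t i \<le> 1"
proof -
  obtain m where "m < n" "i = sorted_row n z m"
    using bij_betw_sorted_row[of n z] assms by (auto simp: bij_betw_def image_iff)
  then show "0 \<le> sort_weight n z t i" "sort_weight n z t i \<le> 1"
    by (simp_all add: sort_weight_sorted_row ramp_ge_0 ramp_le_1)
qed

text \<open>The rows in the first \<open>n * t\<close> sorted positions and those with key at most \<open>t\<close> are nested,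
  so that their difference is determined by its size.\<close>

lemma sum_abs_sort_weight_diff:
  assumes "t \<in> {0..1}"
  shows "(\<Sum>i<n. \<bar>sort_weight n z t i - (if z i \<le> x then 1 else 0)\<bar>) = \<bar>real n * t - real (count_le n z x)\<bar>"
proof -
  have c: "count_le n z x \<le> n"
  proof -
    have "count_le n z x \<le> card {..<n}" unfolding count_le_def by (intro card_mono) auto
    then show ?thesis by simp
  qed
  have "(\<Sum>i<n. \<bar>sort_weight n z t i - (if z i \<le> x then 1 else 0)\<bar>) =
      (\<Sum>m<n. \<bar>sort_weight n z t (sorted_row n z m) - (if z (sorted_row n z m) \<le> x then 1 else 0)\<bar>)"
    by (rule sum.reindex_bij_betw[OF bij_betw_sorted_row, symmetric])
  also have "\<dots> = (\<Sum>m<n. \<bar>ramp (real n * t - real m) - ramp (real (count_le n z x) - real m)\<bar>)"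
  proof (intro sum.cong refl)
    fix m assume "m \<in> {..<n}"
    moreover have "(if m < count_le n z x then 1 else 0) = ramp (real (count_le n z x) - real m)"
      by (auto simp: ramp_nonpos ramp_ge1)
    ultimately show "\<bar>sort_weight n z t (sorted_row n z m) - (if z (sorted_row n z m) \<le> x then 1 else 0)\<bar> =
        \<bar>ramp (real n * t - real m) - ramp (real (count_le n z x) - real m)\<bar>"
      by (simp add: sort_weight_sorted_row sorted_row_le_iff)
  qed
  also have "\<dots> = \<bar>real n * t - real (count_le n z x)\<bar>"
    using assms c by (intro sum_abs_ramp_diff) (auto simp: mult_left_le)
  finally show ?thesis .
qed

text \<open>Extended by the identity, the permutation of the first \<open>n\<close> indices becomes
  an injection of all naturals and can act on the infinite sequence of errors.\<close>

definition list_perm :: "nat \<Rightarrow> nat list \<Rightarrow> nat \<Rightarrow> nat" where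
  "list_perm n l k = (if k < n then l ! k else k)"

definition sort_perm :: "nat \<Rightarrow> (nat \<Rightarrow> real) \<Rightarrow> nat \<Rightarrow> nat" where
  "sort_perm n z = list_perm n (sort_key z [0..<n])"

lemma sort_perm_eq: "k < n \<Longrightarrow> sort_perm n z k = sorted_row n z k"
  by (simp add: sort_perm_def list_perm_def sorted_row_def)

definition perms_below :: "nat \<Rightarrow> (nat \<Rightarrow> nat) set" where
  "perms_below n = {p \<in> list_perm n ` {l. set l \<subseteq> {..<n} \<and> length l = n}. inj p}"

lemma finite_perms_below: "finite (perms_below n)"
  unfolding perms_below_def by (auto intro!: finite_imageI finite_lists_length_eq)

lemma sort_perm_in_perms_below: "sort_perm n z \<in> perms_below n"
proof -
  have "sort_perm n z \<in> list_perm n ` {l. set l \<subseteq> {..<n} \<and> length l = n}"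
    unfolding sort_perm_def by (intro imageI) auto
  moreover have "inj (sort_perm n z)"
  proof (rule injI)
    fix k l assume e: "sort_perm n z k = sort_perm n z l"
    have o: "sort_perm n z k = k" if "\<not> k < n" for k using that by (simp add: sort_perm_def list_perm_def)
    consider "k < n" "l < n" | "k < n" "\<not> l < n" | "\<not> k < n" "l < n" | "\<not> k < n" "\<not> l < n" by blast
    then show "k = l"
    proof cases
      case 1
      then show ?thesis using e bij_betw_sorted_row[of n z] by (auto simp: sort_perm_eq bij_betw_def inj_on_def)
    next
      case 2 then show ?thesis using e o[of l] sorted_row_less[of k n z] by (simp add: sort_perm_eq)
    next
      case 3 then show ?thesis using e o[of k] sorted_row_less[of l n z] by (simp add: sort_perm_eq)
    next
      case 4 then show ?thesis using e o by simp
    qed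
  qed
  ultimately show ?thesis unfolding perms_below_def by simp
qed

text \<open>Lists of indices form a countable space, and insertion branches only on the events
  \<open>z x \<le> z y\<close>. Measurability of sorting follows by recursion over insertion
  sort.\<close>

lemma insort_key_measurable:
  fixes z :: "'a \<Rightarrow> nat \<Rightarrow> real"
  assumes z: "\<And>i. (\<lambda>\<omega>. z \<omega> i) \<in> borel_measurable M"
  shows "(\<lambda>\<omega>. insort_key (z \<omega>) x l) \<in> measurable M (count_space UNIV)"
proof (induction l)
  case (Cons y l)
  have "{\<omega> \<in> space M. z \<omega> x \<le> z \<omega> y} \<in> sets M" by (intro borel_measurable_le z)
  then have "(\<lambda>\<omega>. if z \<omega> x \<le> z \<omega> y then x # y # l else y # insort_key (z \<omega>) x l) \<in> measurable M (count_space UNIV)"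
    by (intro measurable_If measurable_compose[OF Cons]) auto
  then show ?case by simp
qed simp

lemma sort_key_measurable:
  fixes z :: "'a \<Rightarrow> nat \<Rightarrow> real"
  assumes z: "\<And>i. (\<lambda>\<omega>. z \<omega> i) \<in> borel_measurable M"
  shows "(\<lambda>\<omega>. sort_key (z \<omega>) l) \<in> measurable M (count_space UNIV)"
proof (induction l)
  case (Cons x l)
  have "(\<lambda>\<omega>. insort_key (z \<omega>) x (sort_key (z \<omega>) l)) \<in> measurable M (count_space UNIV)"
    by (rule measurable_compose_countable[OF insort_key_measurable[OF z] Cons])
  then show ?case by simp
qed simp

lemma sort_weight_measurable:
  fixes z :: "'a \<Rightarrow> nat \<Rightarrow> real"
  assumes z: "\<And>i. (\<lambda>\<omega>. z \<omega> i) \<in> borel_measurable M"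
  shows "(\<lambda>\<omega>. sort_weight n (z \<omega>) t i) \<in> borel_measurable M"
proof -
  have "(\<lambda>\<omega>. (\<lambda>l. \<Sum>m<n. ramp (real n * t - real m) * (if l ! m = i then 1 else 0)) (sort_key (z \<omega>) [0..<n])) \<in> borel_measurable M"
    by (rule measurable_compose[OF sort_key_measurable[OF z]]) simp
  then show ?thesis unfolding sort_weight_def sorted_row_def .
qed

lemma sort_perm_measurable:
  fixes z :: "'a \<Rightarrow> nat \<Rightarrow> real"
  assumes z: "\<And>i. (\<lambda>\<omega>. z \<omega> i) \<in> borel_measurable M"
  shows "{\<omega> \<in> space M. sort_perm n (z \<omega>) = p} \<in> sets M"
proof -
  have "(\<lambda>\<omega>. sort_key (z \<omega>) [0..<n]) -` {l. list_perm n l = p} \<inter> space M \<in> sets M"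
    by (rule measurable_sets[OF sort_key_measurable[OF z]]) simp
  then show ?thesis by (simp add: sort_perm_def vimage_def Collect_conj_eq Int_commute)
qed

subsection \<open>Least squares\<close>

lemma vec_measurableI:
  fixes f :: "'a \<Rightarrow> real^'d"
  assumes "\<And>j. (\<lambda>\<omega>. f \<omega> $ j) \<in> borel_measurable M"
  shows "f \<in> borel_measurable M"
proof (rule borel_measurable_euclidean_space[THEN iffD2], intro ballI)
  fix b :: "real^'d" assume "b \<in> Basis"
  then obtain j where "b = axis j 1" by (auto simp: Basis_vec_def)
  then show "(\<lambda>\<omega>. f \<omega> \<bullet> b) \<in> borel_measurable M" using assms[of j] by (simp add: inner_axis)
qed

lemma vec_nth_measurable [measurable (raw)]:
  "f \<in> borel_measurable M \<Longrightarrow> (\<lambda>\<omega>. (f \<omega> :: real^'d) $ j) \<in> borel_measurable M"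
  by (rule borel_measurable_continuous_on[OF continuous_on_component[OF continuous_on_id]])

lemma det_measurable:
  fixes A :: "'a \<Rightarrow> real^'q^'q"
  assumes "\<And>i j. (\<lambda>\<omega>. A \<omega> $ i $ j) \<in> borel_measurable M"
  shows "(\<lambda>\<omega>. det (A \<omega>)) \<in> borel_measurable M"
  unfolding det_def by (intro borel_measurable_sum borel_measurable_times borel_measurable_prod borel_measurable_const assms)

lemma matrix_inv_mult:
  fixes A :: "real^'q^'q"
  assumes "invertible A"
  shows "A ** matrix_inv A = mat 1" "matrix_inv A ** A = mat 1"
proof -
  have "\<exists>A'. A ** A' = mat 1 \<and> A' ** A = mat 1" using assms by (simp add: invertible_def)
  from someI_ex[OF this] show "A ** matrix_inv A = mat 1" "matrix_inv A ** A = mat 1"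
    by (auto simp: matrix_inv_def)
qed

lemma matrix_inv_vector_mult:
  fixes A :: "real^'q^'q"
  assumes "invertible A"
  shows "A *v (matrix_inv A *v x) = x" "matrix_inv A *v (A *v x) = x"
  using matrix_inv_mult[OF assms] by (simp_all add: matrix_vector_mul_assoc)

text \<open>Where the determinant is nonzero, Cramer's rule writes each component as a quotient of
  determinants. Where it is zero, no inverse exists, the choice in \<open>matrix_inv\<close> is made
  from a constantly false predicate, and the result is one fixed matrix.\<close>

lemma matrix_inv_vector_measurable:
  fixes A :: "'a \<Rightarrow> real^'q^'q" and r :: "'a \<Rightarrow> real^'q"
  assumes A: "\<And>i j. (\<lambda>\<omega>. A \<omega> $ i $ j) \<in> borel_measurable M" and r: "\<And>i. (\<lambda>\<omega>. r \<omega> $ i) \<in> borel_measurable M"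
  shows "(\<lambda>\<omega>. (matrix_inv (A \<omega>) *v r \<omega>) $ k) \<in> borel_measurable M"
proof -
  define Z where "Z = (SOME B :: real^'q^'q. False)"
  have eq: "(matrix_inv (A \<omega>) *v r \<omega>) $ k = (if det (A \<omega>) = 0 then (\<Sum>j\<in>UNIV. Z $ k $ j * r \<omega> $ j)
      else det (\<chi> i j. if j = k then r \<omega> $ i else A \<omega> $ i $ j) / det (A \<omega>))" for \<omega>
  proof (cases "det (A \<omega>) = 0")
    case True
    then have "\<not> invertible (A \<omega>)" by (simp add: invertible_det_nz)
    then have "matrix_inv (A \<omega>) = Z" unfolding matrix_inv_def Z_def invertible_def by (intro arg_cong[where f=Eps]) auto
    then show ?thesis using True by (simp add: matrix_vector_mult_def)
  next
    case False
    then have "A \<omega> *v (matrix_inv (A \<omega>) *v r \<omega>) = r \<omega>"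
      by (intro matrix_inv_vector_mult) (simp add: invertible_det_nz)
    then show ?thesis using False cramer[OF False, of "matrix_inv (A \<omega>) *v r \<omega>" "r \<omega>"] by simp
  qed
  have d: "(\<lambda>\<omega>. det (A \<omega>)) \<in> borel_measurable M" by (rule det_measurable[OF A])
  have "(\<lambda>\<omega>. det (\<chi> i j. if j = k then r \<omega> $ i else A \<omega> $ i $ j)) \<in> borel_measurable M"
  proof (rule det_measurable)
    show "(\<lambda>\<omega>. (\<chi> i j. if j = k then r \<omega> $ i else A \<omega> $ i $ j) $ i $ j) \<in> borel_measurable M" for i j
      using A r by (cases "j = k") auto
  qed
  moreover have "{\<omega> \<in> space M. det (A \<omega>) = 0} \<in> sets M" using d by measurable
  ultimately show ?thesis unfolding eq
    by (intro measurable_If borel_measurable_divide d borel_measurable_sum borel_measurable_times borel_measurable_const r) auto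
qed

lemma norm_matrix_vector_le:
  fixes A :: "real^'q^'q"
  assumes "\<And>i j. \<bar>A $ i $ j\<bar> \<le> \<delta>"
  shows "norm (A *v x) \<le> (real CARD('q))\<^sup>2 * \<delta> * norm x"
proof -
  have "\<bar>(A *v x) $ i\<bar> \<le> real CARD('q) * (\<delta> * norm x)" for i
  proof -
    have "\<bar>(A *v x) $ i\<bar> \<le> (\<Sum>j\<in>UNIV. \<bar>A $ i $ j\<bar> * \<bar>x $ j\<bar>)"
      unfolding matrix_vector_mult_def by (simp add: order_trans[OF sum_abs] abs_mult)
    also have "\<dots> \<le> (\<Sum>j\<in>(UNIV :: 'q set). \<delta> * norm x)"
      using assms order_trans[OF abs_ge_zero assms] by (intro sum_mono mult_mono component_le_norm_cart) auto
    finally show ?thesis by simp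
  qed
  then have "norm (A *v x) \<le> (\<Sum>i\<in>(UNIV :: 'q set). real CARD('q) * (\<delta> * norm x))" by (rule norm_vec_le)
  then show ?thesis by (simp add: power2_eq_square mult_ac)
qed

text \<open>With \<open>B\<close> a bound for the inverse of \<open>G\<close>, the vector
  \<open>y\<close> differs from the inverse of \<open>G\<close> applied to \<open>H *v y\<close> by
  at most \<open>B * q * \<delta> * norm y\<close>. Once this factor is at most 1/2,
  \<open>H\<close> has trivial kernel and \<open>norm y \<le> 2 * B * norm x\<close>, which turns
  the difference into a multiple of \<open>norm x\<close>.\<close>

lemma inverse_perturbation:
  fixes G :: "real^'q^'q"
  assumes G: "invertible G" and e: "e > 0"
  obtains \<delta> where "\<delta> > 0" "\<And>H. (\<And>a b. \<bar>H $ a $ b - G $ a $ b\<bar> \<le> \<delta>) \<Longrightarrow> invertible H"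
    "\<And>H x y. (\<And>a b. \<bar>H $ a $ b - G $ a $ b\<bar> \<le> \<delta>) \<Longrightarrow> H *v y = x \<Longrightarrow> norm (y - matrix_inv G *v x) \<le> e * norm x"
proof -
  obtain B where B: "B > 0" "\<And>x. norm (matrix_inv G *v x) \<le> B * norm x"
    using bounded_linear.pos_bounded[OF matrix_vector_mul_bounded_linear[of "matrix_inv G"]] by (metis mult.commute)
  define q where "q = (real CARD('q))\<^sup>2"
  have q: "q > 0" by (simp add: q_def)
  \<comment> \<open>The first term gives contraction by 1/2, the second the final accuracy
    \<open>e\<close>.\<close>
  define \<delta> where "\<delta> = min (1 / (2 * B * q)) (e / (2 * B\<^sup>2 * q))"
  have d: "\<delta> > 0" using B(1) q e by (simp add: \<delta>_def)
  have "\<delta> \<le> 1 / (2 * B * q)" "\<delta> \<le> e / (2 * B\<^sup>2 * q)" by (auto simp: \<delta>_def)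
  then have d1: "B * (q * \<delta>) \<le> 1/2" and d2: "2 * B\<^sup>2 * (q * \<delta>) \<le> e"
    using B(1) q by (auto simp: field_simps)
  have key: "norm (y - matrix_inv G *v (H *v y)) \<le> B * (q * \<delta>) * norm y"
    if H: "\<And>a b. \<bar>H $ a $ b - G $ a $ b\<bar> \<le> \<delta>" for H y
  proof -
    have "matrix_inv G *v ((H - G) *v y) = matrix_inv G *v (H *v y) - y"
      using matrix_inv_vector_mult(2)[OF G, of y] by (simp add: matrix_vector_mult_diff_rdistrib matrix_vector_mult_diff_distrib)
    then have "norm (y - matrix_inv G *v (H *v y)) = norm (matrix_inv G *v ((H - G) *v y))"
      by (simp add: norm_minus_commute)
    also have "\<dots> \<le> B * norm ((H - G) *v y)" by (rule B(2))
    also have "\<dots> \<le> B * (q * \<delta> * norm y)"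
      using B(1) H unfolding q_def by (intro mult_left_mono norm_matrix_vector_le) auto
    finally show ?thesis by (simp add: mult_ac)
  qed
  have half: "norm (y - matrix_inv G *v (H *v y)) \<le> 1/2 * norm y"
    if "\<And>a b. \<bar>H $ a $ b - G $ a $ b\<bar> \<le> \<delta>" for H y
    using key[OF that, of y] mult_right_mono[OF d1, of "norm y"] by simp
  show thesis
  proof (rule that[OF d])
    fix H :: "real^'q^'q" assume H: "\<And>a b. \<bar>H $ a $ b - G $ a $ b\<bar> \<le> \<delta>"
    have "y = 0" if "H *v y = 0" for y
      using half[OF H, of y] that by simp
    then show "invertible H"
      by (simp add: invertible_left_inverse matrix_left_invertible_ker)
    fix x y assume y: "H *v y = x"
    have "norm y \<le> norm (y - matrix_inv G *v x) + norm (matrix_inv G *v x)" 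
      using norm_triangle_ineq[of "y - matrix_inv G *v x" "matrix_inv G *v x"] by simp
    also have "\<dots> \<le> 1/2 * norm y + B * norm x" using half[OF H, of y] B(2)[of x] y by simp
    finally have ny: "norm y \<le> 2 * B * norm x" by simp
    have "norm (y - matrix_inv G *v x) \<le> B * (q * \<delta>) * norm y" using key[OF H, of y] y by simp
    also have "\<dots> \<le> B * (q * \<delta>) * (2 * B * norm x)" using ny B(1) q d by (intro mult_left_mono) auto
    also have "\<dots> = 2 * B\<^sup>2 * (q * \<delta>) * norm x" by (simp add: power2_eq_square)
    also have "\<dots> \<le> e * norm x" using d2 by (intro mult_right_mono) auto
    finally show "norm (y - matrix_inv G *v x) \<le> e * norm x" .
  qed
qed

lemma normal_rhs_linear:
  assumes "\<And>i. i < n \<Longrightarrow> y i = u i \<bullet> \<theta> + e i"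
  shows "normal_rhs n u y = normal_matrix n u *v \<theta> + normal_rhs n u e"
proof -
  have "(\<Sum>i<n. u i $ a * y i) = (\<Sum>b\<in>UNIV. (\<Sum>i<n. u i $ a * u i $ b) * \<theta> $ b) + (\<Sum>i<n. u i $ a * e i)" for a
  proof -
    have "(\<Sum>i<n. u i $ a * y i) = (\<Sum>i<n. u i $ a * (u i \<bullet> \<theta>)) + (\<Sum>i<n. u i $ a * e i)"
      using assms by (simp add: algebra_simps sum.distrib)
    also have "(\<Sum>i<n. u i $ a * (u i \<bullet> \<theta>)) = (\<Sum>i<n. \<Sum>b\<in>UNIV. u i $ a * u i $ b * \<theta> $ b)"
      by (simp add: inner_vec_def sum_distrib_left mult.assoc)
    also have "\<dots> = (\<Sum>b\<in>UNIV. \<Sum>i<n. u i $ a * u i $ b * \<theta> $ b)" by (rule sum.swap)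
    finally show ?thesis by (simp add: sum_distrib_right)
  qed
  then show ?thesis by (simp add: vec_eq_iff normal_rhs_def normal_matrix_def matrix_vector_mult_def)
qed

lemma least_squares_error:
  assumes "\<And>i. i < n \<Longrightarrow> y i = u i \<bullet> \<theta> + e i" and inv: "invertible (normal_matrix n u)"
  shows "normal_matrix n u *v (least_squares n u y - \<theta>) = normal_rhs n u e"
  using matrix_inv_vector_mult[OF inv] normal_rhs_linear[OF assms(1)]
  by (simp add: least_squares_def matrix_vector_mult_diff_distrib)

text \<open>A residual is the error minus the regressor times the estimation error. The error part
  is kept in sorted order, for exchangeability; the regressor part is returned to the original order
  with \<open>sort_weight\<close>, for the law of large numbers.\<close>

lemma residual_process_decomposition:
  assumes t: "t \<in> {0..1}" and y: "\<And>i. i < n \<Longrightarrow> y i = u i \<bullet> \<theta> + e i"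
  shows "residual_process n v x u y t $ j =
     walk n (sqrt (real n * v)) (\<lambda>m. e (sort_perm n (\<lambda>i. x i $ j) m)) t
     - ((\<Sum>i<n. sort_weight n (\<lambda>i. x i $ j) t i *\<^sub>R u i) \<bullet> (least_squares n u y - \<theta>)) / sqrt (real n * v)"
proof -
  let ?z = "\<lambda>i. x i $ j" and ?\<tau> = "least_squares n u y - \<theta>"
  have "residual_process n v x u y t $ j =
      (\<Sum>m<n. ramp (real n * t - real m) * residual n u y (sorted_row n ?z m)) / sqrt (real n * v)"
    using t by (simp add: residual_process_def partial_sum_def piecewise_linear_sums)
  also have "(\<Sum>m<n. ramp (real n * t - real m) * residual n u y (sorted_row n ?z m)) =
      (\<Sum>m<n. ramp (real n * t - real m) * (e (sort_perm n ?z m) - u (sorted_row n ?z m) \<bullet> ?\<tau>))"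
  proof (intro sum.cong refl)
    fix m assume "m \<in> {..<n}"
    then have "residual n u y (sorted_row n ?z m) = e (sort_perm n ?z m) - u (sorted_row n ?z m) \<bullet> ?\<tau>"
      using y[of "sorted_row n ?z m"] sorted_row_less[of m n ?z] by (simp add: residual_def sort_perm_eq inner_diff_right)
    then show "ramp (real n * t - real m) * residual n u y (sorted_row n ?z m) =
        ramp (real n * t - real m) * (e (sort_perm n ?z m) - u (sorted_row n ?z m) \<bullet> ?\<tau>)" by simp
  qed
  also have "\<dots> = (\<Sum>m<n. ramp (real n * t - real m) * e (sort_perm n ?z m))
      - (\<Sum>m<n. ramp (real n * t - real m) *\<^sub>R u (sorted_row n ?z m)) \<bullet> ?\<tau>"
    by (simp add: right_diff_distrib sum_subtractf inner_sum_left)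
  finally show ?thesis
    by (simp add: walk_def sum_sorted_row diff_divide_distrib)
qed

subsection \<open>The regression model\<close>

text \<open>The copula and the regression functions enter in integrated form: \<open>uniform\<close>
  gives the marginals, and \<open>L_entry\<close> reads \<open>L j t\<close> as the mean of \<xi>
  over the event \<open>X_j \<le> t\<close>, so that no conditional expectation appears in the
  asymptotics.\<close>

locale regression_model = prob_space M for M :: "'w measure" +
  fixes X :: "nat \<Rightarrow> 'w \<Rightarrow> real^'d" and \<xi> :: "nat \<Rightarrow> 'w \<Rightarrow> real^'q" and \<epsilon> :: "nat \<Rightarrow> 'w \<Rightarrow> real"
    and v :: real and G :: "real^'q^'q" and L :: "'d \<Rightarrow> real \<Rightarrow> real^'q"
  assumes rows: "indep_vars (\<lambda>_. borel) (\<lambda>i \<omega>. (X i \<omega>, \<xi> i \<omega>, \<epsilon> i \<omega>)) UNIV"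
    and ident: "\<And>i. distr M borel (\<lambda>\<omega>. (X i \<omega>, \<xi> i \<omega>, \<epsilon> i \<omega>)) = distr M borel (\<lambda>\<omega>. (X 0 \<omega>, \<xi> 0 \<omega>, \<epsilon> 0 \<omega>))"
    and errors: "independent_elements M (Pi\<^sub>M UNIV (\<lambda>_::nat. borel)) (\<lambda>\<omega> i. \<epsilon> i \<omega>)
           (Pi\<^sub>M UNIV (\<lambda>_::nat. borel)) (\<lambda>\<omega> i. (X i \<omega>, \<xi> i \<omega>))"
    and eps_mean: "expectation (\<epsilon> 0) = 0" and eps_sq: "integrable M (\<lambda>\<omega>. (\<epsilon> 0 \<omega>)\<^sup>2)"
    and v_eq: "v = expectation (\<lambda>\<omega>. (\<epsilon> 0 \<omega>)\<^sup>2)" and v_pos: "v > 0"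
    and xi_sq: "\<And>a b. integrable M (\<lambda>\<omega>. \<xi> 0 \<omega> $ a * \<xi> 0 \<omega> $ b)"
    and G_entry: "\<And>a b. G $ a $ b = expectation (\<lambda>\<omega>. \<xi> 0 \<omega> $ a * \<xi> 0 \<omega> $ b)" and G_inv: "invertible G"
    and uniform: "\<And>j t. t \<in> {0..1} \<Longrightarrow> prob {\<omega> \<in> space M. X 0 \<omega> $ j \<le> t} = t"
    and L_entry: "\<And>j t a. t \<in> {0..1} \<Longrightarrow> L j t $ a = expectation (\<lambda>\<omega>. \<xi> 0 \<omega> $ a * (if X 0 \<omega> $ j \<le> t then 1 else 0))"
begin

lemma row_measurable: "(\<lambda>\<omega>. (X i \<omega>, \<xi> i \<omega>, \<epsilon> i \<omega>)) \<in> borel_measurable M"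
  using rows by (simp add: indep_vars_def)

lemma X_measurable [measurable]: "X i \<in> borel_measurable M"
  and xi_measurable [measurable]: "\<xi> i \<in> borel_measurable M"
  and eps_measurable [measurable]: "\<epsilon> i \<in> borel_measurable M"
proof -
  show "X i \<in> borel_measurable M"
    using borel_measurable_continuous_on[OF continuous_on_fst[OF continuous_on_id] row_measurable[of i]] by simp
  have "(\<lambda>\<omega>. (\<xi> i \<omega>, \<epsilon> i \<omega>)) \<in> borel_measurable M"
    using borel_measurable_continuous_on[OF continuous_on_snd[OF continuous_on_id] row_measurable[of i]] by simp
  from borel_measurable_continuous_on[OF continuous_on_fst[OF continuous_on_id] this]
    borel_measurable_continuous_on[OF continuous_on_snd[OF continuous_on_id] this]
  show "\<xi> i \<in> borel_measurable M" "\<epsilon> i \<in> borel_measurable M" by simp_all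
qed

lemma row_distr:
  assumes [measurable]: "f \<in> borel_measurable borel"
  shows "distr M borel (\<lambda>\<omega>. f (X i \<omega>, \<xi> i \<omega>, \<epsilon> i \<omega>)) = distr M borel (\<lambda>\<omega>. f (X 0 \<omega>, \<xi> 0 \<omega>, \<epsilon> 0 \<omega>))"
proof -
  have "distr (distr M borel (\<lambda>\<omega>. (X i \<omega>, \<xi> i \<omega>, \<epsilon> i \<omega>))) borel f = distr M borel (\<lambda>\<omega>. f (X i \<omega>, \<xi> i \<omega>, \<epsilon> i \<omega>))" for i
    using distr_distr[OF assms row_measurable] by (simp add: comp_def)
  from this[of i] this[of 0] show ?thesis by (simp only: ident[of i])
qed

lemma row_indep:
  assumes "f \<in> borel_measurable borel"
  shows "indep_vars (\<lambda>_. borel) (\<lambda>i \<omega>. f (X i \<omega>, \<xi> i \<omega>, \<epsilon> i \<omega>)) UNIV"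
  by (rule indep_vars_compose2[OF rows, of "\<lambda>_. f"]) (simp add: assms)

lemma row_expectation:
  fixes f :: "_ \<Rightarrow> real"
  assumes [measurable]: "f \<in> borel_measurable borel"
  shows "expectation (\<lambda>\<omega>. f (X i \<omega>, \<xi> i \<omega>, \<epsilon> i \<omega>)) = expectation (\<lambda>\<omega>. f (X 0 \<omega>, \<xi> 0 \<omega>, \<epsilon> 0 \<omega>))"
    and "integrable M (\<lambda>\<omega>. f (X i \<omega>, \<xi> i \<omega>, \<epsilon> i \<omega>)) \<longleftrightarrow> integrable M (\<lambda>\<omega>. f (X 0 \<omega>, \<xi> 0 \<omega>, \<epsilon> 0 \<omega>))"
  using integral_distr[OF row_measurable[of i] assms] integral_distr[OF row_measurable[of 0] assms]
    integrable_distr_eq[OF row_measurable[of i] assms] integrable_distr_eq[OF row_measurable[of 0] assms] ident[of i]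
  by auto

lemma row_component_measurable:
  "(\<lambda>r :: (real^'d) \<times> (real^'q) \<times> real. fst r $ j) \<in> borel_measurable borel"
  "(\<lambda>r :: (real^'d) \<times> (real^'q) \<times> real. fst (snd r) $ a) \<in> borel_measurable borel"
  "(\<lambda>r :: (real^'d) \<times> (real^'q) \<times> real. snd (snd r)) \<in> borel_measurable borel"
  by (intro borel_measurable_continuous_onI continuous_intros)+

lemma eps_indep: "indep_vars (\<lambda>_. borel) \<epsilon> UNIV"
  and eps_ident: "distr M borel (\<epsilon> i) = distr M borel (\<epsilon> 0)"
  using row_indep[OF row_component_measurable(3)] row_distr[OF row_component_measurable(3), of i] by simp_all

lemma eps_facts: "integrable M (\<lambda>\<omega>. (\<epsilon> i \<omega>)\<^sup>2)" "integrable M (\<epsilon> i)" "expectation (\<epsilon> i) = 0"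
  "expectation (\<lambda>\<omega>. (\<epsilon> i \<omega>)\<^sup>2) = v"
proof -
  have m: "(\<lambda>r :: (real^'d) \<times> (real^'q) \<times> real. (snd (snd r))\<^sup>2) \<in> borel_measurable borel"
    using row_component_measurable(3) by measurable
  show sq: "integrable M (\<lambda>\<omega>. (\<epsilon> i \<omega>)\<^sup>2)" for i using row_expectation(2)[OF m, of i] eps_sq by simp
  show "integrable M (\<epsilon> i)" by (rule square_integrable_imp_integrable[OF eps_measurable sq])
  show "expectation (\<epsilon> i) = 0" using row_expectation(1)[OF row_component_measurable(3), of i] eps_mean by simp
  show "expectation (\<lambda>\<omega>. (\<epsilon> i \<omega>)\<^sup>2) = v" using row_expectation(1)[OF m, of i] v_eq by simp
qed

lemma eps_products: "integrable M (\<lambda>\<omega>. \<epsilon> i \<omega> * \<epsilon> k \<omega>)"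
  "expectation (\<lambda>\<omega>. \<epsilon> i \<omega> * \<epsilon> k \<omega>) = (if i = k then v else 0)"
proof -
  show "integrable M (\<lambda>\<omega>. \<epsilon> i \<omega> * \<epsilon> k \<omega>)"
    by (rule Cauchy_Schwarz_expectation(1)) (auto simp: eps_facts)
  show "expectation (\<lambda>\<omega>. \<epsilon> i \<omega> * \<epsilon> k \<omega>) = (if i = k then v else 0)"
  proof (cases "i = k")
    case True then show ?thesis using eps_facts(4)[of k] by (simp add: power2_eq_square)
  next
    case False
    have "indep_var borel (\<epsilon> i) borel (\<epsilon> k)"
      using indep_vars_sum[of "{k}" i \<epsilon>] indep_vars_subset[OF eps_indep, of "{i, k}"] False by simp
    from indep_var_lebesgue_integral[OF this eps_facts(2) eps_facts(2)] show ?thesis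
      using False by (simp add: eps_facts)
  qed
qed

lemma design_measurable: "(\<lambda>\<omega> i. (X i \<omega>, \<xi> i \<omega>)) \<in> measurable M (Pi\<^sub>M UNIV (\<lambda>_::nat. borel))"
  using errors by (simp add: independent_elements_def)

text \<open>The weights may depend on the whole design. It is independent of the errors, and these
  are uncorrelated, so the cross terms vanish exactly as for constant weights. Weights computed from
  ranks are thus admissible.\<close>

lemma weighted_errors:
  assumes c: "\<And>i. c i \<in> borel_measurable (Pi\<^sub>M UNIV (\<lambda>_::nat. borel))"
    and c2: "\<And>i. i < n \<Longrightarrow> integrable M (\<lambda>\<omega>. (c i (\<lambda>i. (X i \<omega>, \<xi> i \<omega>)))\<^sup>2)"
  shows "integrable M (\<lambda>\<omega>. (\<Sum>i<n. c i (\<lambda>i. (X i \<omega>, \<xi> i \<omega>)) * \<epsilon> i \<omega>)\<^sup>2)"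
    and "expectation (\<lambda>\<omega>. (\<Sum>i<n. c i (\<lambda>i. (X i \<omega>, \<xi> i \<omega>)) * \<epsilon> i \<omega>)\<^sup>2)
       = v * (\<Sum>i<n. expectation (\<lambda>\<omega>. (c i (\<lambda>i. (X i \<omega>, \<xi> i \<omega>)))\<^sup>2))"
proof -
  let ?D = "\<lambda>\<omega> i. (X i \<omega>, \<xi> i \<omega>)"
  have cm [measurable]: "(\<lambda>\<omega>. c i (?D \<omega>)) \<in> borel_measurable M" for i
    by (rule measurable_compose[OF design_measurable c])
  have cc: "integrable M (\<lambda>\<omega>. c i (?D \<omega>) * c k (?D \<omega>))" if "i < n" "k < n" for i k
    by (rule Cauchy_Schwarz_expectation(1)) (auto simp: that c2)
  have ind: "indep_var borel (\<lambda>\<omega>. \<epsilon> i \<omega> * \<epsilon> k \<omega>) borel (\<lambda>\<omega>. c i (?D \<omega>) * c k (?D \<omega>))" for i k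
  proof -
    have "(\<lambda>e. e i * e k) \<in> borel_measurable (Pi\<^sub>M UNIV (\<lambda>_::nat. borel :: real measure))" by measurable
    moreover have "(\<lambda>d. c i d * c k d) \<in> borel_measurable (Pi\<^sub>M UNIV (\<lambda>_::nat. borel))" using c by measurable
    ultimately show ?thesis by (rule independent_elements_indep_var[OF errors])
  qed
  have sq: "(\<Sum>i<n. c i (?D \<omega>) * \<epsilon> i \<omega>)\<^sup>2 = (\<Sum>i<n. \<Sum>k<n. (\<epsilon> i \<omega> * \<epsilon> k \<omega>) * (c i (?D \<omega>) * c k (?D \<omega>)))" for \<omega>
    by (simp add: power2_eq_square sum_product mult_ac)
  have int: "integrable M (\<lambda>\<omega>. (\<epsilon> i \<omega> * \<epsilon> k \<omega>) * (c i (?D \<omega>) * c k (?D \<omega>)))" if "i < n" "k < n" for i k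
    by (rule indep_var_integrable[OF ind eps_products(1) cc[OF that]])
  show "integrable M (\<lambda>\<omega>. (\<Sum>i<n. c i (?D \<omega>) * \<epsilon> i \<omega>)\<^sup>2)"
    unfolding sq by (intro Bochner_Integration.integrable_sum int) auto
  have "expectation (\<lambda>\<omega>. (\<Sum>i<n. c i (?D \<omega>) * \<epsilon> i \<omega>)\<^sup>2) =
      (\<Sum>i<n. \<Sum>k<n. expectation (\<lambda>\<omega>. (\<epsilon> i \<omega> * \<epsilon> k \<omega>) * (c i (?D \<omega>) * c k (?D \<omega>))))"
  proof -
    have "expectation (\<lambda>\<omega>. \<Sum>i<n. \<Sum>k<n. (\<epsilon> i \<omega> * \<epsilon> k \<omega>) * (c i (?D \<omega>) * c k (?D \<omega>))) =
        (\<Sum>i<n. expectation (\<lambda>\<omega>. \<Sum>k<n. (\<epsilon> i \<omega> * \<epsilon> k \<omega>) * (c i (?D \<omega>) * c k (?D \<omega>))))"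
      by (rule Bochner_Integration.integral_sum) (intro Bochner_Integration.integrable_sum int; simp)
    also have "\<dots> = (\<Sum>i<n. \<Sum>k<n. expectation (\<lambda>\<omega>. (\<epsilon> i \<omega> * \<epsilon> k \<omega>) * (c i (?D \<omega>) * c k (?D \<omega>))))"
      by (intro sum.cong refl Bochner_Integration.integral_sum int) auto
    finally show ?thesis unfolding sq .
  qed
  also have "\<dots> = (\<Sum>i<n. \<Sum>k<n. if i = k then v * expectation (\<lambda>\<omega>. (c i (?D \<omega>))\<^sup>2) else 0)"
    by (intro sum.cong refl)
      (simp add: indep_var_lebesgue_integral[OF ind eps_products(1) cc] eps_products(2) power2_eq_square)
  also have "\<dots> = v * (\<Sum>i<n. expectation (\<lambda>\<omega>. (c i (?D \<omega>))\<^sup>2))"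
    by (simp add: sum_distrib_left)
  finally show "expectation (\<lambda>\<omega>. (\<Sum>i<n. c i (?D \<omega>) * \<epsilon> i \<omega>)\<^sup>2)
       = v * (\<Sum>i<n. expectation (\<lambda>\<omega>. (c i (?D \<omega>))\<^sup>2))" .
qed

subsection \<open>The limiting covariance\<close>

text \<open>Coefficients of the L2-projection of the indicator of \<open>X_j \<le> t\<close> on the
  regressors: \<open>G *v slope j t = L j t\<close> is its normal equation.\<close>

definition slope :: "'d \<Rightarrow> real \<Rightarrow> real^'q" where
  "slope j t = matrix_inv G *v L j t"

text \<open>The residual of that projection; multiplied by the error it is the asymptotic
  contribution of one observation.\<close>

definition influence :: "'d \<Rightarrow> real \<Rightarrow> real^'d \<Rightarrow> real^'q \<Rightarrow> real" where
  "influence j t x z = (if x $ j \<le> t then 1 else 0) - slope j t \<bullet> z"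

definition influence_cov :: "'d \<Rightarrow> 'd \<Rightarrow> real \<Rightarrow> real \<Rightarrow> real" where
  "influence_cov i j s t = expectation (\<lambda>\<omega>. influence i s (X 0 \<omega>) (\<xi> 0 \<omega>) * influence j t (X 0 \<omega>) (\<xi> 0 \<omega>))"

lemma G_slope: "G *v slope j t = L j t"
  unfolding slope_def by (rule matrix_inv_vector_mult(1)[OF G_inv])

lemma xi_inner_expand: "(a \<bullet> \<xi> 0 \<omega>) * (b \<bullet> \<xi> 0 \<omega>) = (\<Sum>i\<in>UNIV. \<Sum>k\<in>UNIV. a $ i * b $ k * (\<xi> 0 \<omega> $ i * \<xi> 0 \<omega> $ k))"
  by (simp add: inner_vec_def sum_product mult_ac)

lemma xi_quadratic: "integrable M (\<lambda>\<omega>. (a \<bullet> \<xi> 0 \<omega>) * (b \<bullet> \<xi> 0 \<omega>))"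
  "expectation (\<lambda>\<omega>. (a \<bullet> \<xi> 0 \<omega>) * (b \<bullet> \<xi> 0 \<omega>)) = a \<bullet> (G *v b)"
proof -
  show "integrable M (\<lambda>\<omega>. (a \<bullet> \<xi> 0 \<omega>) * (b \<bullet> \<xi> 0 \<omega>))"
    unfolding xi_inner_expand by (intro Bochner_Integration.integrable_sum integrable_mult_right xi_sq)
  have "expectation (\<lambda>\<omega>. (a \<bullet> \<xi> 0 \<omega>) * (b \<bullet> \<xi> 0 \<omega>)) = (\<Sum>i\<in>UNIV. \<Sum>k\<in>UNIV. a $ i * b $ k * G $ i $ k)"
    unfolding xi_inner_expand by (simp add: Bochner_Integration.integral_sum xi_sq G_entry)
  then show "expectation (\<lambda>\<omega>. (a \<bullet> \<xi> 0 \<omega>) * (b \<bullet> \<xi> 0 \<omega>)) = a \<bullet> (G *v b)"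
    by (simp add: inner_vec_def matrix_vector_mult_def sum_distrib_left mult_ac)
qed

lemma G_symmetric: "a \<bullet> (G *v b) = b \<bullet> (G *v a)"
  using xi_quadratic(2)[of a b] xi_quadratic(2)[of b a] by (simp add: mult.commute)

lemma slope_inner: "slope j t \<bullet> x = L j t \<bullet> (matrix_inv G *v x)"
proof -
  have "slope j t \<bullet> (G *v (matrix_inv G *v x)) = (matrix_inv G *v x) \<bullet> (G *v slope j t)" by (rule G_symmetric)
  then show ?thesis by (simp add: matrix_inv_vector_mult(1)[OF G_inv] G_slope inner_commute)
qed

lemma xi_integrable: "integrable M (\<lambda>\<omega>. a \<bullet> \<xi> 0 \<omega>)"
  by (rule square_integrable_imp_integrable) (use xi_quadratic(1)[of a a] in \<open>auto simp: power2_eq_square\<close>)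

lemma xi_indicator:
  assumes t: "t \<in> {0..1}"
  shows "integrable M (\<lambda>\<omega>. (a \<bullet> \<xi> 0 \<omega>) * (if X 0 \<omega> $ j \<le> t then 1 else 0))"
    and "expectation (\<lambda>\<omega>. (a \<bullet> \<xi> 0 \<omega>) * (if X 0 \<omega> $ j \<le> t then 1 else 0)) = a \<bullet> L j t"
proof -
  show *: "integrable M (\<lambda>\<omega>. (a \<bullet> \<xi> 0 \<omega>) * (if X 0 \<omega> $ j \<le> t then 1 else 0))" for a
    by (rule Bochner_Integration.integrable_bound[OF xi_integrable[of a]]) auto
  have *: "integrable M (\<lambda>\<omega>. \<xi> 0 \<omega> $ b * (if X 0 \<omega> $ j \<le> t then 1 else 0))" for b
    using *[of "axis b 1"] by (simp add: inner_axis')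
  have "expectation (\<lambda>\<omega>. (a \<bullet> \<xi> 0 \<omega>) * (if X 0 \<omega> $ j \<le> t then 1 else 0)) =
      expectation (\<lambda>\<omega>. \<Sum>b\<in>UNIV. a $ b * (\<xi> 0 \<omega> $ b * (if X 0 \<omega> $ j \<le> t then 1 else 0)))"
    by (simp add: inner_vec_def sum_distrib_right mult.assoc)
  also have "\<dots> = (\<Sum>b\<in>UNIV. a $ b * expectation (\<lambda>\<omega>. \<xi> 0 \<omega> $ b * (if X 0 \<omega> $ j \<le> t then 1 else 0)))"
    by (subst Bochner_Integration.integral_sum) (auto intro!: integrable_mult_right *)
  also have "\<dots> = a \<bullet> L j t" using t by (simp add: inner_vec_def L_entry)
  finally show "expectation (\<lambda>\<omega>. (a \<bullet> \<xi> 0 \<omega>) * (if X 0 \<omega> $ j \<le> t then 1 else 0)) = a \<bullet> L j t" .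
qed

lemma influence_measurable [measurable]: "(\<lambda>\<omega>. influence j t (X i \<omega>) (\<xi> i \<omega>)) \<in> borel_measurable M"
  unfolding influence_def by measurable

lemma influence_square_integrable: "integrable M (\<lambda>\<omega>. (influence j t (X 0 \<omega>) (\<xi> 0 \<omega>))\<^sup>2)"
proof (rule Bochner_Integration.integrable_bound)
  show "integrable M (\<lambda>\<omega>. 2 + 2 * ((slope j t \<bullet> \<xi> 0 \<omega>) * (slope j t \<bullet> \<xi> 0 \<omega>)))"
    by (intro Bochner_Integration.integrable_add integrable_const integrable_mult_right xi_quadratic)
  have "(x - y)\<^sup>2 \<le> 2 + 2 * (y * y)" if "x = 0 \<or> x = 1" for x y :: real
    using that zero_le_power2[of "y + 1"] zero_le_power2[of y] by (auto simp: power2_eq_square algebra_simps)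
  then show "AE \<omega> in M. norm ((influence j t (X 0 \<omega>) (\<xi> 0 \<omega>))\<^sup>2) \<le> norm (2 + 2 * ((slope j t \<bullet> \<xi> 0 \<omega>) * (slope j t \<bullet> \<xi> 0 \<omega>)))"
    unfolding influence_def by (intro AE_I2) (simp add: abs_of_nonneg)
qed measurable

lemma influence_cov_integrable:
  "integrable M (\<lambda>\<omega>. influence i s (X 0 \<omega>) (\<xi> 0 \<omega>) * influence j t (X 0 \<omega>) (\<xi> 0 \<omega>))"
  by (rule Cauchy_Schwarz_expectation(1)) (auto simp: influence_square_integrable)

text \<open>The product of two residuals expands into the joint indicator, two cross terms and a
  quadratic term. By the normal equations the quadratic term cancels one cross term, leaving the
  covariance of the limit.\<close>

lemma influence_cov_eq:
  assumes s: "s \<in> {0..1}" and t: "t \<in> {0..1}"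
  shows "influence_cov i j s t = prob {\<omega> \<in> space M. X 0 \<omega> $ i \<le> s \<and> X 0 \<omega> $ j \<le> t} - L i s \<bullet> slope j t"
proof -
  let ?I = "\<lambda>j t \<omega>. if X 0 \<omega> $ j \<le> t then 1 else 0 :: real"
  define A where "A = {\<omega> \<in> space M. X 0 \<omega> $ i \<le> s \<and> X 0 \<omega> $ j \<le> t}"
  have A [measurable]: "A \<in> sets M" unfolding A_def by measurable
  have iA: "integrable M (indicator A :: _ \<Rightarrow> real)"
    by (rule integrable_real_indicator[OF A]) (simp add: emeasure_eq_measure)
  have *: "influence i s (X 0 \<omega>) (\<xi> 0 \<omega>) * influence j t (X 0 \<omega>) (\<xi> 0 \<omega>) =
      indicator A \<omega> - (slope j t \<bullet> \<xi> 0 \<omega>) * ?I i s \<omega> - (slope i s \<bullet> \<xi> 0 \<omega>) * ?I j t \<omega>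
      + (slope i s \<bullet> \<xi> 0 \<omega>) * (slope j t \<bullet> \<xi> 0 \<omega>)" if "\<omega> \<in> space M" for \<omega>
    using that by (simp add: influence_def A_def indicator_def algebra_simps)
  have "influence_cov i j s t = expectation (\<lambda>\<omega>. indicator A \<omega> - (slope j t \<bullet> \<xi> 0 \<omega>) * ?I i s \<omega> - (slope i s \<bullet> \<xi> 0 \<omega>) * ?I j t \<omega>
      + (slope i s \<bullet> \<xi> 0 \<omega>) * (slope j t \<bullet> \<xi> 0 \<omega>))"
    unfolding influence_cov_def by (rule Bochner_Integration.integral_cong[OF refl *])
  also have "\<dots> = expectation (indicator A) - expectation (\<lambda>\<omega>. (slope j t \<bullet> \<xi> 0 \<omega>) * ?I i s \<omega>)
      - expectation (\<lambda>\<omega>. (slope i s \<bullet> \<xi> 0 \<omega>) * ?I j t \<omega>) + expectation (\<lambda>\<omega>. (slope i s \<bullet> \<xi> 0 \<omega>) * (slope j t \<bullet> \<xi> 0 \<omega>))"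
    by (simp only: Bochner_Integration.integral_add Bochner_Integration.integral_diff Bochner_Integration.integrable_diff
        iA xi_indicator(1)[OF s] xi_indicator(1)[OF t] xi_quadratic(1))
  also have "\<dots> = prob A - slope j t \<bullet> L i s - slope i s \<bullet> L j t + slope i s \<bullet> L j t"
    using A by (simp add: xi_indicator(2)[OF s] xi_indicator(2)[OF t] xi_quadratic(2) G_slope)
  finally show ?thesis by (simp add: A_def inner_commute)
qed

lemma influence_cov_sym: "influence_cov i j s t = influence_cov j i t s"
  unfolding influence_cov_def by (simp add: mult.commute)

lemma influence_combination:
  assumes "finite A"
  shows "integrable M (\<lambda>\<omega>. (\<Sum>k\<in>A. a k * influence (j k) (t k) (X 0 \<omega>) (\<xi> 0 \<omega>))\<^sup>2)"
    and "expectation (\<lambda>\<omega>. (\<Sum>k\<in>A. a k * influence (j k) (t k) (X 0 \<omega>) (\<xi> 0 \<omega>))\<^sup>2) =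
      (\<Sum>k\<in>A. \<Sum>l\<in>A. a k * a l * influence_cov (j k) (j l) (t k) (t l))"
proof -
  let ?f = "\<lambda>k \<omega>. influence (j k) (t k) (X 0 \<omega>) (\<xi> 0 \<omega>)"
  have sq: "(\<Sum>k\<in>A. a k * ?f k \<omega>)\<^sup>2 = (\<Sum>k\<in>A. \<Sum>l\<in>A. a k * a l * (?f k \<omega> * ?f l \<omega>))" for \<omega>
    by (simp add: power2_eq_square sum_product mult_ac)
  show "integrable M (\<lambda>\<omega>. (\<Sum>k\<in>A. a k * ?f k \<omega>)\<^sup>2)"
    unfolding sq by (intro Bochner_Integration.integrable_sum integrable_mult_right influence_cov_integrable)
  show "expectation (\<lambda>\<omega>. (\<Sum>k\<in>A. a k * ?f k \<omega>)\<^sup>2) =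
      (\<Sum>k\<in>A. \<Sum>l\<in>A. a k * a l * influence_cov (j k) (j l) (t k) (t l))"
    unfolding sq influence_cov_def
    by (simp add: Bochner_Integration.integral_sum Bochner_Integration.integrable_sum influence_cov_integrable)
qed

lemma influence_variance_le:
  assumes t: "t \<in> {0..1}" shows "influence_cov j j t t \<le> 1"
proof -
  have "0 \<le> expectation (\<lambda>\<omega>. (slope j t \<bullet> \<xi> 0 \<omega>) * (slope j t \<bullet> \<xi> 0 \<omega>))" by simp
  then have "0 \<le> L j t \<bullet> slope j t" unfolding xi_quadratic(2) G_slope by (simp add: inner_commute)
  then show ?thesis using influence_cov_eq[OF t t, of j j] uniform[OF t, of j] t by simp
qed

text \<open>Up to sign an increment of the influence is the projection residual of an indicator of
  probability \<open>\<bar>t - s\<bar>\<close>, and projecting only decreases the second moment; in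
  formulas, \<open>G\<close> is positive semidefinite at the difference of the slopes. This bound
  feeds the chaining of the limit process.\<close>

lemma influence_increment:
  assumes s: "s \<in> {0..1}" and t: "t \<in> {0..1}"
  shows "influence_cov j j t t - 2 * influence_cov j j s t + influence_cov j j s s \<le> \<bar>t - s\<bar>"
proof -
  have *: "influence_cov j j t t - 2 * influence_cov j j s t + influence_cov j j s s \<le> \<bar>t - s\<bar>"
    if s: "s \<in> {0..1}" and t: "t \<in> {0..1}" and "s \<le> t" for s t
  proof -
    define w where "w = slope j t - slope j s"
    have "0 \<le> expectation (\<lambda>\<omega>. (w \<bullet> \<xi> 0 \<omega>) * (w \<bullet> \<xi> 0 \<omega>))" by simp
    then have "0 \<le> w \<bullet> (G *v w)" unfolding xi_quadratic(2) .
    moreover have "G *v w = L j t - L j s"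
      unfolding w_def by (simp add: matrix_vector_mult_diff_distrib G_slope)
    moreover have "slope j s \<bullet> L j t = slope j t \<bullet> L j s"
      using G_symmetric[of "slope j s" "slope j t"] by (simp add: G_slope)
    ultimately have q: "0 \<le> slope j t \<bullet> L j t - 2 * (slope j t \<bullet> L j s) + slope j s \<bullet> L j s"
      unfolding w_def by (simp add: inner_diff_left inner_diff_right)
    have "{\<omega> \<in> space M. X 0 \<omega> $ j \<le> s \<and> X 0 \<omega> $ j \<le> t} = {\<omega> \<in> space M. X 0 \<omega> $ j \<le> s}"
      using \<open>s \<le> t\<close> by auto
    then show ?thesis
      using q influence_cov_eq[OF t t, of j j] influence_cov_eq[OF s t, of j j] influence_cov_eq[OF s s, of j j]
        uniform[OF s, of j] uniform[OF t, of j] \<open>s \<le> t\<close> by (simp add: inner_commute)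
  qed
  show ?thesis
  proof (cases "s \<le> t")
    case False
    then show ?thesis using *[OF t s] influence_cov_sym[of j j s t] by simp
  qed (rule *[OF s t])
qed

text \<open>Cauchy-Schwarz: the increment has second moment at most
  \<open>\<bar>s - s'\<bar>\<close> and the other factor at most 1. Joint continuity of the kernel
  follows.\<close>

lemma influence_cov_increment_le:
  assumes s: "s \<in> {0..1}" "s' \<in> {0..1}" and t: "t \<in> {0..1}"
  shows "\<bar>influence_cov i j s t - influence_cov i j s' t\<bar> \<le> sqrt \<bar>s - s'\<bar>"
proof -
  let ?f = "\<lambda>i s \<omega>. influence i s (X 0 \<omega>) (\<xi> 0 \<omega>)"
  have d: "integrable M (\<lambda>\<omega>. (?f i s \<omega> - ?f i s' \<omega>)\<^sup>2) \<and> expectation (\<lambda>\<omega>. (?f i s \<omega> - ?f i s' \<omega>)\<^sup>2) =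
      influence_cov i i s s - 2 * influence_cov i i s' s + influence_cov i i s' s'"
    using influence_combination[of "{0, 1::nat}" "\<lambda>k. if k = 0 then 1 else -1" "\<lambda>_. i" "\<lambda>k. if k = 0 then s else s'"]
      influence_cov_sym[of i i s s'] by simp
  have "influence_cov i j s t - influence_cov i j s' t = expectation (\<lambda>\<omega>. (?f i s \<omega> - ?f i s' \<omega>) * ?f j t \<omega>)"
    unfolding influence_cov_def left_diff_distrib
    by (rule Bochner_Integration.integral_diff[symmetric]) (rule influence_cov_integrable)+
  then have "(influence_cov i j s t - influence_cov i j s' t)\<^sup>2 \<le>
      expectation (\<lambda>\<omega>. (?f i s \<omega> - ?f i s' \<omega>)\<^sup>2) * expectation (\<lambda>\<omega>. (?f j t \<omega>)\<^sup>2)"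
    using Cauchy_Schwarz_expectation(2)[of "\<lambda>\<omega>. ?f i s \<omega> - ?f i s' \<omega>" "?f j t"] d influence_square_integrable by simp
  also have "\<dots> \<le> \<bar>s - s'\<bar> * 1"
    using d influence_increment[OF s(2,1), of i] influence_variance_le[OF t, of j]
    by (intro mult_mono) (auto simp: influence_cov_def power2_eq_square)
  finally show ?thesis by (simp add: real_le_rsqrt power2_abs)
qed

lemma influence_cov_continuous:
  assumes s: "s \<in> {0..1}" and t: "t \<in> {0..1}"
  shows "(\<lambda>m. influence_cov i j (dyadic_floor m s) (dyadic_floor m t)) \<longlonglongrightarrow> influence_cov i j s t"
proof (rule Lim_null_comparison[THEN LIM_zero_cancel])
  let ?s = "\<lambda>m. dyadic_floor m s" and ?t = "\<lambda>m. dyadic_floor m t"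
  show "\<forall>\<^sub>F m in sequentially. norm (influence_cov i j (?s m) (?t m) - influence_cov i j s t) \<le> sqrt \<bar>?s m - s\<bar> + sqrt \<bar>?t m - t\<bar>"
  proof (intro always_eventually allI)
    fix m
    have sm: "?s m \<in> {0..1}" and tm: "?t m \<in> {0..1}" using s t dyadic_floor_in_unit by blast+
    show "norm (influence_cov i j (?s m) (?t m) - influence_cov i j s t) \<le> sqrt \<bar>?s m - s\<bar> + sqrt \<bar>?t m - t\<bar>"
      using influence_cov_increment_le[OF sm s tm, of i j] influence_cov_increment_le[OF tm t s, of j i]
        influence_cov_sym[of i j s "?t m"] influence_cov_sym[of i j s t] unfolding real_norm_def by linarith
  qed
  have "(\<lambda>m. sqrt \<bar>?s m - s\<bar> + sqrt \<bar>?t m - t\<bar>) \<longlonglongrightarrow> sqrt \<bar>s - s\<bar> + sqrt \<bar>t - t\<bar>"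
    by (intro tendsto_intros dyadic_floor_tendsto)
  then show "(\<lambda>m. sqrt \<bar>?s m - s\<bar> + sqrt \<bar>?t m - t\<bar>) \<longlonglongrightarrow> 0" by simp
qed

subsection \<open>The leading term of the residual process\<close>

definition leading :: "nat \<Rightarrow> 'd \<Rightarrow> real \<Rightarrow> 'w \<Rightarrow> real" where
  "leading n j t \<omega> = (\<Sum>i<n. influence j t (X i \<omega>) (\<xi> i \<omega>) * \<epsilon> i \<omega>) / sqrt (real n * v)"

lemma leading_measurable [measurable]: "leading n j t \<in> borel_measurable M"
  unfolding leading_def by measurable

lemma influence_borel: "(\<lambda>r :: (real^'d) \<times> (real^'q) \<times> real. influence j t (fst r) (fst (snd r))) \<in> borel_measurable borel"
proof -
  have "{r \<in> space (borel :: ((real^'d) \<times> (real^'q) \<times> real) measure). fst r $ j \<le> t} \<in> sets borel"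
    by (intro borel_measurable_le row_component_measurable borel_measurable_const)
  moreover have "(\<lambda>r :: (real^'d) \<times> (real^'q) \<times> real. slope j t \<bullet> fst (snd r)) \<in> borel_measurable borel"
    by (intro borel_measurable_continuous_onI continuous_intros)
  ultimately show ?thesis unfolding influence_def
    by (intro borel_measurable_diff measurable_If) auto
qed

lemma influence_row_second_moment:
  "integrable M (\<lambda>\<omega>. (influence j t (X i \<omega>) (\<xi> i \<omega>))\<^sup>2)"
  "expectation (\<lambda>\<omega>. (influence j t (X i \<omega>) (\<xi> i \<omega>))\<^sup>2) = influence_cov j j t t"
  using row_expectation[OF borel_measurable_power[OF influence_borel[of j t], of 2], of i] influence_square_integrable[of j t]
  by (simp_all add: influence_cov_def power2_eq_square)

lemma influence_design_measurable:
  "(\<lambda>d. influence j t (fst (d i)) (snd (d i))) \<in> borel_measurable (Pi\<^sub>M UNIV (\<lambda>_::nat. borel :: ((real^'d) \<times> (real^'q)) measure))"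
proof -
  have "(\<lambda>r :: (real^'d) \<times> (real^'q). influence j t (fst r) (snd r)) \<in> borel_measurable borel"
  proof -
    have "{r \<in> space (borel :: ((real^'d) \<times> (real^'q)) measure). fst r $ j \<le> t} \<in> sets borel"
      by (intro borel_measurable_le borel_measurable_const borel_measurable_continuous_onI continuous_intros)
    moreover have "(\<lambda>r :: (real^'d) \<times> (real^'q). slope j t \<bullet> snd r) \<in> borel_measurable borel"
      by (intro borel_measurable_continuous_onI continuous_intros)
    ultimately show ?thesis unfolding influence_def by (intro borel_measurable_diff measurable_If) auto
  qed
  from measurable_compose[OF measurable_component_singleton[of i UNIV] this] show ?thesis by simp
qed

text \<open>The bound is uniform in \<open>n\<close>, as the finite-dimensional limit theorem
  demands; the residual process itself contains a random matrix inverse, and no moment bound is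
  claimed for it.\<close>

lemma leading_second_moment:
  assumes t: "t \<in> {0..1}"
  shows "integrable M (\<lambda>\<omega>. (leading n j t \<omega>)\<^sup>2)" and "expectation (\<lambda>\<omega>. (leading n j t \<omega>)\<^sup>2) \<le> 1"
proof -
  let ?c = "\<lambda>i d. influence j t (fst (d i)) (snd (d i))"
  have c2: "integrable M (\<lambda>\<omega>. (?c i (\<lambda>i. (X i \<omega>, \<xi> i \<omega>)))\<^sup>2)" for i
    using influence_row_second_moment(1) by simp
  note w = weighted_errors[of ?c n, OF influence_design_measurable c2]
  have sq: "(leading n j t \<omega>)\<^sup>2 = (\<Sum>i<n. influence j t (X i \<omega>) (\<xi> i \<omega>) * \<epsilon> i \<omega>)\<^sup>2 / (real n * v)" for \<omega>
    using v_pos by (simp add: leading_def power_divide)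
  show "integrable M (\<lambda>\<omega>. (leading n j t \<omega>)\<^sup>2)" using w(1) by (simp add: sq)
  have "expectation (\<lambda>\<omega>. (leading n j t \<omega>)\<^sup>2) = v * (real n * influence_cov j j t t) / (real n * v)"
    using w(2) by (simp add: sq influence_row_second_moment(2))
  also have "\<dots> \<le> 1" using v_pos influence_variance_le[OF t, of j] by (cases "n = 0") auto
  finally show "expectation (\<lambda>\<omega>. (leading n j t \<omega>)\<^sup>2) \<le> 1" .
qed

text \<open>A linear combination of leading terms at different times and coordinates is again one
  normalized i.i.d. sum, of products of the error with a function of the design. Independence gives
  it mean zero and variance \<open>v\<close> times the quadratic form of
  \<open>influence_cov\<close>, and \<open>v\<close> cancels.\<close>

lemma leading_cos_limit:
  assumes "finite A"
  shows "(\<lambda>n. expectation (\<lambda>\<omega>. cos ((\<Sum>k\<in>A. c k * leading n (j k) (t k) \<omega>) + b)))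
     \<longlonglongrightarrow> cos b * exp (- (\<Sum>k\<in>A. \<Sum>l\<in>A. c k * c l * influence_cov (j k) (j l) (t k) (t l)) / 2)"
proof -
  define F where "F r = (\<Sum>k\<in>A. c k * influence (j k) (t k) (fst r) (fst (snd r))) * snd (snd r)"
    for r :: "(real^'d) \<times> (real^'q) \<times> real"
  have Fm: "F \<in> borel_measurable borel"
    unfolding F_def by (intro borel_measurable_times borel_measurable_sum borel_measurable_const influence_borel row_component_measurable)
  define \<Phi> where "\<Phi> d = (\<Sum>k\<in>A. c k * influence (j k) (t k) (fst (d 0)) (snd (d 0)))"
    for d :: "nat \<Rightarrow> (real^'d) \<times> (real^'q)"
  have Pm: "\<Phi> \<in> borel_measurable (Pi\<^sub>M UNIV (\<lambda>_. borel))"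
    unfolding \<Phi>_def by (intro borel_measurable_times borel_measurable_sum borel_measurable_const influence_design_measurable)
  define Y where "Y i \<omega> = F (X i \<omega>, \<xi> i \<omega>, \<epsilon> i \<omega>)" for i \<omega>
  let ?D = "\<lambda>\<omega> i. (X i \<omega>, \<xi> i \<omega>)"
  have Y0: "Y 0 \<omega> = \<epsilon> 0 \<omega> * \<Phi> (?D \<omega>)" for \<omega> by (simp add: Y_def F_def \<Phi>_def)
  have P2: "integrable M (\<lambda>\<omega>. (\<Phi> (?D \<omega>))\<^sup>2)"
    "expectation (\<lambda>\<omega>. (\<Phi> (?D \<omega>))\<^sup>2) = (\<Sum>k\<in>A. \<Sum>l\<in>A. c k * c l * influence_cov (j k) (j l) (t k) (t l))"
    unfolding \<Phi>_def using influence_combination[OF assms, of c j t] by simp_all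
  have P1: "integrable M (\<lambda>\<omega>. \<Phi> (?D \<omega>))"
    by (rule square_integrable_imp_integrable[OF measurable_compose[OF design_measurable Pm] P2(1)])
  have i1: "indep_var borel (\<lambda>\<omega>. \<epsilon> 0 \<omega>) borel (\<lambda>\<omega>. \<Phi> (?D \<omega>))"
    by (rule independent_elements_indep_var[OF errors _ Pm]) measurable
  have i2: "indep_var borel (\<lambda>\<omega>. (\<epsilon> 0 \<omega>)\<^sup>2) borel (\<lambda>\<omega>. (\<Phi> (?D \<omega>))\<^sup>2)"
    by (rule independent_elements_indep_var[OF errors _ borel_measurable_power[OF Pm]]) measurable
  have EY: "expectation (Y 0) = 0"
    unfolding Y0 using indep_var_lebesgue_integral[OF i1 eps_facts(2) P1] by (simp add: eps_facts)
  have EY2: "integrable M (\<lambda>\<omega>. (Y 0 \<omega>)\<^sup>2)" "expectation (\<lambda>\<omega>. (Y 0 \<omega>)\<^sup>2) = v * expectation (\<lambda>\<omega>. (\<Phi> (?D \<omega>))\<^sup>2)"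
    unfolding Y0 power_mult_distrib
    using indep_var_integrable[OF i2 eps_facts(1) P2(1)] indep_var_lebesgue_integral[OF i2 eps_facts(1) P2(1)]
    by (simp_all add: eps_facts)
  have "(\<lambda>n. expectation (\<lambda>\<omega>. cos ((\<Sum>i<n. Y i \<omega>) / sqrt (real n * v) + b)))
    \<longlonglongrightarrow> cos b * exp (- (expectation (\<lambda>\<omega>. (Y 0 \<omega>)\<^sup>2) / v) / 2)"
    by (rule iid_cos_limit[where Y=Y, OF _ _ EY2(1) EY v_pos])
      (use row_indep[OF Fm] row_distr[OF Fm] in \<open>auto simp: Y_def[abs_def]\<close>)
  moreover have "(\<Sum>i<n. Y i \<omega>) / sqrt (real n * v) = (\<Sum>k\<in>A. c k * leading n (j k) (t k) \<omega>)" for n \<omega>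
  proof -
    have "(\<Sum>i<n. Y i \<omega>) = (\<Sum>i<n. \<Sum>k\<in>A. c k * (influence (j k) (t k) (X i \<omega>) (\<xi> i \<omega>) * \<epsilon> i \<omega>))"
      by (simp add: Y_def F_def sum_distrib_right mult.assoc)
    also have "\<dots> = (\<Sum>k\<in>A. \<Sum>i<n. c k * (influence (j k) (t k) (X i \<omega>) (\<xi> i \<omega>) * \<epsilon> i \<omega>))" by (rule sum.swap)
    finally show ?thesis by (simp add: leading_def sum_distrib_left sum_divide_distrib)
  qed
  ultimately show ?thesis using v_pos by (simp add: EY2(2) P2(2))
qed

end

subsection \<open>Asymptotic linearization\<close>

lemma (in prob_space) negligible_family_prob:
  assumes A: "finite A" and Y: "\<And>i. i \<in> A \<Longrightarrow> negligible_sequence (Y i)" and d: "\<delta> > 0"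
  shows "\<And>n. {\<omega> \<in> space M. \<exists>i\<in>A. \<delta> \<le> \<bar>Y i n \<omega>\<bar>} \<in> sets M"
    and "(\<lambda>n. prob {\<omega> \<in> space M. \<exists>i\<in>A. \<delta> \<le> \<bar>Y i n \<omega>\<bar>}) \<longlonglongrightarrow> 0"
proof -
  have S: "{\<omega> \<in> space M. \<delta> \<le> \<bar>Y i n \<omega>\<bar>} \<in> sets M" if "i \<in> A" for i n
    using negligible_measurable[OF Y[OF that], of n] by measurable
  have eq: "{\<omega> \<in> space M. \<exists>i\<in>A. \<delta> \<le> \<bar>Y i n \<omega>\<bar>} = (\<Union>i\<in>A. {\<omega> \<in> space M. \<delta> \<le> \<bar>Y i n \<omega>\<bar>})" for n by auto
  show "{\<omega> \<in> space M. \<exists>i\<in>A. \<delta> \<le> \<bar>Y i n \<omega>\<bar>} \<in> sets M" for n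
    unfolding eq using A S by (intro sets.finite_UN) auto
  show "(\<lambda>n. prob {\<omega> \<in> space M. \<exists>i\<in>A. \<delta> \<le> \<bar>Y i n \<omega>\<bar>}) \<longlonglongrightarrow> 0"
  proof (rule tendsto_sandwich[where f="\<lambda>_. 0"])
    show "\<forall>\<^sub>F n in sequentially. prob {\<omega> \<in> space M. \<exists>i\<in>A. \<delta> \<le> \<bar>Y i n \<omega>\<bar>} \<le> (\<Sum>i\<in>A. prob {\<omega> \<in> space M. \<delta> \<le> \<bar>Y i n \<omega>\<bar>})"
      unfolding eq using A S by (intro always_eventually allI finite_measure_subadditive_finite) auto
    have "(\<lambda>n. \<Sum>i\<in>A. prob {\<omega> \<in> space M. \<delta> \<le> \<bar>Y i n \<omega>\<bar>}) \<longlonglongrightarrow> (\<Sum>i\<in>A. 0)"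
      by (intro tendsto_sum negligible_prob Y d)
    then show "(\<lambda>n. \<Sum>i\<in>A. prob {\<omega> \<in> space M. \<delta> \<le> \<bar>Y i n \<omega>\<bar>}) \<longlonglongrightarrow> 0" by simp
  qed auto
qed

context regression_model
begin

text \<open>Normalized by \<open>n\<close>, so that it converges to \<open>G\<close>;
  \<open>score\<close> is normalized by the square root of \<open>n\<close>, so that its second
  moment stays bounded.\<close>

definition gram :: "nat \<Rightarrow> 'w \<Rightarrow> real^'q^'q" where
  "gram n \<omega> = (\<chi> a b. (\<Sum>i<n. \<xi> i \<omega> $ a * \<xi> i \<omega> $ b) / real n)"

definition score :: "nat \<Rightarrow> 'w \<Rightarrow> real^'q" where
  "score n \<omega> = (1 / sqrt (real n)) *\<^sub>R normal_rhs n (\<lambda>i. \<xi> i \<omega>) (\<lambda>i. \<epsilon> i \<omega>)"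

definition estimation_error :: "real^'q \<Rightarrow> nat \<Rightarrow> 'w \<Rightarrow> real^'q" where
  "estimation_error \<theta> n \<omega> = least_squares n (\<lambda>i. \<xi> i \<omega>) (\<lambda>i. \<xi> i \<omega> \<bullet> \<theta> + \<epsilon> i \<omega>) - \<theta>"

definition weighted_regressors :: "nat \<Rightarrow> 'd \<Rightarrow> real \<Rightarrow> 'w \<Rightarrow> real^'q" where
  "weighted_regressors n j t \<omega> = (\<Sum>i<n. sort_weight n (\<lambda>i. X i \<omega> $ j) t i *\<^sub>R \<xi> i \<omega>)"

definition proc :: "real^'q \<Rightarrow> nat \<Rightarrow> 'd \<Rightarrow> real \<Rightarrow> 'w \<Rightarrow> real" where
  "proc \<theta> n j t \<omega> = residual_process n v (\<lambda>i. X i \<omega>) (\<lambda>i. \<xi> i \<omega>) (\<lambda>i. \<xi> i \<omega> \<bullet> \<theta> + \<epsilon> i \<omega>) t $ j"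

lemma gram_measurable [measurable]: "(\<lambda>\<omega>. gram n \<omega> $ a $ b) \<in> borel_measurable M"
  unfolding gram_def by simp

lemma score_measurable [measurable]: "score n \<in> borel_measurable M"
  by (rule vec_measurableI) (simp add: score_def normal_rhs_def)

lemma estimation_error_measurable [measurable]: "estimation_error \<theta> n \<in> borel_measurable M"
proof (rule vec_measurableI)
  fix k
  have "(\<lambda>\<omega>. (matrix_inv (normal_matrix n (\<lambda>i. \<xi> i \<omega>)) *v normal_rhs n (\<lambda>i. \<xi> i \<omega>) (\<lambda>i. \<xi> i \<omega> \<bullet> \<theta> + \<epsilon> i \<omega>)) $ k) \<in> borel_measurable M"
    by (rule matrix_inv_vector_measurable) (simp_all add: normal_matrix_def normal_rhs_def)
  then show "(\<lambda>\<omega>. estimation_error \<theta> n \<omega> $ k) \<in> borel_measurable M"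
    by (simp add: estimation_error_def least_squares_def)
qed

lemma sort_weight_X_measurable [measurable]: "(\<lambda>\<omega>. sort_weight n (\<lambda>i. X i \<omega> $ j) t i) \<in> borel_measurable M"
  by (rule sort_weight_measurable) simp

lemma weighted_regressors_measurable [measurable]: "weighted_regressors n j t \<in> borel_measurable M"
  unfolding weighted_regressors_def by measurable

lemma gram_mult: "gram n \<omega> *v y = (1 / real n) *\<^sub>R (normal_matrix n (\<lambda>i. \<xi> i \<omega>) *v y)"
  by (simp add: vec_eq_iff gram_def normal_matrix_def matrix_vector_mult_def flip: sum_divide_distrib)

text \<open>The normal equations for the estimation error, divided by the square root of
  \<open>n\<close>.\<close>

lemma gram_estimation_error:
  assumes n: "n > 0" and inv: "invertible (gram n \<omega>)"
  shows "gram n \<omega> *v (sqrt (real n) *\<^sub>R estimation_error \<theta> n \<omega>) = score n \<omega>"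
proof -
  let ?N = "normal_matrix n (\<lambda>i. \<xi> i \<omega>)"
  have "y = 0" if "?N *v y = 0" for y
  proof -
    have "gram n \<omega> *v y = 0" using that by (simp add: gram_mult)
    then have "matrix_inv (gram n \<omega>) *v (gram n \<omega> *v y) = 0" by (simp add: matrix_vector_mult_0_right)
    then show ?thesis by (simp add: matrix_inv_vector_mult[OF inv])
  qed
  then have "invertible ?N" by (simp add: invertible_left_inverse matrix_left_invertible_ker)
  then have "?N *v estimation_error \<theta> n \<omega> = normal_rhs n (\<lambda>i. \<xi> i \<omega>) (\<lambda>i. \<epsilon> i \<omega>)"
    unfolding estimation_error_def by (intro least_squares_error) auto
  moreover have "sqrt (real n) / real n = 1 / sqrt (real n)" using n by (simp add: real_div_sqrt field_simps)
  ultimately show ?thesis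
    by (simp add: gram_mult score_def matrix_vector_mult_scaleR)
qed

lemma row_law_of_large_numbers:
  assumes f: "f \<in> borel_measurable borel" and int: "integrable M (\<lambda>\<omega>. f (X 0 \<omega>, \<xi> 0 \<omega>, \<epsilon> 0 \<omega>))"
  shows "\<And>n. integrable M (\<lambda>\<omega>. (\<Sum>i<n. f (X i \<omega>, \<xi> i \<omega>, \<epsilon> i \<omega>)) / real n - expectation (\<lambda>\<omega>. f (X 0 \<omega>, \<xi> 0 \<omega>, \<epsilon> 0 \<omega>)))"
    and "(\<lambda>n. expectation (\<lambda>\<omega>. \<bar>(\<Sum>i<n. f (X i \<omega>, \<xi> i \<omega>, \<epsilon> i \<omega>)) / real n - expectation (\<lambda>\<omega>. f (X 0 \<omega>, \<xi> 0 \<omega>, \<epsilon> 0 \<omega>))\<bar>)) \<longlonglongrightarrow> 0"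
    and "negligible_sequence (\<lambda>n \<omega>. (\<Sum>i<n. f (X i \<omega>, \<xi> i \<omega>, \<epsilon> i \<omega>)) / real n - expectation (\<lambda>\<omega>. f (X 0 \<omega>, \<xi> 0 \<omega>, \<epsilon> 0 \<omega>)))"
proof -
  note lln = L1_law_of_large_numbers[where Y="\<lambda>i \<omega>. f (X i \<omega>, \<xi> i \<omega>, \<epsilon> i \<omega>)", OF row_indep[OF f] row_distr[OF f] int]
  show "\<And>n. integrable M (\<lambda>\<omega>. (\<Sum>i<n. f (X i \<omega>, \<xi> i \<omega>, \<epsilon> i \<omega>)) / real n - expectation (\<lambda>\<omega>. f (X 0 \<omega>, \<xi> 0 \<omega>, \<epsilon> 0 \<omega>)))"
    by (rule lln(1))
  show "(\<lambda>n. expectation (\<lambda>\<omega>. \<bar>(\<Sum>i<n. f (X i \<omega>, \<xi> i \<omega>, \<epsilon> i \<omega>)) / real n - expectation (\<lambda>\<omega>. f (X 0 \<omega>, \<xi> 0 \<omega>, \<epsilon> 0 \<omega>))\<bar>)) \<longlonglongrightarrow> 0"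
    by (rule lln(2))
  show "negligible_sequence (\<lambda>n \<omega>. (\<Sum>i<n. f (X i \<omega>, \<xi> i \<omega>, \<epsilon> i \<omega>)) / real n - expectation (\<lambda>\<omega>. f (X 0 \<omega>, \<xi> 0 \<omega>, \<epsilon> 0 \<omega>)))"
    by (rule negligible_L1[OF lln(1) order_refl lln(2)])
qed

lemma gram_converges: "negligible_sequence (\<lambda>n \<omega>. gram n \<omega> $ a $ b - G $ a $ b)"
proof -
  have f: "(\<lambda>r :: (real^'d) \<times> (real^'q) \<times> real. fst (snd r) $ a * fst (snd r) $ b) \<in> borel_measurable borel"
    by (intro borel_measurable_times row_component_measurable)
  show ?thesis
    using row_law_of_large_numbers(3)[OF f] xi_sq[of a b] by (simp add: gram_def G_entry)
qed

lemma score_second_moment: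
  "integrable M (\<lambda>\<omega>. (norm (score n \<omega>))\<^sup>2)"
  "expectation (\<lambda>\<omega>. (norm (score n \<omega>))\<^sup>2) \<le> v * (\<Sum>a\<in>UNIV. G $ a $ a)"
proof -
  let ?c = "\<lambda>a i d. snd (d i) $ a"
  have cm: "?c a i \<in> borel_measurable (Pi\<^sub>M UNIV (\<lambda>_::nat. borel :: ((real^'d) \<times> (real^'q)) measure))" for a i
  proof -
    have "(\<lambda>r :: (real^'d) \<times> (real^'q). snd r $ a) \<in> borel_measurable borel"
      by (intro borel_measurable_continuous_onI continuous_intros)
    from measurable_compose[OF measurable_component_singleton[of i UNIV] this] show ?thesis by simp
  qed
  have f: "(\<lambda>r :: (real^'d) \<times> (real^'q) \<times> real. (fst (snd r) $ a)\<^sup>2) \<in> borel_measurable borel" for a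
    by (intro borel_measurable_power row_component_measurable)
  have c2: "integrable M (\<lambda>\<omega>. (\<xi> i \<omega> $ a)\<^sup>2)" "expectation (\<lambda>\<omega>. (\<xi> i \<omega> $ a)\<^sup>2) = G $ a $ a" for a i
    using row_expectation[OF f[of a], of i] xi_sq[of a a] by (simp_all add: G_entry power2_eq_square)
  have w: "integrable M (\<lambda>\<omega>. (\<Sum>i<n. \<xi> i \<omega> $ a * \<epsilon> i \<omega>)\<^sup>2)"
    "expectation (\<lambda>\<omega>. (\<Sum>i<n. \<xi> i \<omega> $ a * \<epsilon> i \<omega>)\<^sup>2) = v * (real n * G $ a $ a)" for a
    using weighted_errors[of "?c a" n, OF cm] c2 by simp_all
  have sq: "(norm (score n \<omega>))\<^sup>2 = (\<Sum>a\<in>UNIV. (\<Sum>i<n. \<xi> i \<omega> $ a * \<epsilon> i \<omega>)\<^sup>2 / real n)" for \<omega>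
  proof -
    have "(norm (score n \<omega>))\<^sup>2 = (\<Sum>a\<in>UNIV. (score n \<omega> $ a)\<^sup>2)"
      unfolding power2_norm_eq_inner inner_vec_def by (simp add: power2_eq_square)
    moreover have "(score n \<omega> $ a)\<^sup>2 = (\<Sum>i<n. \<xi> i \<omega> $ a * \<epsilon> i \<omega>)\<^sup>2 / real n" for a
      by (simp add: score_def normal_rhs_def power_divide)
    ultimately show ?thesis by simp
  qed
  show "integrable M (\<lambda>\<omega>. (norm (score n \<omega>))\<^sup>2)" unfolding sq using w(1) by simp
  have "expectation (\<lambda>\<omega>. (norm (score n \<omega>))\<^sup>2) = (\<Sum>a\<in>UNIV. v * (real n * G $ a $ a) / real n)"
    unfolding sq using w by simp
  also have "\<dots> \<le> (\<Sum>a\<in>UNIV. v * G $ a $ a)"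
  proof (intro sum_mono)
    fix a
    have "0 \<le> G $ a $ a" unfolding c2(2)[of 0 a, symmetric] by (rule Bochner_Integration.integral_nonneg) simp
    then show "v * (real n * G $ a $ a) / real n \<le> v * G $ a $ a" using v_pos by (cases "n = 0") auto
  qed
  finally show "expectation (\<lambda>\<omega>. (norm (score n \<omega>))\<^sup>2) \<le> v * (\<Sum>a\<in>UNIV. G $ a $ a)" by (simp add: sum_distrib_left)
qed

lemma score_bounded: "integrable M (\<lambda>\<omega>. norm (score n \<omega>))"
  "expectation (\<lambda>\<omega>. norm (score n \<omega>)) \<le> 1 + v * (\<Sum>a\<in>UNIV. G $ a $ a)"
proof -
  have m: "(\<lambda>\<omega>. norm (score n \<omega>)) \<in> borel_measurable M" by measurable
  show "integrable M (\<lambda>\<omega>. norm (score n \<omega>))"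
    by (rule square_integrable_imp_integrable[OF m score_second_moment(1)])
  show "expectation (\<lambda>\<omega>. norm (score n \<omega>)) \<le> 1 + v * (\<Sum>a\<in>UNIV. G $ a $ a)"
    using expectation_abs_le_second_moment[OF m score_second_moment(1), of 1] score_second_moment(2)[of n] by simp
qed

text \<open>The error of the empirical distribution function at one fixed \<open>t\<close>. By
  nestedness it controls the whole cost of passing from ranks to indicators, so nothing uniform in
  \<open>t\<close> has to be shown here.\<close>

lemma count_deviation:
  assumes t: "t \<in> {0..1}"
  shows "integrable M (\<lambda>\<omega>. real (count_le n (\<lambda>i. X i \<omega> $ j) t) / real n - t)"
    and "(\<lambda>n. expectation (\<lambda>\<omega>. \<bar>real (count_le n (\<lambda>i. X i \<omega> $ j) t) / real n - t\<bar>)) \<longlonglongrightarrow> 0"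
proof -
  let ?f = "\<lambda>r :: (real^'d) \<times> (real^'q) \<times> real. if fst r $ j \<le> t then 1 else 0 :: real"
  have "{r \<in> space (borel :: ((real^'d) \<times> (real^'q) \<times> real) measure). fst r $ j \<le> t} \<in> sets borel"
    by (intro borel_measurable_le row_component_measurable borel_measurable_const)
  then have f: "?f \<in> borel_measurable borel" by (intro measurable_If) auto
  have i: "integrable M (\<lambda>\<omega>. ?f (X 0 \<omega>, \<xi> 0 \<omega>, \<epsilon> 0 \<omega>))"
    by (rule integrable_const_bound[of _ 1]) auto
  have A: "{\<omega> \<in> space M. X 0 \<omega> $ j \<le> t} \<in> sets M" by measurable
  have "expectation (\<lambda>\<omega>. ?f (X 0 \<omega>, \<xi> 0 \<omega>, \<epsilon> 0 \<omega>)) = expectation (indicator {\<omega> \<in> space M. X 0 \<omega> $ j \<le> t})"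
    by (rule Bochner_Integration.integral_cong) (auto simp: indicator_def)
  also have "\<dots> = t" using A uniform[OF t, of j] by simp
  finally have e: "expectation (\<lambda>\<omega>. ?f (X 0 \<omega>, \<xi> 0 \<omega>, \<epsilon> 0 \<omega>)) = t" .
  have c: "real (count_le n (\<lambda>i. X i \<omega> $ j) t) = (\<Sum>i<n. ?f (X i \<omega>, \<xi> i \<omega>, \<epsilon> i \<omega>))" for n \<omega>
    by (simp add: count_le_def sum.If_cases Int_def lessThan_def)
  show "integrable M (\<lambda>\<omega>. real (count_le n (\<lambda>i. X i \<omega> $ j) t) / real n - t)"
    and "(\<lambda>n. expectation (\<lambda>\<omega>. \<bar>real (count_le n (\<lambda>i. X i \<omega> $ j) t) / real n - t\<bar>)) \<longlonglongrightarrow> 0"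
    using row_law_of_large_numbers(1,2)[OF f i] unfolding e c by blast+
qed

section \<open>From rank weights to indicator weights\<close>

definition rank_weight_error :: "nat \<Rightarrow> 'd \<Rightarrow> real \<Rightarrow> nat \<Rightarrow> 'w \<Rightarrow> real" where
  "rank_weight_error n j t i \<omega> = sort_weight n (\<lambda>i. X i \<omega> $ j) t i - (if X i \<omega> $ j \<le> t then 1 else 0)"

lemma rank_weight_error_measurable [measurable]: "rank_weight_error n j t i \<in> borel_measurable M"
  unfolding rank_weight_error_def by measurable

lemma rank_weight_error_abs_le: "i < n \<Longrightarrow> \<bar>rank_weight_error n j t i \<omega>\<bar> \<le> 1"
  using sort_weight_bounds[of i n "\<lambda>i. X i \<omega> $ j" t] by (auto simp: rank_weight_error_def)

lemma rank_weight_error_square_le: "i < n \<Longrightarrow> (rank_weight_error n j t i \<omega>)\<^sup>2 \<le> \<bar>rank_weight_error n j t i \<omega>\<bar>"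
  using mult_left_mono[OF rank_weight_error_abs_le[of i n j t \<omega>], of "\<bar>rank_weight_error n j t i \<omega>\<bar>"]
  by (simp add: power2_eq_square)

lemma rank_weight_error_sum:
  assumes "t \<in> {0..1}" "n > 0"
  shows "(\<Sum>i<n. \<bar>rank_weight_error n j t i \<omega>\<bar>) = real n * \<bar>real (count_le n (\<lambda>i. X i \<omega> $ j) t) / real n - t\<bar>"
proof -
  have "\<bar>real n * t - real (count_le n (\<lambda>i. X i \<omega> $ j) t)\<bar> = \<bar>real n * (real (count_le n (\<lambda>i. X i \<omega> $ j) t) / real n - t)\<bar>"
    using assms by (simp add: right_diff_distrib abs_minus_commute)
  then show ?thesis
    using sum_abs_sort_weight_diff[OF assms(1), of n "\<lambda>i. X i \<omega> $ j" t]
    by (simp add: rank_weight_error_def abs_mult)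
qed

text \<open>The second moment is the mean of the squared weight errors, averaged over rows. Each is
  at most its absolute value, and the absolute values average to the deviation of the empirical
  distribution function at \<open>t\<close>.\<close>

lemma rank_weighted_errors_negligible:
  assumes t: "t \<in> {0..1}"
  shows "negligible_sequence (\<lambda>n \<omega>. (\<Sum>i<n. rank_weight_error n j t i \<omega> * \<epsilon> i \<omega>) / sqrt (real n * v))"
proof (rule negligible_L2[OF _ _ _ count_deviation(2)[OF t, of j]])
  show "(\<lambda>\<omega>. (\<Sum>i<n. rank_weight_error n j t i \<omega> * \<epsilon> i \<omega>) / sqrt (real n * v)) \<in> borel_measurable M" for n
    by measurable
  fix n
  let ?c = "\<lambda>i d. sort_weight n (\<lambda>i. fst (d i) $ j) t i - (if fst (d i) $ j \<le> t then 1 else 0)"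
  have fm: "(\<lambda>d. fst (d i) $ j) \<in> borel_measurable (Pi\<^sub>M UNIV (\<lambda>_::nat. borel :: ((real^'d) \<times> (real^'q)) measure))" for i
  proof -
    have "(\<lambda>r :: (real^'d) \<times> (real^'q). fst r $ j) \<in> borel_measurable borel"
      by (intro borel_measurable_continuous_onI continuous_intros)
    from measurable_compose[OF measurable_component_singleton[of i UNIV] this] show ?thesis by simp
  qed
  have cm: "?c i \<in> borel_measurable (Pi\<^sub>M UNIV (\<lambda>_::nat. borel :: ((real^'d) \<times> (real^'q)) measure))" for i
    by (intro borel_measurable_diff sort_weight_measurable fm measurable_If borel_measurable_le borel_measurable_const)
  have c: "?c i (\<lambda>i. (X i \<omega>, \<xi> i \<omega>)) = rank_weight_error n j t i \<omega>" for i \<omega> by (simp add: rank_weight_error_def)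
  have c2: "integrable M (\<lambda>\<omega>. (rank_weight_error n j t i \<omega>)\<^sup>2)" if "i < n" for i
  proof (rule integrable_const_bound[of _ 1])
    show "AE \<omega> in M. norm ((rank_weight_error n j t i \<omega>)\<^sup>2) \<le> 1"
      using order_trans[OF rank_weight_error_square_le[OF that] rank_weight_error_abs_le[OF that]] by simp
  qed measurable
  have w: "integrable M (\<lambda>\<omega>. (\<Sum>i<n. rank_weight_error n j t i \<omega> * \<epsilon> i \<omega>)\<^sup>2)"
    "expectation (\<lambda>\<omega>. (\<Sum>i<n. rank_weight_error n j t i \<omega> * \<epsilon> i \<omega>)\<^sup>2) = v * (\<Sum>i<n. expectation (\<lambda>\<omega>. (rank_weight_error n j t i \<omega>)\<^sup>2))"
    using weighted_errors[of ?c n, OF cm] c2 unfolding c by blast+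
  have sq: "((\<Sum>i<n. rank_weight_error n j t i \<omega> * \<epsilon> i \<omega>) / sqrt (real n * v))\<^sup>2 =
      (\<Sum>i<n. rank_weight_error n j t i \<omega> * \<epsilon> i \<omega>)\<^sup>2 / (real n * v)" for \<omega>
    using v_pos by (simp add: power_divide)
  show "integrable M (\<lambda>\<omega>. ((\<Sum>i<n. rank_weight_error n j t i \<omega> * \<epsilon> i \<omega>) / sqrt (real n * v))\<^sup>2)"
    unfolding sq using w(1) by simp
  show "expectation (\<lambda>\<omega>. ((\<Sum>i<n. rank_weight_error n j t i \<omega> * \<epsilon> i \<omega>) / sqrt (real n * v))\<^sup>2)
      \<le> expectation (\<lambda>\<omega>. \<bar>real (count_le n (\<lambda>i. X i \<omega> $ j) t) / real n - t\<bar>)"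
  proof (cases "n = 0")
    case False
    then have n: "n > 0" by simp
    have "(\<Sum>i<n. expectation (\<lambda>\<omega>. (rank_weight_error n j t i \<omega>)\<^sup>2)) = expectation (\<lambda>\<omega>. \<Sum>i<n. (rank_weight_error n j t i \<omega>)\<^sup>2)"
      by (rule Bochner_Integration.integral_sum[symmetric]) (use c2 in auto)
    also have "\<dots> \<le> expectation (\<lambda>\<omega>. real n * \<bar>real (count_le n (\<lambda>i. X i \<omega> $ j) t) / real n - t\<bar>)"
    proof (rule integral_mono)
      show "integrable M (\<lambda>\<omega>. \<Sum>i<n. (rank_weight_error n j t i \<omega>)\<^sup>2)"
        by (rule Bochner_Integration.integrable_sum) (use c2 in auto)
      show "integrable M (\<lambda>\<omega>. real n * \<bar>real (count_le n (\<lambda>i. X i \<omega> $ j) t) / real n - t\<bar>)"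
        by (intro integrable_mult_right integrable_abs count_deviation(1)[OF t])
      show "(\<Sum>i<n. (rank_weight_error n j t i \<omega>)\<^sup>2) \<le> real n * \<bar>real (count_le n (\<lambda>i. X i \<omega> $ j) t) / real n - t\<bar>" for \<omega>
        unfolding rank_weight_error_sum[OF t n, symmetric] by (intro sum_mono rank_weight_error_square_le) auto
    qed
    finally have *: "(\<Sum>i<n. expectation (\<lambda>\<omega>. (rank_weight_error n j t i \<omega>)\<^sup>2)) \<le>
        real n * expectation (\<lambda>\<omega>. \<bar>real (count_le n (\<lambda>i. X i \<omega> $ j) t) / real n - t\<bar>)" by simp
    show ?thesis unfolding sq using w(2) * n v_pos by (simp add: field_simps)
  qed simp
qed

text \<open>With indicator weights this is the law of large numbers with limit \<open>L j t\<close>.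
  In the correction, weight errors and regressors are dependent and only square integrability is at
  hand, so they are separated by Young's inequality.\<close>

lemma weighted_regressors_converge:
  assumes t: "t \<in> {0..1}"
  shows "negligible_sequence (\<lambda>n \<omega>. weighted_regressors n j t \<omega> $ a / real n - L j t $ a)"
proof -
  let ?f = "\<lambda>r :: (real^'d) \<times> (real^'q) \<times> real. fst (snd r) $ a * (if fst r $ j \<le> t then 1 else 0 :: real)"
  have "{r \<in> space (borel :: ((real^'d) \<times> (real^'q) \<times> real) measure). fst r $ j \<le> t} \<in> sets borel"
    by (intro borel_measurable_le row_component_measurable borel_measurable_const)
  then have f: "?f \<in> borel_measurable borel" by (intro borel_measurable_times row_component_measurable measurable_If) auto
  have i: "integrable M (\<lambda>\<omega>. ?f (X 0 \<omega>, \<xi> 0 \<omega>, \<epsilon> 0 \<omega>))"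
    using xi_indicator(1)[OF t, of "axis a 1" j] by (simp add: inner_axis')
  have e: "expectation (\<lambda>\<omega>. ?f (X 0 \<omega>, \<xi> 0 \<omega>, \<epsilon> 0 \<omega>)) = L j t $ a" using L_entry[OF t] by simp
  have 1: "negligible_sequence (\<lambda>n \<omega>. (\<Sum>i<n. \<xi> i \<omega> $ a * (if X i \<omega> $ j \<le> t then 1 else 0)) / real n - L j t $ a)"
    using row_law_of_large_numbers(3)[OF f i] unfolding e by simp
  let ?S = "\<lambda>n \<omega>. (\<Sum>i<n. rank_weight_error n j t i \<omega> * \<xi> i \<omega> $ a) / real n"
  have 2: "negligible_sequence ?S"
  proof (rule negligible_sequenceI)
    show Sm: "?S n \<in> borel_measurable M" for n by measurable
    fix e :: real assume e: "e > 0"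
    define g where "g = expectation (\<lambda>\<omega>. (\<xi> 0 \<omega> $ a)\<^sup>2)"
    have g: "g \<ge> 0" by (simp add: g_def)
    \<comment> \<open>Makes the regressor part \<open>lam * g\<close> at most \<open>e\<close>; the
      weight part is divided by this fixed number and still tends to 0.\<close>
    define lam where "lam = e / (1 + g)"
    have lam: "lam > 0" using e g by (simp add: lam_def)
    let ?r = "\<lambda>n \<omega>. \<bar>real (count_le n (\<lambda>i. X i \<omega> $ j) t) / real n - t\<bar>"
    have sqm: "(\<lambda>r :: (real^'d) \<times> (real^'q) \<times> real. (fst (snd r) $ a)\<^sup>2) \<in> borel_measurable borel"
      by (intro borel_measurable_power row_component_measurable)
    have x2: "integrable M (\<lambda>\<omega>. (\<xi> i \<omega> $ a)\<^sup>2)" "expectation (\<lambda>\<omega>. (\<xi> i \<omega> $ a)\<^sup>2) = g" for i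
      using row_expectation[OF sqm, of i] xi_sq[of a a] by (simp_all add: g_def power2_eq_square)
    have "expectation (\<lambda>\<omega>. min 1 \<bar>?S n \<omega>\<bar>) \<le> expectation (?r n) / lam + e" for n
    proof (cases "n = 0")
      case False
      then have n: "n > 0" by simp
      have pt: "\<bar>?S n \<omega>\<bar> \<le> ?r n \<omega> / lam + lam * (\<Sum>i<n. (\<xi> i \<omega> $ a)\<^sup>2) / real n" for \<omega>
      proof -
        have "\<bar>rank_weight_error n j t i \<omega> * \<xi> i \<omega> $ a\<bar> \<le> \<bar>rank_weight_error n j t i \<omega>\<bar> / lam + lam * (\<xi> i \<omega> $ a)\<^sup>2"
          if "i < n" for i
        proof -
          \<comment> \<open>Young's inequality, from the square of
            \<open>\<bar>y\<bar> - lam * \<bar>z\<bar>\<close>.\<close>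
          have yz: "\<bar>y * z\<bar> \<le> y\<^sup>2 / lam + lam * z\<^sup>2" for y z :: real
          proof -
            have "0 \<le> (\<bar>y\<bar> - lam * \<bar>z\<bar>)\<^sup>2 / lam" using lam by simp
            also have "\<dots> = y\<^sup>2 / lam - 2 * (\<bar>y\<bar> * \<bar>z\<bar>) + lam * z\<^sup>2"
            proof -
              have "(\<bar>y\<bar> - lam * \<bar>z\<bar>)\<^sup>2 = y\<^sup>2 - 2 * lam * (\<bar>y\<bar> * \<bar>z\<bar>) + lam\<^sup>2 * z\<^sup>2"
                by (simp add: power2_diff power_mult_distrib mult_ac)
              moreover have "(p - 2 * lam * q + lam\<^sup>2 * r) / lam = p / lam - 2 * q + lam * r" for p q r
                using lam by (simp add: field_simps power2_eq_square)
              ultimately show ?thesis by simp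
            qed
            finally have "2 * (\<bar>y\<bar> * \<bar>z\<bar>) \<le> y\<^sup>2 / lam + lam * z\<^sup>2" by linarith
            moreover have "0 \<le> \<bar>y\<bar> * \<bar>z\<bar>" by simp
            ultimately show ?thesis unfolding abs_mult by linarith
          qed
          have "(rank_weight_error n j t i \<omega>)\<^sup>2 / lam \<le> \<bar>rank_weight_error n j t i \<omega>\<bar> / lam"
            using rank_weight_error_square_le[OF that] lam by (intro divide_right_mono) auto
          then show ?thesis using yz[of "rank_weight_error n j t i \<omega>" "\<xi> i \<omega> $ a"] by linarith
        qed
        then have "\<bar>\<Sum>i<n. rank_weight_error n j t i \<omega> * \<xi> i \<omega> $ a\<bar> \<le> (\<Sum>i<n. \<bar>rank_weight_error n j t i \<omega>\<bar> / lam + lam * (\<xi> i \<omega> $ a)\<^sup>2)"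
          by (intro order_trans[OF sum_abs] sum_mono) auto
        also have "\<dots> = real n * ?r n \<omega> / lam + lam * (\<Sum>i<n. (\<xi> i \<omega> $ a)\<^sup>2)"
          by (simp only: sum.distrib sum_divide_distrib[symmetric] sum_distrib_left[symmetric] rank_weight_error_sum[OF t n])
        finally have "\<bar>\<Sum>i<n. rank_weight_error n j t i \<omega> * \<xi> i \<omega> $ a\<bar> / real n \<le>
            (real n * ?r n \<omega> / lam + lam * (\<Sum>i<n. (\<xi> i \<omega> $ a)\<^sup>2)) / real n"
          by (rule divide_right_mono) simp
        then show ?thesis using n by (simp add: add_divide_distrib)
      qed
      have ir: "integrable M (\<lambda>\<omega>. ?r n \<omega> / lam)"
        by (intro integrable_divide_zero integrable_abs count_deviation(1)[OF t])
      have ix: "integrable M (\<lambda>\<omega>. lam * (\<Sum>i<n. (\<xi> i \<omega> $ a)\<^sup>2) / real n)"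
        using x2(1) by (intro integrable_divide_zero integrable_mult_right Bochner_Integration.integrable_sum)
      have "expectation (\<lambda>\<omega>. min 1 \<bar>?S n \<omega>\<bar>) \<le> expectation (\<lambda>\<omega>. ?r n \<omega> / lam + lam * (\<Sum>i<n. (\<xi> i \<omega> $ a)\<^sup>2) / real n)"
        by (rule integral_mono[OF integrable_min_1_abs[OF Sm] Bochner_Integration.integrable_add[OF ir ix]])
          (rule min.coboundedI2[OF pt])
      also have "\<dots> = expectation (?r n) / lam + lam * g"
        unfolding Bochner_Integration.integral_add[OF ir ix] using n x2 by simp
      also have "lam * g \<le> e" using e g by (simp add: lam_def field_simps)
      finally show ?thesis by simp
    qed (use e lam in \<open>simp add: add_nonneg_nonneg\<close>)
    moreover have "(\<lambda>n. expectation (?r n) / lam) \<longlonglongrightarrow> 0 / lam"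
      by (intro tendsto_divide tendsto_const count_deviation(2)[OF t]) (use lam in simp)
    ultimately show "\<exists>b. b \<longlonglongrightarrow> 0 \<and> (\<forall>n. expectation (\<lambda>\<omega>. min 1 \<bar>?S n \<omega>\<bar>) \<le> b n + e)"
      by (intro exI[of _ "\<lambda>n. expectation (?r n) / lam"]) simp
  qed
  have "weighted_regressors n j t \<omega> $ a / real n - L j t $ a =
      ?S n \<omega> + ((\<Sum>i<n. \<xi> i \<omega> $ a * (if X i \<omega> $ j \<le> t then 1 else 0)) / real n - L j t $ a)" for n \<omega>
  proof -
    have "weighted_regressors n j t \<omega> $ a =
        (\<Sum>i<n. rank_weight_error n j t i \<omega> * \<xi> i \<omega> $ a + \<xi> i \<omega> $ a * (if X i \<omega> $ j \<le> t then 1 else 0))"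
      unfolding weighted_regressors_def sum_component
      by (intro sum.cong refl) (auto simp: rank_weight_error_def left_diff_distrib)
    then show ?thesis by (simp add: sum.distrib add_divide_distrib)
  qed
  then show ?thesis using negligible_add[OF 2 1] by (simp only:)
qed

end

lemma dyadic_interpolation_cong:
  assumes "\<And>s. s \<in> {0..1} \<Longrightarrow> y s = y' s" "t \<in> {0..1}"
  shows "dyadic_interpolation m y t = dyadic_interpolation m y' t"
proof -
  obtain k a where *: "k < 2 ^ m" "\<And>v. piecewise_linear (2 ^ m) v t = (1 - a) * v k + a * v (Suc k)"
    by (rule piecewise_linear_cases[of t "2 ^ m"]) (use assms(2) in auto)
  have "y (real k / 2 ^ m) = y' (real k / 2 ^ m)" "y (real (Suc k) / 2 ^ m) = y' (real (Suc k) / 2 ^ m)"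
    using *(1) unit_dyadicsI[of k m] unit_dyadicsI[of "Suc k" m] unit_dyadics_subset by (intro assms(1); auto simp del: of_nat_Suc)+
  then show ?thesis unfolding dyadic_interpolation_def *(2) by simp
qed

text \<open>A pathwise bound by Cauchy-Schwarz. It depends on the steps through their sum of squares
  only, which sorting leaves unchanged.\<close>

lemma walk_increment_square_le:
  assumes n: "n > 0" and v: "v > 0" and t: "t \<in> {0..1}" and u: "u \<in> {0..1}"
  shows "(walk n (sqrt (real n * v)) a t - walk n (sqrt (real n * v)) a u)\<^sup>2 \<le> \<bar>t - u\<bar> / v * (\<Sum>m<n. (a m)\<^sup>2)"
proof -
  let ?s = "sqrt (real n * v)"
  let ?d = "\<lambda>m. ramp (real n * t - real m) - ramp (real n * u - real m)"
  have nt: "0 \<le> real n * t" "real n * t \<le> real n" "0 \<le> real n * u" "real n * u \<le> real n"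
    using t u by (auto simp: mult_left_le)
  have "(walk n ?s a t - walk n ?s a u)\<^sup>2 \<le> (\<Sum>m<n. (?d m / ?s)\<^sup>2) * (\<Sum>m<n. (a m)\<^sup>2)"
    unfolding walk_increment by (rule Cauchy_Schwarz_ineq_sum)
  also have "(\<Sum>m<n. (?d m / ?s)\<^sup>2) = (\<Sum>m<n. (?d m)\<^sup>2) / (real n * v)"
    using v by (simp add: power_divide sum_divide_distrib)
  also have "(\<Sum>m<n. (?d m)\<^sup>2) / (real n * v) * (\<Sum>m<n. (a m)\<^sup>2) \<le> \<bar>real n * t - real n * u\<bar> / (real n * v) * (\<Sum>m<n. (a m)\<^sup>2)"
    using sum_ramp_diff_squared_le[OF nt(3,4,1,2)] v n
    by (intro mult_right_mono divide_right_mono sum_nonneg) auto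
  also have "\<bar>real n * t - real n * u\<bar> / (real n * v) = \<bar>t - u\<bar> / v"
    unfolding right_diff_distrib[symmetric] abs_mult using n by simp
  finally show ?thesis .
qed

lemma matrix_inv_bound:
  fixes G :: "real^'q^'q"
  obtains B where "B > 0" "\<And>x. norm (matrix_inv G *v x) \<le> B * norm x"
  using bounded_linear.pos_bounded[OF matrix_vector_mul_bounded_linear[of "matrix_inv G"]] by (metis mult.commute)

context regression_model
begin

lemma proc_decomposition:
  assumes "t \<in> {0..1}"
  shows "proc \<theta> n j t \<omega> = walk n (sqrt (real n * v)) (\<lambda>m. \<epsilon> (sort_perm n (\<lambda>i. X i \<omega> $ j) m) \<omega>) t
     - (weighted_regressors n j t \<omega> \<bullet> estimation_error \<theta> n \<omega>) / sqrt (real n * v)"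
  unfolding proc_def weighted_regressors_def estimation_error_def
  by (rule residual_process_decomposition[OF assms]) simp

lemma walk_sorted:
  "walk n s (\<lambda>m. e (sort_perm n z m)) t = (\<Sum>i<n. sort_weight n z t i * e i) / s"
proof -
  have "(\<Sum>m<n. ramp (real n * t - real m) * e (sort_perm n z m)) = (\<Sum>m<n. ramp (real n * t - real m) *\<^sub>R e (sorted_row n z m))"
    by (intro sum.cong refl) (simp add: sort_perm_eq)
  also have "\<dots> = (\<Sum>i<n. sort_weight n z t i * e i)" using sum_sorted_row[where f=e and n=n and t=t and z=z] by simp
  finally show ?thesis by (simp add: walk_def)
qed

lemma proc_measurable:
  assumes "t \<in> {0..1}" shows "proc \<theta> n j t \<in> borel_measurable M"
proof -
  have "(\<lambda>\<omega>. (\<Sum>i<n. sort_weight n (\<lambda>i. X i \<omega> $ j) t i * \<epsilon> i \<omega>) / sqrt (real n * v)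
     - (weighted_regressors n j t \<omega> \<bullet> estimation_error \<theta> n \<omega>) / sqrt (real n * v)) \<in> borel_measurable M"
    by measurable
  moreover have "proc \<theta> n j t \<omega> = (\<Sum>i<n. sort_weight n (\<lambda>i. X i \<omega> $ j) t i * \<epsilon> i \<omega>) / sqrt (real n * v)
     - (weighted_regressors n j t \<omega> \<bullet> estimation_error \<theta> n \<omega>) / sqrt (real n * v)" for \<omega>
    unfolding proc_decomposition[OF assms] walk_sorted[of n _ "\<lambda>i. \<epsilon> i \<omega>"] ..
  ultimately show ?thesis by (simp add: fun_eq_iff[symmetric] cong: measurable_cong)
qed

lemma score_const_pos: "0 < 1 + v * (\<Sum>a\<in>UNIV. G $ a $ a)"
proof -
  have "0 \<le> expectation (\<lambda>\<omega>. (norm (score 0 \<omega>))\<^sup>2)" by (rule Bochner_Integration.integral_nonneg) simp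
  then show ?thesis using score_second_moment(2)[of 0] by linarith
qed

text \<open>Let \<open>S\<close> be the averaged weighted regressors, \<open>y\<close> the scaled
  estimation error and \<open>U\<close> the score. Outside two events of vanishing probability,
  \<open>S\<close> is close to \<open>L j t\<close> and \<open>y\<close> is close to the inverse of
  \<open>G\<close> applied to \<open>U\<close>, so the difference is at most a small multiple of
  \<open>norm U\<close>, whose mean is bounded by \<open>C\<close>.\<close>

lemma remainder_negligible:
  assumes t: "t \<in> {0..1}"
  shows "negligible_sequence (\<lambda>n \<omega>. (weighted_regressors n j t \<omega> \<bullet> estimation_error \<theta> n \<omega>) / sqrt (real n * v)
     - (slope j t \<bullet> normal_rhs n (\<lambda>i. \<xi> i \<omega>) (\<lambda>i. \<epsilon> i \<omega>)) / sqrt (real n * v))" (is "negligible_sequence ?B")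
proof (rule negligible_sequenceI)
  have [measurable]: "(\<lambda>\<omega>. normal_rhs n (\<lambda>i. \<xi> i \<omega>) (\<lambda>i. \<epsilon> i \<omega>)) \<in> borel_measurable M" for n
    by (rule vec_measurableI) (simp add: normal_rhs_def)
  show Bm: "?B n \<in> borel_measurable M" for n by measurable
  fix e :: real assume e: "e > 0"
  define C where "C = 1 + v * (\<Sum>a\<in>UNIV. G $ a $ a)"
  have C: "C > 0" using score_const_pos by (simp add: C_def)
  obtain b where b: "b > 0" "\<And>x. norm (matrix_inv G *v x) \<le> b * norm x" using matrix_inv_bound by blast
  define \<kappa> where "\<kappa> = e / C"
  have \<kappa>: "\<kappa> > 0" using e C by (simp add: \<kappa>_def)
  define q where "q = real CARD('q)"
  have q: "q > 0" by (simp add: q_def)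
  \<comment> \<open>\<open>e2\<close> is the accuracy in inverting the Gram matrix and
    \<open>d2\<close> that of the averaged regressors; each may use half of
    \<open>\<kappa> * sqrt v\<close>. Having \<open>e2 \<le> 1\<close> also gives
    \<open>norm y \<le> (b + 1) * norm U\<close>.\<close>
  define e2 where "e2 = min 1 (\<kappa> * sqrt v / (2 * (norm (L j t) + 1)))"
  define d2 where "d2 = \<kappa> * sqrt v / (2 * q * (b + 1))"
  have e2: "e2 > 0" "e2 \<le> 1" using \<kappa> v_pos by (auto simp: e2_def intro!: divide_pos_pos add_nonneg_pos)
  have d2: "d2 > 0" using \<kappa> v_pos b(1) q by (simp add: d2_def)
  have le2: "norm (L j t) * e2 \<le> \<kappa> * sqrt v / 2"
  proof -
    have n1: "0 < norm (L j t) + 1" by (simp add: add_nonneg_pos)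
    have cancel: "c * (x / (2 * c)) = x / 2" if "c > 0" for c x :: real using that by simp
    have "norm (L j t) * e2 \<le> (norm (L j t) + 1) * (\<kappa> * sqrt v / (2 * (norm (L j t) + 1)))"
      using e2(1) by (intro mult_mono) (auto simp: e2_def)
    also have "\<dots> = \<kappa> * sqrt v / 2" by (rule cancel[OF n1])
    finally show ?thesis .
  qed
  have qd2: "q * d2 * (b + 1) = \<kappa> * sqrt v / 2"
  proof -
    have "q * (x / (2 * q * c)) * c = x / 2" if "c > 0" for c x :: real using that q by simp
    then show ?thesis unfolding d2_def using b(1) by simp
  qed
  obtain \<delta> where \<delta>: "\<delta> > 0" "\<And>H. (\<And>a b. \<bar>H $ a $ b - G $ a $ b\<bar> \<le> \<delta>) \<Longrightarrow> invertible H"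
    "\<And>H x y. (\<And>a b. \<bar>H $ a $ b - G $ a $ b\<bar> \<le> \<delta>) \<Longrightarrow> H *v y = x \<Longrightarrow> norm (y - matrix_inv G *v x) \<le> e2 * norm x"
    using inverse_perturbation[OF G_inv e2(1)] by metis
  define B1 where "B1 n = {\<omega> \<in> space M. \<exists>i\<in>UNIV. \<delta> \<le> \<bar>gram n \<omega> $ fst i $ snd i - G $ fst i $ snd i\<bar>}" for n
  define B2 where "B2 n = {\<omega> \<in> space M. \<exists>a\<in>UNIV. d2 \<le> \<bar>weighted_regressors n j t \<omega> $ a / real n - L j t $ a\<bar>}" for n
  have B1: "B1 n \<in> sets M" "(\<lambda>n. prob (B1 n)) \<longlonglongrightarrow> 0" for n
    unfolding B1_def by (rule negligible_family_prob[OF _ gram_converges \<delta>(1)], simp)+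
  have B2: "B2 n \<in> sets M" "(\<lambda>n. prob (B2 n)) \<longlonglongrightarrow> 0" for n
    unfolding B2_def by (rule negligible_family_prob[OF _ weighted_regressors_converge[OF t] d2], simp)+
  have off: "\<bar>?B n \<omega>\<bar> \<le> \<kappa> * norm (score n \<omega>)" if w: "\<omega> \<in> space M" "\<omega> \<notin> B1 n \<union> B2 n" for n \<omega>
  proof (cases "n = 0")
    case True then show ?thesis using \<kappa> by simp
  next
    case False
    then have n: "n > 0" by simp
    have g: "\<bar>gram n \<omega> $ a $ b - G $ a $ b\<bar> \<le> \<delta>" for a b
    proof (rule ccontr)
      assume "\<not> \<bar>gram n \<omega> $ a $ b - G $ a $ b\<bar> \<le> \<delta>"
      then have "\<delta> \<le> \<bar>gram n \<omega> $ fst (a, b) $ snd (a, b) - G $ fst (a, b) $ snd (a, b)\<bar>" by simp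
      then show False using w unfolding B1_def by blast
    qed
    have l: "\<bar>((1 / real n) *\<^sub>R weighted_regressors n j t \<omega> - L j t) $ a\<bar> \<le> d2" for a
    proof (rule ccontr)
      assume "\<not> \<bar>((1 / real n) *\<^sub>R weighted_regressors n j t \<omega> - L j t) $ a\<bar> \<le> d2"
      then have "d2 \<le> \<bar>weighted_regressors n j t \<omega> $ a / real n - L j t $ a\<bar>" by simp
      then show False using w unfolding B2_def by blast
    qed
    define S where "S = (1 / real n) *\<^sub>R weighted_regressors n j t \<omega>"
    define U where "U = score n \<omega>"
    define y where "y = sqrt (real n) *\<^sub>R estimation_error \<theta> n \<omega>"
    have inv: "invertible (gram n \<omega>)" by (rule \<delta>(2)[OF g])
    have gy: "gram n \<omega> *v y = U" unfolding y_def U_def by (rule gram_estimation_error[OF n inv])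
    have y1: "norm (y - matrix_inv G *v U) \<le> e2 * norm U" by (rule \<delta>(3)[OF g gy])
    have Sn: "norm (S - L j t) \<le> q * d2"
      using norm_vec_le[of "S - L j t" "\<lambda>_. d2"] l by (simp add: S_def q_def)
    have ny: "norm y \<le> (b + 1) * norm U"
    proof -
      have "norm y \<le> norm (y - matrix_inv G *v U) + norm (matrix_inv G *v U)"
        using norm_triangle_ineq[of "y - matrix_inv G *v U" "matrix_inv G *v U"] by simp
      also have "\<dots> \<le> 1 * norm U + b * norm U"
        using y1 b(2)[of U] mult_right_mono[OF e2(2) norm_ge_zero[of U]] by linarith
      finally show ?thesis by (simp add: algebra_simps)
    qed
    have "?B n \<omega> = (S \<bullet> y - slope j t \<bullet> U) / sqrt v"
    proof -
      have sn: "sqrt (real n) * sqrt (real n) = real n" by simp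
      have s0: "sqrt (real n) > 0" using n by simp
      have a: "weighted_regressors n j t \<omega> = real n *\<^sub>R S" using n by (simp add: S_def)
      have c: "normal_rhs n (\<lambda>i. \<xi> i \<omega>) (\<lambda>i. \<epsilon> i \<omega>) = sqrt (real n) *\<^sub>R U" using s0 by (simp add: U_def score_def)
      have "weighted_regressors n j t \<omega> \<bullet> estimation_error \<theta> n \<omega> = sqrt (real n) * (S \<bullet> y)"
        unfolding a y_def using sn by (simp add: mult.assoc[symmetric])
      then show ?thesis unfolding c using s0 by (simp add: real_sqrt_mult diff_divide_distrib)
    qed
    \<comment> \<open>Symmetry of \<open>G\<close> moves the inverse from \<open>L j t\<close> to
      \<open>U\<close>, which exposes the two small differences.\<close>
    also have "S \<bullet> y - slope j t \<bullet> U = (S - L j t) \<bullet> y + L j t \<bullet> (y - matrix_inv G *v U)"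
      unfolding slope_inner by (simp add: inner_diff_left inner_diff_right)
    also have "\<bar>((S - L j t) \<bullet> y + L j t \<bullet> (y - matrix_inv G *v U)) / sqrt v\<bar> \<le> \<kappa> * norm U"
    proof -
      have "\<bar>(S - L j t) \<bullet> y\<bar> \<le> (q * d2) * ((b + 1) * norm U)"
        by (rule order_trans[OF Cauchy_Schwarz_ineq2]) (intro mult_mono Sn ny, use q d2 in auto)
      moreover have "\<bar>L j t \<bullet> (y - matrix_inv G *v U)\<bar> \<le> norm (L j t) * (e2 * norm U)"
        by (rule order_trans[OF Cauchy_Schwarz_ineq2]) (intro mult_left_mono y1, simp)
      ultimately have "\<bar>(S - L j t) \<bullet> y + L j t \<bullet> (y - matrix_inv G *v U)\<bar> \<le> (q * d2 * (b + 1)) * norm U + (norm (L j t) * e2) * norm U"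
        by (simp add: mult.assoc)
      also have "\<dots> \<le> (\<kappa> * sqrt v / 2) * norm U + (\<kappa> * sqrt v / 2) * norm U"
        unfolding qd2 using le2 by (intro add_left_mono mult_right_mono) auto
      finally show ?thesis using v_pos by (simp add: pos_divide_le_eq mult_ac)
    qed
    finally show ?thesis by (simp add: U_def)
  qed
  have "expectation (\<lambda>\<omega>. min 1 \<bar>?B n \<omega>\<bar>) \<le> (prob (B1 n) + prob (B2 n)) + e" for n
  proof -
    have iU: "integrable M (\<lambda>\<omega>. \<kappa> * norm (score n \<omega>))" by (intro integrable_mult_right score_bounded)
    have "expectation (\<lambda>\<omega>. min 1 \<bar>?B n \<omega>\<bar>) \<le> prob (B1 n \<union> B2 n) + expectation (\<lambda>\<omega>. \<kappa> * norm (score n \<omega>))"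
      by (rule expectation_min_le_off_event[OF Bm _ iU _ off]) (use B1 B2 \<kappa> in auto)
    also have "prob (B1 n \<union> B2 n) \<le> prob (B1 n) + prob (B2 n)" by (rule measure_Un_le) (use B1 B2 in auto)
    also have "expectation (\<lambda>\<omega>. \<kappa> * norm (score n \<omega>)) \<le> \<kappa> * C"
      using score_bounded(2)[of n] \<kappa> by (simp add: C_def)
    also have "\<kappa> * C = e" using C by (simp add: \<kappa>_def)
    finally show ?thesis by simp
  qed
  moreover have "(\<lambda>n. prob (B1 n) + prob (B2 n)) \<longlonglongrightarrow> 0" using tendsto_add[OF B1(2) B2(2)] by simp
  ultimately show "\<exists>b. b \<longlonglongrightarrow> 0 \<and> (\<forall>n. expectation (\<lambda>\<omega>. min 1 \<bar>?B n \<omega>\<bar>) \<le> b n + e)"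
    by (intro exI[of _ "\<lambda>n. prob (B1 n) + prob (B2 n)"]) simp
qed

text \<open>The leading term and the process differ in two ways: indicators replaced by rank weights
  on the errors, and the limiting expansion of the estimation error replaced by the exact
  one.\<close>

theorem proc_leading_negligible:
  assumes t: "t \<in> {0..1}"
  shows "negligible_sequence (\<lambda>n \<omega>. leading n j t \<omega> - proc \<theta> n j t \<omega>)"
proof -
  let ?A = "\<lambda>n \<omega>. (\<Sum>i<n. rank_weight_error n j t i \<omega> * \<epsilon> i \<omega>) / sqrt (real n * v)"
  let ?B = "\<lambda>n \<omega>. (weighted_regressors n j t \<omega> \<bullet> estimation_error \<theta> n \<omega>) / sqrt (real n * v)
     - (slope j t \<bullet> normal_rhs n (\<lambda>i. \<xi> i \<omega>) (\<lambda>i. \<epsilon> i \<omega>)) / sqrt (real n * v)"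
  have A: "negligible_sequence (\<lambda>n \<omega>. - ?A n \<omega>)"
    using rank_weighted_errors_negligible[OF t, of j] by (simp add: negligible_sequence_def)
  have "leading n j t \<omega> - proc \<theta> n j t \<omega> = - ?A n \<omega> + ?B n \<omega>" for n \<omega>
  proof -
    have "slope j t \<bullet> normal_rhs n (\<lambda>i. \<xi> i \<omega>) (\<lambda>i. \<epsilon> i \<omega>) = (\<Sum>a\<in>UNIV. \<Sum>i<n. slope j t $ a * \<xi> i \<omega> $ a * \<epsilon> i \<omega>)"
      by (simp add: inner_vec_def normal_rhs_def sum_distrib_left mult.assoc)
    also have "\<dots> = (\<Sum>i<n. \<Sum>a\<in>UNIV. slope j t $ a * \<xi> i \<omega> $ a * \<epsilon> i \<omega>)" by (rule sum.swap)
    also have "\<dots> = (\<Sum>i<n. (slope j t \<bullet> \<xi> i \<omega>) * \<epsilon> i \<omega>)" by (simp add: inner_vec_def sum_distrib_right)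
    finally have r: "slope j t \<bullet> normal_rhs n (\<lambda>i. \<xi> i \<omega>) (\<lambda>i. \<epsilon> i \<omega>) = (\<Sum>i<n. (slope j t \<bullet> \<xi> i \<omega>) * \<epsilon> i \<omega>)" .
    have "(\<Sum>i<n. influence j t (X i \<omega>) (\<xi> i \<omega>) * \<epsilon> i \<omega>) =
        (\<Sum>i<n. sort_weight n (\<lambda>i. X i \<omega> $ j) t i * \<epsilon> i \<omega>) - (\<Sum>i<n. rank_weight_error n j t i \<omega> * \<epsilon> i \<omega>)
        - (\<Sum>i<n. (slope j t \<bullet> \<xi> i \<omega>) * \<epsilon> i \<omega>)"
      unfolding sum_subtractf[symmetric]
      by (intro sum.cong refl) (simp add: influence_def rank_weight_error_def algebra_simps)
    then show ?thesis
      unfolding leading_def proc_decomposition[OF t] walk_sorted[of n _ "\<lambda>i. \<epsilon> i \<omega>"] r by (simp add: diff_divide_distrib)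
  qed
  then show ?thesis using negligible_add[OF A remainder_negligible[OF t, of j \<theta>]] by simp
qed

section \<open>Modulus of continuity of the residual process\<close>

lemma regressors_quadratic:
  "(\<Sum>i<n. (\<xi> i \<omega> \<bullet> z)\<^sup>2) = real n * (z \<bullet> (gram n \<omega> *v z))"
proof (cases "n = 0")
  case False
  have "(\<Sum>i<n. (\<xi> i \<omega> \<bullet> z)\<^sup>2) = (\<Sum>i<n. \<Sum>a\<in>UNIV. \<Sum>b\<in>UNIV. z $ a * z $ b * (\<xi> i \<omega> $ a * \<xi> i \<omega> $ b))"
    by (simp add: power2_eq_square inner_vec_def sum_product mult_ac)
  also have "\<dots> = (\<Sum>a\<in>UNIV. \<Sum>i<n. \<Sum>b\<in>UNIV. z $ a * z $ b * (\<xi> i \<omega> $ a * \<xi> i \<omega> $ b))" by (rule sum.swap)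
  also have "\<dots> = (\<Sum>a\<in>UNIV. \<Sum>b\<in>UNIV. \<Sum>i<n. z $ a * z $ b * (\<xi> i \<omega> $ a * \<xi> i \<omega> $ b))"
    by (intro sum.cong refl sum.swap)
  also have "\<dots> = (\<Sum>a\<in>UNIV. \<Sum>b\<in>UNIV. real n * (z $ a * (gram n \<omega> $ a $ b * z $ b)))"
    using False by (intro sum.cong refl) (simp add: gram_def sum_distrib_left[symmetric] mult_ac)
  also have "\<dots> = real n * (z \<bullet> (gram n \<omega> *v z))"
    by (simp add: inner_vec_def matrix_vector_mult_def sum_distrib_left)
  finally show ?thesis .
qed simp

text \<open>The estimation part is the walk with steps
  \<open>\<xi> i \<omega> \<bullet> \<tau>\<close>. Their sum of squares is the Gram form at the
  scaled error \<open>y\<close>; since the Gram matrix maps \<open>y\<close> to the score, it is an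
  inner product bounded by \<open>b * (norm (score n \<omega>))^2\<close>. The Hoelder constant is
  therefore free of \<open>n\<close> and of individual regressors.\<close>

lemma estimation_part_modulus:
  assumes n: "n > 0" and inv: "invertible (gram n \<omega>)" and b: "norm (sqrt (real n) *\<^sub>R estimation_error \<theta> n \<omega>) \<le> b * norm (score n \<omega>)"
    and t: "t \<in> {0..1}"
  shows "\<bar>(weighted_regressors n j t \<omega> \<bullet> estimation_error \<theta> n \<omega>) / sqrt (real n * v)
     - dyadic_interpolation m (\<lambda>t. (weighted_regressors n j t \<omega> \<bullet> estimation_error \<theta> n \<omega>) / sqrt (real n * v)) t\<bar>
     \<le> sqrt ((1/2) ^ m * b / v) * norm (score n \<omega>)"
proof -
  define \<tau> where "\<tau> = estimation_error \<theta> n \<omega>"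
  define y where "y = sqrt (real n) *\<^sub>R \<tau>"
  let ?z = "\<lambda>i. X i \<omega> $ j"
  let ?e = "\<lambda>i. \<xi> i \<omega> \<bullet> \<tau>"
  let ?w = "walk n (sqrt (real n * v)) (\<lambda>m. ?e (sort_perm n ?z m))"
  have w: "(weighted_regressors n j t \<omega> \<bullet> \<tau>) / sqrt (real n * v) = ?w t" for t
    unfolding walk_sorted[of n _ "\<lambda>i. \<xi> i \<omega> \<bullet> \<tau>"] weighted_regressors_def by (simp add: inner_sum_left)
  have "(\<Sum>m<n. (?e (sort_perm n ?z m))\<^sup>2) = (\<Sum>m<n. (?e (sorted_row n ?z m))\<^sup>2)"
    by (intro sum.cong refl) (simp add: sort_perm_eq)
  also have "\<dots> = (\<Sum>i<n. (?e i)\<^sup>2)" by (rule sum.reindex_bij_betw[OF bij_betw_sorted_row])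
  also have "\<dots> = real n * (\<tau> \<bullet> (gram n \<omega> *v \<tau>))" by (rule regressors_quadratic)
  also have "\<dots> = y \<bullet> (gram n \<omega> *v y)"
    by (simp add: y_def matrix_vector_mult_scaleR)
  also have "\<dots> = y \<bullet> score n \<omega>" unfolding y_def \<tau>_def by (simp only: gram_estimation_error[OF n inv])
  also have "\<dots> \<le> norm y * norm (score n \<omega>)" by (rule norm_cauchy_schwarz)
  also have "\<dots> \<le> (b * norm (score n \<omega>)) * norm (score n \<omega>)"
    using b by (intro mult_right_mono) (auto simp: y_def \<tau>_def)
  finally have Q: "(\<Sum>m<n. (?e (sort_perm n ?z m))\<^sup>2) \<le> b * (norm (score n \<omega>))\<^sup>2" by (simp add: power2_eq_square)
  have "\<bar>?w s - ?w t\<bar> \<le> sqrt ((1/2) ^ m * b / v) * norm (score n \<omega>)"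
    if s: "0 \<le> s" "s \<le> 1" "\<bar>s - t\<bar> \<le> 1 / 2 ^ m" for s
  proof -
    have "(?w s - ?w t)\<^sup>2 \<le> \<bar>s - t\<bar> / v * (\<Sum>m<n. (?e (sort_perm n ?z m))\<^sup>2)"
      using s by (intro walk_increment_square_le n v_pos t) auto
    also have "\<dots> \<le> (1/2) ^ m / v * (b * (norm (score n \<omega>))\<^sup>2)"
      using s(3) v_pos Q by (intro mult_mono divide_right_mono) (auto simp: power_one_over sum_nonneg)
    finally have "sqrt ((?w s - ?w t)\<^sup>2) \<le> sqrt ((1/2) ^ m / v * (b * (norm (score n \<omega>))\<^sup>2))" by (rule real_sqrt_le_mono)
    also have "(1/2) ^ m / v * (b * (norm (score n \<omega>))\<^sup>2) = ((1/2) ^ m * b / v) * (norm (score n \<omega>))\<^sup>2" by simp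
    finally show ?thesis by (simp only: real_sqrt_mult real_sqrt_abs abs_norm_cancel)
  qed
  then have "\<bar>dyadic_interpolation m ?w t - ?w t\<bar> \<le> sqrt ((1/2) ^ m * b / v) * norm (score n \<omega>)"
    using t by (intro dyadic_interpolation_diff_le) auto
  then show ?thesis unfolding \<tau>_def[symmetric] w by (simp add: abs_minus_commute)
qed

end

context regression_model
begin

lemma design_covariate_measurable:
  "(\<lambda>d. fst (d i) $ j) \<in> borel_measurable (Pi\<^sub>M UNIV (\<lambda>_::nat. borel :: ((real^'d) \<times> (real^'q)) measure))"
proof -
  have "(\<lambda>r :: (real^'d) \<times> (real^'q). fst r $ j) \<in> borel_measurable borel"
    by (intro borel_measurable_continuous_onI continuous_intros)
  from measurable_compose[OF measurable_component_singleton[of i UNIV] this] show ?thesis by simp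
qed

lemma sorted_errors_expectation:
  fixes g :: "(nat \<Rightarrow> real) \<Rightarrow> real"
  assumes g: "g \<in> borel_measurable (Pi\<^sub>M UNIV (\<lambda>_. borel))" and B: "\<And>x. \<bar>g x\<bar> \<le> B"
  shows "(\<lambda>\<omega>. g (\<lambda>i. \<epsilon> (sort_perm n (\<lambda>i. X i \<omega> $ j) i) \<omega>)) \<in> borel_measurable M"
    and "expectation (\<lambda>\<omega>. g (\<lambda>i. \<epsilon> (sort_perm n (\<lambda>i. X i \<omega> $ j) i) \<omega>)) = expectation (\<lambda>\<omega>. g (\<lambda>i. \<epsilon> i \<omega>))"
proof -
  have inj: "inj p" if "p \<in> perms_below n" for p using that by (simp add: perms_below_def)
  have sm: "{d \<in> space (Pi\<^sub>M UNIV (\<lambda>_::nat. borel :: ((real^'d) \<times> (real^'q)) measure)). sort_perm n (\<lambda>i. fst (d i) $ j) = p}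
      \<in> sets (Pi\<^sub>M UNIV (\<lambda>_. borel))" for p
    by (rule sort_perm_measurable[where z="\<lambda>d i. fst (d i) $ j"]) (rule design_covariate_measurable)
  note r = random_permutation_expectation[where \<pi>="\<lambda>d :: nat \<Rightarrow> (real^'d) \<times> (real^'q). sort_perm n (\<lambda>i. fst (d i) $ j)", OF errors eps_indep eps_ident finite_perms_below[of n] inj
      sort_perm_in_perms_below sm g B]
  show "(\<lambda>\<omega>. g (\<lambda>i. \<epsilon> (sort_perm n (\<lambda>i. X i \<omega> $ j) i) \<omega>)) \<in> borel_measurable M"
    using r(1) by simp
  show "expectation (\<lambda>\<omega>. g (\<lambda>i. \<epsilon> (sort_perm n (\<lambda>i. X i \<omega> $ j) i) \<omega>)) = expectation (\<lambda>\<omega>. g (\<lambda>i. \<epsilon> i \<omega>))"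
    using r(2) by simp
qed

lemma proc_dyadic_deviation:
  assumes n: "n > 0" and t: "t \<in> {0..1}" and inv: "invertible (gram n \<omega>)"
    and b: "norm (sqrt (real n) *\<^sub>R estimation_error \<theta> n \<omega>) \<le> b * norm (score n \<omega>)"
    and w: "\<bar>walk n (sqrt (real n * v)) (\<lambda>m. \<epsilon> (sort_perm n (\<lambda>i. X i \<omega> $ j) m) \<omega>) t
      - dyadic_interpolation m (walk n (sqrt (real n * v)) (\<lambda>m. \<epsilon> (sort_perm n (\<lambda>i. X i \<omega> $ j) m) \<omega>)) t\<bar> \<le> r"
  shows "\<bar>proc \<theta> n j t \<omega> - dyadic_interpolation m (\<lambda>t. proc \<theta> n j t \<omega>) t\<bar> \<le> r + sqrt ((1/2) ^ m * b / v) * norm (score n \<omega>)"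
proof -
  let ?w = "walk n (sqrt (real n * v)) (\<lambda>m. \<epsilon> (sort_perm n (\<lambda>i. X i \<omega> $ j) m) \<omega>)"
  let ?e = "\<lambda>t. (weighted_regressors n j t \<omega> \<bullet> estimation_error \<theta> n \<omega>) / sqrt (real n * v)"
  have "dyadic_interpolation m (\<lambda>t. proc \<theta> n j t \<omega>) t = dyadic_interpolation m (\<lambda>t. ?w t - ?e t) t"
    by (rule dyadic_interpolation_cong[OF _ t]) (rule proc_decomposition)
  also have "\<dots> = dyadic_interpolation m ?w t - dyadic_interpolation m ?e t"
    by (simp add: dyadic_interpolation_def piecewise_linear_diff)
  finally have "proc \<theta> n j t \<omega> - dyadic_interpolation m (\<lambda>t. proc \<theta> n j t \<omega>) t =
      (?w t - dyadic_interpolation m ?w t) - (?e t - dyadic_interpolation m ?e t)"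
    unfolding proc_decomposition[OF t] by simp
  then show ?thesis using w estimation_part_modulus[OF n inv b t, of j m] by linarith
qed

text \<open>Asymptotic equicontinuity through a random majorant \<open>Q\<close>, uniform in time
  and coordinate. The alternative \<open>1 \<le> Q \<omega>\<close> absorbs exceptional events,
  where nothing is claimed, and \<open>E min 1 Q\<close> is what bounded Lipschitz functions
  see.\<close>

theorem proc_modulus:
  assumes \<delta>: "\<delta> > 0"
  shows "\<exists>m0. \<forall>m\<ge>m0. \<exists>n0. \<forall>n\<ge>n0. \<exists>Q\<in>borel_measurable M.
     (\<forall>\<omega>. 0 \<le> Q \<omega>) \<and> expectation (\<lambda>\<omega>. min 1 (Q \<omega>)) \<le> \<delta> \<and>
     (\<forall>\<omega>\<in>space M. 1 \<le> Q \<omega> \<or> (\<forall>t\<in>{0..1}. \<forall>j.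
        \<bar>proc \<theta> n j t \<omega> - dyadic_interpolation m (\<lambda>t. proc \<theta> n j t \<omega>) t\<bar> \<le> Q \<omega>))"
proof -
  define d where "d = real CARD('d)"
  have d: "d > 0" by (simp add: d_def)
  \<comment> \<open>One third of \<delta> is shared by the \<open>d\<close> sorted error walks, one
    third goes to the score term and one third to the event that the Gram matrix is far from
    \<open>G\<close>.\<close>
  have "\<delta> / (3 * d) > 0" using \<delta> d by simp
  with walk_tight[OF eps_indep eps_ident eps_sq eps_mean v_pos] obtain m1 R where
    Rm: "\<And>m n. R m n \<in> borel_measurable (PiM UNIV (\<lambda>_. borel))" and R0: "\<And>m n e. 0 \<le> R m n e"
    and Rd: "\<And>m n e t. t \<in> {0..1} \<Longrightarrow> n > 0 \<Longrightarrow>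
       \<bar>walk n (sqrt (real n * v)) e t - dyadic_interpolation m (walk n (sqrt (real n * v)) e) t\<bar> \<le> R m n e"
    and RE: "\<And>m n. m \<ge> m1 \<Longrightarrow> n > 0 \<Longrightarrow> expectation (\<lambda>\<omega>. min 1 (R m n (\<lambda>i. \<epsilon> i \<omega>))) \<le> \<delta> / (3 * d)"
    by metis
  obtain b where b: "b > 0" "\<And>x. norm (matrix_inv G *v x) \<le> b * norm x" using matrix_inv_bound by blast
  define C where "C = 1 + v * (\<Sum>a\<in>UNIV. G $ a $ a)"
  have C: "C > 0" using score_const_pos by (simp add: C_def)
  define q where "q m = sqrt ((1/2) ^ m * (b + 1) / v)" for m :: nat
  have q0: "q m \<ge> 0" for m using b(1) v_pos by (simp add: q_def)
  have "q \<longlonglongrightarrow> sqrt (0 * (b + 1) / v)"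
    unfolding q_def by (intro tendsto_intros LIMSEQ_power_zero) (use v_pos in auto)
  then have "(\<lambda>m. q m * C) \<longlonglongrightarrow> 0" using tendsto_mult_right[of q 0 sequentially C] by simp
  then obtain m2 where m2: "\<And>m. m \<ge> m2 \<Longrightarrow> q m * C < \<delta> / 3"
    using order_tendstoD(2)[of "\<lambda>m. q m * C" 0 sequentially "\<delta> / 3"] \<delta> by (auto simp: eventually_sequentially)
  obtain \<rho> where \<rho>: "\<rho> > 0" "\<And>H. (\<And>a b. \<bar>H $ a $ b - G $ a $ b\<bar> \<le> \<rho>) \<Longrightarrow> invertible H"
    "\<And>H x y. (\<And>a b. \<bar>H $ a $ b - G $ a $ b\<bar> \<le> \<rho>) \<Longrightarrow> H *v y = x \<Longrightarrow> norm (y - matrix_inv G *v x) \<le> 1 * norm x"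
    using inverse_perturbation[OF G_inv zero_less_one] by metis
  define E where "E n = {\<omega> \<in> space M. \<exists>i\<in>UNIV. \<rho> \<le> \<bar>gram n \<omega> $ fst i $ snd i - G $ fst i $ snd i\<bar>}" for n
  have E: "E n \<in> sets M" "(\<lambda>n. prob (E n)) \<longlonglongrightarrow> 0" for n
    unfolding E_def by (rule negligible_family_prob[OF _ gram_converges \<rho>(1)], simp)+
  obtain n1 where n1: "\<And>n. n \<ge> n1 \<Longrightarrow> prob (E n) < \<delta> / 3"
    using order_tendstoD(2)[OF E(2), of "\<delta> / 3"] \<delta> by (auto simp: eventually_sequentially)
  have off: "invertible (gram n \<omega>) \<and> norm (sqrt (real n) *\<^sub>R estimation_error \<theta> n \<omega>) \<le> (b + 1) * norm (score n \<omega>)"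
    if n: "n > 0" and w: "\<omega> \<in> space M" "\<omega> \<notin> E n" for n \<omega>
  proof -
    have g: "\<bar>gram n \<omega> $ a $ b - G $ a $ b\<bar> \<le> \<rho>" for a b
    proof (rule ccontr)
      assume "\<not> \<bar>gram n \<omega> $ a $ b - G $ a $ b\<bar> \<le> \<rho>"
      then have "\<rho> \<le> \<bar>gram n \<omega> $ fst (a, b) $ snd (a, b) - G $ fst (a, b) $ snd (a, b)\<bar>" by simp
      then show False using w unfolding E_def by blast
    qed
    let ?y = "sqrt (real n) *\<^sub>R estimation_error \<theta> n \<omega>" and ?U = "score n \<omega>"
    have inv: "invertible (gram n \<omega>)" by (rule \<rho>(2)[OF g])
    have "norm (?y - matrix_inv G *v ?U) \<le> 1 * norm ?U"
      by (rule \<rho>(3)[OF g gram_estimation_error[OF n inv]])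
    moreover have "norm ?y \<le> norm (?y - matrix_inv G *v ?U) + norm (matrix_inv G *v ?U)"
      using norm_triangle_ineq[of "?y - matrix_inv G *v ?U" "matrix_inv G *v ?U"] by simp
    ultimately have "norm ?y \<le> (b + 1) * norm ?U"
      using b(2)[of ?U] unfolding distrib_right by linarith
    with inv show ?thesis by blast
  qed
  show ?thesis
  proof (rule exI[of _ "max m1 m2"], intro allI impI)
    fix m assume m: "m \<ge> max m1 m2"
    show "\<exists>n0. \<forall>n\<ge>n0. \<exists>Q\<in>borel_measurable M. (\<forall>\<omega>. 0 \<le> Q \<omega>) \<and> expectation (\<lambda>\<omega>. min 1 (Q \<omega>)) \<le> \<delta> \<and>
     (\<forall>\<omega>\<in>space M. 1 \<le> Q \<omega> \<or> (\<forall>t\<in>{0..1}. \<forall>j.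
        \<bar>proc \<theta> n j t \<omega> - dyadic_interpolation m (\<lambda>t. proc \<theta> n j t \<omega>) t\<bar> \<le> Q \<omega>))"
    proof (intro exI[of _ "max n1 1"] allI impI)
      fix n assume "n \<ge> max n1 1"
      then have n: "n > 0" "n \<ge> n1" by auto
      let ?g = "\<lambda>e. min 1 (R m n e)"
      have gm: "?g \<in> borel_measurable (PiM UNIV (\<lambda>_. borel))" using Rm by (intro borel_measurable_min) auto
      have g1: "\<bar>?g e\<bar> \<le> 1" for e using R0[of m n e] by simp
      let ?\<epsilon> = "\<lambda>j \<omega> i. \<epsilon> (sort_perm n (\<lambda>i. X i \<omega> $ j) i) \<omega>"
      note gj = sorted_errors_expectation[OF gm g1, of n]
      \<comment> \<open>The errors sorted by one column are distributed as the unsorted ones, but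
        this says nothing jointly over columns. Only expectations are used, so a sum over
        \<open>j\<close> suffices.\<close>
      define W where "W \<omega> = (\<Sum>j\<in>UNIV. ?g (?\<epsilon> j \<omega>)) + q m * norm (score n \<omega>)" for \<omega>
      define Q where "Q \<omega> = W \<omega> + indicator (E n) \<omega>" for \<omega>
      have ig: "integrable M (\<lambda>\<omega>. ?g (?\<epsilon> j \<omega>))" for j
        by (rule integrable_const_bound[where B=1, OF _ gj(1)]) (use g1 in simp)
      have iW: "integrable M W"
        unfolding W_def by (intro Bochner_Integration.integrable_add Bochner_Integration.integrable_sum ig integrable_mult_right score_bounded)
      have Wm: "W \<in> borel_measurable M" using iW by simp
      have Qm: "Q \<in> borel_measurable M"
        unfolding Q_def by (intro borel_measurable_add Wm borel_measurable_indicator E)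
      have g0: "0 \<le> ?g e" for e using R0[of m n e] by simp
      have W0: "0 \<le> W \<omega>" for \<omega> unfolding W_def by (intro add_nonneg_nonneg sum_nonneg g0 mult_nonneg_nonneg q0) simp
      have Q0: "0 \<le> Q \<omega>" for \<omega> using W0[of \<omega>] by (simp add: Q_def)
      have EW: "expectation W \<le> 2 * \<delta> / 3"
      proof -
        have "expectation W = (\<Sum>j\<in>(UNIV::'d set). expectation (\<lambda>\<omega>. ?g (?\<epsilon> j \<omega>))) + q m * expectation (\<lambda>\<omega>. norm (score n \<omega>))"
          unfolding W_def
          by (subst Bochner_Integration.integral_add)
            (simp_all add: Bochner_Integration.integral_sum ig score_bounded Bochner_Integration.integrable_sum)
        also have "\<dots> \<le> (\<Sum>j\<in>(UNIV::'d set). \<delta> / (3 * d)) + q m * C"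
          unfolding gj(2) C_def using RE[of m n] m n q0 score_bounded(2)
          by (intro add_mono sum_mono mult_left_mono) auto
        also have "\<dots> \<le> \<delta> / 3 + \<delta> / 3" using m2[of m] m d by (simp add: d_def)
        finally show ?thesis by simp
      qed
      have EQ: "expectation (\<lambda>\<omega>. min 1 (Q \<omega>)) \<le> \<delta>"
      proof -
        have "expectation (\<lambda>\<omega>. min 1 (Q \<omega>)) = expectation (\<lambda>\<omega>. min 1 \<bar>Q \<omega>\<bar>)" using Q0 by simp
        also have "\<dots> \<le> prob (E n) + expectation W"
          by (rule expectation_min_le_off_event[OF Qm E(1) iW W0]) (use W0 in \<open>simp add: Q_def\<close>)
        finally show ?thesis using EW n1[OF n(2)] by linarith
      qed
      have "1 \<le> Q \<omega> \<or> (\<forall>t\<in>{0..1}. \<forall>j. \<bar>proc \<theta> n j t \<omega> - dyadic_interpolation m (\<lambda>t. proc \<theta> n j t \<omega>) t\<bar> \<le> Q \<omega>)"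
        if w: "\<omega> \<in> space M" for \<omega>
      proof (cases "1 \<le> Q \<omega>")
        case False
        then have wE: "\<omega> \<notin> E n" using W0[of \<omega>] by (auto simp: Q_def)
        then have QW: "Q \<omega> = W \<omega>" by (simp add: Q_def)
        have "\<bar>proc \<theta> n j t \<omega> - dyadic_interpolation m (\<lambda>t. proc \<theta> n j t \<omega>) t\<bar> \<le> Q \<omega>" if t: "t \<in> {0..1}" for t j
        proof -
          have "?g (?\<epsilon> j \<omega>) \<le> (\<Sum>j\<in>UNIV. ?g (?\<epsilon> j \<omega>))"
            by (rule member_le_sum[of j UNIV "\<lambda>j. ?g (?\<epsilon> j \<omega>)"]) (use g0 in auto)
          then have le: "?g (?\<epsilon> j \<omega>) + q m * norm (score n \<omega>) \<le> W \<omega>" unfolding W_def by linarith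
          moreover have "0 \<le> q m * norm (score n \<omega>)" using q0 by simp
          \<comment> \<open>Below 1 the cut in \<open>?g\<close> is inactive, so it is a genuine
            bound for the error walk.\<close>
          ultimately have "?g (?\<epsilon> j \<omega>) < 1" using False QW by linarith
          then have "R m n (?\<epsilon> j \<omega>) = ?g (?\<epsilon> j \<omega>)" by linarith
          then have "\<bar>proc \<theta> n j t \<omega> - dyadic_interpolation m (\<lambda>t. proc \<theta> n j t \<omega>) t\<bar> \<le> ?g (?\<epsilon> j \<omega>) + q m * norm (score n \<omega>)"
            using proc_dyadic_deviation[OF n(1) t conjunct1[OF off[OF n(1) w wE]] conjunct2[OF off[OF n(1) w wE]] Rd[OF t n(1)]]
            unfolding q_def by metis
          then show ?thesis using le QW by linarith
        qed
        then show ?thesis by blast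
      qed simp
      then show "\<exists>Q\<in>borel_measurable M. (\<forall>\<omega>. 0 \<le> Q \<omega>) \<and> expectation (\<lambda>\<omega>. min 1 (Q \<omega>)) \<le> \<delta> \<and>
         (\<forall>\<omega>\<in>space M. 1 \<le> Q \<omega> \<or> (\<forall>t\<in>{0..1}. \<forall>j.
            \<bar>proc \<theta> n j t \<omega> - dyadic_interpolation m (\<lambda>t. proc \<theta> n j t \<omega>) t\<bar> \<le> Q \<omega>))"
        using Qm Q0 EQ by blast
    qed
  qed
qed

end

subsection \<open>Weak convergence of paths\<close>

text \<open>Unlike \<open>path_nodes\<close> it never evaluates a path outside the unit interval, so
  every coordinate is measurable when only the variables at times in [0,1] are.\<close>

definition unit_nodes :: "nat \<Rightarrow> (real \<Rightarrow> real^'d) \<Rightarrow> nat \<times> 'd \<Rightarrow> real" where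
  "unit_nodes m y i = (if fst i \<le> 2 ^ m then y (real (fst i) / 2 ^ m) $ snd i else 0)"

lemma unit_node_in: "k \<le> 2 ^ m \<Longrightarrow> real k / 2 ^ m \<in> {0..1}"
  using of_nat_le_iff[of k "2 ^ m", where 'a=real] by simp

lemma unit_nodes_cong:
  assumes "\<And>t. t \<in> {0..1} \<Longrightarrow> y t = y' t" shows "unit_nodes m y = unit_nodes m y'"
proof
  fix i show "unit_nodes m y i = unit_nodes m y' i"
    using assms[OF unit_node_in, of "fst i" m] by (simp add: unit_nodes_def)
qed

lemma polygon_cong:
  assumes "\<And>k j. k \<le> 2 ^ m \<Longrightarrow> x (k, j) = y (k, j)"
  shows "polygon m x = polygon m (y :: nat \<times> 'd::finite \<Rightarrow> real)"
proof -
  have "piecewise_linear (2 ^ m) (\<lambda>k. x (k, j)) t = piecewise_linear (2 ^ m) (\<lambda>k. y (k, j)) t" if t: "t \<in> {0..1}" for t j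
    using piecewise_linear_diff_le[of t "2 ^ m" "\<lambda>k. x (k, j) - y (k, j)" 0 0] t assms
    by (simp add: piecewise_linear_diff)
  then show ?thesis by (auto simp: polygon_def restrict_def fun_eq_iff vec_eq_iff)
qed

lemma polygon_unit_nodes: "polygon m (unit_nodes m y) = polygon m (path_nodes m y)"
  by (rule polygon_cong) (simp add: unit_nodes_def path_nodes_def)

lemma polygon_dist_path_of_le:
  fixes Y :: "real \<Rightarrow> 'w \<Rightarrow> real^'d"
  assumes c: "continuous_on {0..1} (\<lambda>t. Y t \<omega>)"
    and q: "\<And>t j. t \<in> {0..1} \<Longrightarrow> \<bar>Y t \<omega> $ j - dyadic_interpolation m (\<lambda>t. Y t \<omega> $ j) t\<bar> \<le> q"
  shows "mdist path_metric (path_of Y \<omega>) (polygon m (unit_nodes m (\<lambda>t. Y t \<omega>))) \<le> real CARD('d) * q"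
proof -
  have "norm (path_of Y \<omega> t - polygon m (unit_nodes m (\<lambda>t. Y t \<omega>)) t) \<le> real CARD('d) * q" if t: "t \<in> {0..1}" for t
    using norm_vec_le[of "path_of Y \<omega> t - polygon m (unit_nodes m (\<lambda>t. Y t \<omega>)) t" "\<lambda>_. q"] q[OF t] t
    by (simp add: polygon_unit_nodes polygon_path_nodes path_of_def)
  then show ?thesis
    by (simp add: path_mdist_le[OF path_of_in_mspace[where Z=Y, OF c] polygon_in_mspace] del: atLeastAtMost_iff)
qed

context
  fixes f :: "(real \<Rightarrow> real^'d) \<Rightarrow> real" and B K :: real
  assumes f_bound: "\<And>x. x \<in> mspace path_metric \<Longrightarrow> \<bar>f x\<bar> \<le> B" and K_nonneg: "K \<ge> 0"
    and f_Lipschitz: "\<And>x y. x \<in> mspace path_metric \<Longrightarrow> y \<in> mspace path_metric \<Longrightarrow> \<bar>f x - f y\<bar> \<le> K * mdist path_metric x y"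
begin

text \<open>For \<open>q \<ge> 1\<close> boundedness of \<open>f\<close> is used, for
  \<open>q < 1\<close> its Lipschitz constant; together they reduce differences of expectations to
  \<open>E min 1 Q\<close>.\<close>

lemma Lipschitz_diff_le_min:
  assumes x: "x \<in> mspace path_metric" and y: "y \<in> mspace path_metric" and q: "q \<ge> 0"
    and le: "1 \<le> q \<or> mdist path_metric x y \<le> real CARD('d) * q"
  shows "\<bar>f x - f y\<bar> \<le> (2 * B + K * real CARD('d)) * min 1 q"
proof -
  have B: "0 \<le> B" using f_bound[OF x] by linarith
  have d: "\<bar>f x - f y\<bar> \<le> 2 * B" using f_bound[OF x] f_bound[OF y] by linarith
  have Kd: "0 \<le> K * real CARD('d)" using K_nonneg by simp
  show ?thesis
  proof (cases "1 \<le> q")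
    case True then show ?thesis using d Kd by simp
  next
    case False
    then have "\<bar>f x - f y\<bar> \<le> K * (real CARD('d) * q)"
      using le f_Lipschitz[OF x y] mult_left_mono[OF _ K_nonneg, of "mdist path_metric x y" "real CARD('d) * q"] by linarith
    also have "\<dots> \<le> (2 * B + K * real CARD('d)) * q" using B q by (simp add: distrib_right)
    finally show ?thesis using False by simp
  qed
qed

lemma polygon_function_diff_le:
  "\<bar>f (polygon m x) - f (polygon m y)\<bar> \<le> K * (real CARD('d) * (\<Sum>i\<in>{..2 ^ m} \<times> UNIV. \<bar>x i - y i\<bar>))"
  (is "_ \<le> K * (_ * ?S)")
proof -
  have "\<bar>x (k, j) - y (k, j)\<bar> \<le> ?S" if "k \<le> 2 ^ m" for k j
    using that by (intro member_le_sum[of "(k, j)" _ "\<lambda>i. \<bar>x i - y i\<bar>"]) auto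
  then have "mdist path_metric (polygon m x) (polygon m y) \<le> real CARD('d) * ?S" by (rule polygon_dist_le)
  then have "K * mdist path_metric (polygon m x) (polygon m y) \<le> K * (real CARD('d) * ?S)"
    by (rule mult_left_mono[OF _ K_nonneg])
  then show ?thesis using f_Lipschitz[OF polygon_in_mspace polygon_in_mspace, of m x m y] by linarith
qed

text \<open>The functional of a polygon depends on finitely many nodes in a Lipschitz way, hence
  continuously in the product topology.\<close>

lemma polygon_function_continuous: "continuous_on UNIV (\<lambda>x. f (polygon m x))"
  unfolding continuous_on_def
proof
  fix x :: "nat \<times> 'd \<Rightarrow> real"
  have "continuous_on UNIV (\<lambda>y. K * (real CARD('d) * (\<Sum>i\<in>{..2 ^ m} \<times> (UNIV::'d set). \<bar>y i - x i\<bar>)))"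
    by (intro continuous_intros continuous_on_product_coordinates)
  then have "((\<lambda>y. K * (real CARD('d) * (\<Sum>i\<in>{..2 ^ m} \<times> (UNIV::'d set). \<bar>y i - x i\<bar>)))
      \<longlongrightarrow> K * (real CARD('d) * (\<Sum>i\<in>{..2 ^ m} \<times> (UNIV::'d set). \<bar>x i - x i\<bar>))) (at x)"
    unfolding continuous_on_def by blast
  then have "((\<lambda>y. K * (real CARD('d) * (\<Sum>i\<in>{..2 ^ m} \<times> (UNIV::'d set). \<bar>y i - x i\<bar>))) \<longlongrightarrow> 0) (at x)" by simp
  moreover have "\<forall>\<^sub>F y in at x. norm (f (polygon m y) - f (polygon m x)) \<le> K * (real CARD('d) * (\<Sum>i\<in>{..2 ^ m} \<times> (UNIV::'d set). \<bar>y i - x i\<bar>))"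
    unfolding real_norm_def by (intro always_eventually allI polygon_function_diff_le)
  ultimately have "((\<lambda>y. f (polygon m y) - f (polygon m x)) \<longlongrightarrow> 0) (at x)" by (rule Lim_null_comparison[rotated])
  then show "((\<lambda>x. f (polygon m x)) \<longlongrightarrow> f (polygon m x)) (at x)" by (rule LIM_zero_cancel)
qed

lemma polygon_function_measurable:
  assumes "\<And>t. t \<in> {0..1} \<Longrightarrow> Y t \<in> borel_measurable M"
  shows "(\<lambda>\<omega>. f (polygon m (unit_nodes m (\<lambda>t. Y t \<omega>)))) \<in> borel_measurable M"
proof -
  have "(\<lambda>\<omega>. unit_nodes m (\<lambda>t. Y t \<omega>) i) \<in> borel_measurable M" for i
    unfolding unit_nodes_def using vec_nth_measurable[OF assms[OF unit_node_in]] by (cases "fst i \<le> 2 ^ m") auto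
  then have "(\<lambda>\<omega>. unit_nodes m (\<lambda>t. Y t \<omega>)) \<in> borel_measurable M"
    by (rule measurable_coordinatewise_then_product)
  from measurable_compose[OF this borel_measurable_continuous_onI[OF polygon_function_continuous[of m]]] show ?thesis .
qed

lemma path_function_measurable:
  assumes "\<And>t. t \<in> {0..1} \<Longrightarrow> Y t \<in> borel_measurable M" and "\<And>\<omega>. \<omega> \<in> space M \<Longrightarrow> continuous_on {0..1} (\<lambda>t. Y t \<omega>)"
  shows "(\<lambda>\<omega>. f (path_of Y \<omega>)) \<in> borel_measurable M"
proof -
  have "continuous_map (mtopology_of path_metric) euclideanreal f"
    by (rule Lipschitz_imp_continuous_map_real[OF f_Lipschitz])
  from measurable_compose[OF path_of_measurable[OF assms] continuous_map_borel_measurable[OF this]] show ?thesis .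
qed

lemma polygon_expectation_tendsto:
  assumes "prob_space N"
    and Zm: "\<And>t. t \<in> {0..1} \<Longrightarrow> Z t \<in> borel_measurable N" and Zc: "\<And>\<omega>. \<omega> \<in> space N \<Longrightarrow> continuous_on {0..1} (\<lambda>t. Z t \<omega>)"
  shows "(\<lambda>m. integral\<^sup>L N (\<lambda>\<omega>. f (polygon m (unit_nodes m (\<lambda>t. Z t \<omega>))))) \<longlonglongrightarrow> integral\<^sup>L N (\<lambda>\<omega>. f (path_of Z \<omega>))"
proof (rule integral_dominated_convergence[where w="\<lambda>_. B"])
  interpret N: prob_space N by fact
  show "integrable N (\<lambda>_. B)" by simp
  show "(\<lambda>\<omega>. f (path_of Z \<omega>)) \<in> borel_measurable N" by (rule path_function_measurable[OF Zm Zc])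
  show "(\<lambda>\<omega>. f (polygon m (unit_nodes m (\<lambda>t. Z t \<omega>)))) \<in> borel_measurable N" for m
    by (rule polygon_function_measurable[OF Zm])
  show "AE \<omega> in N. norm (f (polygon m (unit_nodes m (\<lambda>t. Z t \<omega>)))) \<le> B" for m
    using f_bound[OF polygon_in_mspace] by simp
  show "AE \<omega> in N. (\<lambda>m. f (polygon m (unit_nodes m (\<lambda>t. Z t \<omega>)))) \<longlonglongrightarrow> f (path_of Z \<omega>)"
  proof (rule AE_I2)
    fix \<omega> assume w: "\<omega> \<in> space N"
    have z: "path_of Z \<omega> \<in> mspace path_metric" by (rule path_of_in_mspace[where Z=Z, OF Zc[OF w]])
    have eq: "unit_nodes m (\<lambda>t. Z t \<omega>) = unit_nodes m (path_of Z \<omega>)" for m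
      by (rule unit_nodes_cong) (simp add: path_of_def)
    show "(\<lambda>m. f (polygon m (unit_nodes m (\<lambda>t. Z t \<omega>)))) \<longlonglongrightarrow> f (path_of Z \<omega>)"
    proof (rule LIMSEQ_I)
      fix e :: real assume e: "e > 0"
      have K1: "K + 1 > 0" using K_nonneg by linarith
      then have "e / (K + 1) > 0" using e by simp
      from polygon_tendsto[OF z this] obtain m where
        m: "\<And>m'. m' \<ge> m \<Longrightarrow> mdist path_metric (polygon m' (path_nodes m' (path_of Z \<omega>))) (path_of Z \<omega>) \<le> e / (K + 1)" by metis
      have "norm (f (polygon m' (unit_nodes m' (\<lambda>t. Z t \<omega>))) - f (path_of Z \<omega>)) < e" if "m' \<ge> m" for m'
      proof -
        have "\<bar>f (polygon m' (path_nodes m' (path_of Z \<omega>))) - f (path_of Z \<omega>)\<bar> \<le> K * (e / (K + 1))"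
          using f_Lipschitz[OF polygon_in_mspace z] mult_left_mono[OF m[OF that] K_nonneg] by (rule order_trans)
        also have "\<dots> < e" using e K1 by (simp add: field_simps)
        finally show ?thesis unfolding eq polygon_unit_nodes by simp
      qed
      then show "\<exists>no. \<forall>n\<ge>no. norm (f (polygon n (unit_nodes n (\<lambda>t. Z t \<omega>))) - f (path_of Z \<omega>)) < e" by blast
    qed
  qed
qed

text \<open>At a fixed level there are finitely many nodes, and the sum of the node differences
  bounds the polygon distance. Closeness in probability at each fixed time is therefore
  enough.\<close>

lemma polygon_expectation_diff_tendsto:
  fixes Y W :: "nat \<Rightarrow> real \<Rightarrow> 'w \<Rightarrow> real^'d"
  assumes "prob_space M"
    and Ym: "\<And>n t. t \<in> {0..1} \<Longrightarrow> Y n t \<in> borel_measurable M" and Wm: "\<And>n t. t \<in> {0..1} \<Longrightarrow> W n t \<in> borel_measurable M"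
    and close: "\<And>t j. t \<in> {0..1} \<Longrightarrow> prob_space.negligible_sequence M (\<lambda>n \<omega>. W n t \<omega> $ j - Y n t \<omega> $ j)"
  shows "(\<lambda>n. integral\<^sup>L M (\<lambda>\<omega>. f (polygon m (unit_nodes m (\<lambda>t. W n t \<omega>))))
      - integral\<^sup>L M (\<lambda>\<omega>. f (polygon m (unit_nodes m (\<lambda>t. Y n t \<omega>))))) \<longlonglongrightarrow> 0"
proof -
  interpret M: prob_space M by fact
  define D where "D n \<omega> = (\<Sum>i\<in>{..2 ^ m} \<times> (UNIV::'d set). \<bar>W n (real (fst i) / 2 ^ m) \<omega> $ snd i - Y n (real (fst i) / 2 ^ m) \<omega> $ snd i\<bar>)" for n \<omega>
  have "M.negligible_sequence D" unfolding D_def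
  proof (rule M.negligible_sum)
    fix i :: "nat \<times> 'd" assume "i \<in> {..2 ^ m} \<times> (UNIV::'d set)"
    then have "real (fst i) / 2 ^ m \<in> {0..1}" by (intro unit_node_in) auto
    from close[OF this, of "snd i"] show "M.negligible_sequence (\<lambda>n \<omega>. \<bar>W n (real (fst i) / 2 ^ m) \<omega> $ snd i - Y n (real (fst i) / 2 ^ m) \<omega> $ snd i\<bar>)"
      by (auto simp: M.negligible_sequence_def intro!: borel_measurable_abs)
  qed
  then have Dm: "D n \<in> borel_measurable M" and DE: "(\<lambda>n. M.expectation (\<lambda>\<omega>. min 1 \<bar>D n \<omega>\<bar>)) \<longlonglongrightarrow> 0" for n
    by (auto simp: M.negligible_sequence_def)
  let ?c = "2 * B + K * real CARD('d)"
  show ?thesis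
  proof (rule Lim_null_comparison)
    show "(\<lambda>n. ?c * M.expectation (\<lambda>\<omega>. min 1 \<bar>D n \<omega>\<bar>)) \<longlonglongrightarrow> 0"
      using tendsto_mult_left[OF DE, of ?c] by simp
    show "\<forall>\<^sub>F n in sequentially. norm (integral\<^sup>L M (\<lambda>\<omega>. f (polygon m (unit_nodes m (\<lambda>t. W n t \<omega>))))
      - integral\<^sup>L M (\<lambda>\<omega>. f (polygon m (unit_nodes m (\<lambda>t. Y n t \<omega>))))) \<le> ?c * M.expectation (\<lambda>\<omega>. min 1 \<bar>D n \<omega>\<bar>)"
    proof (intro always_eventually allI)
      fix n
      let ?w = "\<lambda>\<omega>. f (polygon m (unit_nodes m (\<lambda>t. W n t \<omega>)))" and ?y = "\<lambda>\<omega>. f (polygon m (unit_nodes m (\<lambda>t. Y n t \<omega>)))"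
      have iw: "integrable M ?w" "integrable M ?y"
        using f_bound[OF polygon_in_mspace]
        by (auto intro!: M.integrable_const_bound[of _ B] polygon_function_measurable Wm Ym)
      have D0: "D n \<omega> \<ge> 0" for \<omega> unfolding D_def by (intro sum_nonneg) auto
      have "\<bar>?w \<omega> - ?y \<omega>\<bar> \<le> ?c * min 1 \<bar>D n \<omega>\<bar>" for \<omega>
      proof -
        have "\<bar>unit_nodes m (\<lambda>t. W n t \<omega>) (k, j) - unit_nodes m (\<lambda>t. Y n t \<omega>) (k, j)\<bar> \<le> D n \<omega>" if "k \<le> 2 ^ m" for k j
          using that member_le_sum[of "(k, j)" "{..2 ^ m} \<times> (UNIV::'d set)" "\<lambda>i. \<bar>W n (real (fst i) / 2 ^ m) \<omega> $ snd i - Y n (real (fst i) / 2 ^ m) \<omega> $ snd i\<bar>"]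
          by (simp add: unit_nodes_def D_def)
        from Lipschitz_diff_le_min[OF polygon_in_mspace polygon_in_mspace D0[of \<omega>] disjI2[OF polygon_dist_le[where x="unit_nodes m (\<lambda>t. W n t \<omega>)" and y="unit_nodes m (\<lambda>t. Y n t \<omega>)", OF this]]]
        show ?thesis using D0[of \<omega>] by simp
      qed
      then have "M.expectation (\<lambda>\<omega>. \<bar>?w \<omega> - ?y \<omega>\<bar>) \<le> M.expectation (\<lambda>\<omega>. ?c * min 1 \<bar>D n \<omega>\<bar>)"
        using iw by (intro integral_mono integrable_abs Bochner_Integration.integrable_diff integrable_mult_right M.integrable_min_1_abs Dm) auto
      moreover have "norm (integral\<^sup>L M ?w - integral\<^sup>L M ?y) \<le> M.expectation (\<lambda>\<omega>. \<bar>?w \<omega> - ?y \<omega>\<bar>)"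
        unfolding Bochner_Integration.integral_diff[OF iw, symmetric] real_norm_def by (rule integral_abs_bound)
      ultimately show "norm (integral\<^sup>L M ?w - integral\<^sup>L M ?y) \<le> ?c * M.expectation (\<lambda>\<omega>. min 1 \<bar>D n \<omega>\<bar>)" by simp
    qed
  qed
qed

lemma polygon_expectation_close:
  assumes "prob_space M"
    and Ym: "\<And>t. t \<in> {0..1} \<Longrightarrow> Y t \<in> borel_measurable M" and Yc: "\<And>\<omega>. \<omega> \<in> space M \<Longrightarrow> continuous_on {0..1} (\<lambda>t. Y t \<omega>)"
    and Q: "Q \<in> borel_measurable M" "\<And>\<omega>. 0 \<le> Q \<omega>"
    and le: "\<And>\<omega>. \<omega> \<in> space M \<Longrightarrow> 1 \<le> Q \<omega> \<or> (\<forall>t\<in>{0..1}. \<forall>j. \<bar>Y t \<omega> $ j - dyadic_interpolation m (\<lambda>t. Y t \<omega> $ j) t\<bar> \<le> Q \<omega>)"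
  shows "\<bar>integral\<^sup>L M (\<lambda>\<omega>. f (path_of Y \<omega>)) - integral\<^sup>L M (\<lambda>\<omega>. f (polygon m (unit_nodes m (\<lambda>t. Y t \<omega>))))\<bar>
    \<le> (2 * B + K * real CARD('d)) * integral\<^sup>L M (\<lambda>\<omega>. min 1 (Q \<omega>))"
proof -
  interpret M: prob_space M by fact
  let ?c = "2 * B + K * real CARD('d)"
  let ?y = "\<lambda>\<omega>. f (path_of Y \<omega>)" and ?p = "\<lambda>\<omega>. f (polygon m (unit_nodes m (\<lambda>t. Y t \<omega>)))"
  have iy: "integrable M ?y"
    using f_bound[OF path_of_in_mspace[where Z=Y, OF Yc]] by (auto intro!: M.integrable_const_bound[of _ B] path_function_measurable Ym Yc)
  have ip: "integrable M ?p"
    using f_bound[OF polygon_in_mspace] by (auto intro!: M.integrable_const_bound[of _ B] polygon_function_measurable Ym)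
  have iQ: "integrable M (\<lambda>\<omega>. min 1 (Q \<omega>))" using M.integrable_min_1_abs[OF Q(1)] Q(2) by simp
  have "\<bar>?y \<omega> - ?p \<omega>\<bar> \<le> ?c * min 1 (Q \<omega>)" if w: "\<omega> \<in> space M" for \<omega>
    by (rule Lipschitz_diff_le_min[OF path_of_in_mspace[where Z=Y, OF Yc[OF w]] polygon_in_mspace Q(2)])
      (use le[OF w] polygon_dist_path_of_le[where Y=Y, OF Yc[OF w], of m "Q \<omega>"] in blast)
  then have "M.expectation (\<lambda>\<omega>. \<bar>?y \<omega> - ?p \<omega>\<bar>) \<le> M.expectation (\<lambda>\<omega>. ?c * min 1 (Q \<omega>))"
    using iy ip iQ by (intro integral_mono integrable_abs Bochner_Integration.integrable_diff integrable_mult_right) auto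
  moreover have "\<bar>integral\<^sup>L M ?y - integral\<^sup>L M ?p\<bar> \<le> M.expectation (\<lambda>\<omega>. \<bar>?y \<omega> - ?p \<omega>\<bar>)"
    unfolding Bochner_Integration.integral_diff[OF iy ip, symmetric] by (rule integral_abs_bound)
  ultimately show ?thesis by simp
qed

lemma polygon_expectation_limit:
  fixes W :: "nat \<Rightarrow> real \<Rightarrow> 'v \<Rightarrow> real^'d" and Z :: "real \<Rightarrow> 'w \<Rightarrow> real^'d"
  assumes "prob_space M" "prob_space N"
    and Wm: "\<And>n t. t \<in> {0..1} \<Longrightarrow> W n t \<in> borel_measurable M" and Zm: "\<And>t. t \<in> {0..1} \<Longrightarrow> Z t \<in> borel_measurable N"
    and W2: "\<And>n t j. t \<in> {0..1} \<Longrightarrow> integrable M (\<lambda>\<omega>. (W n t \<omega> $ j)\<^sup>2)" "\<And>n t j. t \<in> {0..1} \<Longrightarrow> integral\<^sup>L M (\<lambda>\<omega>. (W n t \<omega> $ j)\<^sup>2) \<le> C"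
    and Z2: "\<And>t j. t \<in> {0..1} \<Longrightarrow> integrable N (\<lambda>\<omega>. (Z t \<omega> $ j)\<^sup>2)" "\<And>t j. t \<in> {0..1} \<Longrightarrow> integral\<^sup>L N (\<lambda>\<omega>. (Z t \<omega> $ j)\<^sup>2) \<le> C"
    and fdd: "\<And>A c t j b. finite A \<Longrightarrow> (\<And>i :: nat \<times> 'd. t i \<in> {0..1}) \<Longrightarrow>
        (\<lambda>n. integral\<^sup>L M (\<lambda>\<omega>. cos ((\<Sum>i\<in>A. c i * W n (t i) \<omega> $ j i) + b)))
          \<longlonglongrightarrow> integral\<^sup>L N (\<lambda>\<omega>. cos ((\<Sum>i\<in>A. c i * Z (t i) \<omega> $ j i) + b))"
  shows "(\<lambda>n. integral\<^sup>L M (\<lambda>\<omega>. f (polygon m (unit_nodes m (\<lambda>t. W n t \<omega>)))))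
    \<longlonglongrightarrow> integral\<^sup>L N (\<lambda>\<omega>. f (polygon m (unit_nodes m (\<lambda>t. Z t \<omega>))))"
proof -
  define J where "J = {..2 ^ m :: nat} \<times> (UNIV :: 'd set)"
  \<comment> \<open>Indices beyond the last node get time 0, because \<open>fdd\<close> asks for
    times in the unit interval at all indices.\<close>
  define \<tau> where "\<tau> i = (if fst i \<le> 2 ^ m then real (fst i) / 2 ^ m else 0)" for i :: "nat \<times> 'd"
  have \<tau>: "\<tau> i \<in> {0..1}" for i unfolding \<tau>_def using unit_node_in[of "fst i" m] by auto
  have J: "unit_nodes m y i = y (\<tau> i) $ snd i" if "i \<in> J" for y i
    using that by (auto simp: J_def unit_nodes_def \<tau>_def)
  have um: "(\<lambda>\<omega>. unit_nodes m (\<lambda>t. W n t \<omega>) i) \<in> borel_measurable M" for n i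
    unfolding unit_nodes_def using vec_nth_measurable[OF Wm[OF unit_node_in]] by (cases "fst i \<le> 2 ^ m") auto
  have vm: "(\<lambda>\<omega>. unit_nodes m (\<lambda>t. Z t \<omega>) i) \<in> borel_measurable N" for i
    unfolding unit_nodes_def using vec_nth_measurable[OF Zm[OF unit_node_in]] by (cases "fst i \<le> 2 ^ m") auto
  show ?thesis
  proof (rule finite_dimensional_convergence[OF assms(1,2) _ um vm, where J=J and C=C and F="\<lambda>x. f (polygon m x)"])
    show "finite J" by (simp add: J_def)
    fix i assume i: "i \<in> J"
    show "integrable M (\<lambda>\<omega>. (unit_nodes m (\<lambda>t. W n t \<omega>) i)\<^sup>2)" "integral\<^sup>L M (\<lambda>\<omega>. (unit_nodes m (\<lambda>t. W n t \<omega>) i)\<^sup>2) \<le> C" for n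
      unfolding J[OF i] by (intro W2 \<tau>)+
    show "integrable N (\<lambda>\<omega>. (unit_nodes m (\<lambda>t. Z t \<omega>) i)\<^sup>2)" "integral\<^sup>L N (\<lambda>\<omega>. (unit_nodes m (\<lambda>t. Z t \<omega>) i)\<^sup>2) \<le> C"
      unfolding J[OF i] by (intro Z2 \<tau>)+
  next
    fix c b
    show "(\<lambda>n. integral\<^sup>L M (\<lambda>\<omega>. cos ((\<Sum>i\<in>J. c i * unit_nodes m (\<lambda>t. W n t \<omega>) i) + b)))
         \<longlonglongrightarrow> integral\<^sup>L N (\<lambda>\<omega>. cos ((\<Sum>i\<in>J. c i * unit_nodes m (\<lambda>t. Z t \<omega>) i) + b))"
      using fdd[of J \<tau> c snd b, OF _ \<tau>] by (simp add: J J_def[symmetric] cong: sum.cong) (simp add: J_def)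
  next
    show "continuous_on UNIV (\<lambda>x. f (polygon m x))" by (rule polygon_function_continuous)
    show "\<bar>f (polygon m x)\<bar> \<le> B" for x by (rule f_bound[OF polygon_in_mspace])
    fix x y :: "nat \<times> 'd \<Rightarrow> real" assume "\<And>i. i \<in> J \<Longrightarrow> x i = y i"
    then have "polygon m x = polygon m y" by (intro polygon_cong) (auto simp: J_def)
    then show "f (polygon m x) = f (polygon m y)" by simp
  qed
qed

end

text \<open>Four comparisons, each worth \<open>e/4\<close>: path of \<open>Y\<close> with its
  polygon (modulus), polygon of \<open>Y\<close> with polygon of \<open>W\<close> (closeness at
  nodes), polygon of \<open>W\<close> with polygon of \<open>Z\<close> (finite-dimensional limit),
  polygon of \<open>Z\<close> with its path. The auxiliary \<open>W\<close> carries the second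
  moments, which are not asked of \<open>Y\<close>.\<close>

theorem path_convergence:
  fixes Y W :: "nat \<Rightarrow> real \<Rightarrow> 'v \<Rightarrow> real^'d" and Z :: "real \<Rightarrow> 'w \<Rightarrow> real^'d"
  assumes "prob_space M" "prob_space N"
    and Ym: "\<And>n t. t \<in> {0..1} \<Longrightarrow> Y n t \<in> borel_measurable M" and Yc: "\<And>n \<omega>. \<omega> \<in> space M \<Longrightarrow> continuous_on {0..1} (\<lambda>t. Y n t \<omega>)"
    and Wm: "\<And>n t. t \<in> {0..1} \<Longrightarrow> W n t \<in> borel_measurable M"
    and Zm: "\<And>t. t \<in> {0..1} \<Longrightarrow> Z t \<in> borel_measurable N" and Zc: "\<And>\<omega>. \<omega> \<in> space N \<Longrightarrow> continuous_on {0..1} (\<lambda>t. Z t \<omega>)"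
    and W2: "\<And>n t j. t \<in> {0..1} \<Longrightarrow> integrable M (\<lambda>\<omega>. (W n t \<omega> $ j)\<^sup>2)" "\<And>n t j. t \<in> {0..1} \<Longrightarrow> integral\<^sup>L M (\<lambda>\<omega>. (W n t \<omega> $ j)\<^sup>2) \<le> C"
    and Z2: "\<And>t j. t \<in> {0..1} \<Longrightarrow> integrable N (\<lambda>\<omega>. (Z t \<omega> $ j)\<^sup>2)" "\<And>t j. t \<in> {0..1} \<Longrightarrow> integral\<^sup>L N (\<lambda>\<omega>. (Z t \<omega> $ j)\<^sup>2) \<le> C"
    and fdd: "\<And>A c t j b. finite A \<Longrightarrow> (\<And>i :: nat \<times> 'd. t i \<in> {0..1}) \<Longrightarrow>
        (\<lambda>n. integral\<^sup>L M (\<lambda>\<omega>. cos ((\<Sum>i\<in>A. c i * W n (t i) \<omega> $ j i) + b)))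
          \<longlonglongrightarrow> integral\<^sup>L N (\<lambda>\<omega>. cos ((\<Sum>i\<in>A. c i * Z (t i) \<omega> $ j i) + b))"
    and close: "\<And>t j. t \<in> {0..1} \<Longrightarrow> prob_space.negligible_sequence M (\<lambda>n \<omega>. W n t \<omega> $ j - Y n t \<omega> $ j)"
    and modulus: "\<And>\<delta>. \<delta> > 0 \<Longrightarrow> \<exists>m0. \<forall>m\<ge>m0. \<exists>n0. \<forall>n\<ge>n0. \<exists>Q\<in>borel_measurable M.
       (\<forall>\<omega>. 0 \<le> Q \<omega>) \<and> integral\<^sup>L M (\<lambda>\<omega>. min 1 (Q \<omega>)) \<le> \<delta> \<and>
       (\<forall>\<omega>\<in>space M. 1 \<le> Q \<omega> \<or> (\<forall>t\<in>{0..1}. \<forall>j.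
          \<bar>Y n t \<omega> $ j - dyadic_interpolation m (\<lambda>t. Y n t \<omega> $ j) t\<bar> \<le> Q \<omega>))"
  shows "converges_in_distribution (mtopology_of path_metric) M (\<lambda>n. path_of (Y n)) N (path_of Z)"
proof (rule converges_in_distributionI_Lipschitz[OF assms(1,2)])
  show "path_of (Y n) \<in> measurable M (borel_of_topology (mtopology_of path_metric))" for n
    by (rule path_of_measurable) (rule Ym Yc; assumption)+
  show "path_of Z \<in> measurable N (borel_of_topology (mtopology_of path_metric))"
    by (rule path_of_measurable) (rule Zm Zc; assumption)+
  fix f :: "(real \<Rightarrow> real^'d) \<Rightarrow> real" and B K :: real
  assume fb: "\<And>x. x \<in> mspace path_metric \<Longrightarrow> \<bar>f x\<bar> \<le> B" and K: "K \<ge> 0"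
    and fl: "\<And>x y. x \<in> mspace path_metric \<Longrightarrow> y \<in> mspace path_metric \<Longrightarrow> \<bar>f x - f y\<bar> \<le> K * mdist path_metric x y"
  note f = fb K fl
  let ?Y = "\<lambda>n. integral\<^sup>L M (\<lambda>\<omega>. f (path_of (Y n) \<omega>))" and ?Z = "integral\<^sup>L N (\<lambda>\<omega>. f (path_of Z \<omega>))"
  let ?PY = "\<lambda>m n. integral\<^sup>L M (\<lambda>\<omega>. f (polygon m (unit_nodes m (\<lambda>t. Y n t \<omega>))))"
  let ?PW = "\<lambda>m n. integral\<^sup>L M (\<lambda>\<omega>. f (polygon m (unit_nodes m (\<lambda>t. W n t \<omega>))))"
  let ?PZ = "\<lambda>m. integral\<^sup>L N (\<lambda>\<omega>. f (polygon m (unit_nodes m (\<lambda>t. Z t \<omega>))))"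
  show "?Y \<longlonglongrightarrow> ?Z"
  proof (rule LIMSEQ_I)
    fix e :: real assume e: "e > 0"
    define c where "c = 2 * B + K * real CARD('d)"
    have "0 \<le> B" using fb[OF polygon_in_mspace[of 0 "\<lambda>_. 0"]] by linarith
    then have c: "c \<ge> 0" using K by (simp add: c_def)
    \<comment> \<open>\<open>c + 1\<close> instead of \<open>c\<close> covers
      \<open>c = 0\<close>.\<close>
    then have "e / (4 * (c + 1)) > 0" using e by simp
    from modulus[OF this] obtain m0 where m0: "\<forall>m\<ge>m0. \<exists>n0. \<forall>n\<ge>n0. \<exists>Q\<in>borel_measurable M.
       (\<forall>\<omega>. 0 \<le> Q \<omega>) \<and> integral\<^sup>L M (\<lambda>\<omega>. min 1 (Q \<omega>)) \<le> e / (4 * (c + 1)) \<and>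
       (\<forall>\<omega>\<in>space M. 1 \<le> Q \<omega> \<or> (\<forall>t\<in>{0..1}. \<forall>j.
          \<bar>Y n t \<omega> $ j - dyadic_interpolation m (\<lambda>t. Y n t \<omega> $ j) t\<bar> \<le> Q \<omega>))" by blast
    have e4: "e / 4 > 0" using e by simp
    obtain m1 where m1: "\<And>m. m \<ge> m1 \<Longrightarrow> norm (?PZ m - ?Z) < e / 4"
      using LIMSEQ_D[OF polygon_expectation_tendsto[where Z=Z, OF f assms(2) Zm Zc] e4] by blast
    define m where "m = max m0 m1"
    have m: "m \<ge> m0" "m \<ge> m1" by (auto simp: m_def)
    obtain n0 where n0: "\<forall>n\<ge>n0. \<exists>Q\<in>borel_measurable M.
       (\<forall>\<omega>. 0 \<le> Q \<omega>) \<and> integral\<^sup>L M (\<lambda>\<omega>. min 1 (Q \<omega>)) \<le> e / (4 * (c + 1)) \<and>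
       (\<forall>\<omega>\<in>space M. 1 \<le> Q \<omega> \<or> (\<forall>t\<in>{0..1}. \<forall>j.
          \<bar>Y n t \<omega> $ j - dyadic_interpolation m (\<lambda>t. Y n t \<omega> $ j) t\<bar> \<le> Q \<omega>))" using m0 m(1) by blast
    have lim1: "(\<lambda>n. ?PW m n - ?PY m n) \<longlonglongrightarrow> 0"
      by (rule polygon_expectation_diff_tendsto[where W=W and Y=Y, OF f assms(1)]) (assumption | rule Ym Wm close)+
    have lim2: "?PW m \<longlonglongrightarrow> ?PZ m"
      by (rule polygon_expectation_limit[where W=W and Z=Z and C=C, OF f assms(1,2)]) (assumption | rule Wm Zm W2 Z2 fdd)+
    obtain n1 where n1: "\<And>n. n \<ge> n1 \<Longrightarrow> norm (?PW m n - ?PY m n - 0) < e / 4"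
      using LIMSEQ_D[OF lim1 e4] by blast
    obtain n2 where n2: "\<And>n. n \<ge> n2 \<Longrightarrow> norm (?PW m n - ?PZ m) < e / 4"
      using LIMSEQ_D[OF lim2 e4] by blast
    have "norm (?Y n - ?Z) < e" if n: "n \<ge> max n0 (max n1 n2)" for n
    proof -
      have "n \<ge> n0" using n by simp
      from n0[rule_format, OF this] obtain Q where Qm: "Q \<in> borel_measurable M" and Q': "(\<forall>\<omega>. 0 \<le> Q \<omega>) \<and>
        integral\<^sup>L M (\<lambda>\<omega>. min 1 (Q \<omega>)) \<le> e / (4 * (c + 1)) \<and>
        (\<forall>\<omega>\<in>space M. 1 \<le> Q \<omega> \<or> (\<forall>t\<in>{0..1}. \<forall>j. \<bar>Y n t \<omega> $ j - dyadic_interpolation m (\<lambda>t. Y n t \<omega> $ j) t\<bar> \<le> Q \<omega>))"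
        by (rule bexE)
      note Q = Qm conjunct1[OF Q', rule_format] conjunct1[OF conjunct2[OF Q']] bspec[OF conjunct2[OF conjunct2[OF Q']]]
      have "\<bar>?Y n - ?PY m n\<bar> \<le> c * integral\<^sup>L M (\<lambda>\<omega>. min 1 (Q \<omega>))"
        unfolding c_def by (rule polygon_expectation_close[where Y="Y n", OF f assms(1) Ym Yc Q(1,2,4)])
      also have "\<dots> \<le> c * (e / (4 * (c + 1)))" by (rule mult_left_mono[OF Q(3) c])
      also have "\<dots> \<le> e / 4" using c e by (simp add: field_simps)
      finally have "\<bar>?Y n - ?PY m n\<bar> \<le> e / 4" .
      moreover have "\<bar>?PW m n - ?PY m n\<bar> < e / 4" using n1[of n] n by simp
      moreover have "\<bar>?PW m n - ?PZ m\<bar> < e / 4" using n2[of n] n by simp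
      moreover have "\<bar>?PZ m - ?Z\<bar> < e / 4" using m1[OF m(2)] by simp
      ultimately show ?thesis unfolding real_norm_def by linarith
    qed
    then show "\<exists>no. \<forall>n\<ge>no. norm (?Y n - ?Z) < e" by blast
  qed
qed

text \<open>The type of the sample space is fixed by the final statement. On functions from the
  reals to vectors a product measure is taken whose factors are the laws of vectors with all entries
  equal to one standard normal; one entry at each natural argument gives the sequence.\<close>

lemma std_normal_sequence_exists:
  obtains N :: "(real \<Rightarrow> real^'d) measure" and \<gamma> :: "nat \<Rightarrow> (real \<Rightarrow> real^'d) \<Rightarrow> real" where
    "prob_space N" "prob_space.indep_vars N (\<lambda>_. borel) \<gamma> UNIV" "\<And>n. distr N borel (\<gamma> n) = std_normal_distribution"
proof -
  define \<mu> :: "(real^'d) measure" where "\<mu> = distr std_normal_distribution borel (\<lambda>x. \<chi> j. x)"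
  have std: "prob_space std_normal_distribution" by (rule prob_space_normal_density) simp
  have vm: "(\<lambda>x. (\<chi> j. x) :: real^'d) \<in> borel_measurable std_normal_distribution"
    by (rule vec_measurableI) simp
  interpret mu: prob_space \<mu> unfolding \<mu>_def by (rule prob_space.prob_space_distr[OF std vm])
  have sets_mu: "sets \<mu> = sets borel" by (simp add: \<mu>_def)
  define N where "N = PiM (UNIV :: real set) (\<lambda>_. \<mu>)"
  interpret N: prob_space N unfolding N_def by (intro prob_space_PiM mu.prob_space_axioms)
  have cm: "(\<lambda>\<omega>. \<omega> (real n)) \<in> measurable N \<mu>" for n
    unfolding N_def by (rule measurable_component_singleton) simp
  have cd: "distr N \<mu> (\<lambda>\<omega>. \<omega> (real n)) = \<mu>" for n
    unfolding N_def by (rule distr_PiM_component[of UNIV "\<lambda>_. \<mu>" "real n"]) (auto intro: mu.prob_space_axioms)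
  have ind: "N.indep_vars (\<lambda>_. \<mu>) (\<lambda>n \<omega>. \<omega> (real n)) UNIV"
  proof (subst N.indep_vars_iff_distr_eq_PiM')
    show "distr N (Pi\<^sub>M UNIV (\<lambda>_. \<mu>)) (\<lambda>x. \<lambda>i\<in>UNIV. x (real i)) = Pi\<^sub>M UNIV (\<lambda>i. distr N \<mu> (\<lambda>\<omega>. \<omega> (real i)))"
      unfolding cd unfolding N_def
      by (rule distr_PiM_reindex[of UNIV "\<lambda>_. \<mu>" real UNIV]) (auto intro: mu.prob_space_axioms simp: inj_on_def)
  qed (use cm in auto)
  have j: "(\<lambda>x. x $ j) \<in> borel_measurable \<mu>" for j
    unfolding measurable_cong_sets[OF sets_mu refl] by (intro borel_measurable_continuous_onI continuous_intros)
  have nth: "(\<lambda>x :: real^'d. x $ j) \<in> borel_measurable borel" for j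
    by (intro borel_measurable_continuous_onI continuous_intros)
  fix j :: 'd
  have "distr N borel (\<lambda>\<omega>. \<omega> (real n) $ j) = std_normal_distribution" for n
  proof -
    have "distr N borel (\<lambda>\<omega>. \<omega> (real n) $ j) = distr (distr N \<mu> (\<lambda>\<omega>. \<omega> (real n))) borel (\<lambda>x. x $ j)"
      by (simp add: distr_distr[OF j cm] comp_def)
    also have "\<dots> = distr \<mu> borel (\<lambda>x. x $ j)" by (simp only: cd)
    also have "\<dots> = distr std_normal_distribution borel (\<lambda>x. x)"
      unfolding \<mu>_def by (simp add: distr_distr[OF nth vm] comp_def)
    also have "\<dots> = std_normal_distribution" by (rule distr_id2) simp
    finally show ?thesis .
  qed
  then show thesis
    using N.indep_vars_compose2[OF ind, of "\<lambda>_ x. x $ j" "\<lambda>_. borel"] j by (intro that[OF N.prob_space_axioms]) auto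
qed

section \<open>Law and moments of the limit process\<close>

context prob_space
begin

context
  fixes Z :: "real \<Rightarrow> 'a \<Rightarrow> real^'d" and K :: "'d \<Rightarrow> 'd \<Rightarrow> real \<Rightarrow> real \<Rightarrow> real"
  assumes Z_measurable: "\<And>t. t \<in> {0..1} \<Longrightarrow> Z t \<in> borel_measurable M"
    and Z_gaussian: "\<And>A a t j. finite A \<Longrightarrow> (\<And>k::nat. t k \<in> {0..1}) \<Longrightarrow>
       centered_gaussian M (\<lambda>\<omega>. \<Sum>k\<in>A. a k * Z (t k) \<omega> $ j k)
         (\<Sum>k\<in>A. \<Sum>l\<in>A. a k * a l * K (j k) (j l) (t k) (t l))"
    and K_sym: "\<And>i j s t. K i j s t = K j i t s"
begin

text \<open>Transfers the Gaussian property from families over \<open>nat\<close> to any finite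
  index set, by enumeration; surplus indices get time 0.\<close>

lemma gaussian_combination:
  assumes A: "finite A" and t: "\<And>i. i \<in> A \<Longrightarrow> t i \<in> {0..1}"
  shows "centered_gaussian M (\<lambda>\<omega>. \<Sum>i\<in>A. a i * Z (t i) \<omega> $ j i) (\<Sum>i\<in>A. \<Sum>k\<in>A. a i * a k * K (j i) (j k) (t i) (t k))"
proof -
  obtain h where h: "bij_betw h {0..<card A} A" using ex_bij_betw_nat_finite[OF A] by blast
  have hA: "h k \<in> A" if "k < card A" for k using h that by (auto simp: bij_betw_def)
  define \<tau> where "\<tau> k = (if k < card A then t (h k) else 0)" for k
  have \<tau>: "\<tau> k \<in> {0..1}" for k using t[OF hA] by (simp add: \<tau>_def)
  have s: "(\<Sum>k\<in>{0..<card A}. f (h k)) = (\<Sum>i\<in>A. f i)" for f :: "_ \<Rightarrow> real" by (rule sum.reindex_bij_betw[OF h])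
  have 1: "(\<Sum>k\<in>{0..<card A}. a (h k) * Z (\<tau> k) \<omega> $ j (h k)) = (\<Sum>i\<in>A. a i * Z (t i) \<omega> $ j i)" for \<omega>
    unfolding s[of "\<lambda>i. a i * Z (t i) \<omega> $ j i", symmetric] by (intro sum.cong refl) (simp add: \<tau>_def)
  have "(\<Sum>k\<in>{0..<card A}. \<Sum>l\<in>{0..<card A}. a (h k) * a (h l) * K (j (h k)) (j (h l)) (\<tau> k) (\<tau> l)) =
      (\<Sum>k\<in>{0..<card A}. \<Sum>l\<in>{0..<card A}. a (h k) * a (h l) * K (j (h k)) (j (h l)) (t (h k)) (t (h l)))"
    by (intro sum.cong refl) (simp add: \<tau>_def)
  also have "\<dots> = (\<Sum>k\<in>{0..<card A}. \<Sum>i\<in>A. a (h k) * a i * K (j (h k)) (j i) (t (h k)) (t i))"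
    by (intro sum.cong refl s)
  also have "\<dots> = (\<Sum>i\<in>A. \<Sum>k\<in>A. a i * a k * K (j i) (j k) (t i) (t k))" by (rule s)
  finally have 2: "(\<Sum>k\<in>{0..<card A}. \<Sum>l\<in>{0..<card A}. a (h k) * a (h l) * K (j (h k)) (j (h l)) (\<tau> k) (\<tau> l)) =
      (\<Sum>i\<in>A. \<Sum>k\<in>A. a i * a k * K (j i) (j k) (t i) (t k))" .
  show ?thesis using Z_gaussian[of "{0..<card A}" \<tau> "\<lambda>k. a (h k)" "\<lambda>k. j (h k)", OF _ \<tau>] unfolding 1 2 by simp
qed

lemma gaussian_coordinate:
  assumes "t \<in> {0..1}" shows "centered_gaussian M (\<lambda>\<omega>. Z t \<omega> $ j) (K j j t t)"
  using gaussian_combination[of "{()}" "\<lambda>_. t" "\<lambda>_. 1" "\<lambda>_. j"] assms by simp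

lemma gaussian_processI: "gaussian_process M {0..1} Z"
  unfolding gaussian_process_def
proof (intro conjI allI impI ballI)
  show "Z t \<in> borel_measurable M" if "t \<in> {0..1}" for t by (rule Z_measurable[OF that])
  fix S :: "real set" and c :: "real \<Rightarrow> real^'d" assume S: "finite S" "S \<subseteq> {0..1}"
  have "(\<Sum>t\<in>S. c t \<bullet> Z t \<omega>) = (\<Sum>i\<in>S \<times> UNIV. c (fst i) $ snd i * Z (fst i) \<omega> $ snd i)" for \<omega>
    by (simp add: inner_vec_def sum.cartesian_product case_prod_beta)
  moreover have "gaussian_variable M (\<lambda>\<omega>. \<Sum>i\<in>S \<times> UNIV. c (fst i) $ snd i * Z (fst i) \<omega> $ snd i)"
    by (rule gaussian_variable_centered[OF gaussian_combination]) (use S in auto)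
  ultimately show "gaussian_variable M (\<lambda>\<omega>. \<Sum>t\<in>S. c t \<bullet> Z t \<omega>)" by simp
qed

text \<open>The coordinates have mean 0, and taking a coordinate commutes with the integral of an
  integrable vector; otherwise the integral is 0 by convention.\<close>

lemma gaussian_mean: "t \<in> {0..1} \<Longrightarrow> integral\<^sup>L M (Z t) = 0"
proof (cases "integrable M (Z t)")
  case True
  assume t: "t \<in> {0..1}"
  have "integral\<^sup>L M (Z t) $ j = 0" for j
    using integral_bounded_linear[OF bounded_linear_vec_nth[of j] True] centered_gaussian_moments(2)[OF gaussian_coordinate[OF t, of j]]
    by simp
  then show ?thesis by (simp add: vec_eq_iff)
qed (simp add: not_integrable_integral_eq)

text \<open>Polarization: the variances of both variables and of their sum determine the mean of the
  product, and the symmetry of \<open>K\<close> merges the two mixed terms.\<close>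

lemma gaussian_covariance:
  assumes s: "s \<in> {0..1}" and t: "t \<in> {0..1}"
  shows "covariance M (\<lambda>\<omega>. Z s \<omega> $ i) (\<lambda>\<omega>. Z t \<omega> $ j) = K i j s t"
proof -
  let ?X = "\<lambda>\<omega>. Z s \<omega> $ i" and ?Y = "\<lambda>\<omega>. Z t \<omega> $ j"
  note X = centered_gaussian_moments[OF gaussian_coordinate[OF s, of i]]
  note Y = centered_gaussian_moments[OF gaussian_coordinate[OF t, of j]]
  have XY: "centered_gaussian M (\<lambda>\<omega>. ?X \<omega> + ?Y \<omega>) (K i i s s + K i j s t + (K j i t s + K j j t t))"
    using gaussian_combination[of "UNIV :: bool set" "\<lambda>b. if b then s else t" "\<lambda>_. 1" "\<lambda>b. if b then i else j"] s t
    by (simp add: UNIV_bool ac_simps)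
  note XY = centered_gaussian_moments[OF XY]
  have prod: "?X \<omega> * ?Y \<omega> = ((?X \<omega> + ?Y \<omega>)\<^sup>2 - (?X \<omega>)\<^sup>2 - (?Y \<omega>)\<^sup>2) / 2" for \<omega>
    by (simp add: power2_sum)
  have "expectation (\<lambda>\<omega>. ?X \<omega> * ?Y \<omega>) = (expectation (\<lambda>\<omega>. (?X \<omega> + ?Y \<omega>)\<^sup>2) - expectation (\<lambda>\<omega>. (?X \<omega>)\<^sup>2) - expectation (\<lambda>\<omega>. (?Y \<omega>)\<^sup>2)) / 2"
    unfolding prod using X(1)[of 2] Y(1)[of 2] XY(1)[of 2] by simp
  also have "\<dots> = K i j s t" unfolding X(3) Y(3) XY(3) using K_sym[of j i t s] by simp
  finally show ?thesis by (simp add: covariance_def X(2) Y(2))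
qed

end

end

theorem (in regression_model) residual_process_convergence:
  fixes Z :: "real \<Rightarrow> 'v \<Rightarrow> real^'d"
  assumes "prob_space N" and Zm: "\<And>t. t \<in> {0..1} \<Longrightarrow> Z t \<in> borel_measurable N"
    and Zc: "\<And>\<omega>. \<omega> \<in> space N \<Longrightarrow> continuous_on {0..1} (\<lambda>t. Z t \<omega>)"
    and Zg: "\<And>A a t j. finite A \<Longrightarrow> (\<And>k::nat. t k \<in> {0..1}) \<Longrightarrow>
       centered_gaussian N (\<lambda>\<omega>. \<Sum>k\<in>A. a k * Z (t k) \<omega> $ j k)
         (\<Sum>k\<in>A. \<Sum>l\<in>A. a k * a l * influence_cov (j k) (j l) (t k) (t l))"
  shows "converges_in_distribution (mtopology_of path_metric) M
     (\<lambda>n. path_of (\<lambda>t \<omega>. residual_process n v (\<lambda>i. X i \<omega>) (\<lambda>i. \<xi> i \<omega>) (\<lambda>i. \<xi> i \<omega> \<bullet> \<theta> + \<epsilon> i \<omega>) t)) N (path_of Z)"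
proof -
  interpret N: prob_space N by fact
  let ?Y = "\<lambda>n t \<omega>. residual_process n v (\<lambda>i. X i \<omega>) (\<lambda>i. \<xi> i \<omega>) (\<lambda>i. \<xi> i \<omega> \<bullet> \<theta> + \<epsilon> i \<omega>) t"
  let ?W = "\<lambda>n t \<omega>. (\<chi> j. leading n j t \<omega>) :: real^'d"
  have comb: "centered_gaussian N (\<lambda>\<omega>. \<Sum>i\<in>A. a i * Z (t i) \<omega> $ j i) (\<Sum>i\<in>A. \<Sum>k\<in>A. a i * a k * influence_cov (j i) (j k) (t i) (t k))"
    if "finite A" "\<And>i :: nat \<times> 'd. t i \<in> {0..1}" for A a t j
    by (rule N.gaussian_combination[where Z=Z and K=influence_cov]) (fact Zm | fact Zg | fact influence_cov_sym | fact that | rule that(2))+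
  have coord: "centered_gaussian N (\<lambda>\<omega>. Z t \<omega> $ j) (influence_cov j j t t)" if "t \<in> {0..1}" for t j
    by (rule N.gaussian_coordinate[where Z=Z and K=influence_cov]) (fact Zm | fact Zg | fact influence_cov_sym | fact that)+
  show ?thesis
  proof (rule path_convergence[where W="?W" and C=1, OF prob_space_axioms assms(1)])
    show "?Y n t \<in> borel_measurable M" if "t \<in> {0..1}" for n t
      using proc_measurable[OF that, of \<theta> n] by (intro vec_measurableI) (simp add: proc_def[abs_def])
    show "continuous_on {0..1} (\<lambda>t. ?Y n t \<omega>)" for n \<omega>
      unfolding residual_process_def by (intro continuous_on_vec_lambda continuous_on_piecewise_linear)
    show "?W n t \<in> borel_measurable M" for n t by (rule vec_measurableI) simp
    show "Z t \<in> borel_measurable N" if "t \<in> {0..1}" for t by (rule Zm[OF that])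
    show "continuous_on {0..1} (\<lambda>t. Z t \<omega>)" if "\<omega> \<in> space N" for \<omega> by (rule Zc[OF that])
    show "integrable M (\<lambda>\<omega>. (?W n t \<omega> $ j)\<^sup>2)" "integral\<^sup>L M (\<lambda>\<omega>. (?W n t \<omega> $ j)\<^sup>2) \<le> 1" if "t \<in> {0..1}" for n t j
      using leading_second_moment[OF that, of n j] by simp_all
    show "integrable N (\<lambda>\<omega>. (Z t \<omega> $ j)\<^sup>2)" "integral\<^sup>L N (\<lambda>\<omega>. (Z t \<omega> $ j)\<^sup>2) \<le> 1" if t: "t \<in> {0..1}" for t j
      using N.centered_gaussian_moments(1,3)[OF coord[OF t, of j]] influence_variance_le[OF t, of j] by simp_all
    show "(\<lambda>n. integral\<^sup>L M (\<lambda>\<omega>. cos ((\<Sum>i\<in>A. c i * ?W n (t i) \<omega> $ j i) + b)))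
          \<longlonglongrightarrow> integral\<^sup>L N (\<lambda>\<omega>. cos ((\<Sum>i\<in>A. c i * Z (t i) \<omega> $ j i) + b))"
      if A: "finite A" and t: "\<And>i :: nat \<times> 'd. t i \<in> {0..1}" for A c t j b
      using leading_cos_limit[OF A, of c j t b] N.centered_gaussian_cos[OF comb[of A t c j, OF A t], of b] by simp
    show "negligible_sequence (\<lambda>n \<omega>. ?W n t \<omega> $ j - ?Y n t \<omega> $ j)" if "t \<in> {0..1}" for t j
      using proc_leading_negligible[OF that, of j \<theta>] by (simp add: proc_def)
    fix \<delta> :: real assume "\<delta> > 0"
    then show "\<exists>m0. \<forall>m\<ge>m0. \<exists>n0. \<forall>n\<ge>n0. \<exists>Q\<in>borel_measurable M.
       (\<forall>\<omega>. 0 \<le> Q \<omega>) \<and> integral\<^sup>L M (\<lambda>\<omega>. min 1 (Q \<omega>)) \<le> \<delta> \<and>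
       (\<forall>\<omega>\<in>space M. 1 \<le> Q \<omega> \<or> (\<forall>t\<in>{0..1}. \<forall>j.
          \<bar>?Y n t \<omega> $ j - dyadic_interpolation m (\<lambda>t. ?Y n t \<omega> $ j) t\<bar> \<le> Q \<omega>))"
      using proc_modulus[of \<delta> \<theta>] unfolding proc_def by blast
  qed
qed

subsection \<open>Marginals and regression functions\<close>

text \<open>Continuity from below, as all arguments except the one at \<open>j\<close> increase to
  infinity.\<close>

lemma joint_cdf_marginal:
  assumes "prob_space \<mu>" and sets: "sets \<mu> = sets borel"
  shows "(\<lambda>n. joint_cdf \<mu> (\<chi> i. if i = j then t else real n)) \<longlonglongrightarrow> measure \<mu> {y :: real^'d. y $ j \<le> t}"
proof -
  interpret prob_space \<mu> by fact
  define A where "A n = {y :: real^'d. \<forall>i. y $ i \<le> (if i = j then t else real n)}" for n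
  have "closed (A n)" for n unfolding A_def by (intro closed_Collect_all closed_Collect_le continuous_intros)
  then have "range A \<subseteq> sets \<mu>" unfolding sets by (auto intro: borel_closed)
  moreover have "incseq A" unfolding A_def incseq_def by (auto split: if_splits) (smt (verit) of_nat_mono)
  ultimately have "(\<lambda>n. prob (A n)) \<longlonglongrightarrow> prob (\<Union>n. A n)" by (rule finite_Lim_measure_incseq)
  moreover have "(\<Union>n. A n) = {y. y $ j \<le> t}"
  proof (intro equalityI subsetI)
    fix y :: "real^'d" assume y: "y \<in> {y. y $ j \<le> t}"
    obtain n :: nat where "norm y \<le> real n" using real_arch_simple by blast
    then have "y $ i \<le> real n" for i using component_le_norm_cart[of y i] by linarith
    then show "y \<in> (\<Union>n. A n)" using y by (auto simp: A_def)
  next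
    fix y assume "y \<in> (\<Union>n. A n)"
    then obtain n where "\<forall>i. y $ i \<le> (if i = j then t else real n)" by (auto simp: A_def)
    from spec[OF this, of j] show "y \<in> {y. y $ j \<le> t}" by simp
  qed
  ultimately show ?thesis by (simp add: joint_cdf_def A_def)
qed

text \<open>\<open>is_copula\<close> provides some measure with uniform marginals and the same joint
  distribution function. The marginal distribution functions are limits of the joint one, hence
  agree, and they determine the marginal laws.\<close>

lemma copula_marginal_uniform:
  assumes "prob_space M" and X: "X \<in> borel_measurable M" and C: "is_copula (joint_cdf (distr M borel X))"
  shows "distr M borel (\<lambda>\<omega>. X \<omega> $ j :: real) = uniform_measure lborel {0..1}"
proof -
  interpret prob_space M by fact
  interpret D: prob_space "distr M borel X" by (rule prob_space_distr[OF X])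
  from C obtain \<mu> where mu: "prob_space \<mu>" "sets \<mu> = sets borel" "joint_cdf (distr M borel X) = joint_cdf \<mu>"
    and uni: "\<And>j. distr \<mu> borel (\<lambda>y. y $ j) = uniform_measure lborel {0..1}" by (auto simp: is_copula_def)
  interpret mu: prob_space \<mu> by fact
  have nth: "(\<lambda>y :: real^'b. y $ j) \<in> borel_measurable borel"
    by (intro borel_measurable_continuous_onI continuous_intros)
  have nth_mu: "(\<lambda>y. y $ j) \<in> borel_measurable \<mu>" using nth measurable_cong_sets[OF mu(2) refl] by blast
  have Xj: "(\<lambda>\<omega>. X \<omega> $ j) \<in> borel_measurable M" by (rule measurable_compose[OF X nth])
  have eq: "measure (distr M borel X) {y. y $ j \<le> t} = measure \<mu> {y. y $ j \<le> t}" for t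
    using LIMSEQ_unique[OF joint_cdf_marginal[OF D.prob_space_axioms _, of j t] joint_cdf_marginal[OF mu(1,2), of j t, folded mu(3)]] by simp
  have "distr M borel (\<lambda>\<omega>. X \<omega> $ j) = distr \<mu> borel (\<lambda>y. y $ j)"
  proof (rule cdf_unique)
    show "real_distribution (distr M borel (\<lambda>\<omega>. X \<omega> $ j))" by (rule real_distribution_distr[OF Xj])
    show "real_distribution (distr \<mu> borel (\<lambda>y. y $ j))" by (rule mu.real_distribution_distr[OF nth_mu])
    show "cdf (distr M borel (\<lambda>\<omega>. X \<omega> $ j)) = cdf (distr \<mu> borel (\<lambda>y. y $ j))"
    proof
      fix t
      have "distr M borel (\<lambda>\<omega>. X \<omega> $ j) = distr (distr M borel X) borel (\<lambda>y. y $ j)"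
        by (simp add: distr_distr[OF nth X] comp_def)
      moreover have "measure (distr (distr M borel X) borel (\<lambda>y. y $ j)) {..t} = measure (distr M borel X) {y. y $ j \<le> t}"
        using nth by (subst measure_distr) (auto simp: vimage_def)
      moreover have "measure (distr \<mu> borel (\<lambda>y. y $ j)) {..t} = measure \<mu> {y. y $ j \<le> t}"
        using nth_mu sets_eq_imp_space_eq[OF mu(2)] by (subst measure_distr) (auto simp: vimage_def)
      ultimately show "cdf (distr M borel (\<lambda>\<omega>. X \<omega> $ j)) t = cdf (distr \<mu> borel (\<lambda>y. y $ j)) t"
        using eq by (simp add: cdf_def)
    qed
  qed
  then show ?thesis by (simp add: uni)
qed

lemma uniform_measure_unit_interval: "uniform_measure lborel {0..1::real} = density lborel (\<lambda>x. ennreal (indicator {0..1} x))"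
  by (auto simp: uniform_measure_def indicator_def ennreal_divide_self intro!: arg_cong[of _ _ "density lborel"])

lemma uniform_unit_prob:
  assumes "prob_space M" and [measurable]: "Y \<in> borel_measurable M" and u: "distr M borel Y = uniform_measure lborel {0..1}" and t: "t \<in> {0..1}"
  shows "measure M {\<omega> \<in> space M. Y \<omega> \<le> t} = t"
proof -
  have "measure M {\<omega> \<in> space M. Y \<omega> \<le> t} = measure (distr M borel Y) {..t}"
    by (subst measure_distr) (auto intro!: arg_cong[of _ _ "measure M"])
  also have "\<dots> = measure lborel ({0..1} \<inter> {..t})" unfolding u by (subst measure_uniform_measure) auto
  also have "{0..1} \<inter> {..t} = {0..t}" using t by auto
  finally show ?thesis using t by simp
qed

text \<open>The event \<open>Y \<le> t\<close> belongs to the sigma-algebra of \<open>Y\<close>, so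
  \<open>V\<close> may be replaced there by its conditional expectation
  \<open>h (Y \<omega>)\<close>; since \<open>Y\<close> is uniform, the mean becomes the integral of
  \<open>h\<close> over \<open>{0..t}\<close>.\<close>

lemma cumulative_regression_function:
  fixes h :: "real \<Rightarrow> real^'q"
  assumes "prob_space M" and Y [measurable]: "Y \<in> borel_measurable M"
    and u: "distr M borel Y = uniform_measure lborel {0..1}"
    and V: "\<And>a. integrable M (\<lambda>\<omega>. V \<omega> $ a)" and h: "regression_function M Y V h" and t: "t \<in> {0..1}"
  shows "cumulative h t $ a = integral\<^sup>L M (\<lambda>\<omega>. V \<omega> $ a * (if Y \<omega> \<le> t then 1 else 0))"
proof -
  interpret prob_space M by fact
  define F where "F = vimage_algebra (space M) Y borel"
  have "subalgebra M F"
    unfolding subalgebra_def F_def using measurable_sets[OF Y] by (auto simp: sets_vimage_algebra2)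
  then interpret F: finite_measure_subalgebra M F by unfold_locales
  have hm [measurable]: "h \<in> borel_measurable borel" and hE: "\<And>a. AE \<omega> in M. h (Y \<omega>) $ a = real_cond_exp M F (\<lambda>\<omega>. V \<omega> $ a) \<omega>"
    using h by (auto simp: regression_function_def F_def)
  have nth: "(\<lambda>y :: real^'q. y $ a) \<in> borel_measurable borel" for a
    by (intro borel_measurable_continuous_onI continuous_intros)
  have ha [measurable]: "(\<lambda>x. h x $ a) \<in> borel_measurable borel" for a
    by (rule measurable_compose[OF hm nth])
  have hY [measurable]: "(\<lambda>\<omega>. h (Y \<omega>) $ a) \<in> borel_measurable M" for a
    by (rule measurable_compose[OF Y ha])
  have "integrable M (\<lambda>\<omega>. h (Y \<omega>) $ a)" for a
    using F.real_cond_exp_int(1)[OF V[of a]] hE[of a] by (subst integrable_cong_AE) auto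
  then have "integrable (distr M borel Y) (\<lambda>x. h x $ a)" for a
    by (subst integrable_distr_eq[OF Y ha])
  then have i1: "integrable lborel (\<lambda>x. indicator {0..1} x *\<^sub>R h x $ a)" for a
    unfolding u uniform_measure_unit_interval by (subst (asm) integrable_density) auto
  have "integrable lborel (\<lambda>x. indicator {0..t} x *\<^sub>R (indicator {0..1} x *\<^sub>R h x $ a))" for a
    by (rule integrable_mult_indicator[OF _ i1]) simp
  moreover have ind: "indicator {0..t} x * (indicator {0..1} x * y) = indicator {0..t} x * y" for x y :: real
    using t by (auto simp: indicator_def)
  ultimately have ih: "integrable lborel (\<lambda>x. indicator {0..t} x * h x $ a)" for a by simp
  \<comment> \<open>\<open>cumulative\<close> is an integral of vectors. Its integrability is
    assembled from the coordinates, so that a coordinate may be taken inside.\<close>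
  have "indicator {0..t} x *\<^sub>R h x = (\<Sum>a\<in>UNIV. (indicator {0..t} x * h x $ a) *\<^sub>R axis a 1)" for x
    by (simp add: vec_eq_iff axis_def if_distrib[of "\<lambda>y. _ * y"] cong: if_cong)
  then have iv: "integrable lborel (\<lambda>x. indicator {0..t} x *\<^sub>R h x)"
    using ih by (simp add: Bochner_Integration.integrable_sum integrable_scaleR_left)
  have A: "Y -` {..t} \<inter> space M \<in> sets F" unfolding F_def by (rule in_vimage_algebra) simp
  have AM: "Y -` {..t} \<inter> space M \<in> sets M" by (rule measurable_sets[OF Y]) simp
  have "cumulative h t $ a = (LINT x|lborel. indicator {0..t} x * h x $ a)"
    unfolding cumulative_def set_lebesgue_integral_def
    using integral_bounded_linear[OF bounded_linear_vec_nth[of a] iv] by simp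
  also have "\<dots> = (LINT x|lborel. indicator {0..1} x *\<^sub>R (indicator {..t} x * h x $ a))"
    using t by (intro Bochner_Integration.integral_cong refl) (auto simp: indicator_def)
  also have "\<dots> = (LINT x|distr M borel Y. indicator {..t} x * h x $ a)"
    unfolding u uniform_measure_unit_interval by (subst integral_density) auto
  also have "\<dots> = expectation (\<lambda>\<omega>. indicator {..t} (Y \<omega>) * h (Y \<omega>) $ a)"
    by (rule integral_distr[OF Y]) measurable
  also have "\<dots> = expectation (\<lambda>\<omega>. indicator (Y -` {..t} \<inter> space M) \<omega> * h (Y \<omega>) $ a)"
    by (intro Bochner_Integration.integral_cong refl) (auto simp: indicator_def)
  also have "\<dots> = expectation (\<lambda>\<omega>. indicator (Y -` {..t} \<inter> space M) \<omega> * real_cond_exp M F (\<lambda>\<omega>. V \<omega> $ a) \<omega>)"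
  proof (rule integral_cong_AE)
    show "(\<lambda>\<omega>. indicator (Y -` {..t} \<inter> space M) \<omega> * h (Y \<omega>) $ a) \<in> borel_measurable M"
      by (intro borel_measurable_times borel_measurable_indicator AM hY)
    show "(\<lambda>\<omega>. indicator (Y -` {..t} \<inter> space M) \<omega> * real_cond_exp M F (\<lambda>\<omega>. V \<omega> $ a) \<omega>) \<in> borel_measurable M"
      by (intro borel_measurable_times borel_measurable_indicator AM borel_measurable_cond_exp2)
    show "AE \<omega> in M. indicator (Y -` {..t} \<inter> space M) \<omega> * h (Y \<omega>) $ a = indicator (Y -` {..t} \<inter> space M) \<omega> * real_cond_exp M F (\<lambda>\<omega>. V \<omega> $ a) \<omega>"
      using hE[of a] by eventually_elim simp
  qed
  also have "\<dots> = expectation (\<lambda>\<omega>. indicator (Y -` {..t} \<inter> space M) \<omega> * V \<omega> $ a)"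
    using F.real_cond_exp_intA[OF V[of a] A] by (simp add: set_lebesgue_integral_def)
  also have "\<dots> = expectation (\<lambda>\<omega>. V \<omega> $ a * (if Y \<omega> \<le> t then 1 else 0))"
    by (intro Bochner_Integration.integral_cong refl) (auto simp: indicator_def)
  finally show ?thesis .
qed

theorem theorem2:
  fixes M :: "'w measure"
    and X :: "nat \<Rightarrow> 'w \<Rightarrow> real^'d"
    and \<xi> :: "nat \<Rightarrow> 'w \<Rightarrow> real^'q"
    and \<eta> \<epsilon> :: "nat \<Rightarrow> 'w \<Rightarrow> real"
    and \<theta> :: "real^'q"
    and p :: "real^'d \<Rightarrow> ennreal"
    and h :: "'d \<Rightarrow> real \<Rightarrow> real^'q"
    and G :: "real^'q^'q"
    and L :: "'d \<Rightarrow> real \<Rightarrow> real^'q"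
    and K :: "'d \<Rightarrow> 'd \<Rightarrow> real \<Rightarrow> real \<Rightarrow> real"
  assumes "prob_space M"
    and indep_rows: "prob_space.indep_vars M (\<lambda>_. borel) (\<lambda>i \<omega>. (X i \<omega>, \<xi> i \<omega>, \<eta> i \<omega>)) UNIV"
    and ident_rows: "\<And>i. distr M borel (\<lambda>\<omega>. (X i \<omega>, \<xi> i \<omega>, \<eta> i \<omega>)) =
                         distr M borel (\<lambda>\<omega>. (X 0 \<omega>, \<xi> 0 \<omega>, \<eta> 0 \<omega>))"
    and copula: "is_copula (joint_cdf (distr M borel (X 0)))"
    and copula_density: "distributed M lborel (X 0) p"
    and H0: "\<And>i \<omega>. \<omega> \<in> space M \<Longrightarrow> \<eta> i \<omega> = \<xi> i \<omega> \<bullet> \<theta> + \<epsilon> i \<omega>"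
    and indep_errors: "independent_elements M
           (Pi\<^sub>M UNIV (\<lambda>_::nat. borel)) (\<lambda>\<omega> i. \<epsilon> i \<omega>)
           (Pi\<^sub>M UNIV (\<lambda>_::nat. borel)) (\<lambda>\<omega> i. (X i \<omega>, \<xi> i \<omega>))"
    and "integrable M (\<epsilon> 0)" and "prob_space.expectation M (\<epsilon> 0) = 0"
    and "integrable M (\<lambda>\<omega>. (\<epsilon> 0 \<omega>)\<^sup>2)" and "prob_space.variance M (\<epsilon> 0) > 0"
    and "\<And>a b. integrable M (\<lambda>\<omega>. \<xi> 0 \<omega> $ a * \<xi> 0 \<omega> $ b)"
    and G_def: "G = second_moment_matrix M (\<xi> 0)"
    and "invertible G"
    and h: "\<And>j. regression_function M (\<lambda>\<omega>. X 0 \<omega> $ j) (\<xi> 0) (h j)"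
    and L_def: "\<And>j x. L j x = cumulative (h j) x"
    and K_def: "\<And>i j s t. K i j s t =
           measure M {\<omega> \<in> space M. X 0 \<omega> $ i \<le> s \<and> X 0 \<omega> $ j \<le> t}
           - L i s \<bullet> (matrix_inv G *v L j t)"
  shows "\<exists>(N :: (real \<Rightarrow> real^'d) measure) (Z :: real \<Rightarrow> (real \<Rightarrow> real^'d) \<Rightarrow> real^'d).
           prob_space N \<and>
           gaussian_process N {0..1} Z \<and>
           (\<forall>t\<in>{0..1}. integral\<^sup>L N (Z t) = 0) \<and>
           (AE \<omega> in N. continuous_on {0..1} (\<lambda>t. Z t \<omega>)) \<and>
           (\<forall>i j. \<forall>s\<in>{0..1}. \<forall>t\<in>{0..1}.
              covariance N (\<lambda>\<omega>. Z s \<omega> $ i) (\<lambda>\<omega>. Z t \<omega> $ j) = K i j s t) \<and>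
           converges_in_distribution (mtopology_of path_metric)
             M (\<lambda>n. path_of (\<lambda>t \<omega>. residual_process n (prob_space.variance M (\<epsilon> 0))
                      (\<lambda>i. X i \<omega>) (\<lambda>i. \<xi> i \<omega>) (\<lambda>i. \<eta> i \<omega>) t))
             N (path_of Z)"
proof -
  interpret prob_space M by fact
  \<comment> \<open>The hypothesis relates \<eta> and \<epsilon> on \<open>space M\<close> only. The
    errors recomputed from \<eta> satisfy the model equation at every point, and the rows containing
    them are a continuous image of the observed rows, which transfers independence and equality of
    laws.\<close>
  define \<epsilon>' where "\<epsilon>' i \<omega> = \<eta> i \<omega> - \<xi> i \<omega> \<bullet> \<theta>" for i \<omega>
  define v where "v = variance (\<epsilon> 0)"
  have eps: "\<epsilon>' i \<omega> = \<epsilon> i \<omega>" if "\<omega> \<in> space M" for i \<omega> using H0[OF that] by (simp add: \<epsilon>'_def)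
  have eta: "\<eta> i \<omega> = \<xi> i \<omega> \<bullet> \<theta> + \<epsilon>' i \<omega>" for i \<omega> by (simp add: \<epsilon>'_def)
  define \<phi> where "\<phi> r = (fst r, fst (snd r), snd (snd r) - fst (snd r) \<bullet> \<theta>)" for r :: "(real^'d) \<times> (real^'q) \<times> real"
  have \<phi>: "\<phi> \<in> borel_measurable borel"
    unfolding \<phi>_def by (intro borel_measurable_continuous_onI continuous_intros)
  have \<phi>_row: "\<phi> (X i \<omega>, \<xi> i \<omega>, \<eta> i \<omega>) = (X i \<omega>, \<xi> i \<omega>, \<epsilon>' i \<omega>)" for i \<omega> by (simp add: \<phi>_def \<epsilon>'_def)
  have rm: "(\<lambda>\<omega>. (X i \<omega>, \<xi> i \<omega>, \<eta> i \<omega>)) \<in> borel_measurable M" for i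
    using indep_rows by (simp add: indep_vars_def)
  have Xm: "X i \<in> borel_measurable M" for i
    using borel_measurable_continuous_on[OF continuous_on_fst[OF continuous_on_id] rm[of i]] by simp
  have \<xi>m: "\<xi> i \<in> borel_measurable M" for i
    using borel_measurable_continuous_on[OF continuous_on_fst[OF continuous_on_snd[OF continuous_on_id]] rm[of i]] by simp
  have Xjm: "(\<lambda>\<omega>. X i \<omega> $ j) \<in> borel_measurable M" for i j by (rule vec_nth_measurable[OF Xm])
  have uniX: "distr M borel (\<lambda>\<omega>. X 0 \<omega> $ j) = uniform_measure lborel {0..1}" for j
    by (rule copula_marginal_uniform[OF assms(1) Xm copula])
  have \<xi>_int: "integrable M (\<lambda>\<omega>. \<xi> 0 \<omega> $ a)" for a
    by (rule square_integrable_imp_integrable[OF vec_nth_measurable[OF \<xi>m]])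
      (use \<open>\<And>a b. integrable M (\<lambda>\<omega>. \<xi> 0 \<omega> $ a * \<xi> 0 \<omega> $ b)\<close>[of a a] in \<open>simp add: power2_eq_square\<close>)
  interpret R: regression_model M X \<xi> \<epsilon>' v G L
  proof (intro regression_model.intro regression_model_axioms.intro prob_space_axioms)
    show "indep_vars (\<lambda>_. borel) (\<lambda>i \<omega>. (X i \<omega>, \<xi> i \<omega>, \<epsilon>' i \<omega>)) UNIV"
      using indep_vars_compose2[OF indep_rows, of "\<lambda>_. \<phi>" "\<lambda>_. borel"] \<phi> by (simp add: \<phi>_row)
    show "distr M borel (\<lambda>\<omega>. (X i \<omega>, \<xi> i \<omega>, \<epsilon>' i \<omega>)) = distr M borel (\<lambda>\<omega>. (X 0 \<omega>, \<xi> 0 \<omega>, \<epsilon>' 0 \<omega>))" for i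
    proof -
      have "distr (distr M borel (\<lambda>\<omega>. (X i \<omega>, \<xi> i \<omega>, \<eta> i \<omega>))) borel \<phi> = distr M borel (\<lambda>\<omega>. (X i \<omega>, \<xi> i \<omega>, \<epsilon>' i \<omega>))" for i
        using distr_distr[OF \<phi> rm] by (simp add: comp_def \<phi>_row)
      from this[of i] this[of 0] show ?thesis by (simp only: ident_rows[of i])
    qed
    have "(\<lambda>\<omega> i. \<epsilon>' i \<omega>) \<in> measurable M (Pi\<^sub>M UNIV (\<lambda>_::nat. borel)) \<longleftrightarrow> (\<lambda>\<omega> i. \<epsilon> i \<omega>) \<in> measurable M (Pi\<^sub>M UNIV (\<lambda>_::nat. borel))"
      by (rule measurable_cong) (simp add: eps)
    moreover have "vimage_algebra (space M) (\<lambda>\<omega> i. \<epsilon>' i \<omega>) (Pi\<^sub>M UNIV (\<lambda>_::nat. borel)) =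
        vimage_algebra (space M) (\<lambda>\<omega> i. \<epsilon> i \<omega>) (Pi\<^sub>M UNIV (\<lambda>_::nat. borel))"
      by (rule vimage_algebra_cong) (simp_all add: eps)
    ultimately show "independent_elements M (Pi\<^sub>M UNIV (\<lambda>_::nat. borel)) (\<lambda>\<omega> i. \<epsilon>' i \<omega>)
           (Pi\<^sub>M UNIV (\<lambda>_::nat. borel)) (\<lambda>\<omega> i. (X i \<omega>, \<xi> i \<omega>))"
      using indep_errors by (simp add: independent_elements_def)
    have c: "expectation (\<lambda>\<omega>. f (\<epsilon>' 0 \<omega>)) = expectation (\<lambda>\<omega>. f (\<epsilon> 0 \<omega>))" for f :: "real \<Rightarrow> real"
      by (intro Bochner_Integration.integral_cong refl) (simp add: eps)
    show "expectation (\<epsilon>' 0) = 0" using c[of "\<lambda>x. x"] \<open>expectation (\<epsilon> 0) = 0\<close> by simp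
    show "integrable M (\<lambda>\<omega>. (\<epsilon>' 0 \<omega>)\<^sup>2)"
      using \<open>integrable M (\<lambda>\<omega>. (\<epsilon> 0 \<omega>)\<^sup>2)\<close> by (simp add: eps cong: Bochner_Integration.integrable_cong)
    show "v = expectation (\<lambda>\<omega>. (\<epsilon>' 0 \<omega>)\<^sup>2)"
      using c[of "\<lambda>x. x\<^sup>2"] \<open>expectation (\<epsilon> 0) = 0\<close> by (simp add: v_def)
    show "v > 0" unfolding v_def by fact
    show "integrable M (\<lambda>\<omega>. \<xi> 0 \<omega> $ a * \<xi> 0 \<omega> $ b)" for a b by fact
    show "G $ a $ b = expectation (\<lambda>\<omega>. \<xi> 0 \<omega> $ a * \<xi> 0 \<omega> $ b)" for a b
      by (simp add: G_def second_moment_matrix_def)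
    show "invertible G" by fact
    show "prob {\<omega> \<in> space M. X 0 \<omega> $ j \<le> t} = t" if "t \<in> {0..1}" for j t
      by (rule uniform_unit_prob[OF assms(1) Xjm uniX that])
    show "L j t $ a = expectation (\<lambda>\<omega>. \<xi> 0 \<omega> $ a * (if X 0 \<omega> $ j \<le> t then 1 else 0))" if "t \<in> {0..1}" for j t a
      unfolding L_def by (rule cumulative_regression_function[OF assms(1) Xjm uniX \<xi>_int h that])
  qed
  have K: "R.influence_cov i j s t = K i j s t" if "s \<in> {0..1}" "t \<in> {0..1}" for i j s t
    unfolding K_def R.influence_cov_eq[OF that] R.slope_def ..
  obtain N :: "(real \<Rightarrow> real^'d) measure" and \<gamma> where N: "prob_space N"
    and \<gamma>: "prob_space.indep_vars N (\<lambda>_. borel) \<gamma> (UNIV :: nat set)" "\<And>n. distr N borel (\<gamma> n) = std_normal_distribution"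
    using std_normal_sequence_exists by metis
  interpret N: prob_space N by fact
  \<comment> \<open>The quadratic form is the second moment of the corresponding combination of
    influences.\<close>
  have psd: "0 \<le> (\<Sum>k\<in>A. \<Sum>l\<in>A. a k * a l * R.influence_cov (j k) (j l) (t k) (t l))" if "finite A" for A :: "nat set" and a t j
    unfolding R.influence_combination(2)[OF that, symmetric] by simp
  obtain Z :: "real \<Rightarrow> (real \<Rightarrow> real^'d) \<Rightarrow> real^'d" where
    Zm: "\<And>t. t \<in> {0..1} \<Longrightarrow> Z t \<in> borel_measurable N" and Zc: "\<And>\<omega>. continuous_on {0..1} (\<lambda>t. Z t \<omega>)"
    and Zg: "\<And>A a t j. finite A \<Longrightarrow> (\<And>k::nat. t k \<in> {0..1}) \<Longrightarrow>
       centered_gaussian N (\<lambda>\<omega>. \<Sum>k\<in>A. a k * Z (t k) \<omega> $ j k)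
         (\<Sum>k\<in>A. \<Sum>l\<in>A. a k * a l * R.influence_cov (j k) (j l) (t k) (t l))"
  proof (rule N.gaussian_process_exists[where K=R.influence_cov and \<gamma>=\<gamma>])
    fix Z :: "real \<Rightarrow> (real \<Rightarrow> real^'d) \<Rightarrow> real^'d"
    assume Z: "\<And>t. t \<in> {0..1} \<Longrightarrow> Z t \<in> borel_measurable N" "\<And>\<omega>. continuous_on {0..1} (\<lambda>t. Z t \<omega>)"
      "\<And>A a t j. finite A \<Longrightarrow> (\<And>k::nat. t k \<in> {0..1}) \<Longrightarrow>
       centered_gaussian N (\<lambda>\<omega>. \<Sum>k\<in>A. a k * Z (t k) \<omega> $ j k)
         (\<Sum>k\<in>A. \<Sum>l\<in>A. a k * a l * R.influence_cov (j k) (j l) (t k) (t l))"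
    show thesis by (rule that[of Z]) (fact Z)+
  qed (rule \<gamma> R.influence_cov_sym psd R.influence_increment R.influence_cov_continuous; assumption?)+
  have "gaussian_process N {0..1} Z"
    by (rule N.gaussian_processI[where K=R.influence_cov]) (fact Zm | fact Zg | fact R.influence_cov_sym)+
  moreover have "integral\<^sup>L N (Z t) = 0" if t: "t \<in> {0..1}" for t
    by (rule N.gaussian_mean[where K=R.influence_cov]) (fact t | fact Zm | fact Zg | fact R.influence_cov_sym)+
  moreover have "AE \<omega> in N. continuous_on {0..1} (\<lambda>t. Z t \<omega>)" using Zc by simp
  moreover have "covariance N (\<lambda>\<omega>. Z s \<omega> $ i) (\<lambda>\<omega>. Z t \<omega> $ j) = K i j s t" if st: "s \<in> {0..1}" "t \<in> {0..1}" for i j s t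
    unfolding K[OF st, symmetric]
    by (rule N.gaussian_covariance[where K=R.influence_cov]) (fact st | fact Zm | fact Zg | fact R.influence_cov_sym)+
  moreover have "converges_in_distribution (mtopology_of path_metric) M
     (\<lambda>n. path_of (\<lambda>t \<omega>. residual_process n v (\<lambda>i. X i \<omega>) (\<lambda>i. \<xi> i \<omega>) (\<lambda>i. \<eta> i \<omega>) t)) N (path_of Z)"
    unfolding eta by (rule R.residual_process_convergence) (fact N | fact Zm | rule Zc | fact Zg)+
  ultimately show ?thesis using N unfolding v_def by blast
qed

end
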